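(* Let $G=C_2$, let $\mathbb{R}^{3,1}$ be the direct sum of a $2$-dimensional trivial real $C_2$-representation and the $1$-dimensional sign representation, and let $B=\mathbb{P}(\mathbb{R}^{3,1})$ be the $C_2$-space of lines through the origin in $\mathbb{R}^{3,1}$. Then there is an isomorphism of abelian groups $$RO(\Pi\, \mathbb{P}(\mathbb{R}^{3,1}))\cong \mathbb{Z}^3\times \mathbb{Z}/2 .$$
   Context: Let $G$ be a finite group (here $G=C_2$). All representations and vector bundles are real and orthogonal; bundle maps are isomorphisms on fibers. Orbit category: $\mathcal{O}_G$ has objects $G/H$ for $H\subset G$ and morphisms the $G$-maps. Equivariant fundamental groupoid: for a $G$-space $B$, $\Pi B$ is the category over $\mathcal{O}_G$ whose objects are $G$-maps $x\colon G/H\to B$. A morphism from $x\colon G/H\to B$ to $y\colon G/K\to B$ is a pair $(\alpha,\omega)$ with $\alpha\colon G/H\to G/K$ a $G$-map and $\omega\colon G/H\times I\to B$ a $G$-homotopy from $x$ to $y\circ\alpha$, where $\omega$ is taken up to $G$-homotopy relative to $G/H\times\{0,1\}$. Composition is $(\alpha,\omega)\circ(\alpha',\omega')=(\alpha\alpha',\omega(\alpha'\times \mathrm{id}_I)\star\omega')$, where $\omega_2\star\omega_1$ means $\omega_1$ followed by $\omega_2$. The functor $\Pi B\to\mathcal{O}_G$ sends $x\colon G/H\to B$ to $G/H$ and $(\alpha,\omega)$ to $\alpha$. Virtual bundles: for each $H\subset G$ fix one orthogonal $H$-representation in each isomorphism class. For $n\in\mathbb{Z}$, the category $v\mathcal{V}_G(n)$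 over $\mathcal{O}_G$ has objects pairs $(G\times_H V_1, G\times_H V_2)$ of bundles over an orbit $G/H$, with $V_1,V_2$ chosen $H$-representations and $\dim V_1-\dim V_2=n$. A morphism from $(G\times_HV_1,G\times_HV_2)$ to $(G\times_KW_1,G\times_KW_2)$ is a $G$-map $\alpha\colon G/H\to G/K$ together with an equivalence class of pairs of $G$-bundle maps $f_i\colon G\times_H(V_i\oplus Z)\to G\times_K(W_i\oplus Z')$ over $\alpha$ ($i=1,2$), with $Z$ an $H$-representation and $Z'$ a $K$-representation. The equivalence relation is generated by $G$-bundle homotopy and by $(\alpha,f_1,f_2)\sim(\alpha,f_1\oplus k,f_2\oplus k)$ for any bundle map $k\colon G\times_HT\to G\times_KT'$ over $\alpha$. The functor to $\mathcal{O}_G$ remembers the base orbit and $\alpha$. $RO(\Pi B)$: a virtual representation of $\Pi B$ of dimension $n$ is a functor $\gamma\colon\Pi B\to v\mathcal{V}_G(n)$ commuting with the functors to $\mathcal{O}_G$. $RO(\Pi B)$ is the set of natural isomorphism classes (over $\mathcal{O}_G$) of virtual representations of all dimensions $n\in\mathbb{Z}$; it is an abelian group under fiberwise direct sum. *)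

theory Defs
  imports "HOL-Analysis.Analysis" "HOL-Algebra.Group_Action" "HOL-Algebra.Left_Coset" "HOL-Algebra.Elementary_Groups"
begin

section \<open>Spaces with a group action\<close>

definition quotient_topology :: "'a topology \<Rightarrow> ('a \<Rightarrow> 'b) \<Rightarrow> 'b topology" where
  "quotient_topology X q =
     topology (\<lambda>U. U \<subseteq> q ` topspace X \<and> openin X {x \<in> topspace X. q x \<in> U})"

lemma openin_quotient_topology:
  "openin (quotient_topology X q) U \<longleftrightarrow>
     U \<subseteq> q ` topspace X \<and> openin X {x \<in> topspace X. q x \<in> U}"
proof -
  have "istopology (\<lambda>U. U \<subseteq> q ` topspace X \<and> openin X {x \<in> topspace X. q x \<in> U})"
    unfolding istopology_def
  proof (intro conjI allI impI)
    fix S T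
    assume S: "S \<subseteq> q ` topspace X \<and> openin X {x \<in> topspace X. q x \<in> S}"
      and T: "T \<subseteq> q ` topspace X \<and> openin X {x \<in> topspace X. q x \<in> T}"
    have "{x \<in> topspace X. q x \<in> S \<inter> T} =
        {x \<in> topspace X. q x \<in> S} \<inter> {x \<in> topspace X. q x \<in> T}"
      by blast
    then show "openin X {x \<in> topspace X. q x \<in> S \<inter> T}"
      using S T by auto
    show "S \<inter> T \<subseteq> q ` topspace X"
      using S by blast
  next
    fix \<K>
    assume K: "\<forall>K\<in>\<K>. K \<subseteq> q ` topspace X \<and> openin X {x \<in> topspace X. q x \<in> K}"
    have "{x \<in> topspace X. q x \<in> \<Union>\<K>} = (\<Union>K\<in>\<K>. {x \<in> topspace X. q x \<in> K})"
      by blast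
    then show "openin X {x \<in> topspace X. q x \<in> \<Union>\<K>}"
      using K by auto
    show "\<Union>\<K> \<subseteq> q ` topspace X"
      using K by blast
  qed
  then show ?thesis
    by (simp add: quotient_topology_def topology_inverse')
qed

lemma topspace_quotient_topology: "topspace (quotient_topology X q) = q ` topspace X"
proof
  show "topspace (quotient_topology X q) \<subseteq> q ` topspace X"
    by (metis openin_quotient_topology openin_topspace)
  have "{x \<in> topspace X. q x \<in> q ` topspace X} = topspace X"
    by blast
  then have "openin (quotient_topology X q) (q ` topspace X)"
    by (simp add: openin_quotient_topology)
  then show "q ` topspace X \<subseteq> topspace (quotient_topology X q)"
    by (rule openin_subset)
qed

lemma quotient_map_quotient_topology: "quotient_map X (quotient_topology X q) q"
  by (simp add: quotient_map_def topspace_quotient_topology openin_quotient_topology)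

record ('g, 'a) gspace =
  gtop :: "'a topology"
  gact :: "'g \<Rightarrow> 'a \<Rightarrow> 'a"

definition is_gspace :: "('g, 'm) monoid_scheme \<Rightarrow> ('g, 'a) gspace \<Rightarrow> bool" where
  "is_gspace G X \<longleftrightarrow> group_action G (topspace (gtop X)) (gact X) \<and>
     (\<forall>g\<in>carrier G. continuous_map (gtop X) (gtop X) (gact X g))"

text \<open>Maps are extensional, so that equality of maps is equality on the underlying space.\<close>

definition gmaps ::
  "('g, 'm) monoid_scheme \<Rightarrow> ('g, 'a) gspace \<Rightarrow> ('g, 'b) gspace \<Rightarrow> ('a \<Rightarrow> 'b) set" where
  "gmaps G X Y = {f \<in> extensional (topspace (gtop X)). continuous_map (gtop X) (gtop Y) f \<and>
     (\<forall>g\<in>carrier G. \<forall>x\<in>topspace (gtop X). f (gact X g x) = gact Y g (f x))}"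

definition orbit_gspace :: "('g, 'm) monoid_scheme \<Rightarrow> 'g set \<Rightarrow> ('g, 'g set) gspace" where
  "orbit_gspace G H = \<lparr>gtop = discrete_topology (lcosets\<^bsub>G\<^esub> H),
     gact = (\<lambda>g. \<lambda>c\<in>lcosets\<^bsub>G\<^esub> H. g <#\<^bsub>G\<^esub> c)\<rparr>"

definition cylinder :: "('g, 'a) gspace \<Rightarrow> ('g, 'a \<times> real) gspace" where
  "cylinder X = \<lparr>gtop = prod_topology (gtop X) (top_of_set {0..1}),
     gact = (\<lambda>g. \<lambda>(x, t)\<in>topspace (gtop X) \<times> {0..1}. (gact X g x, t))\<rparr>"


section \<open>Categories, functors, natural isomorphisms\<close>

record ('o, 'a) cat =
  ob :: "'o set"
  arr :: "'o \<Rightarrow> 'o \<Rightarrow> 'a set"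
  idt :: "'o \<Rightarrow> 'a"
  cmp :: "'o \<Rightarrow> 'o \<Rightarrow> 'o \<Rightarrow> 'a \<Rightarrow> 'a \<Rightarrow> 'a"

text \<open>\<^term>\<open>cmp C x y z g f\<close> is the composite of \<open>f: x \<rightarrow> y\<close> and \<open>g: y \<rightarrow> z\<close>.\<close>

type_synonym ('o, 'a, 'p, 'b) cat_functor = "('o \<Rightarrow> 'p) \<times> ('o \<Rightarrow> 'o \<Rightarrow> 'a \<Rightarrow> 'b)"

definition is_functor ::
  "('o, 'a) cat \<Rightarrow> ('p, 'b) cat \<Rightarrow> ('o, 'a, 'p, 'b) cat_functor \<Rightarrow> bool" where
  "is_functor C D = (\<lambda>(F0, F1).
     (\<forall>x\<in>ob C. F0 x \<in> ob D) \<and>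
     (\<forall>x\<in>ob C. \<forall>y\<in>ob C. \<forall>f\<in>arr C x y. F1 x y f \<in> arr D (F0 x) (F0 y)) \<and>
     (\<forall>x\<in>ob C. F1 x x (idt C x) = idt D (F0 x)) \<and>
     (\<forall>x\<in>ob C. \<forall>y\<in>ob C. \<forall>z\<in>ob C. \<forall>f\<in>arr C x y. \<forall>g\<in>arr C y z.
        F1 x z (cmp C x y z g f) = cmp D (F0 x) (F0 y) (F0 z) (F1 y z g) (F1 x y f)))"

definition is_iso_arr :: "('o, 'a) cat \<Rightarrow> 'o \<Rightarrow> 'o \<Rightarrow> 'a \<Rightarrow> bool" where
  "is_iso_arr C x y f \<longleftrightarrow> f \<in> arr C x y \<and>
     (\<exists>g\<in>arr C y x. cmp C x y x g f = idt C x \<and> cmp C y x y f g = idt C y)"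

definition orbit_cat ::
  "('g, 'm) monoid_scheme \<Rightarrow> ('g set, 'g set \<Rightarrow> 'g set) cat" where
  "orbit_cat G = \<lparr>ob = {H. subgroup H G},
     arr = (\<lambda>H K. gmaps G (orbit_gspace G H) (orbit_gspace G K)),
     idt = (\<lambda>H. \<lambda>c\<in>lcosets\<^bsub>G\<^esub> H. c),
     cmp = (\<lambda>H K L \<beta> \<alpha>. compose (lcosets\<^bsub>G\<^esub> H) \<beta> \<alpha>)\<rparr>"

text \<open>
  In both categories over \<^const>\<open>orbit_cat\<close> used below, the first component of an object is the
  subgroup \<open>H\<close> of the underlying orbit \<open>G/H\<close> and the first component of a morphism is the
  underlying map \<open>\<alpha>\<close> of orbits; the functor to \<^const>\<open>orbit_cat\<close> is \<^const>\<open>fst\<close> on objects and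
  on morphisms.
\<close>

definition over_orbits ::
  "('g set \<times> 'x, 'h \<times> 'a) cat \<Rightarrow>
   ('g set \<times> 'x, 'h \<times> 'a, 'g set \<times> 'y, 'h \<times> 'b) cat_functor \<Rightarrow> bool" where
  "over_orbits C = (\<lambda>(F0, F1).
     (\<forall>x\<in>ob C. fst (F0 x) = fst x) \<and>
     (\<forall>x\<in>ob C. \<forall>y\<in>ob C. \<forall>f\<in>arr C x y. fst (F1 x y f) = fst f))"

definition nat_iso_over ::
  "('g, 'm) monoid_scheme \<Rightarrow>
   ('g set \<times> 'x, ('g set \<Rightarrow> 'g set) \<times> 'a) cat \<Rightarrow>
   ('g set \<times> 'y, ('g set \<Rightarrow> 'g set) \<times> 'b) cat \<Rightarrow>
   ('g set \<times> 'x, ('g set \<Rightarrow> 'g set) \<times> 'a, 'g set \<times> 'y, ('g set \<Rightarrow> 'g set) \<times> 'b) cat_functor \<Rightarrow>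
   ('g set \<times> 'x, ('g set \<Rightarrow> 'g set) \<times> 'a, 'g set \<times> 'y, ('g set \<Rightarrow> 'g set) \<times> 'b) cat_functor \<Rightarrow>
   bool" where
  "nat_iso_over G C D = (\<lambda>(E0, E1) (F0, F1). \<exists>\<eta>.
     (\<forall>x\<in>ob C. is_iso_arr D (E0 x) (F0 x) (\<eta> x) \<and> fst (\<eta> x) = idt (orbit_cat G) (fst x)) \<and>
     (\<forall>x\<in>ob C. \<forall>y\<in>ob C. \<forall>f\<in>arr C x y.
        cmp D (E0 x) (E0 y) (F0 y) (\<eta> y) (E1 x y f) =
        cmp D (E0 x) (F0 x) (F0 y) (F1 x y f) (\<eta> x)))"


section \<open>The equivariant fundamental groupoid\<close>

definition ghomotopies ::
  "('g, 'm) monoid_scheme \<Rightarrow> ('g, 'b) gspace \<Rightarrow> 'g set \<Rightarrow> ('g set \<Rightarrow> 'b) \<Rightarrow> ('g set \<Rightarrow> 'b) \<Rightarrow>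
   ('g set \<times> real \<Rightarrow> 'b) set" where
  "ghomotopies G B H x z = {\<omega> \<in> gmaps G (cylinder (orbit_gspace G H)) B.
     \<forall>c\<in>lcosets\<^bsub>G\<^esub> H. \<omega> (c, 0) = x c \<and> \<omega> (c, 1) = z c}"

definition rel_homotopy ::
  "('g, 'm) monoid_scheme \<Rightarrow> ('g, 'b) gspace \<Rightarrow> 'g set \<Rightarrow> ('g set \<Rightarrow> 'b) \<Rightarrow> ('g set \<Rightarrow> 'b) \<Rightarrow>
   (('g set \<times> real \<Rightarrow> 'b) \<times> ('g set \<times> real \<Rightarrow> 'b)) set" where
  "rel_homotopy G B H x z = {(\<omega>, \<omega>').
     homotopic_with (\<lambda>\<eta>. \<eta> \<in> ghomotopies G B H x z)
       (gtop (cylinder (orbit_gspace G H))) (gtop B) \<omega> \<omega>'}"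

text \<open>\<open>concat_htpy G H \<omega>\<^sub>2 \<omega>\<^sub>1\<close> is \<open>\<omega>\<^sub>1\<close> followed by \<open>\<omega>\<^sub>2\<close>.\<close>

definition concat_htpy ::
  "('g, 'm) monoid_scheme \<Rightarrow> 'g set \<Rightarrow> ('g set \<times> real \<Rightarrow> 'b) \<Rightarrow> ('g set \<times> real \<Rightarrow> 'b) \<Rightarrow>
   'g set \<times> real \<Rightarrow> 'b" where
  "concat_htpy G H \<omega>2 \<omega>1 = (\<lambda>(c, t)\<in>(lcosets\<^bsub>G\<^esub> H) \<times> {0..1}.
     if t \<le> 1/2 then \<omega>1 (c, 2 * t) else \<omega>2 (c, 2 * t - 1))"

definition fundamental_groupoid ::
  "('g, 'm) monoid_scheme \<Rightarrow> ('g, 'b) gspace \<Rightarrow>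
   ('g set \<times> ('g set \<Rightarrow> 'b), ('g set \<Rightarrow> 'g set) \<times> ('g set \<times> real \<Rightarrow> 'b) set) cat" where
  "fundamental_groupoid G B = \<lparr>
     ob = {(H, x). subgroup H G \<and> x \<in> gmaps G (orbit_gspace G H) B},
     arr = (\<lambda>(H, x) (K, y). {(\<alpha>, P). \<alpha> \<in> arr (orbit_cat G) H K \<and>
       P \<in> ghomotopies G B H x (compose (lcosets\<^bsub>G\<^esub> H) y \<alpha>) //
            rel_homotopy G B H x (compose (lcosets\<^bsub>G\<^esub> H) y \<alpha>)}),
     idt = (\<lambda>(H, x). (idt (orbit_cat G) H,
       rel_homotopy G B H x x `` {\<lambda>(c, t)\<in>(lcosets\<^bsub>G\<^esub> H) \<times> {0..1}. x c})),
     cmp = (\<lambda>(H, x) (K, y) (L, z) (\<alpha>, P) (\<alpha>', P').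
       (cmp (orbit_cat G) H K L \<alpha> \<alpha>',
        rel_homotopy G B H x (compose (lcosets\<^bsub>G\<^esub> H) z (cmp (orbit_cat G) H K L \<alpha> \<alpha>')) ``
          {concat_htpy G H (\<lambda>(c, t). \<omega> (\<alpha>' c, t)) \<omega>' | \<omega> \<omega>'. \<omega> \<in> P \<and> \<omega>' \<in> P'}))\<rparr>"


section \<open>Orthogonal representations\<close>

text \<open>
  \<open>\<real>\<^sup>n\<close> is the underlying set of \<^const>\<open>Euclidean_space\<close>: the sequences vanishing from index \<open>n\<close> on.
  A representation is its dimension together with the action; values of the action outside the
  acting subgroup are irrelevant.
\<close>

type_synonym rvec = "nat \<Rightarrow> real"
type_synonym 'g rep = "nat \<times> ('g \<Rightarrow> rvec \<Rightarrow> rvec)"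

abbreviation Rn :: "nat \<Rightarrow> rvec set" where
  "Rn n \<equiv> topspace (Euclidean_space n)"

definition linear_Rn :: "nat \<Rightarrow> nat \<Rightarrow> (rvec \<Rightarrow> rvec) \<Rightarrow> bool" where
  "linear_Rn m n A \<longleftrightarrow> A \<in> Rn m \<rightarrow> Rn n \<and>
     (\<forall>u\<in>Rn m. \<forall>v\<in>Rn m. \<forall>a b. A (\<lambda>i. a * u i + b * v i) = (\<lambda>i. a * A u i + b * A v i))"

definition linear_iso_Rn :: "nat \<Rightarrow> nat \<Rightarrow> (rvec \<Rightarrow> rvec) \<Rightarrow> bool" where
  "linear_iso_Rn m n A \<longleftrightarrow> linear_Rn m n A \<and> bij_betw A (Rn m) (Rn n)"

definition orth_rep :: "('g, 'm) monoid_scheme \<Rightarrow> 'g set \<Rightarrow> 'g rep \<Rightarrow> bool" where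
  "orth_rep G H = (\<lambda>(n, \<rho>). group_action (G\<lparr>carrier := H\<rparr>) (Rn n) \<rho> \<and>
     (\<forall>h\<in>H. linear_Rn n n (\<rho> h) \<and>
       (\<forall>u\<in>Rn n. \<forall>v\<in>Rn n. (\<Sum>i<n. \<rho> h u i * \<rho> h v i) = (\<Sum>i<n. u i * v i))))"

definition rep_iso :: "'g set \<Rightarrow> 'g rep \<Rightarrow> 'g rep \<Rightarrow> bool" where
  "rep_iso H = (\<lambda>(m, \<rho>) (n, \<sigma>). \<exists>A. linear_iso_Rn m n A \<and>
     (\<forall>h\<in>H. \<forall>u\<in>Rn m. A (\<rho> h u) = \<sigma> h (A u)))"

definition append_vec :: "nat \<Rightarrow> rvec \<Rightarrow> rvec \<Rightarrow> rvec" where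
  "append_vec m u v = (\<lambda>i. if i < m then u i else v (i - m))"

definition take_vec :: "nat \<Rightarrow> rvec \<Rightarrow> rvec" where
  "take_vec m u = (\<lambda>i. if i < m then u i else 0)"

definition drop_vec :: "nat \<Rightarrow> rvec \<Rightarrow> rvec" where
  "drop_vec m u = (\<lambda>i. u (i + m))"

text \<open>
  The direct sum is formed in block coordinates. It is strictly associative, but commutative only
  up to isomorphism.
\<close>

definition rep_sum :: "'g rep \<Rightarrow> 'g rep \<Rightarrow> 'g rep" (infixr \<open>\<oplus>\<^sub>r\<close> 65) where
  "rep_sum = (\<lambda>(m, \<rho>) (n, \<sigma>). (m + n, \<lambda>h. \<lambda>u\<in>Rn (m + n).
     append_vec m (\<rho> h (take_vec m u)) (\<sigma> h (drop_vec m u))))"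

definition zero_rep :: "'g rep" where
  "zero_rep = (0, \<lambda>h. \<lambda>u\<in>Rn 0. u)"

definition rep_system :: "('g, 'm) monoid_scheme \<Rightarrow> ('g set \<Rightarrow> 'g rep set) \<Rightarrow> bool" where
  "rep_system G R \<longleftrightarrow> (\<forall>H. subgroup H G \<longrightarrow>
     (\<forall>V\<in>R H. orth_rep G H V) \<and>
     (\<forall>V. orth_rep G H V \<longrightarrow> (\<exists>!W. W \<in> R H \<and> rep_iso H V W)))"

lemma rep_iso_refl: "rep_iso H V V"
proof (cases V)
  case (Pair n \<rho>)
  have "linear_iso_Rn n n (\<lambda>u. u)"
    by (simp add: linear_iso_Rn_def linear_Rn_def bij_betw_def)
  then show ?thesis
    unfolding Pair rep_iso_def by auto
qed

lemma rep_iso_trans: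
  assumes "rep_iso H U V" "rep_iso H V W"
  shows "rep_iso H U W"
proof -
  obtain l \<rho> m \<sigma> n \<tau> where UVW: "U = (l, \<rho>)" "V = (m, \<sigma>)" "W = (n, \<tau>)"
    by (metis surj_pair)
  obtain A where A: "linear_iso_Rn l m A" "\<And>h u. h \<in> H \<Longrightarrow> u \<in> Rn l \<Longrightarrow> A (\<rho> h u) = \<sigma> h (A u)"
    using assms(1) unfolding UVW rep_iso_def by auto
  obtain B where B: "linear_iso_Rn m n B" "\<And>h u. h \<in> H \<Longrightarrow> u \<in> Rn m \<Longrightarrow> B (\<sigma> h u) = \<tau> h (B u)"
    using assms(2) unfolding UVW rep_iso_def by auto
  have mem: "A u \<in> Rn m" if "u \<in> Rn l" for u
    using A(1) that by (auto simp: linear_iso_Rn_def linear_Rn_def)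
  have "linear_iso_Rn l n (B \<circ> A)"
    using A(1) B(1) mem unfolding linear_iso_Rn_def linear_Rn_def
    by (auto intro: bij_betw_trans)
  moreover have "(B \<circ> A) (\<rho> h u) = \<tau> h ((B \<circ> A) u)" if "h \<in> H" "u \<in> Rn l" for h u
    using that A(2) B(2) mem by simp
  ultimately show ?thesis
    unfolding UVW rep_iso_def by auto
qed

lemma rep_iso_sym:
  assumes V: "orth_rep G H V" and iso: "rep_iso H V W"
  shows "rep_iso H W V"
proof -
  obtain m \<rho> n \<sigma> where VW: "V = (m, \<rho>)" "W = (n, \<sigma>)"
    by (metis surj_pair)
  obtain A where A: "linear_iso_Rn m n A" "\<And>h u. h \<in> H \<Longrightarrow> u \<in> Rn m \<Longrightarrow> A (\<rho> h u) = \<sigma> h (A u)"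
    using iso unfolding VW rep_iso_def by auto
  define B where "B = inv_into (Rn m) A"
  have bij: "bij_betw A (Rn m) (Rn n)" and lin: "linear_Rn m n A"
    using A(1) by (auto simp: linear_iso_Rn_def)
  have B: "B v \<in> Rn m" "A (B v) = v" if "v \<in> Rn n" for v
    using bij that unfolding B_def
    by (auto simp: bij_betw_def inv_into_into f_inv_into_f)
  have eq: "B v = u" if "u \<in> Rn m" "A u = v" for u v
    using bij that unfolding B_def by (auto simp: bij_betw_def)
  have comb: "(\<lambda>i. a * u i + b * v i) \<in> Rn m" if "u \<in> Rn m" "v \<in> Rn m" for a b u v
    using that by (auto simp: topspace_Euclidean_space)
  have "B (\<lambda>i. a * u i + b * v i) = (\<lambda>i. a * B u i + b * B v i)"
    if "u \<in> Rn n" "v \<in> Rn n" for a b u v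
    by (rule eq) (use that B lin comb in \<open>auto simp: linear_Rn_def\<close>)
  then have "linear_iso_Rn n m B"
    using B bij_betw_inv_into[OF bij] by (auto simp: linear_iso_Rn_def linear_Rn_def B_def)
  moreover have "B (\<sigma> h v) = \<rho> h (B v)" if "h \<in> H" "v \<in> Rn n" for h v
  proof (rule eq)
    show "\<rho> h (B v) \<in> Rn m"
      using V that B(1)[of v] unfolding VW orth_rep_def linear_Rn_def by blast
    show "A (\<rho> h (B v)) = \<sigma> h v"
      using A(2)[of h "B v"] B that by simp
  qed
  ultimately show ?thesis
    unfolding VW rep_iso_def by auto
qed

lemma rep_system_exists: "\<exists>R. rep_system G R"
proof -
  define c where "c = (\<lambda>H V. SOME W. orth_rep G H W \<and> rep_iso H V W)"
  have c: "orth_rep G H (c H V) \<and> rep_iso H V (c H V)" if "orth_rep G H V" for H V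
    unfolding c_def by (rule someI[of _ V]) (simp add: that rep_iso_refl)
  have c_eq: "c H V = c H W" if "orth_rep G H V" "orth_rep G H W" "rep_iso H V W" for H V W
  proof -
    have "rep_iso H V U \<longleftrightarrow> rep_iso H W U" for U
      using that rep_iso_trans rep_iso_sym by blast
    then show ?thesis
      by (simp add: c_def)
  qed
  have "rep_system G (\<lambda>H. c H ` {V. orth_rep G H V})"
    unfolding rep_system_def
  proof (intro allI impI conjI)
    fix H
    show "\<forall>V\<in>c H ` {V. orth_rep G H V}. orth_rep G H V"
      using c by blast
    fix V assume V: "orth_rep G H V"
    show "\<exists>!W. W \<in> c H ` {V. orth_rep G H V} \<and> rep_iso H V W"
    proof (rule ex1I[of _ "c H V"])
      show "c H V \<in> c H ` {V. orth_rep G H V} \<and> rep_iso H V (c H V)"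
        using V c by blast
      fix W assume "W \<in> c H ` {V. orth_rep G H V} \<and> rep_iso H V W"
      then obtain U where U: "orth_rep G H U" "W = c H U" "rep_iso H V W"
        by blast
      then have "rep_iso H V U"
        using c[OF U(1)] rep_iso_sym[OF U(1)] rep_iso_trans by metis
      then show "W = c H V"
        using c_eq[OF V U(1)] U(2) by simp
    qed
  qed
  then show ?thesis
    by blast
qed

abbreviation all_reps :: "('g, 'm) monoid_scheme \<Rightarrow> 'g set \<Rightarrow> 'g rep set" where
  "all_reps G H \<equiv> {V. orth_rep G H V}"


section \<open>Bundles over orbits\<close>

text \<open>
  A point \<open>[a, u]\<close> of \<open>G \<times>\<^sub>H V\<close> is the class of \<open>(a, u)\<close> for \<open>(a, u) \<sim> (a h\<^sup>-\<^sup>1, h u)\<close>. The set of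
  first components of the class is the coset \<open>a H\<close>, i.e. \<open>fst ` p\<close> is the projection of \<open>p\<close> to
  \<open>G/H\<close>.
\<close>

definition bpoint ::
  "('g, 'm) monoid_scheme \<Rightarrow> 'g set \<Rightarrow> 'g rep \<Rightarrow> 'g \<times> rvec \<Rightarrow> ('g \<times> rvec) set" where
  "bpoint G H V = (\<lambda>(a, u). {(a \<otimes>\<^bsub>G\<^esub> inv\<^bsub>G\<^esub> h, snd V h u) | h. h \<in> H})"

definition vbundle ::
  "('g, 'm) monoid_scheme \<Rightarrow> 'g set \<Rightarrow> 'g rep \<Rightarrow> ('g, ('g \<times> rvec) set) gspace" where
  "vbundle G H V = \<lparr>
     gtop = quotient_topology
       (prod_topology (discrete_topology (carrier G)) (Euclidean_space (fst V))) (bpoint G H V),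
     gact = (\<lambda>g. \<lambda>p\<in>bpoint G H V ` (carrier G \<times> Rn (fst V)).
       (\<lambda>(a, u). (g \<otimes>\<^bsub>G\<^esub> a, u)) ` p)\<rparr>"

abbreviation bpoints ::
  "('g, 'm) monoid_scheme \<Rightarrow> 'g set \<Rightarrow> 'g rep \<Rightarrow> ('g \<times> rvec) set set" where
  "bpoints G H V \<equiv> topspace (gtop (vbundle G H V))"

type_synonym 'g bmap = "('g \<times> rvec) set \<Rightarrow> ('g \<times> rvec) set"

text \<open>
  In the coordinates \<open>u \<mapsto> [a, u]\<close> and \<open>w \<mapsto> [b, w]\<close> on the fibres over \<open>a H\<close> and over
  \<open>b K = \<alpha> (a H)\<close>, a bundle map over \<open>\<alpha>\<close> is a linear isomorphism.
\<close>

definition bundle_map ::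
  "('g, 'm) monoid_scheme \<Rightarrow> 'g set \<Rightarrow> 'g rep \<Rightarrow> 'g set \<Rightarrow> 'g rep \<Rightarrow>
   ('g set \<Rightarrow> 'g set) \<Rightarrow> 'g bmap \<Rightarrow> bool" where
  "bundle_map G H V K W \<alpha> f \<longleftrightarrow> f \<in> gmaps G (vbundle G H V) (vbundle G K W) \<and>
     (\<forall>a\<in>carrier G. \<forall>b\<in>\<alpha> (a <#\<^bsub>G\<^esub> H). \<exists>A. linear_iso_Rn (fst V) (fst W) A \<and>
        (\<forall>u\<in>Rn (fst V). f (bpoint G H V (a, u)) = bpoint G K W (b, A u)))"

definition bundle_homotopic ::
  "('g, 'm) monoid_scheme \<Rightarrow> 'g set \<Rightarrow> 'g rep \<Rightarrow> 'g set \<Rightarrow> 'g rep \<Rightarrow>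
   ('g set \<Rightarrow> 'g set) \<Rightarrow> 'g bmap \<Rightarrow> 'g bmap \<Rightarrow> bool" where
  "bundle_homotopic G H V K W \<alpha> =
     homotopic_with (bundle_map G H V K W \<alpha>) (gtop (vbundle G H V)) (gtop (vbundle G K W))"

definition bid :: "('g, 'm) monoid_scheme \<Rightarrow> 'g set \<Rightarrow> 'g rep \<Rightarrow> 'g bmap" where
  "bid G H V = (\<lambda>p\<in>bpoints G H V. p)"

definition on_fibres :: "(rvec \<Rightarrow> rvec) \<Rightarrow> 'g bmap" where
  "on_fibres \<theta> p = (\<lambda>(a, u). (a, \<theta> u)) ` p"

text \<open>
  The sum of \<open>f: G \<times>\<^sub>H V \<rightarrow> G \<times>\<^sub>K W\<close> and \<open>k: G \<times>\<^sub>H T \<rightarrow> G \<times>\<^sub>K T'\<close> over the same map of orbits, with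
  \<open>n = dim W\<close>: if \<open>f [a, u] = [b, w]\<close> and \<open>k [a, t] = [b, s]\<close>, then \<open>[a, u \<oplus> t]\<close> is sent to
  \<open>[b, w \<oplus> s]\<close>.
\<close>

definition bmap_sum ::
  "('g, 'm) monoid_scheme \<Rightarrow> 'g set \<Rightarrow> 'g rep \<Rightarrow> 'g rep \<Rightarrow> nat \<Rightarrow> 'g bmap \<Rightarrow> 'g bmap \<Rightarrow> 'g bmap" where
  "bmap_sum G H V T n f k = (\<lambda>p\<in>bpoints G H (V \<oplus>\<^sub>r T).
     {(b, append_vec n w s) | b w s.
        (b, w) \<in> f (on_fibres (take_vec (fst V)) p) \<and>
        (b, s) \<in> k (on_fibres (drop_vec (fst V)) p)})"


section \<open>Virtual bundles over orbits\<close>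

type_synonym 'g vobj = "'g set \<times> 'g rep \<times> 'g rep"
type_synonym 'g vpair = "'g rep \<times> 'g rep \<times> 'g bmap \<times> 'g bmap"

text \<open>
  Representatives \<open>(Z, Z', f\<^sub>1, f\<^sub>2)\<close> of the morphisms over \<open>\<alpha>\<close>, with
  \<open>f\<^sub>i: G \<times>\<^sub>H (V\<^sub>i \<oplus> Z) \<rightarrow> G \<times>\<^sub>K (W\<^sub>i \<oplus> Z')\<close>.
\<close>

definition vpairs ::
  "('g, 'm) monoid_scheme \<Rightarrow> 'g vobj \<Rightarrow> 'g vobj \<Rightarrow> ('g set \<Rightarrow> 'g set) \<Rightarrow> 'g vpair set" where
  "vpairs G = (\<lambda>(H, V1, V2) (K, W1, W2) \<alpha>. {(Z, Z', f1, f2).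
     orth_rep G H Z \<and> orth_rep G K Z' \<and>
     bundle_map G H (V1 \<oplus>\<^sub>r Z) K (W1 \<oplus>\<^sub>r Z') \<alpha> f1 \<and>
     bundle_map G H (V2 \<oplus>\<^sub>r Z) K (W2 \<oplus>\<^sub>r Z') \<alpha> f2})"

text \<open>
  The equivalence relation generated by bundle homotopy and by stabilization. The rule \<open>change\<close>
  says that the auxiliary representations \<open>Z\<close>, \<open>Z'\<close> matter only up to isomorphism, as is implicit
  when direct sums are identified along their canonical isomorphisms: here \<open>Z \<oplus> T\<close> and \<open>T \<oplus> Z\<close>
  are different representations on the same \<open>\<real>\<^sup>n\<close>, and without it two morphisms need not have
  representatives that can be composed. (Identifying only \<open>Z \<oplus> T\<close> with \<open>T \<oplus> Z\<close> along the
  interchange of summands, separately in the source and in the target, generates the same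
  relation: \<open>f\<^sub>i \<oplus> j\<close> and \<open>f\<^sub>i (1 \<oplus> j) \<oplus> 1\<close> agree, after such an interchange in the source, up to
  homotopy and an automorphism \<open>-1\<close> of a summand common to \<open>i = 1, 2\<close>, and
  \<open>f\<^sub>i (1 \<oplus> u) \<oplus> u\<^sup>-\<^sup>1\<close> is homotopic to \<open>f\<^sub>i \<oplus> 1\<close> for any automorphism \<open>u\<close> of \<open>Z\<close>.)
\<close>

inductive_set vpair_rel ::
  "('g, 'm) monoid_scheme \<Rightarrow> 'g vobj \<Rightarrow> 'g vobj \<Rightarrow> ('g set \<Rightarrow> 'g set) \<Rightarrow> ('g vpair \<times> 'g vpair) set"
  for G :: "('g, 'm) monoid_scheme" and X Y :: "'g vobj" and \<alpha> :: "'g set \<Rightarrow> 'g set"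
  where
    refl: "p \<in> vpairs G X Y \<alpha> \<Longrightarrow> (p, p) \<in> vpair_rel G X Y \<alpha>"
  | sym: "(p, q) \<in> vpair_rel G X Y \<alpha> \<Longrightarrow> (q, p) \<in> vpair_rel G X Y \<alpha>"
  | trans: "\<lbrakk>(p, q) \<in> vpair_rel G X Y \<alpha>; (q, r) \<in> vpair_rel G X Y \<alpha>\<rbrakk> \<Longrightarrow>
      (p, r) \<in> vpair_rel G X Y \<alpha>"
  | homotopy: "\<lbrakk>X = (H, V1, V2); Y = (K, W1, W2);
      (Z, Z', f1, f2) \<in> vpairs G X Y \<alpha>;
      bundle_homotopic G H (V1 \<oplus>\<^sub>r Z) K (W1 \<oplus>\<^sub>r Z') \<alpha> f1 f1';
      bundle_homotopic G H (V2 \<oplus>\<^sub>r Z) K (W2 \<oplus>\<^sub>r Z') \<alpha> f2 f2'\<rbrakk> \<Longrightarrow>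
      ((Z, Z', f1, f2), (Z, Z', f1', f2')) \<in> vpair_rel G X Y \<alpha>"
  | stabilize: "\<lbrakk>X = (H, V1, V2); Y = (K, W1, W2);
      (Z, Z', f1, f2) \<in> vpairs G X Y \<alpha>;
      orth_rep G H T; orth_rep G K T'; bundle_map G H T K T' \<alpha> k\<rbrakk> \<Longrightarrow>
      ((Z, Z', f1, f2),
       (Z \<oplus>\<^sub>r T, Z' \<oplus>\<^sub>r T',
        bmap_sum G H (V1 \<oplus>\<^sub>r Z) T (fst (W1 \<oplus>\<^sub>r Z')) f1 k,
        bmap_sum G H (V2 \<oplus>\<^sub>r Z) T (fst (W2 \<oplus>\<^sub>r Z')) f2 k)) \<in> vpair_rel G X Y \<alpha>"
  | change: "\<lbrakk>X = (H, V1, V2); Y = (K, W1, W2);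
      (Z, Z', f1, f2) \<in> vpairs G X Y \<alpha>;
      orth_rep G H U; bundle_map G H U H Z (idt (orbit_cat G) H) j;
      orth_rep G K U'; bundle_map G K Z' K U' (idt (orbit_cat G) K) c\<rbrakk> \<Longrightarrow>
      ((Z, Z', f1, f2),
       (U, U',
        compose (bpoints G H (V1 \<oplus>\<^sub>r U)) (bmap_sum G K W1 Z' (fst W1) (bid G K W1) c \<circ> f1)
          (bmap_sum G H V1 U (fst V1) (bid G H V1) j),
        compose (bpoints G H (V2 \<oplus>\<^sub>r U)) (bmap_sum G K W2 Z' (fst W2) (bid G K W2) c \<circ> f2)
          (bmap_sum G H V2 U (fst V2) (bid G H V2) j))) \<in> vpair_rel G X Y \<alpha>"

text \<open>
  The category of virtual bundles of dimension \<open>n\<close> over orbits, with fibres taken from \<open>R\<close>.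
  Morphisms are composed by composing representatives \<open>f\<^sub>i: G \<times>\<^sub>H (V\<^sub>i \<oplus> Z) \<rightarrow> G \<times>\<^sub>K (W\<^sub>i \<oplus> Z')\<close> and
  \<open>g\<^sub>i: G \<times>\<^sub>K (W\<^sub>i \<oplus> Z') \<rightarrow> G \<times>\<^sub>L (U\<^sub>i \<oplus> Z'')\<close>.
\<close>

definition virtual_bundles ::
  "('g, 'm) monoid_scheme \<Rightarrow> ('g set \<Rightarrow> 'g rep set) \<Rightarrow> int \<Rightarrow>
   ('g vobj, ('g set \<Rightarrow> 'g set) \<times> 'g vpair set) cat" where
  "virtual_bundles G R n = \<lparr>
     ob = {(H, V1, V2). subgroup H G \<and> V1 \<in> R H \<and> V2 \<in> R H \<and> int (fst V1) - int (fst V2) = n},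
     arr = (\<lambda>X Y. {(\<alpha>, P). \<alpha> \<in> arr (orbit_cat G) (fst X) (fst Y) \<and>
       P \<in> vpairs G X Y \<alpha> // vpair_rel G X Y \<alpha>}),
     idt = (\<lambda>(H, V1, V2). (idt (orbit_cat G) H,
       vpair_rel G (H, V1, V2) (H, V1, V2) (idt (orbit_cat G) H) ``
         {(zero_rep, zero_rep, bid G H (V1 \<oplus>\<^sub>r zero_rep), bid G H (V2 \<oplus>\<^sub>r zero_rep))})),
     cmp = (\<lambda>(H, V1, V2) (K, W1, W2) (L, U1, U2) (\<beta>, Q) (\<alpha>, P).
       (cmp (orbit_cat G) H K L \<beta> \<alpha>,
        vpair_rel G (H, V1, V2) (L, U1, U2) (cmp (orbit_cat G) H K L \<beta> \<alpha>) ``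
          {(Z, Z'', compose (bpoints G H (V1 \<oplus>\<^sub>r Z)) g1 f1,
                    compose (bpoints G H (V2 \<oplus>\<^sub>r Z)) g2 f2) | Z Z' Z'' f1 f2 g1 g2.
             (Z, Z', f1, f2) \<in> P \<and> (Z', Z'', g1, g2) \<in> Q}))\<rparr>"


section \<open>Virtual representations of the fundamental groupoid\<close>

type_synonym ('g, 'b) virtual_rep =
  "('g set \<times> ('g set \<Rightarrow> 'b), ('g set \<Rightarrow> 'g set) \<times> ('g set \<times> real \<Rightarrow> 'b) set,
    'g vobj, ('g set \<Rightarrow> 'g set) \<times> 'g vpair set) cat_functor"

definition virtual_reps ::
  "('g, 'm) monoid_scheme \<Rightarrow> ('g set \<Rightarrow> 'g rep set) \<Rightarrow> ('g, 'b) gspace \<Rightarrow> int \<Rightarrow>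
   ('g, 'b) virtual_rep set" where
  "virtual_reps G R B n = {\<gamma>.
     is_functor (fundamental_groupoid G B) (virtual_bundles G R n) \<gamma> \<and>
     over_orbits (fundamental_groupoid G B) \<gamma>}"

definition virtual_rep_iso ::
  "('g, 'm) monoid_scheme \<Rightarrow> ('g set \<Rightarrow> 'g rep set) \<Rightarrow> ('g, 'b) gspace \<Rightarrow> int \<Rightarrow>
   (('g, 'b) virtual_rep \<times> ('g, 'b) virtual_rep) set" where
  "virtual_rep_iso G R B n = {(\<gamma>, \<delta>). \<gamma> \<in> virtual_reps G R B n \<and> \<delta> \<in> virtual_reps G R B n \<and>
     nat_iso_over G (fundamental_groupoid G B) (virtual_bundles G R n) \<gamma> \<delta>}"

text \<open>
  \<open>interchange a b c\<close> is \<open>x \<oplus> y \<oplus> z \<oplus> w \<mapsto> x \<oplus> z \<oplus> y \<oplus> w\<close> for \<open>x\<close>, \<open>y\<close>, \<open>z\<close> of dimensions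
  \<open>a\<close>, \<open>b\<close>, \<open>c\<close>.
\<close>

definition interchange :: "nat \<Rightarrow> nat \<Rightarrow> nat \<Rightarrow> rvec \<Rightarrow> rvec" where
  "interchange a b c u = (\<lambda>i. if i < a then u i else if i < a + c then u (i + b)
     else if i < a + c + b then u (i - c) else u i)"

text \<open>
  The sum of \<open>f: G \<times>\<^sub>H (V \<oplus> Z) \<rightarrow> G \<times>\<^sub>K (W \<oplus> Z')\<close> and \<open>g: G \<times>\<^sub>H (V' \<oplus> S) \<rightarrow> G \<times>\<^sub>K (W' \<oplus> S')\<close>,
  as a map \<open>G \<times>\<^sub>H ((V \<oplus> V') \<oplus> (Z \<oplus> S)) \<rightarrow> G \<times>\<^sub>K ((W \<oplus> W') \<oplus> (Z' \<oplus> S'))\<close>.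
\<close>

definition stable_sum ::
  "('g, 'm) monoid_scheme \<Rightarrow> 'g set \<Rightarrow> 'g rep \<Rightarrow> 'g rep \<Rightarrow> 'g rep \<Rightarrow> 'g rep \<Rightarrow>
   'g rep \<Rightarrow> 'g rep \<Rightarrow> 'g rep \<Rightarrow> 'g bmap \<Rightarrow> 'g bmap \<Rightarrow> 'g bmap" where
  "stable_sum G H V V' Z S W W' Z' f g = (\<lambda>p\<in>bpoints G H ((V \<oplus>\<^sub>r V') \<oplus>\<^sub>r (Z \<oplus>\<^sub>r S)).
     on_fibres (interchange (fst W) (fst Z') (fst W'))
       (bmap_sum G H (V \<oplus>\<^sub>r Z) (V' \<oplus>\<^sub>r S) (fst (W \<oplus>\<^sub>r Z')) f g
         (on_fibres (interchange (fst V) (fst V') (fst Z)) p)))"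

definition vobj_sum :: "'g vobj \<Rightarrow> 'g vobj \<Rightarrow> 'g vobj" where
  "vobj_sum = (\<lambda>(H, V1, V2) (H', V1', V2'). (H, V1 \<oplus>\<^sub>r V1', V2 \<oplus>\<^sub>r V2'))"

text \<open>
  The fibrewise direct sum is used only for objects with the same underlying orbit and morphisms
  with the same underlying map of orbits. Its fibres need not belong to the chosen system.
\<close>

definition varr_sum ::
  "('g, 'm) monoid_scheme \<Rightarrow> 'g vobj \<Rightarrow> 'g vobj \<Rightarrow> 'g vobj \<Rightarrow> 'g vobj \<Rightarrow>
   ('g set \<Rightarrow> 'g set) \<times> 'g vpair set \<Rightarrow> ('g set \<Rightarrow> 'g set) \<times> 'g vpair set \<Rightarrow>
   ('g set \<Rightarrow> 'g set) \<times> 'g vpair set" where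
  "varr_sum G = (\<lambda>(H, V1, V2) (H', V1', V2') (K, W1, W2) (K', W1', W2') (\<alpha>, P) (\<alpha>', P').
     (\<alpha>, vpair_rel G (vobj_sum (H, V1, V2) (H', V1', V2'))
                      (vobj_sum (K, W1, W2) (K', W1', W2')) \<alpha> ``
        {(Z \<oplus>\<^sub>r S, Z' \<oplus>\<^sub>r S',
          stable_sum G H V1 V1' Z S W1 W1' Z' f1 g1,
          stable_sum G H V2 V2' Z S W2 W2' Z' f2 g2) | Z Z' S S' f1 f2 g1 g2.
            (Z, Z', f1, f2) \<in> P \<and> (S, S', g1, g2) \<in> P'}))"

definition virtual_rep_sum ::
  "('g, 'm) monoid_scheme \<Rightarrow> ('g, 'b) virtual_rep \<Rightarrow> ('g, 'b) virtual_rep \<Rightarrow>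
   ('g, 'b) virtual_rep" where
  "virtual_rep_sum G = (\<lambda>(E0, E1) (F0, F1).
     (\<lambda>x. vobj_sum (E0 x) (F0 x),
      \<lambda>x y f. varr_sum G (E0 x) (F0 x) (E0 y) (F0 y) (E1 x y f) (F1 x y f)))"

definition virtual_rep_zero :: "('g, 'm) monoid_scheme \<Rightarrow> ('g, 'b) virtual_rep" where
  "virtual_rep_zero G =
     (\<lambda>(H, x). (H, zero_rep, zero_rep),
      \<lambda>(H, x) (K, y) (\<alpha>, P).
        let z = (\<lambda>p\<in>bpoints G H (zero_rep \<oplus>\<^sub>r zero_rep). {(b, \<lambda>i. 0) | b. b \<in> \<alpha> (fst ` p)})
        in (\<alpha>, vpair_rel G (H, zero_rep, zero_rep) (K, zero_rep, zero_rep) \<alpha> ``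
                 {(zero_rep, zero_rep, z, z)}))"

text \<open>
  The sum of two classes consists of the virtual representations with fibres in the chosen system
  \<open>R\<close> that are isomorphic to the fibrewise direct sum of representatives, the isomorphism being
  one of functors to virtual bundles with arbitrary orthogonal fibres.
\<close>

definition RO_Pi ::
  "('g, 'm) monoid_scheme \<Rightarrow> ('g set \<Rightarrow> 'g rep set) \<Rightarrow> ('g, 'b) gspace \<Rightarrow>
   ('g, 'b) virtual_rep set monoid" where
  "RO_Pi G R B = \<lparr>
     carrier = (\<Union>n. virtual_reps G R B n // virtual_rep_iso G R B n),
     mult = (\<lambda>X Y. {\<epsilon>. \<exists>m n. \<exists>\<gamma> \<in> X \<inter> virtual_reps G R B m. \<exists>\<delta> \<in> Y \<inter> virtual_reps G R B n.
       \<epsilon> \<in> virtual_reps G R B (m + n) \<and>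
       nat_iso_over G (fundamental_groupoid G B) (virtual_bundles G (all_reps G) (m + n))
         \<epsilon> (virtual_rep_sum G \<gamma> \<delta>)}),
     one = {\<epsilon> \<in> virtual_reps G R B 0.
       nat_iso_over G (fundamental_groupoid G B) (virtual_bundles G (all_reps G) 0)
         \<epsilon> (virtual_rep_zero G)}\<rparr>"


section \<open>The projective space of lines in \<open>\<real>\<^sup>2 \<oplus> \<sigma>\<close>\<close>

definition projective_gspace ::
  "('g \<Rightarrow> 'v::euclidean_space \<Rightarrow> 'v) \<Rightarrow> ('g, 'v set) gspace" where
  "projective_gspace \<rho> = \<lparr>
     gtop = quotient_topology (top_of_set (UNIV - {0})) (\<lambda>v. span {v}),
     gact = (\<lambda>g. \<lambda>L\<in>{L. subspace L \<and> dim L = 1}. \<rho> g ` L)\<rparr>"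

lemma topspace_projective_gspace:
  fixes \<rho> :: "'g \<Rightarrow> 'v::euclidean_space \<Rightarrow> 'v"
  shows "topspace (gtop (projective_gspace \<rho>)) = {L. subspace L \<and> dim L = 1}"
proof -
  have "\<exists>v. v \<noteq> 0 \<and> L = span {v}" if L: "subspace L" "dim L = 1" for L :: "'v set"
  proof -
    obtain b where b: "b \<subseteq> L" "independent b" "L \<subseteq> span b" "card b = dim L"
      using basis_exists by blast
    then obtain v where v: "b = {v}"
      using L card_1_singletonE by metis
    have "L = span {v}"
      using b L(1) v span_minimal by blast
    then show ?thesis
      using b(2) v by auto
  qed
  then show ?thesis
    by (auto simp: projective_gspace_def topspace_quotient_topology image_iff dim_insert span_empty)
qed

abbreviation C2 :: "int monoid" where
  "C2 \<equiv> integer_mod_group 2"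

text \<open>\<open>\<real>\<^sup>2 \<oplus> \<sigma>\<close>, with \<open>\<sigma>\<close> the sign representation of \<^const>\<open>C2\<close>.\<close>

definition R31_action :: "int \<Rightarrow> (real^2) \<times> real \<Rightarrow> (real^2) \<times> real" where
  "R31_action g = (\<lambda>(u, s). (u, if g = 0 then s else - s))"

definition PR31 :: "(int, ((real^2) \<times> real) set) gspace" where
  "PR31 = projective_gspace R31_action"

lemma is_gspace_PR31: "is_gspace C2 PR31"
proof -
  let ?L = "{L :: ((real^2) \<times> real) set. subspace L \<and> dim L = 1}"
  have C2: "carrier C2 = {0, 1}"
    by (auto simp: carrier_integer_mod_group)
  have lin: "linear (R31_action g)" for g
    unfolding R31_action_def by (auto intro!: linearI simp: algebra_simps)
  have inv: "R31_action g (R31_action g v) = v" for g v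
    by (auto simp: R31_action_def split: prod.splits)
  have inj: "inj (R31_action g)" for g
    by (metis injI inv)
  have im: "R31_action g ` L \<in> ?L" if "L \<in> ?L" for g L
    using that dim_image_eq[OF lin[of g] inj_on_subset[OF inj[of g]]]
    by (simp add: linear_subspace_image[OF lin[of g]])
  have im2: "R31_action g ` R31_action g ` L = L" for g L
    by (simp add: image_image inv)
  have act: "gact PR31 g = (\<lambda>L\<in>?L. R31_action g ` L)" for g
    by (simp add: PR31_def projective_gspace_def)
  have bij: "bij_betw (gact PR31 g) ?L ?L" for g
    by (rule bij_betw_byWitness[of _ "gact PR31 g"]) (use im im2 in \<open>auto simp: act\<close>)
  have id: "R31_action 0 = (\<lambda>v. v)"
    by (auto simp: R31_action_def)
  have Bij: "gact PR31 g \<in> Bij ?L" for g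
    using bij[of g] by (simp add: Bij_def act)
  have mult: "gact PR31 ((g + h) mod 2) = compose ?L (gact PR31 g) (gact PR31 h)"
    if "g \<in> {0, 1}" "h \<in> {0, 1}" for g h
  proof
    fix L
    have "(R31_action g \<circ> R31_action h) v = R31_action ((g + h) mod 2) v" for v
      using that by (auto simp: id inv)
    then have "R31_action g ` R31_action h ` L = R31_action ((g + h) mod 2) ` L"
      by (auto simp: image_image)
    then show "gact PR31 ((g + h) mod 2) L = compose ?L (gact PR31 g) (gact PR31 h) L"
      using im[of L h] by (simp add: act compose_def)
  qed
  have "gact PR31 \<in> hom C2 (BijGroup ?L)"
    by (rule homI) (use Bij mult in \<open>auto simp: C2 BijGroup_def\<close>)
  then have "group_action C2 ?L (gact PR31)"
    by (simp add: group_action_def group_hom_def group_hom_axioms_def group_BijGroup)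
  moreover have "continuous_map (gtop PR31) (gtop PR31) (gact PR31 g)" for g
  proof -
    let ?X = "top_of_set (UNIV - {0 :: (real^2) \<times> real})"
    have top: "gtop PR31 = quotient_topology ?X (\<lambda>v. span {v})"
      by (simp add: PR31_def projective_gspace_def)
    have q: "quotient_map ?X (gtop PR31) (\<lambda>v. span {v})"
      by (simp add: top quotient_map_quotient_topology)
    have nz: "R31_action g v \<noteq> 0" if "v \<noteq> 0" for v
      using that inv[of g v] linear_0[OF lin[of g]] by metis
    have "continuous_map ?X ?X (R31_action g)"
      using nz by (auto intro!: linear_continuous_on linear_conv_bounded_linear[THEN iffD1] lin)
    then have "continuous_map ?X (gtop PR31) ((\<lambda>v. span {v}) \<circ> R31_action g)"
      using q continuous_map_compose quotient_imp_continuous_map by blast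
    moreover have "((\<lambda>v. span {v}) \<circ> R31_action g) v = (gact PR31 g \<circ> (\<lambda>v. span {v})) v"
      if "v \<in> topspace ?X" for v
      using that linear_span_image[OF lin[of g], of "{v}"]
      by (simp add: act dim_insert span_empty)
    ultimately have "continuous_map ?X (gtop PR31) (gact PR31 g \<circ> (\<lambda>v. span {v}))"
      by (rule continuous_map_eq)
    then show ?thesis
      using continuous_compose_quotient_map[OF q] by blast
  qed
  ultimately show ?thesis
    by (simp add: is_gspace_def topspace_projective_gspace PR31_def)
qed

end

theory Submission
  imports Defs "Jordan_Normal_Form.Determinant"
begin

text \<open>
  The isomorphism class of a virtual representation of the fundamental groupoid of \<open>B = P(\<real>\<^sup>2 \<oplus> \<sigma>)\<close> is
  described by four numbers. The \<open>C\<^sub>2\<close>-fixed points of \<open>B\<close> are an isolated point and a circle. The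
  invariants are the virtual dimension \<open>n\<close>, the virtual dimensions \<open>a\<close> and \<open>b\<close> of the fixed parts of the
  fibres over the point and over the circle, and the sign by which the loop around the circle acts on the
  orientation of the fixed parts. They are additive, and they take all values in \<open>\<int>\<^sup>3 \<times> \<int>/2\<close>.

  \<^emph>\<open>Virtual bundles.\<close> By Schur's lemma the space of equivariant isomorphisms of representations is a product of general
  linear groups, each of which has two path components, told apart by the sign of the determinant
  (\<open>iso_path_if_sgn_det_eq\<close>, \<open>eqv_path_if_esgn_eq\<close>). So a morphism of virtual bundles over a given map of
  orbits is determined by a sign on the fibres and, over a fixed orbit, a second sign on their fixed
  parts: stabilization changes both members of a pair by the same sign, so the product is well defined
  (\<open>vpair_rel_sound\<close>), and there are no further invariants (\<open>vpair_rel_complete\<close>). Composition multiplies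
  signs, up to the twist in \<open>cmp_vb\<close> by the sign of the involution on a virtual representation.

  \<^emph>\<open>Arrows.\<close> Lines are the points of the sphere modulo the antipode, so an arrow of the
  fundamental groupoid is a homotopy class of paths of unit vectors, starting at one of the two unit
  vectors in a line (\<open>arr_parr\<close>, \<open>parr_inj\<close>, \<open>parr_comp\<close>).

  \<^emph>\<open>Uniqueness.\<close> If \<open>n\<close>, \<open>a\<close> and \<open>b\<close> agree for two virtual representations, then the quotient of their signs is
  multiplicative. On the fibres it is a coboundary because the sphere is simply connected and because the
  involution and the antipode are tied to trivial automorphisms over the fixed points (\<open>coboundary\<close>). On the
  fixed parts, the circle leaves the sign of its half turn as the only obstruction (\<open>fixed_coboundary\<close>).
  This gives \<open>nat_iso_iff\<close>.

  \<^emph>\<open>Existence.\<close> Whether a lifted path ends at the chosen or at the opposite unit vector is a sign \<open>lam\<close>, which is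
  \<open>-1\<close> on the loop around the circle. Its powers, corrected on the involution of free orbits, have exactly
  the multiplicativity that the twist requires of the signs on the fibres if the exponent has the parity of
  \<open>b - a\<close>, while any power serves for the signs on the fixed parts (\<open>VR_exists\<close>).
\<close>

hide_const (open) Matrix.append_vec
hide_fact (open) Matrix.append_vec_def

notation rep_sum (infixr "+r" 65)

abbreviation orep :: "int set => int rep => bool" where "orep \<equiv> orth_rep C2"
abbreviation bpt :: "int set => int rep => int \<times> rvec => (int \<times> rvec) set" where "bpt \<equiv> bpoint C2"
abbreviation cosets :: "int set => int set set" where "cosets H \<equiv> lcosets\<^bsub>C2\<^esub> H"
abbreviation vbund :: "(int set => int rep set) => int => (int vobj, (int set => int set) \<times> int vpair set) cat" where
 "vbund \<equiv> virtual_bundles C2"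
abbreviation vreps :: "(int set => int rep set) => int => (int, ((real^2) \<times> real) set) virtual_rep set" where
 "vreps R n \<equiv> virtual_reps C2 R PR31 n"

section \<open>Linear maps in coordinates, and their determinants\<close>

definition ev :: "nat => rvec" where
 "ev j = (%i. if i = j then 1 else 0)"

lemma Rn_iff: "u : Rn n \<longleftrightarrow> (ALL i>=n. u i = 0)"
 by (simp add: topspace_Euclidean_space)

lemma ev_in_Rn: "j < n ==> ev j : Rn n"
 by (simp add: Rn_iff ev_def)

lemma lincomb_in_Rn: "u : Rn n ==> v : Rn n ==> (%i. a * u i + b * v i) : Rn n"
 by (simp add: Rn_iff)

lemma zero_in_Rn: "(%i. 0) : Rn n"
 by (simp add: Rn_iff)

lemma linear_RnD:
 assumes "linear_Rn m n A"
 shows "u : Rn m ==> A u : Rn n"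
  and "u : Rn m ==> v : Rn m ==> A (%i. a * u i + b * v i) = (%i. a * A u i + b * A v i)"
 using assms by (auto simp: linear_Rn_def)

lemma linear_Rn_zero: "linear_Rn m n A ==> A (%i. 0) = (%i. 0)"
 using linear_RnD(2)[of m n A "%i. 0" "%i. 0" 0 0] by (simp add: zero_in_Rn)

lemma linear_Rn_scale: "linear_Rn m n A ==> u : Rn m ==> A (%i. a * u i) = (%i. a * A u i)"
 using linear_RnD(2)[of m n A u u a 0] by simp

lemma linear_Rn_add: "linear_Rn m n A ==> u : Rn m ==> v : Rn m ==> A (%i. u i + v i) = (%i. A u i + A v i)"
 using linear_RnD(2)[of m n A u v 1 1] by simp

lemma linear_Rn_sum:
 assumes A: "linear_Rn m n A" and "finite J" and u: "!!j. j : J ==> u j : Rn m"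
 shows "A (%i. \<Sum>j\<in>J. c j * u j i) = (%i. \<Sum>j\<in>J. c j * A (u j) i) & (%i. \<Sum>j\<in>J. c j * u j i) : Rn m"
 using assms(2) u
proof (induction J)
 case empty
 thus ?case using linear_Rn_zero[OF A] zero_in_Rn by simp
next
 case (insert x J)
 thus ?case
  using linear_RnD(2)[OF A, of "u x" "%i. \<Sum>j\<in>J. c j * u j i" "c x" 1]
   lincomb_in_Rn[of "u x" m "%i. \<Sum>j\<in>J. c j * u j i" "c x" 1]
  by (simp add: insert.hyps)
qed

lemma Rn_expand: "u : Rn m ==> u = (%i. \<Sum>j<m. u j * ev j i)"
 by (rule ext) (auto simp: Rn_iff ev_def if_distrib cong: if_cong)

lemma linear_Rn_expand:
 assumes "linear_Rn m n A" "u : Rn m"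
 shows "A u = (%i. \<Sum>j<m. u j * A (ev j) i)"
proof -
 have "A u = A (%i. \<Sum>j<m. u j * ev j i)"
  using Rn_expand[OF assms(2)] by simp
 also have "\<dots> = (%i. \<Sum>j<m. u j * A (ev j) i)"
  using linear_Rn_sum[OF assms(1), of "{..<m}" ev u] by (simp add: ev_in_Rn)
 finally show ?thesis .
qed

lemma linear_Rn_comp: "linear_Rn m n A ==> linear_Rn n l B ==> linear_Rn m l (B o A)"
 by (auto simp: linear_Rn_def Pi_iff)

lemma linear_Rn_cong: "linear_Rn m n A ==> (!!u. u : Rn m ==> B u = A u) ==> linear_Rn m n B"
 using lincomb_in_Rn unfolding linear_Rn_def by (simp add: Pi_iff)

lemma linear_iso_RnD:
 assumes "linear_iso_Rn m n A"
 shows "linear_Rn m n A" "bij_betw A (Rn m) (Rn n)"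
 using assms by (auto simp: linear_iso_Rn_def)

lemma linear_iso_Rn_cong: "linear_iso_Rn m n A ==> (!!u. u : Rn m ==> B u = A u) ==> linear_iso_Rn m n B"
 unfolding linear_iso_Rn_def using linear_Rn_cong bij_betw_cong by metis

lemma linear_iso_Rn_comp: "linear_iso_Rn m n A ==> linear_iso_Rn n l B ==> linear_iso_Rn m l (B o A)"
 unfolding linear_iso_Rn_def using linear_Rn_comp bij_betw_trans by blast

lemma linear_iso_Rn_id: "linear_iso_Rn m m (%u. u)"
 by (simp add: linear_iso_Rn_def linear_Rn_def bij_betw_def)

text \<open>A linear bijection from \<open>\<real>\<^sup>p\<close> onto a subset of some \<open>\<real>\<^sup>n\<close>, i.e. a basis of that subspace.\<close>

definition frame :: "nat => nat => rvec set => (rvec => rvec) => bool" where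
 "frame p n S \<phi> \<longleftrightarrow> linear_Rn p n \<phi> & bij_betw \<phi> (Rn p) S"

lemma frame_inv:
 assumes "frame p n S \<phi>"
 shows "s : S ==> inv_into (Rn p) \<phi> s : Rn p"
  and "s : S ==> \<phi> (inv_into (Rn p) \<phi> s) = s"
  and "u : Rn p ==> inv_into (Rn p) \<phi> (\<phi> u) = u"
  and "u : Rn p ==> \<phi> u : S"
 using assms unfolding frame_def
 by (auto simp: bij_betw_def inv_into_into f_inv_into_f)

lemma frame_iso_frame:
 assumes \<phi>: "frame p n S \<phi>" and \<psi>: "frame q l T \<psi>"
  and A: "linear_Rn n l A" "bij_betw A S T"
 shows "linear_iso_Rn p q (inv_into (Rn q) \<psi> o A o \<phi>)"
 unfolding linear_iso_Rn_def linear_Rn_def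
proof (intro conjI ballI allI)
 note F = frame_inv[OF \<phi>] and G = frame_inv[OF \<psi>]
 have AS: "A s : T" if "s : S" for s using A(2) that by (auto simp: bij_betw_def)
 show bij: "bij_betw (inv_into (Rn q) \<psi> o A o \<phi>) (Rn p) (Rn q)"
  using \<phi> A(2) bij_betw_inv_into \<psi> unfolding frame_def by (auto intro!: bij_betw_trans)
 thus "inv_into (Rn q) \<psi> o A o \<phi> : Rn p \<rightarrow> Rn q" by (auto simp: bij_betw_def)
 fix u v a b assume uv: "u : Rn p" "v : Rn p"
 let ?B = "inv_into (Rn q) \<psi> o A o \<phi>"
 have lin\<phi>: "linear_Rn p n \<phi>" and lin\<psi>: "linear_Rn q l \<psi>" using \<phi> \<psi> by (auto simp: frame_def)
 let ?w = "%i. a * u i + b * v i"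
 have w: "?w : Rn p" using uv by (rule lincomb_in_Rn)
 have B: "?B u : Rn q" "?B v : Rn q" using uv F(4) AS G(1) by auto
 have "\<psi> (%i. a * ?B u i + b * ?B v i) = (%i. a * \<psi> (?B u) i + b * \<psi> (?B v) i)"
  using linear_RnD(2)[OF lin\<psi> B] .
 also have "\<dots> = (%i. a * A (\<phi> u) i + b * A (\<phi> v) i)"
  using uv F(4) AS G(2) by simp
 also have "\<dots> = A (%i. a * \<phi> u i + b * \<phi> v i)"
  using linear_RnD(2)[OF A(1)] linear_RnD(1)[OF lin\<phi>] uv by simp
 also have "\<dots> = A (\<phi> ?w)" using linear_RnD(2)[OF lin\<phi> uv] by simp
 finally have "inv_into (Rn q) \<psi> (A (\<phi> ?w)) = inv_into (Rn q) \<psi> (\<psi> (%i. a * ?B u i + b * ?B v i))" by simp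
 also have "\<dots> = (%i. a * ?B u i + b * ?B v i)" by (rule G(3)) (rule lincomb_in_Rn[OF B])
 finally show "?B ?w = (%i. a * ?B u i + b * ?B v i)" by simp
qed

lemma frame_Rn: "frame n n (Rn n) (%u. u)"
 using linear_iso_Rn_id[of n] by (simp add: frame_def linear_iso_Rn_def)

lemma frame_of_iso: "linear_iso_Rn m n A \<longleftrightarrow> frame m n (Rn n) A"
 by (simp add: frame_def linear_iso_Rn_def)

lemma linear_iso_inv:
 assumes "linear_iso_Rn m n A"
 shows "linear_iso_Rn n m (inv_into (Rn m) A)"
 using frame_iso_frame[OF frame_Rn[of n] assms[unfolded frame_of_iso], of "%u. u"] linear_iso_Rn_id[of n]
 by (simp add: linear_iso_Rn_def o_def)

text \<open>The trace of \<open>BA\<close> is the trace of \<open>AB\<close>, so isomorphic coordinate spaces have equal dimension.\<close>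

lemma linear_iso_dim:
 assumes A: "linear_iso_Rn m n A"
 shows "m = n"
proof -
 define B where "B = inv_into (Rn m) A"
 have B: "linear_iso_Rn n m B" using linear_iso_inv[OF A] by (simp add: B_def)
 have BA: "B (A u) = u" if "u : Rn m" for u
  using frame_inv(3)[OF A[unfolded frame_of_iso] that] by (simp add: B_def)
 have AB: "A (B u) = u" if "u : Rn n" for u
  using frame_inv(2)[OF A[unfolded frame_of_iso] that] by (simp add: B_def)
 have *: "(\<Sum>k<m. (\<Sum>l<n. A (ev k) l * B (ev l) k)) = real m"
 proof -
  have "(\<Sum>l<n. A (ev k) l * B (ev l) k) = 1" if "k < m" for k
  proof -
   have "B (A (ev k)) k = (\<Sum>l<n. A (ev k) l * B (ev l) k)"
    using linear_Rn_expand[OF linear_iso_RnD(1)[OF B], of "A (ev k)"]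
     linear_RnD(1)[OF linear_iso_RnD(1)[OF A] ev_in_Rn[OF that]] by simp
   thus ?thesis using BA[OF ev_in_Rn[OF that]] by (simp add: ev_def)
  qed
  thus ?thesis by simp
 qed
 have **: "(\<Sum>l<n. (\<Sum>k<m. B (ev l) k * A (ev k) l)) = real n"
 proof -
  have "(\<Sum>k<m. B (ev l) k * A (ev k) l) = 1" if "l < n" for l
  proof -
   have "A (B (ev l)) l = (\<Sum>k<m. B (ev l) k * A (ev k) l)"
    using linear_Rn_expand[OF linear_iso_RnD(1)[OF A], of "B (ev l)"]
     linear_RnD(1)[OF linear_iso_RnD(1)[OF B] ev_in_Rn[OF that]] by simp
   thus ?thesis using AB[OF ev_in_Rn[OF that]] by (simp add: ev_def)
  qed
  thus ?thesis by simp
 qed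
 have "real m = real n"
  using * ** sum.swap[of "%k l. A (ev k) l * B (ev l) k" "{..<n}" "{..<m}"] by (simp add: mult.commute)
 thus ?thesis by simp
qed

lemma frame_dim:
 assumes "frame p n S \<phi>" "frame q n S \<psi>"
 shows "p = q"
proof -
 have "linear_iso_Rn p q (inv_into (Rn q) \<psi> o (%u. u) o \<phi>)"
  by (rule frame_iso_frame[OF assms]) (auto simp: linear_Rn_def bij_betw_def)
 thus ?thesis by (rule linear_iso_dim)
qed

definition detR :: "nat => (rvec => rvec) => real" where
 "detR n A = Determinant.det (Matrix.mat n n (%(i, j). A (ev j) i))"

lemma detR_cong: "(!!u. u : Rn n ==> A u = B u) ==> detR n A = detR n B"
 unfolding detR_def by (rule arg_cong[of _ _ Determinant.det]) (auto intro!: eq_matI simp: ev_in_Rn)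

lemma detR_id: "detR n (%u. u) = 1"
proof -
 have "Matrix.mat n n (%(i, j). ev j i) = (1\<^sub>m n :: real mat)"
  by (rule eq_matI) (auto simp: ev_def)
 thus ?thesis by (simp add: detR_def)
qed

lemma detR_comp:
 assumes A: "linear_Rn n n A" and B: "linear_Rn n n B"
 shows "detR n (B o A) = detR n B * detR n A"
proof -
 let ?M = "%A. Matrix.mat n n (%(i, j). A (ev j) i) :: real mat"
 have "?M (B o A) = ?M B * ?M A"
 proof (rule eq_matI)
  fix i j assume "i < dim_row (?M B * ?M A)" "j < dim_col (?M B * ?M A)"
  hence ij: "i < n" "j < n" by auto
  have "B (A (ev j)) i = (\<Sum>k<n. A (ev j) k * B (ev k) i)"
   using linear_Rn_expand[OF B, of "A (ev j)"] linear_RnD(1)[OF A ev_in_Rn[OF ij(2)]] by simp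
  also have "\<dots> = (?M B * ?M A) $$ (i, j)"
   using ij by (simp add: scalar_prod_def atLeast0LessThan mult.commute)
  finally show "?M (B o A) $$ (i, j) = (?M B * ?M A) $$ (i, j)" using ij by simp
 qed auto
 thus ?thesis unfolding detR_def by (simp add: det_mult[of _ n])
qed

lemma detR_nonzero:
 assumes "linear_iso_Rn n n A"
 shows "detR n A ~= 0"
proof -
 let ?B = "inv_into (Rn n) A"
 have "detR n (?B o A) = detR n (%u. u)"
  by (rule detR_cong) (use frame_inv(3)[OF assms[unfolded frame_of_iso]] in simp)
 thus ?thesis
  using detR_comp[OF linear_iso_RnD(1)[OF assms] linear_iso_RnD(1)[OF linear_iso_inv[OF assms]]]
  by (auto simp: detR_id)
qed

text \<open>The block sum of linear maps; \<open>n\<close> is the dimension of the target of \<open>A\<close>.\<close>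

definition dsum :: "nat => nat => (rvec => rvec) => (rvec => rvec) => rvec => rvec" where
 "dsum m n A k u = append_vec n (A (take_vec m u)) (k (drop_vec m u))"

lemma take_in_Rn: "take_vec m u : Rn m"
 by (simp add: Rn_iff take_vec_def)

lemma drop_in_Rn: "u : Rn (m + n) ==> drop_vec m u : Rn n"
 by (simp add: Rn_iff drop_vec_def)

lemma append_in_Rn: "v : Rn n ==> append_vec m u v : Rn (m + n)"
 by (auto simp: Rn_iff append_vec_def)

lemma take_append: "u : Rn m ==> take_vec m (append_vec m u v) = u"
 by (auto simp: Rn_iff append_vec_def take_vec_def)

lemma drop_append: "drop_vec m (append_vec m u v) = v"
 by (auto simp: append_vec_def drop_vec_def)

lemma append_take_drop: "append_vec m (take_vec m u) (drop_vec m u) = u"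
 by (auto simp: append_vec_def drop_vec_def take_vec_def)

lemma append_inject: "u : Rn m ==> u' : Rn m ==> append_vec m u v = append_vec m u' v' \<longleftrightarrow> u = u' & v = v'"
 by (metis take_append drop_append)

lemma dsum_append: "u : Rn m ==> dsum m n A k (append_vec m u v) = append_vec n (A u) (k v)"
 by (simp add: dsum_def take_append drop_append)

lemma dsum_in_Rn: "linear_Rn m' n' k ==> u : Rn (m + m') ==> dsum m n A k u : Rn (n + n')"
 by (simp add: dsum_def append_in_Rn drop_in_Rn linear_RnD(1))

lemma linear_Rn_dsum:
 assumes A: "linear_Rn m n A" and k: "linear_Rn m' n' k"
 shows "linear_Rn (m + m') (n + n') (dsum m n A k)"
 unfolding linear_Rn_def
proof (intro conjI ballI allI)
 show "dsum m n A k : Rn (m + m') \<rightarrow> Rn (n + n')" using dsum_in_Rn[OF k] by auto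
 fix u v a b assume uv: "u : Rn (m + m')" "v : Rn (m + m')"
 have t: "take_vec m (%i. a * u i + b * v i) = (%i. a * take_vec m u i + b * take_vec m v i)"
  by (auto simp: take_vec_def)
 have d: "drop_vec m (%i. a * u i + b * v i) = (%i. a * drop_vec m u i + b * drop_vec m v i)"
  by (auto simp: drop_vec_def)
 show "dsum m n A k (%i. a * u i + b * v i) = (%i. a * dsum m n A k u i + b * dsum m n A k v i)"
  unfolding dsum_def t d linear_RnD(2)[OF A take_in_Rn take_in_Rn]
   linear_RnD(2)[OF k drop_in_Rn[OF uv(1)] drop_in_Rn[OF uv(2)]]
  by (auto simp: append_vec_def)
qed

lemma dsum_comp:
 assumes "linear_Rn m n A"
 shows "dsum n l B k' (dsum m n A k u) = dsum m l (B o A) (k' o k) u"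
 using assms by (simp add: dsum_def take_append drop_append linear_RnD(1) take_in_Rn)

lemma dsum_id: "dsum m m (%u. u) (%u. u) u = u"
 by (simp add: dsum_def append_take_drop)

lemma frame_dsum:
 assumes \<phi>: "frame p n S \<phi>" and \<psi>: "frame q l T \<psi>" and S: "S \<subseteq> Rn n"
 shows "frame (p + q) (n + l) {u. EX s:S. EX t:T. u = append_vec n s t} (dsum p n \<phi> \<psi>)"
 unfolding frame_def
proof (intro conjI bij_betwI)
 note F = frame_inv[OF \<phi>] and G = frame_inv[OF \<psi>]
 show "linear_Rn (p + q) (n + l) (dsum p n \<phi> \<psi>)"
  using \<phi> \<psi> by (auto simp: frame_def linear_Rn_dsum)
 show "dsum p n \<phi> \<psi> : Rn (p + q) \<rightarrow> {u. EX s:S. EX t:T. u = append_vec n s t}"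
  using F(4) G(4) take_in_Rn drop_in_Rn unfolding dsum_def by blast
 show "dsum n p (inv_into (Rn p) \<phi>) (inv_into (Rn q) \<psi>) : {u. EX s:S. EX t:T. u = append_vec n s t} \<rightarrow> Rn (p + q)"
  using S F(1) G(1) by (auto simp: dsum_append subset_iff intro!: append_in_Rn)
 show "dsum n p (inv_into (Rn p) \<phi>) (inv_into (Rn q) \<psi>) (dsum p n \<phi> \<psi> u) = u" if "u : Rn (p + q)" for u
 proof -
  have "dsum n p (inv_into (Rn p) \<phi>) (inv_into (Rn q) \<psi>) (dsum p n \<phi> \<psi> u)
    = append_vec p (inv_into (Rn p) \<phi> (\<phi> (take_vec p u))) (inv_into (Rn q) \<psi> (\<psi> (drop_vec p u)))"
   using S F(4)[OF take_in_Rn[of p u]] unfolding dsum_def[of p]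
   by (subst dsum_append) auto
  thus ?thesis using that by (simp add: F(3) G(3) take_in_Rn drop_in_Rn append_take_drop)
 qed
 show "dsum p n \<phi> \<psi> (dsum n p (inv_into (Rn p) \<phi>) (inv_into (Rn q) \<psi>) y) = y"
  if y: "y : {u. EX s:S. EX t:T. u = append_vec n s t}" for y
 proof -
  obtain s t where st: "s : S" "t : T" "y = append_vec n s t" using y by auto
  hence "s : Rn n" using S by auto
  thus ?thesis using st F(1,2) G(2) by (simp add: dsum_append)
 qed
qed

lemma linear_iso_dsum:
 assumes "linear_iso_Rn m n A" "linear_iso_Rn m' n' k"
 shows "linear_iso_Rn (m + m') (n + n') (dsum m n A k)"
proof -
 have "Rn (n + n') = {u. EX s:Rn n. EX t:Rn n'. u = append_vec n s t}"
 proof (intro equalityI subsetI CollectI)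
  fix u assume "u : Rn (n + n')"
  thus "EX s:Rn n. EX t:Rn n'. u = append_vec n s t"
   using append_take_drop[of n u] take_in_Rn[of n u] drop_in_Rn[of u n n'] by metis
 qed (use append_in_Rn in blast)
 thus ?thesis
  using frame_dsum[OF assms[unfolded frame_of_iso]] by (simp add: frame_of_iso)
qed

lemma detR_dsum:
 assumes "linear_Rn m m A" "linear_Rn n n k"
 shows "detR (m + n) (dsum m m A k) = detR m A * detR n k"
proof -
 let ?M = "%n A. Matrix.mat n n (%(i, j). A (ev j) i) :: real mat"
 have t: "take_vec m (ev j) = (if j < m then ev j else (%i. 0))" for j
  by (auto simp: take_vec_def ev_def)
 have d: "drop_vec m (ev j) = (if j < m then (%i. 0) else ev (j - m))" for j
  by (auto simp: drop_vec_def ev_def fun_eq_iff)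
 have "?M (m + n) (dsum m m A k) = four_block_mat (?M m A) (0\<^sub>m m n) (0\<^sub>m n m) (?M n k)"
  by (rule eq_matI) (auto simp: dsum_def t d append_vec_def linear_Rn_zero[OF assms(1)] linear_Rn_zero[OF assms(2)])
 thus ?thesis
  unfolding detR_def by (subst det_four_block_mat_lower_left_zero[of _ m, symmetric]) auto
qed

section \<open>Path components of the general linear group\<close>

definition lin_path :: "nat => ((rvec => rvec) => bool) => (rvec => rvec) => (rvec => rvec) => bool" where
 "lin_path m P A B \<longleftrightarrow> (EX h. (ALL t:{0..1::real}. P (h t)) & (ALL u:Rn m. h 0 u = A u & h 1 u = B u) &
   (ALL u:Rn m. ALL i. continuous_on {0..1} (%t. h t u i)))"

lemma lin_pathI:
 assumes "!!t. t : {0..1::real} ==> P (h t)" "!!u. u : Rn m ==> h 0 u = A u" "!!u. u : Rn m ==> h 1 u = B u"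
  "!!u i. u : Rn m ==> continuous_on {0..1} (%t. h t u i)"
 shows "lin_path m P A B"
 unfolding lin_path_def using assms by (intro exI[of _ h]) auto

lemma lin_path_refl: "P A' ==> (!!u. u : Rn m ==> A' u = A u) ==> (!!u. u : Rn m ==> A' u = B u) ==> lin_path m P A B"
 by (rule lin_pathI[of P "%t. A'"]) auto

lemma lin_path_sym:
 assumes "lin_path m P A B"
 shows "lin_path m P B A"
proof -
 obtain h where h: "ALL t:{0..1::real}. P (h t)" "ALL u:Rn m. h 0 u = A u & h 1 u = B u"
   "ALL u:Rn m. ALL i. continuous_on {0..1} (%t. h t u i)" using assms by (auto simp: lin_path_def)
 have "continuous_on {0..1} (%t. h (1 - t) u i)" if "u : Rn m" for u i
  by (rule continuous_on_compose2[OF h(3)[rule_format, OF that, of i]]) (auto intro!: continuous_intros)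
 thus ?thesis
  by (intro lin_pathI[of P "%t. h (1 - t)"]) (use h(1,2) in auto)
qed

lemma lin_path_trans:
 assumes "lin_path m P A B" "lin_path m P B C"
 shows "lin_path m P A C"
proof -
 obtain h where h: "ALL t:{0..1::real}. P (h t)" "ALL u:Rn m. h 0 u = A u & h 1 u = B u"
   "ALL u:Rn m. ALL i. continuous_on {0..1} (%t. h t u i)" using assms(1) by (auto simp: lin_path_def)
 obtain k where k: "ALL t:{0..1::real}. P (k t)" "ALL u:Rn m. k 0 u = B u & k 1 u = C u"
   "ALL u:Rn m. ALL i. continuous_on {0..1} (%t. k t u i)" using assms(2) by (auto simp: lin_path_def)
 show ?thesis
 proof (rule lin_pathI)
  show "P ((h +++ k) t)" if "t : {0..1}" for t
   using h(1) k(1) that by (auto simp: joinpaths_def)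
  show "(h +++ k) 0 u = A u" "(h +++ k) 1 u = C u" if "u : Rn m" for u
   using h(2) k(2) that by (auto simp: joinpaths_def)
  show "continuous_on {0..1} (%t. (h +++ k) t u i)" if "u : Rn m" for u i
  proof -
   have "path ((%t. h t u i) +++ (%t. k t u i))"
    by (rule path_join_imp) (use h k that in \<open>auto simp: path_def pathstart_def pathfinish_def\<close>)
   moreover have "((%t. h t u i) +++ (%t. k t u i)) = (%t. (h +++ k) t u i)"
    by (auto simp: joinpaths_def)
   ultimately show ?thesis by (simp add: path_def)
  qed
 qed
qed

lemma lin_path_pre:
 assumes "lin_path m P A B" "!!u. u : Rn k ==> C u : Rn m" "!!X. P X ==> Q (X o C)"
 shows "lin_path k Q (A o C) (B o C)"
proof -
 obtain h where h: "ALL t:{0..1::real}. P (h t)" "ALL u:Rn m. h 0 u = A u & h 1 u = B u"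
   "ALL u:Rn m. ALL i. continuous_on {0..1} (%t. h t u i)" using assms(1) by (auto simp: lin_path_def)
 show ?thesis
  by (rule lin_pathI[of Q "%t. h t o C"]) (use h assms in auto)
qed

lemma lin_path_post:
 assumes "lin_path m P A B" and P: "!!X u. P X ==> u : Rn m ==> X u : Rn n"
  and C: "linear_Rn n l C" and Q: "!!X. P X ==> Q (C o X)"
 shows "lin_path m Q (C o A) (C o B)"
proof -
 obtain h where h: "ALL t:{0..1::real}. P (h t)" "ALL u:Rn m. h 0 u = A u & h 1 u = B u"
   "ALL u:Rn m. ALL i. continuous_on {0..1} (%t. h t u i)" using assms(1) by (auto simp: lin_path_def)
 show ?thesis
 proof (rule lin_pathI[of Q "%t. C o h t"])
  show "continuous_on {0..1} (%t. (C o h t) u i)" if "u : Rn m" for u i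
  proof -
   have "continuous_on {0..1} (%t. \<Sum>j<n. h t u j * C (ev j) i)"
    using h(3) that by (intro continuous_intros) auto
   thus ?thesis
    by (rule continuous_on_eq) (use linear_Rn_expand[OF C] P h(1) that in auto)
  qed
 qed (use h Q in auto)
qed

lemma lin_path_dsum:
 assumes "lin_path m P A B" "lin_path m' P' k l" and Q: "!!X Y. P X ==> P' Y ==> Q (dsum m n X Y)"
 shows "lin_path (m + m') Q (dsum m n A k) (dsum m n B l)"
proof -
 obtain h where h: "ALL t:{0..1::real}. P (h t)" "ALL u:Rn m. h 0 u = A u & h 1 u = B u"
   "ALL u:Rn m. ALL i. continuous_on {0..1} (%t. h t u i)" using assms(1) by (auto simp: lin_path_def)
 obtain g where g: "ALL t:{0..1::real}. P' (g t)" "ALL u:Rn m'. g 0 u = k u & g 1 u = l u"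
   "ALL u:Rn m'. ALL i. continuous_on {0..1} (%t. g t u i)" using assms(2) by (auto simp: lin_path_def)
 show ?thesis
 proof (rule lin_pathI[of Q "%t. dsum m n (h t) (g t)"])
  show "continuous_on {0..1} (%t. dsum m n (h t) (g t) u i)" if "u : Rn (m + m')" for u i
   using h(3)[rule_format, OF take_in_Rn[of m u], of i] g(3)[rule_format, OF drop_in_Rn[OF that], of "i - n"]
   by (cases "i < n") (simp_all add: dsum_def append_vec_def)
 qed (use h(1,2) g(1,2) Q in \<open>auto simp: dsum_def take_in_Rn drop_in_Rn\<close>)
qed

lemma lin_path_cong:
 "lin_path m P A B ==> (!!u. u : Rn m ==> A u = A' u) ==> (!!u. u : Rn m ==> B u = B' u) ==> lin_path m P A' B'"
 by (auto simp: lin_path_def)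

text \<open>
  Along the path the determinant is continuous and has no zero.
\<close>

lemma lin_path_det_sgn:
 assumes "lin_path m (linear_iso_Rn m m) A B"
 shows "sgn (detR m A) = sgn (detR m B)"
proof -
 obtain h where h: "ALL t:{0..1::real}. linear_iso_Rn m m (h t)" "ALL u:Rn m. h 0 u = A u & h 1 u = B u"
   "ALL u:Rn m. ALL i. continuous_on {0..1} (%t. h t u i)" using assms(1) by (auto simp: lin_path_def)
 have "continuous_on {0..1} (%t. \<Sum>p | p permutes {0..<m}. signof p * (\<Prod>i = 0..<m. h t (ev (p i)) i))"
  using h(3) by (intro continuous_intros) (auto intro!: ev_in_Rn dest: permutes_in_image)
 moreover have "detR m (h t) = (\<Sum>p | p permutes {0..<m}. signof p * (\<Prod>i = 0..<m. h t (ev (p i)) i))" for t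
 proof -
  have "(\<Prod>i = 0..<m. Matrix.mat m m (%(i, j). h t (ev j) i) $$ (i, p i)) = (\<Prod>i = 0..<m. h t (ev (p i)) i)"
   if "p permutes {0..<m}" for p
   using permutes_in_image[OF that] by (intro prod.cong refl) auto
  thus ?thesis unfolding detR_def Determinant.det_def by simp
 qed
 ultimately have cont: "continuous_on {0..1} (%t. detR m (h t))" by simp
 have nz: "detR m (h t) ~= 0" if "t : {0..1}" for t
  using h(1) that detR_nonzero by blast
 define U where "U = (%t. detR m (h t)) ` {0..1}"
 have con: "connected U" unfolding U_def
  using cont by (rule connected_continuous_image) simp
 have A: "detR m A = detR m (h 0)" and B: "detR m B = detR m (h 1)"
  using h(2) by (auto intro: detR_cong)
 have U: "detR m A : U" "detR m B : U" unfolding U_def A B by auto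
 have U0: "0 ~: U" using nz unfolding U_def by force
 have "\<not> (detR m A <= 0 & 0 <= detR m B)" "\<not> (detR m B <= 0 & 0 <= detR m A)"
  using connectedD_interval[OF con U, of 0] connectedD_interval[OF con U(2,1), of 0] U0 by blast+
 thus ?thesis by (auto simp: sgn_if not_less)
qed

subsection \<open>Shears\<close>

definition shear :: "nat => rvec => rvec => rvec => rvec" where
 "shear n f w u = (%l. u l + (\<Sum>i<n. f i * u i) * w l)"

lemma linear_shear: "w : Rn n ==> linear_Rn n n (shear n f w)"
 unfolding linear_Rn_def shear_def
 by (auto simp: Rn_iff algebra_simps sum.distrib sum_distrib_left sum_distrib_right)

lemma shear_inverse:
 assumes "(\<Sum>i<n. f i * w i) = 0"
 shows "shear n f (%i. - w i) (shear n f w u) = u"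
proof -
 have "(\<Sum>i<n. f i * (u i + c * w i)) = (\<Sum>i<n. f i * u i) + c * (\<Sum>i<n. f i * w i)" for c
  by (simp add: algebra_simps sum.distrib sum_distrib_left)
 thus ?thesis using assms unfolding shear_def by simp
qed

lemma shear_iso:
 assumes w: "w : Rn n" and z: "(\<Sum>i<n. f i * w i) = 0"
 shows "linear_iso_Rn n n (shear n f w)"
proof -
 have w': "(%i. - w i) : Rn n" using w by (simp add: Rn_iff)
 have z': "(\<Sum>i<n. f i * (- w i)) = 0" using z by (simp add: sum_negf)
 have "bij_betw (shear n f w) (Rn n) (Rn n)"
  by (rule bij_betw_byWitness[of _ "shear n f (%i. - w i)"])
   (use linear_RnD(1)[OF linear_shear[OF w]] linear_RnD(1)[OF linear_shear[OF w']] shear_inverse[OF z] shear_inverse[OF z'] in auto)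
 thus ?thesis using linear_shear[OF w] by (simp add: linear_iso_Rn_def)
qed

lemma shear_path:
 assumes w: "w : Rn n" and z: "(\<Sum>i<n. f i * w i) = 0"
 shows "lin_path n (linear_iso_Rn n n) (%u. u) (shear n f w)"
proof (rule lin_pathI[of _ "%t. shear n f (%i. t * w i)"])
 show "linear_iso_Rn n n (shear n f (%i. t * w i))" for t
 proof (rule shear_iso)
  have "(\<Sum>i<n. f i * (t * w i)) = t * (\<Sum>i<n. f i * w i)" by (simp add: sum_distrib_left algebra_simps)
  thus "(\<Sum>i<n. f i * (t * w i)) = 0" using z by simp
 qed (use w in \<open>simp add: Rn_iff\<close>)
 show "continuous_on {0..1} (%t. shear n f (%i. t * w i) u i)" for u i
  unfolding shear_def by (intro continuous_intros)
qed (auto simp: shear_def)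

abbreviation "iso_path n \<equiv> lin_path n (linear_iso_Rn n n)"

lemma iso_path_shear_left:
 assumes A: "linear_iso_Rn n n A" and w: "w : Rn n" "(\<Sum>i<n. f i * w i) = 0"
 shows "iso_path n A (shear n f w o A)" "linear_iso_Rn n n (shear n f w o A)"
proof -
 have "iso_path n ((%u. u) o A) (shear n f w o A)"
 proof (rule lin_path_pre[OF shear_path[OF w]])
  show "A u : Rn n" if "u : Rn n" for u using linear_RnD(1)[OF linear_iso_RnD(1)[OF A] that] .
  show "linear_iso_Rn n n (X o A)" if "linear_iso_Rn n n X" for X using linear_iso_Rn_comp[OF A that] .
 qed
 thus "iso_path n A (shear n f w o A)" by (simp add: o_def)
 show "linear_iso_Rn n n (shear n f w o A)" using linear_iso_Rn_comp[OF A shear_iso[OF w]] .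
qed

lemma iso_path_shear_right:
 assumes A: "linear_iso_Rn n n A" and w: "w : Rn n" "(\<Sum>i<n. f i * w i) = 0"
 shows "iso_path n A (A o shear n f w)" "linear_iso_Rn n n (A o shear n f w)"
proof -
 have "iso_path n (A o (%u. u)) (A o shear n f w)"
 proof (rule lin_path_post[OF shear_path[OF w] _ linear_iso_RnD(1)[OF A]])
  show "X u : Rn n" if "linear_iso_Rn n n X" "u : Rn n" for X u
   using linear_RnD(1)[OF linear_iso_RnD(1)[OF that(1)] that(2)] .
  show "linear_iso_Rn n n (A o X)" if "linear_iso_Rn n n X" for X using linear_iso_Rn_comp[OF that A] .
 qed
 thus "iso_path n A (A o shear n f w)" by (simp add: o_def)
 show "linear_iso_Rn n n (A o shear n f w)" using linear_iso_Rn_comp[OF shear_iso[OF w] A] .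
qed

definition scale0 :: "real => rvec => rvec" where
 "scale0 s u = (%i. if i = 0 then s * u 0 else u i)"

lemma linear_scale0: "0 < n ==> linear_Rn n n (scale0 s)"
 by (auto simp: linear_Rn_def scale0_def Rn_iff algebra_simps)

lemma scale0_iso:
 assumes "0 < n" "s ~= 0"
 shows "linear_iso_Rn n n (scale0 s)"
proof -
 have "bij_betw (scale0 s) (Rn n) (Rn n)"
  by (rule bij_betw_byWitness[of _ "scale0 (1 / s)"]) (use assms in \<open>auto simp: scale0_def Rn_iff\<close>)
 thus ?thesis using linear_scale0[OF assms(1)] by (simp add: linear_iso_Rn_def)
qed

lemma detR_scale0: "0 < n ==> detR n (scale0 s) = s"
proof -
 have 1: "detR (Suc 0) (scale0 s) = s"
  unfolding detR_def by (subst det_single) (auto simp: scale0_def ev_def)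
 assume "0 < n"
 then obtain k where n: "n = Suc 0 + k" by (metis add_Suc gr0_implies_Suc add_0)
 have "detR (Suc 0 + k) (dsum (Suc 0) (Suc 0) (scale0 s) (%u. u)) = s"
  by (subst detR_dsum) (use linear_iso_RnD(1)[OF linear_iso_Rn_id] in \<open>auto simp: 1 detR_id linear_scale0\<close>)
 moreover have "dsum (Suc 0) (Suc 0) (scale0 s) (%u. u) = scale0 s"
  by (auto simp: fun_eq_iff dsum_def append_vec_def take_vec_def drop_vec_def scale0_def)
 ultimately show ?thesis using n by simp
qed

text \<open>
  Gaussian elimination along paths: shears are homotopic to the identity, and the last row and
  column can be cleared by shears once some other entry of the last column is nonzero.
\<close>

lemma iso_path_clear:
 assumes A: "linear_iso_Rn (Suc m) (Suc m) A" and m: "0 < m"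
 shows "EX A'. linear_iso_Rn (Suc m) (Suc m) A' & iso_path (Suc m) A A' & A' (ev m) = ev m &
   (ALL u:Rn m. A' u : Rn m)"
proof -
 let ?n = "Suc m"
 note trans = lin_path_trans
 have em: "ev m : Rn ?n" by (simp add: ev_in_Rn)
 have R: "!!X u. linear_iso_Rn ?n ?n X ==> u : Rn ?n ==> X u : Rn ?n"
  using linear_RnD(1) linear_iso_RnD(1) by blast
 have evsum: "(\<Sum>i<?n. ev k i * u i) = u k" if "k < ?n" for k and u :: rvec
  using that by (simp add: ev_def if_distrib[of "%x. x * _"] cong: if_cong)
 have "EX A1. linear_iso_Rn ?n ?n A1 & iso_path ?n A A1 & (EX i<m. A1 (ev m) i ~= 0)"
 proof (cases "EX i<m. A (ev m) i ~= 0")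
  case True
  thus ?thesis using A lin_path_refl[of "linear_iso_Rn ?n ?n" A] by blast
 next
  case False
  have "A (ev m) m ~= 0"
  proof
   assume "A (ev m) m = 0"
   with False R[OF A em] have "A (ev m) = (%i. 0)"
    by (auto simp: fun_eq_iff Rn_iff) (metis not_less_eq_eq not_less linorder_neqE_nat)
   hence "ev m = (%i. 0)"
    using linear_Rn_zero[OF linear_iso_RnD(1)[OF A]] linear_iso_RnD(2)[OF A] em zero_in_Rn
    by (auto simp: bij_betw_def inj_on_def)
   thus False by (metis ev_def zero_neq_one)
  qed
  moreover have "(shear ?n (ev m) (ev 0) o A) (ev m) 0 = A (ev m) 0 + A (ev m) m"
   using m by (simp add: shear_def evsum) (simp add: ev_def)
  ultimately have "(shear ?n (ev m) (ev 0) o A) (ev m) 0 ~= 0" using False m by simp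
  moreover have "(\<Sum>i<?n. ev m i * ev 0 i) = 0" using m by (simp add: evsum) (simp add: ev_def)
  ultimately show ?thesis
   using iso_path_shear_left[OF A ev_in_Rn[of 0 ?n], of "ev m"] m by (metis zero_less_Suc)
 qed
 then obtain A1 i where A1: "linear_iso_Rn ?n ?n A1" "iso_path ?n A A1" and i: "i < m" "A1 (ev m) i ~= 0" by blast
 define c where "c = A1 (ev m)"
 define A2 where "A2 = shear ?n (%k. (1 - c m) / c i * ev i k) (ev m) o A1"
 have s2: "(\<Sum>k<?n. (1 - c m) / c i * ev i k * u k) = (1 - c m) / c i * u i" for u :: rvec
  using evsum[of i u] i unfolding mult.assoc sum_distrib_left[symmetric] by simp
 have "(\<Sum>k<?n. (1 - c m) / c i * ev i k * ev m k) = 0" unfolding s2 using i by (simp add: ev_def)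
 hence A2: "linear_iso_Rn ?n ?n A2" "iso_path ?n A1 A2"
  using iso_path_shear_left[OF A1(1) em] unfolding A2_def by auto
 have A2m: "A2 (ev m) m = 1"
  using i unfolding A2_def o_def shear_def s2 by (simp add: c_def[symmetric]) (simp add: ev_def)
 define d where "d = A2 (ev m)"
 have dR: "d : Rn ?n" using R[OF A2(1) em] by (simp add: d_def)
 define w where "w = (%k. ev m k - d k)"
 have w: "w : Rn ?n" using dR em by (auto simp: w_def Rn_iff)
 have wm: "w m = 0" using A2m by (simp add: w_def d_def ev_def)
 define A3 where "A3 = shear ?n (ev m) w o A2"
 have A3: "linear_iso_Rn ?n ?n A3" "iso_path ?n A2 A3"
  using iso_path_shear_left[OF A2(1) w, of "ev m"] evsum[of m w] wm unfolding A3_def by auto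
 have A3m: "A3 (ev m) = ev m"
 proof -
  have "A3 (ev m) = (%l. d l + d m * w l)"
   unfolding A3_def o_def d_def[symmetric] shear_def by (simp only: evsum lessI)
  thus ?thesis using A2m by (simp add: w_def d_def)
 qed
 define r where "r = (%k. if k < m then - A3 (ev k) m else 0)"
 define A4 where "A4 = A3 o shear ?n r (ev m)"
 have "(\<Sum>k<?n. r k * ev m k) = 0" by (rule sum.neutral) (auto simp: r_def ev_def)
 hence A4: "linear_iso_Rn ?n ?n A4" "iso_path ?n A3 A4"
  using iso_path_shear_right[OF A3(1) em, of r] unfolding A4_def by auto
 have A4e: "A4 u = (%l. A3 u l + (\<Sum>k<?n. r k * u k) * ev m l)" if "u : Rn ?n" for u
  using linear_RnD(2)[OF linear_iso_RnD(1)[OF A3(1)] that em, of 1 "\<Sum>k<?n. r k * u k"] A3m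
  by (simp add: A4_def shear_def)
 have "A4 (ev m) = ev m"
  using A4e[OF em] A3m \<open>(\<Sum>k<?n. r k * ev m k) = 0\<close> by simp
 moreover have "A4 u : Rn m" if u: "u : Rn m" for u
 proof -
  have u': "u : Rn ?n" using u by (auto simp: Rn_iff)
  have "A3 u m = (\<Sum>k<?n. u k * A3 (ev k) m)"
   using linear_Rn_expand[OF linear_iso_RnD(1)[OF A3(1)] u'] by simp
  also have "\<dots> = - (\<Sum>k<?n. r k * u k)"
   using u by (simp add: r_def Rn_iff sum_negf[symmetric] mult.commute)
  finally have "A4 u m = 0" using A4e[OF u'] by (simp add: ev_def)
  moreover have "A4 u : Rn ?n" using R[OF A4(1) u'] .
  ultimately show ?thesis by (auto simp: Rn_iff) (metis le_neq_implies_less not_less_eq_eq not_less)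
 qed
 ultimately show ?thesis using trans[OF A1(2) trans[OF A2(2) trans[OF A3(2) A4(2)]]] A4(1) by blast
qed

text \<open>
  Clearing the last row and column reduces the dimension by one; what remains in dimension one is a nonzero number,
  which moves to its sign.
\<close>

lemma iso_path_normal_form:
 "linear_iso_Rn (Suc m) (Suc m) A ==> EX s:{1, -1}. iso_path (Suc m) A (scale0 s)"
proof (induction m arbitrary: A)
 case 0
 define a where "a = A (ev 0) 0"
 have Au: "A u = scale0 a u" if "u : Rn (Suc 0)" for u
  using linear_Rn_expand[OF linear_iso_RnD(1)[OF 0] that] linear_RnD(1)[OF linear_iso_RnD(1)[OF 0] that] that
  by (auto simp: fun_eq_iff scale0_def a_def Rn_iff)
 have "detR (Suc 0) A = a" using detR_cong[of "Suc 0" A "scale0 a"] Au detR_scale0[of "Suc 0" a] by auto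
 hence a: "a ~= 0" using detR_nonzero[OF 0] by auto
 have "iso_path (Suc 0) A (scale0 (sgn a))"
 proof (rule lin_pathI[of _ "%t. scale0 ((1 - t) * a + t * sgn a)"])
  fix t :: real assume t: "t : {0..1}"
  have "(1 - t) * a + t * sgn a ~= 0"
  proof (cases "a > 0")
   case True
   hence "(1 - t) * a + t > 0" using t by (cases "t = 0") (auto intro: add_nonneg_pos)
   thus ?thesis using True by simp
  next
   case False
   hence "(1 - t) * (-a) + t > 0" using t a
    by (cases "t = 0") (auto intro: le_less_trans[OF mult_nonneg_nonpos])
   thus ?thesis using False a by simp
  qed
  thus "linear_iso_Rn (Suc 0) (Suc 0) (scale0 ((1 - t) * a + t * sgn a))" by (intro scale0_iso) auto
 next
  fix u i
  show "continuous_on {0..1} (%t. scale0 ((1 - t) * a + t * sgn a) u i)"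
   unfolding scale0_def by (cases "i = 0") (auto intro!: continuous_intros)
 qed (simp_all add: Au scale0_def)
 thus ?case using a by (auto simp: sgn_if split: if_splits)
next
 case (Suc m)
 obtain B where B: "linear_iso_Rn (Suc (Suc m)) (Suc (Suc m)) B" "iso_path (Suc (Suc m)) A B"
   "B (ev (Suc m)) = ev (Suc m)" "ALL u:Rn (Suc m). B u : Rn (Suc m)"
  using iso_path_clear[OF Suc.prems] by auto
 note Blin = linear_iso_RnD(1)[OF B(1)]
 have sub: "u : Rn (Suc (Suc m))" if "u : Rn (Suc m)" for u using that by (auto simp: Rn_iff)
 have BB: "B u = dsum (Suc m) (Suc m) B (%u. u) u" if u: "u : Rn (Suc m + 1)" for u
 proof -
  have "u = (%i. 1 * take_vec (Suc m) u i + u (Suc m) * ev (Suc m) i)"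
   using u by (auto simp: fun_eq_iff take_vec_def ev_def Rn_iff)
  hence "B u = (%i. 1 * B (take_vec (Suc m) u) i + u (Suc m) * ev (Suc m) i)"
   using linear_RnD(2)[OF Blin sub[OF take_in_Rn[of _ u]] ev_in_Rn[of "Suc m"], of 1 "u (Suc m)"] B(3) by auto
  also have "\<dots> = dsum (Suc m) (Suc m) B (%u. u) u"
   using B(4)[rule_format, OF take_in_Rn[of "Suc m" u]] u
   by (auto simp: fun_eq_iff dsum_def append_vec_def drop_vec_def ev_def Rn_iff)
  finally show ?thesis .
 qed
 have "linear_iso_Rn (Suc m) (Suc m) B"
  unfolding linear_iso_Rn_def linear_Rn_def
 proof (intro conjI bij_betwI')
  show "B : Rn (Suc m) \<rightarrow> Rn (Suc m)" using B(4) by auto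
  show "ALL u:Rn (Suc m). ALL v:Rn (Suc m). ALL a b. B (%i. a * u i + b * v i) = (%i. a * B u i + b * B v i)"
   using linear_RnD(2)[OF Blin] sub by auto
  show "B x = B y \<longleftrightarrow> x = y" if "x : Rn (Suc m)" "y : Rn (Suc m)" for x y
   using linear_iso_RnD(2)[OF B(1)] sub that by (auto simp: bij_betw_def inj_on_def)
  show "B x : Rn (Suc m)" if "x : Rn (Suc m)" for x using B(4) that by auto
  show "EX x:Rn (Suc m). y = B x" if y: "y : Rn (Suc m)" for y
  proof -
   have "y : B ` Rn (Suc (Suc m))" using linear_iso_RnD(2)[OF B(1)] sub[OF y] by (auto simp: bij_betw_def)
   then obtain x where x: "x : Rn (Suc m + 1)" "y = B x" by auto
   have "y (Suc m) = x (Suc m)" using BB[OF x(1)] x(2) by (simp add: dsum_def append_vec_def drop_vec_def)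
   hence "x : Rn (Suc m)" using x(1) y by (auto simp: Rn_iff) (metis Suc_leI le_neq_implies_less)
   thus ?thesis using x(2) by blast
  qed
 qed
 from Suc.IH[OF this] obtain s where s: "s : {1, -1}" "iso_path (Suc m) B (scale0 s)" by blast
 have "iso_path 1 (%u. u) (%u. u)"
  by (rule lin_path_refl[of _ "%u. u"]) (simp_all add: linear_iso_Rn_id)
 from lin_path_dsum[OF s(2) this] linear_iso_dsum
 have "iso_path (Suc m + 1) (dsum (Suc m) (Suc m) B (%u. u)) (dsum (Suc m) (Suc m) (scale0 s) (%u. u))"
  by blast
 moreover have "dsum (Suc m) (Suc m) (scale0 s) (%u. u) = scale0 s"
  by (auto simp: fun_eq_iff dsum_def append_vec_def take_vec_def drop_vec_def scale0_def)
 ultimately have "iso_path (Suc m + 1) B (scale0 s)" using BB by (auto intro: lin_path_cong)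
 thus ?case using lin_path_trans[OF B(2)] s(1) by auto
qed

lemma iso_path_if_sgn_det_eq:
 assumes A: "linear_iso_Rn n n A" and B: "linear_iso_Rn n n B" and s: "sgn (detR n A) = sgn (detR n B)"
 shows "iso_path n A B"
proof (cases n)
 case 0
 have X: "X u = (%i. 0)" if X: "linear_iso_Rn n n X" and u: "u : Rn n" for X u
 proof
  fix i
  have "X u : Rn n" by (rule linear_RnD(1)[OF linear_iso_RnD(1)[OF X] u])
  thus "X u i = 0" using 0 by (simp add: Rn_iff)
 qed
 show ?thesis
 proof (rule lin_path_refl[of "linear_iso_Rn n n" A])
  fix u assume u: "u : Rn n"
  show "A u = B u" using X[OF A u] X[OF B u] by simp
 qed (use A in simp_all)
next
 case (Suc m)
 obtain a where a: "a : {1, -1}" "iso_path n A (scale0 a)"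
  using iso_path_normal_form[OF A[unfolded Suc]] by (auto simp only: Suc)
 obtain b where b: "b : {1, -1}" "iso_path n B (scale0 b)"
  using iso_path_normal_form[OF B[unfolded Suc]] by (auto simp only: Suc)
 have d: "detR n (scale0 c) = c" for c using detR_scale0[of n] Suc by simp
 have "sgn a = sgn b"
  using lin_path_det_sgn[OF a(2)] lin_path_det_sgn[OF b(2)] s unfolding d by simp
 hence "a = b" using a(1) b(1) by auto
 thus ?thesis using lin_path_trans[OF a(2)] lin_path_sym[OF b(2)] by simp
qed

section \<open>The group of order two and its orthogonal representations\<close>

lemma C2_simps:
 "carrier C2 = {0, 1}" "x \<otimes>\<^bsub>C2\<^esub> y = (x + y) mod 2" "\<one>\<^bsub>C2\<^esub> = 0"
 by (auto simp: carrier_integer_mod_group)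

lemma C2_inv: "x : {0, 1} ==> inv\<^bsub>C2\<^esub> x = x"
 by (rule group.inv_equality) (auto simp: C2_simps)

lemma group_C2: "group C2" by simp

lemma subgroup_C2_iff: "subgroup H C2 \<longleftrightarrow> H = {0} \<or> H = {0, 1}"
proof
 assume H: "subgroup H C2"
 have "0 : H" using subgroup.one_closed[OF H] by (simp add: C2_simps)
 moreover have "H \<subseteq> {0, 1}" using subgroup.subset[OF H] by (simp add: C2_simps)
 ultimately show "H = {0} \<or> H = {0, 1}" by auto
next
 assume H: "H = {0} \<or> H = {0, 1}"
 show "subgroup H C2"
 proof (rule subgroup.intro)
  show "inv\<^bsub>C2\<^esub> x : H" if "x : H" for x
   using C2_inv[of x] H that by auto
 qed (use H in \<open>auto simp: C2_simps\<close>)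
qed

lemma subgroup_E: "subgroup {0} C2" and subgroup_F: "subgroup {0, 1} C2"
 by (auto simp: subgroup_C2_iff)

lemma orth_rep_C2_iff:
 assumes H: "subgroup H C2"
 shows "orep H V \<longleftrightarrow> (ALL h:H. snd V h : extensional (Rn (fst V))) & (ALL u:Rn (fst V). snd V 0 u = u) &
   (1 : H --> linear_Rn (fst V) (fst V) (snd V 1) & (ALL u:Rn (fst V). snd V 1 (snd V 1 u) = u) &
    (ALL u:Rn (fst V). ALL v:Rn (fst V). (\<Sum>i<fst V. snd V 1 u i * snd V 1 v i) = (\<Sum>i<fst V. u i * v i)))"
  (is "?L \<longleftrightarrow> ?R")
proof -
 obtain n \<rho> where V: "V = (n, \<rho>)" by (cases V)
 have H01: "H = {0} \<or> H = {0, 1}" using H subgroup_C2_iff by blast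
 show ?thesis
 proof
  assume L: ?L
  hence act: "group_action (C2\<lparr>carrier := H\<rparr>) (Rn n) \<rho>" by (simp add: orth_rep_def V)
  have hom: "\<rho> : hom (C2\<lparr>carrier := H\<rparr>) (BijGroup (Rn n))"
   using group_action.group_hom[OF act] group_hom.homh by blast
  have ext: "\<rho> h : Bij (Rn n)" if "h : H" for h
   using hom that by (auto simp: hom_def BijGroup_def)
  have id: "\<rho> 0 u = u" if "u : Rn n" for u
   using fun_cong[OF group_action.id_eq_one[OF act], of u] that by (simp add: C2_simps)
  have inv: "\<rho> 1 (\<rho> 1 u) = u" if "1 : H" "u : Rn n" for u
  proof -
   have "ALL x:H. ALL y:H. \<rho> ((x + y) mod 2) = \<rho> x \<otimes>\<^bsub>BijGroup (Rn n)\<^esub> \<rho> y"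
    using hom by (auto simp: hom_def C2_simps)
   from this[rule_format, OF that(1) that(1)] have "\<rho> 0 = compose (Rn n) (\<rho> 1) (\<rho> 1)"
    using ext[OF that(1)] by (simp add: BijGroup_def C2_simps)
   thus ?thesis using id[OF that(2)] that(2) by (metis compose_eq)
  qed
  show ?R using L ext id inv H01 by (auto simp: V orth_rep_def Bij_def)
 next
  assume R: ?R
  have bij: "bij_betw (\<rho> h) (Rn n) (Rn n)" if "h : H" for h
   by (rule bij_betw_byWitness[of _ "\<rho> h"]) (use R that H01 in \<open>auto simp: V linear_Rn_def\<close>)
  have Bij: "\<rho> h : Bij (Rn n)" if "h : H" for h
   using bij[OF that] R that by (auto simp: Bij_def V)
  have mem: "\<rho> h u : Rn n" if "h : H" "u : Rn n" for h u
   using bij[OF that(1)] that(2) by (auto simp: bij_betw_def)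
  have "\<rho> ((g + h) mod 2) = compose (Rn n) (\<rho> g) (\<rho> h)" if gh: "g : H" "h : H" for g h
  proof
   have H2: "(g + h) mod 2 : H" using gh H01 by auto
   fix u show "\<rho> ((g + h) mod 2) u = compose (Rn n) (\<rho> g) (\<rho> h) u"
   proof (cases "u : Rn n")
    case True
    thus ?thesis using gh H01 R mem[OF _ True] by (auto simp: compose_def V)
   next
    case False
    thus ?thesis using R H2 by (auto simp: compose_def V extensional_def)
   qed
  qed
  hence "\<rho> : hom (C2\<lparr>carrier := H\<rparr>) (BijGroup (Rn n))"
   by (intro homI) (use Bij in \<open>auto simp: BijGroup_def C2_simps\<close>)
  hence "group_action (C2\<lparr>carrier := H\<rparr>) (Rn n) \<rho>"
   using subgroup.subgroup_is_group[OF H group_C2]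
   by (simp add: group_action_def group_hom_def group_hom_axioms_def group_BijGroup)
  moreover have "linear_Rn n n (\<rho> 0)" using R by (auto simp: V linear_Rn_def lincomb_in_Rn)
  ultimately show ?L using R H01 by (auto simp: V orth_rep_def)
 qed
qed

lemma orth_rep_restrict: "orep K V ==> subgroup K C2 ==> subgroup H C2 ==> H \<subseteq> K ==> orep H V"
 by (auto simp: orth_rep_C2_iff)

text \<open>The sum of \<open>p\<close> trivial and \<open>q\<close> sign representations.\<close>

definition std_rep :: "nat => nat => int rep" where
 "std_rep p q = (p + q, %h. \<lambda>u\<in>Rn (p + q). %i. if h = 0 \<or> i < p then u i else - u i)"

lemma fst_std_rep [simp]: "fst (std_rep p q) = p + q"
 by (simp add: std_rep_def)

lemma orth_rep_std:
 assumes "subgroup H C2"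
 shows "orep H (std_rep p q)"
proof -
 have c: "!!u i. (%u. %i. if i < p then u i else - u i) u i = (if i < p then u i else - u i :: real)" by simp
 have m: "(%i. if i < p then u i else - u i) : Rn (p + q)" if "u : Rn (p + q)" for u :: rvec
  using that by (simp add: Rn_iff)
 show ?thesis
  unfolding orth_rep_C2_iff[OF assms]
  by (auto simp: std_rep_def linear_Rn_def lincomb_in_Rn m intro!: sum.cong)
qed

lemma rep_sum_simps:
 "fst (V +r W) = fst V + fst W"
 "snd (V +r W) h = (\<lambda>u\<in>Rn (fst V + fst W). dsum (fst V) (fst V) (snd V h) (snd W h) u)"
 by (auto simp: rep_sum_def dsum_def split: prod.splits)

lemma sum_append:
 "(\<Sum>i<m + n. append_vec m u v i * append_vec m u' v' i) = (\<Sum>i<m. u i * u' i) + (\<Sum>i<n. v i * v' i)"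
proof -
 have "(\<Sum>i<m + n. append_vec m u v i * append_vec m u' v' i) =
  (\<Sum>i<m. append_vec m u v i * append_vec m u' v' i) + (\<Sum>i=m..<m+n. append_vec m u v i * append_vec m u' v' i)"
  by (metis atLeast0LessThan le_add1 sum.atLeastLessThan_concat zero_le)
 also have "(\<Sum>i=m..<m+n. append_vec m u v i * append_vec m u' v' i) = (\<Sum>i<n. v i * v' i)"
  using sum.shift_bounds_nat_ivl[of "%i. append_vec m u v i * append_vec m u' v' i" 0 m n]
  by (simp add: append_vec_def atLeast0LessThan add.commute)
 finally show ?thesis by (simp add: append_vec_def)
qed

lemma orth_rep_sum:
 assumes H: "subgroup H C2" and V: "orep H V" and W: "orep H W"
 shows "orep H (V +r W)"
 unfolding orth_rep_C2_iff[OF H] rep_sum_simps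
proof (intro conjI ballI impI)
 note V' = V[unfolded orth_rep_C2_iff[OF H]] and W' = W[unfolded orth_rep_C2_iff[OF H]]
 let ?m = "fst V" and ?n = "fst W"
 show "(\<lambda>u\<in>Rn (?m + ?n). dsum ?m ?m (snd V h) (snd W h) u) : extensional (Rn (?m + ?n))" for h by simp
 fix u assume u: "u : Rn (?m + ?n)"
 show "(\<lambda>u\<in>Rn (?m + ?n). dsum ?m ?m (snd V 0) (snd W 0) u) u = u"
  using u V' W' by (simp add: dsum_def take_in_Rn drop_in_Rn append_take_drop)
next
 note V' = V[unfolded orth_rep_C2_iff[OF H]] and W' = W[unfolded orth_rep_C2_iff[OF H]]
 let ?m = "fst V" and ?n = "fst W"
 assume 1: "1 : H"
 have lV: "linear_Rn ?m ?m (snd V 1)" and lW: "linear_Rn ?n ?n (snd W 1)" using V' W' 1 by auto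
 have L: "linear_Rn (?m + ?n) (?m + ?n) (dsum ?m ?m (snd V 1) (snd W 1))" using lV lW by (rule linear_Rn_dsum)
 show "linear_Rn (?m + ?n) (?m + ?n) (\<lambda>u\<in>Rn (?m + ?n). dsum ?m ?m (snd V 1) (snd W 1) u)"
  using L by (rule linear_Rn_cong) simp
 fix u assume u: "u : Rn (?m + ?n)"
 have Du: "dsum ?m ?m (snd V 1) (snd W 1) u : Rn (?m + ?n)" using linear_RnD(1)[OF L u] .
 have "dsum ?m ?m (snd V 1) (snd W 1) (dsum ?m ?m (snd V 1) (snd W 1) u) = u"
  unfolding dsum_comp[OF lV] using V' W' 1 u by (simp add: dsum_def take_in_Rn drop_in_Rn append_take_drop)
 thus "(\<lambda>u\<in>Rn (?m + ?n). dsum ?m ?m (snd V 1) (snd W 1) u) ((\<lambda>u\<in>Rn (?m + ?n). dsum ?m ?m (snd V 1) (snd W 1) u) u) = u"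
  using u Du by simp
 fix v assume v: "v : Rn (?m + ?n)"
 have "(\<Sum>i<?m + ?n. u i * v i) = (\<Sum>i<?m. take_vec ?m u i * take_vec ?m v i) + (\<Sum>i<?n. drop_vec ?m u i * drop_vec ?m v i)"
  using sum_append[where m = ?m and n = ?n and u = "take_vec ?m u" and v = "drop_vec ?m u"
    and u' = "take_vec ?m v" and v' = "drop_vec ?m v"]
  by (simp add: append_take_drop)
 thus "(\<Sum>i<?m + ?n. (\<lambda>u\<in>Rn (?m + ?n). dsum ?m ?m (snd V 1) (snd W 1) u) u i * (\<lambda>u\<in>Rn (?m + ?n). dsum ?m ?m (snd V 1) (snd W 1) u) v i) =
   (\<Sum>i<?m + ?n. u i * v i)"
  using u v V' W' 1 by (simp add: dsum_def sum_append take_in_Rn drop_in_Rn)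
qed

lemma orth_rep_zero: "subgroup H C2 ==> orep H zero_rep"
 by (auto simp: orth_rep_C2_iff zero_rep_def linear_Rn_def Rn_iff)

subsection \<open>Frames of fixed subspaces\<close>

text \<open>
  Two kinds of linear subspaces carry orientation signs: the whole representation, and its
  \<open>C\<^sub>2\<close>-fixed part. The flag \<open>c\<close> selects the fixed part.
\<close>

definition subpart :: "bool => int rep => rvec set" where
 "subpart c V = {u : Rn (fst V). c --> snd V 1 u = u}"

definition sub_of :: "bool => int set" where
 "sub_of c = (if c then {0, 1} else {0})"

lemma subpart_sub: "subpart c V \<subseteq> Rn (fst V)"
 by (auto simp: subpart_def)

text \<open>
  By induction on \<open>n\<close>: if \<open>S\<close> contains a vector with a nonzero last coordinate, adding it to a frame of the part
  of \<open>S\<close> where that coordinate vanishes gives a frame of \<open>S\<close>.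
\<close>

lemma frame_exists:
 assumes "S \<subseteq> Rn n" "(%i. 0) : S"
  and cl: "!!u v a b. u : S ==> v : S ==> (%i. a * u i + b * v i) : S"
 shows "EX p \<phi>. frame p n S \<phi>"
 using assms
proof (induction n arbitrary: S)
 case 0
 have "x = (%i. 0)" if "x : S" for x
  using subsetD[OF 0(1) that] by (simp add: Rn_iff fun_eq_iff)
 hence "S = {%i. 0}" using 0(2) by blast
 moreover have "Rn 0 = {%i. 0}" by (auto simp: Rn_iff)
 ultimately have "frame 0 0 S (%u. u)" using frame_Rn[of 0] by simp
 thus ?case by blast
next
 case (Suc n)
 let ?S0 = "S \<inter> Rn n"
 have "EX p \<phi>. frame p n ?S0 \<phi>"
  by (rule Suc.IH) (use Suc.prems in \<open>auto simp: zero_in_Rn lincomb_in_Rn\<close>)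
 then obtain p \<phi> where \<phi>: "frame p n ?S0 \<phi>" by blast
 note F = frame_inv[OF \<phi>]
 have lin: "linear_Rn p (Suc n) \<phi>"
  using \<phi> by (auto simp: frame_def linear_Rn_def Rn_iff Pi_iff)
 show ?case
 proof (cases "S \<subseteq> Rn n")
  case True
  hence "?S0 = S" by blast
  hence "frame p (Suc n) S \<phi>" using \<phi> lin by (simp add: frame_def)
  thus ?thesis by blast
 next
  case False
  then obtain s' where s': "s' : S" "s' ~: Rn n" by blast
  have "s' n ~= 0"
  proof
   assume "s' n = 0"
   hence "s' i = 0" if "i >= n" for i using that s'(1) Suc.prems(1) by (cases "i = n") (auto simp: Rn_iff)
   thus False using s'(2) by (simp add: Rn_iff)
  qed
  define s where "s = (%i. (1 / s' n) * s' i + 0 * s' i)"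
  have s: "s : S" "s n = 1" using Suc.prems(3)[OF s'(1) s'(1), of "1 / s' n" 0] \<open>s' n ~= 0\<close> by (auto simp: s_def)
  have sR: "s : Rn (Suc n)" using s(1) Suc.prems(1) by blast
  define \<psi> where "\<psi> = (%u. %i. 1 * \<phi> (take_vec p u) i + u p * s i)"
  have tn: "\<phi> (take_vec p u) n = 0" "\<phi> (take_vec p u) : S" for u
   using F(4)[OF take_in_Rn[of p u]] by (auto simp: Rn_iff)
  have lin\<psi>: "linear_Rn (Suc p) (Suc n) \<psi>"
   unfolding linear_Rn_def
  proof (intro conjI ballI allI)
   show "\<psi> : Rn (Suc p) \<rightarrow> Rn (Suc n)"
    using linear_RnD(1)[OF lin take_in_Rn] sR by (auto simp: \<psi>_def Rn_iff)
   fix u v a b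
   have t: "take_vec p (%i. a * u i + b * v i) = (%i. a * take_vec p u i + b * take_vec p v i)"
    by (auto simp: take_vec_def)
   show "\<psi> (%i. a * u i + b * v i) = (%i. a * \<psi> u i + b * \<psi> v i)"
    unfolding \<psi>_def t linear_RnD(2)[OF lin take_in_Rn take_in_Rn] by (auto simp: algebra_simps)
  qed
  have "bij_betw \<psi> (Rn (Suc p)) S"
  proof (rule bij_betwI)
   define g where "g = (%y. %i. if i = p then y n else inv_into (Rn p) \<phi> (%i. 1 * y i + (- y n) * s i) i)"
   have y0: "(%i. 1 * y i + (- y n) * s i) : ?S0" if "y : S" for y
   proof
    show "(%i. 1 * y i + (- y n) * s i) : S" using Suc.prems(3)[OF that s(1)] .
    have "1 * y i + (- y n) * s i = 0" if "i >= n" for i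
     using sR subsetD[OF Suc.prems(1) \<open>y : S\<close>] s(2) that by (cases "i = n") (auto simp: Rn_iff)
    thus "(%i. 1 * y i + (- y n) * s i) : Rn n" unfolding Rn_iff by blast
   qed
   show "\<psi> : Rn (Suc p) \<rightarrow> S" unfolding \<psi>_def by (intro funcsetI Suc.prems(3)[OF tn(2) s(1)])
   show "g : S \<rightarrow> Rn (Suc p)" using F(1)[OF y0] by (auto simp: g_def Rn_iff)
   show "g (\<psi> u) = u" if u: "u : Rn (Suc p)" for u
   proof -
    have "\<psi> u n = u p" using tn(1) s(2) by (simp add: \<psi>_def)
    hence "(%i. 1 * \<psi> u i + (- \<psi> u n) * s i) = \<phi> (take_vec p u)" by (simp add: \<psi>_def)
    hence "inv_into (Rn p) \<phi> (%i. 1 * \<psi> u i + (- \<psi> u n) * s i) = take_vec p u"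
     by (simp only: F(3)[OF take_in_Rn])
    hence "g (\<psi> u) = (%i. if i = p then u p else take_vec p u i)"
     unfolding g_def by (simp only: \<open>\<psi> u n = u p\<close>)
    thus ?thesis using u by (auto simp: take_vec_def Rn_iff fun_eq_iff)
   qed
   show "\<psi> (g y) = y" if y: "y : S" for y
   proof -
    have "take_vec p (g y) = inv_into (Rn p) \<phi> (%i. 1 * y i + (- y n) * s i)"
     using F(1)[OF y0[OF y]] by (auto simp: take_vec_def g_def Rn_iff fun_eq_iff)
    hence "\<phi> (take_vec p (g y)) = (%i. 1 * y i + (- y n) * s i)" using F(2)[OF y0[OF y]] by simp
    moreover have "g y p = y n" by (simp add: g_def)
    ultimately show ?thesis by (simp add: \<psi>_def)
   qed
  qed
  hence "frame (Suc p) (Suc n) S \<psi>" using lin\<psi> by (simp add: frame_def)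
  thus ?thesis by blast
 qed
qed

definition fdim :: "bool => int rep => nat" where
 "fdim c V = (SOME p. EX \<phi>. frame p (fst V) (subpart c V) \<phi>)"

definition fr :: "bool => int rep => rvec => rvec" where
 "fr c V = (SOME \<phi>. frame (fdim c V) (fst V) (subpart c V) \<phi>)"

abbreviation repc :: "bool => int rep => bool" where
 "repc c V \<equiv> orep (sub_of c) V"

lemma subgroup_sub_of: "subgroup (sub_of c) C2"
 by (simp add: sub_of_def subgroup_C2_iff)

lemma repc_linear: "repc True V ==> linear_Rn (fst V) (fst V) (snd V 1)"
 using orth_rep_C2_iff[OF subgroup_F] by (simp add: sub_of_def)

lemma repc_invol: "repc True V ==> u : Rn (fst V) ==> snd V 1 (snd V 1 u) = u"
 using orth_rep_C2_iff[OF subgroup_F] by (simp add: sub_of_def)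

lemma frame_fr:
 assumes "repc c V"
 shows "frame (fdim c V) (fst V) (subpart c V) (fr c V)"
proof -
 have "EX p \<phi>. frame p (fst V) (subpart c V) \<phi>"
 proof (rule frame_exists)
  show "subpart c V \<subseteq> Rn (fst V)" by (rule subpart_sub)
  show "(%i. 0) : subpart c V"
   using linear_Rn_zero[OF repc_linear[of V]] assms by (cases c) (auto simp: subpart_def zero_in_Rn)
  show "(%i. a * u i + b * v i) : subpart c V" if "u : subpart c V" "v : subpart c V" for u v a b
   using that linear_RnD(2)[OF repc_linear[of V], of u v a b] assms
   by (cases c) (auto simp: subpart_def lincomb_in_Rn)
 qed
 hence "EX \<phi>. frame (fdim c V) (fst V) (subpart c V) \<phi>" unfolding fdim_def by (rule someI_ex)
 thus ?thesis unfolding fr_def by (rule someI_ex)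
qed

lemma fdim_eqI: "repc c V ==> frame p (fst V) (subpart c V) \<phi> ==> fdim c V = p"
 using frame_dim frame_fr by blast

lemma fdim_False: "repc False V ==> fdim False V = fst V"
 by (rule fdim_eqI[of _ _ _ "%u. u"]) (simp_all add: subpart_def frame_Rn)

lemma subpart_sum:
 assumes "repc c V" "repc c W"
 shows "subpart c (V +r W) = {u. EX s:subpart c V. EX t:subpart c W. u = append_vec (fst V) s t}"
proof (intro equalityI subsetI)
 fix u assume u: "u : subpart c (V +r W)"
 let ?s = "take_vec (fst V) u" and ?t = "drop_vec (fst V) u"
 have uR: "u : Rn (fst V + fst W)" using u by (simp add: subpart_def rep_sum_simps)
 have "snd V 1 ?s = ?s & snd W 1 ?t = ?t" if c
 proof -
  have "append_vec (fst V) (snd V 1 ?s) (snd W 1 ?t) = append_vec (fst V) ?s ?t"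
   using u that uR by (simp add: subpart_def rep_sum_simps dsum_def append_take_drop)
  moreover have "snd V 1 ?s : Rn (fst V)" using linear_RnD(1)[OF repc_linear take_in_Rn] assms(1) that by simp
  ultimately show ?thesis using append_inject take_in_Rn by metis
 qed
 hence "?s : subpart c V" "?t : subpart c W" using uR by (auto simp: subpart_def take_in_Rn drop_in_Rn)
 thus "u : {u. EX s:subpart c V. EX t:subpart c W. u = append_vec (fst V) s t}"
  using append_take_drop[of "fst V" u] by force
next
 fix u assume "u : {u. EX s:subpart c V. EX t:subpart c W. u = append_vec (fst V) s t}"
 then obtain s t where st: "s : subpart c V" "t : subpart c W" "u = append_vec (fst V) s t" by blast
 thus "u : subpart c (V +r W)"
  by (auto simp: subpart_def rep_sum_simps append_in_Rn dsum_append)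
qed

abbreviation fsum :: "bool => int rep => int rep => rvec => rvec" where
 "fsum c V W \<equiv> dsum (fdim c V) (fst V) (fr c V) (fr c W)"

lemma frame_fsum:
 assumes "repc c V" "repc c W"
 shows "frame (fdim c V + fdim c W) (fst V + fst W) (subpart c (V +r W)) (fsum c V W)"
 unfolding subpart_sum[OF assms] by (rule frame_dsum[OF frame_fr[OF assms(1)] frame_fr[OF assms(2)] subpart_sub])

lemma repc_sum: "repc c V ==> repc c W ==> repc c (V +r W)"
 by (rule orth_rep_sum[OF subgroup_sub_of])

lemma fdim_sum: "repc c V ==> repc c W ==> fdim c (V +r W) = fdim c V + fdim c W"
 by (rule fdim_eqI[OF repc_sum]) (use frame_fsum[of c V W] in \<open>simp_all add: rep_sum_simps\<close>)

section \<open>Orientation signs of equivariant isomorphisms\<close>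

text \<open>The sign of the determinant of \<open>A\<close>, in the frames \<open>\<phi>\<close> of its source and \<open>\<psi>\<close> of its target.\<close>

definition sgf :: "nat => (rvec => rvec) => (rvec => rvec) => (rvec => rvec) => real" where
 "sgf p \<phi> \<psi> A = sgn (detR p (inv_into (Rn p) \<psi> o A o \<phi>))"

definition lin_bij :: "nat => nat => rvec set => rvec set => (rvec => rvec) => bool" where
 "lin_bij m n S T A \<longleftrightarrow> linear_Rn m n A & bij_betw A S T"

lemma lin_bij_comp: "lin_bij m n S T A ==> lin_bij n l T U B ==> lin_bij m l S U (B o A)"
 unfolding lin_bij_def using linear_Rn_comp bij_betw_trans by blast

lemma lin_bij_id: "lin_bij m m S S (%u. u)"
 by (simp add: lin_bij_def linear_Rn_def bij_betw_def)

lemma sgf_iso: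
 assumes "frame p m S \<phi>" "frame p n T \<psi>" "lin_bij m n S T A"
 shows "linear_iso_Rn p p (inv_into (Rn p) \<psi> o A o \<phi>)"
 using frame_iso_frame[OF assms(1,2)] assms(3) by (simp add: lin_bij_def)

lemma sgf_values:
 assumes "frame p m S \<phi>" "frame p n T \<psi>" "lin_bij m n S T A"
 shows "sgf p \<phi> \<psi> A : {1, -1}"
 using detR_nonzero[OF sgf_iso[OF assms]] by (simp add: sgf_def sgn_if)

lemma sgf_cong:
 assumes "frame p m S \<phi>" "!!u. u : S ==> A u = B u"
 shows "sgf p \<phi> \<psi> A = sgf p \<phi> \<psi> B"
 unfolding sgf_def by (rule arg_cong[of _ _ sgn], rule detR_cong) (simp add: assms(2)[OF frame_inv(4)[OF assms(1)]])

lemma sgf_comp: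
 assumes \<phi>: "frame p m S \<phi>" and \<psi>: "frame p n T \<psi>" and \<theta>: "frame p l U \<theta>"
  and A: "lin_bij m n S T A" and B: "lin_bij n l T U B"
 shows "sgf p \<phi> \<theta> (B o A) = sgf p \<psi> \<theta> B * sgf p \<phi> \<psi> A"
proof -
 have AT: "A (\<phi> u) : T" if "u : Rn p" for u
  using frame_inv(4)[OF \<phi> that] A by (auto simp: lin_bij_def bij_betw_def)
 have "detR p (inv_into (Rn p) \<theta> o (B o A) o \<phi>) =
   detR p ((inv_into (Rn p) \<theta> o B o \<psi>) o (inv_into (Rn p) \<psi> o A o \<phi>))"
  by (rule detR_cong) (simp add: frame_inv(2)[OF \<psi> AT])
 also have "\<dots> = detR p (inv_into (Rn p) \<theta> o B o \<psi>) * detR p (inv_into (Rn p) \<psi> o A o \<phi>)"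
  by (rule detR_comp) (rule linear_iso_RnD(1)[OF sgf_iso[OF \<phi> \<psi> A]] linear_iso_RnD(1)[OF sgf_iso[OF \<psi> \<theta> B]])+
 finally show ?thesis unfolding sgf_def by (simp add: sgn_mult)
qed

lemma sgf_id:
 assumes "frame p m S \<phi>"
 shows "sgf p \<phi> \<phi> (%u. u) = 1"
proof -
 have "detR p (inv_into (Rn p) \<phi> o (%u. u) o \<phi>) = detR p (%u. u)"
  by (rule detR_cong) (simp add: frame_inv(3)[OF assms])
 thus ?thesis by (simp add: sgf_def detR_id)
qed

lemma sgf_dsum:
 assumes \<phi>: "frame p m S \<phi>" and \<psi>: "frame p n T \<psi>" and A: "lin_bij m n S T A"
  and \<zeta>: "frame q m' S' \<zeta>" and \<xi>: "frame q n' T' \<xi>" and k: "lin_bij m' n' S' T' k"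
  and sub: "S \<subseteq> Rn m" "T \<subseteq> Rn n"
 shows "sgf (p + q) (dsum p m \<phi> \<zeta>) (dsum p n \<psi> \<xi>) (dsum m n A k) = sgf p \<phi> \<psi> A * sgf q \<zeta> \<xi> k"
proof -
 let ?a = "inv_into (Rn p) \<psi> o A o \<phi>" and ?b = "inv_into (Rn q) \<xi> o k o \<zeta>"
 have AT: "A s : T" if "s : S" for s using A that by (auto simp: lin_bij_def bij_betw_def)
 have kT: "k s : T'" if "s : S'" for s using k that by (auto simp: lin_bij_def bij_betw_def)
 have a: "linear_Rn p p ?a" by (rule linear_iso_RnD(1)[OF sgf_iso[OF \<phi> \<psi> A]])
 have b: "linear_Rn q q ?b" by (rule linear_iso_RnD(1)[OF sgf_iso[OF \<zeta> \<xi> k]])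
 note fd = frame_dsum[OF \<psi> \<xi> sub(2)]
 have "detR (p + q) (inv_into (Rn (p + q)) (dsum p n \<psi> \<xi>) o dsum m n A k o dsum p m \<phi> \<zeta>) = detR (p + q) (dsum p p ?a ?b)"
 proof (rule detR_cong)
  fix u assume u: "u : Rn (p + q)"
  let ?t = "take_vec p u" and ?d = "drop_vec p u"
  have t: "\<phi> ?t : S" using frame_inv(4)[OF \<phi> take_in_Rn] .
  have d: "\<zeta> ?d : S'" using frame_inv(4)[OF \<zeta> drop_in_Rn[OF u]] .
  have tR: "\<phi> ?t : Rn m" using t sub by blast
  have D: "dsum p p ?a ?b u : Rn (p + q)" using linear_RnD(1)[OF linear_Rn_dsum[OF a b] u] .
  have aR: "?a ?t : Rn p" using linear_RnD(1)[OF a take_in_Rn] .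
  have "dsum m n A k (dsum p m \<phi> \<zeta> u) = append_vec n (A (\<phi> ?t)) (k (\<zeta> ?d))"
   unfolding dsum_def[of p m] by (rule dsum_append[OF tR])
  also have "\<dots> = dsum p n \<psi> \<xi> (dsum p p ?a ?b u)"
   unfolding dsum_def[of p p] dsum_append[OF aR]
   by (simp add: frame_inv(2)[OF \<psi> AT[OF t]] frame_inv(2)[OF \<xi> kT[OF d]])
  finally show "(inv_into (Rn (p + q)) (dsum p n \<psi> \<xi>) o dsum m n A k o dsum p m \<phi> \<zeta>) u = dsum p p ?a ?b u"
   using frame_inv(3)[OF fd D] by simp
 qed
 thus ?thesis unfolding sgf_def detR_dsum[OF a b] by (simp add: sgn_mult)
qed

subsection \<open>Equivariant isomorphisms\<close>

definition eqv :: "int set => int rep => int rep => (rvec => rvec) => bool" where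
 "eqv H V W A \<longleftrightarrow> linear_iso_Rn (fst V) (fst W) A &
   (1 : H --> (ALL u:Rn (fst V). A (snd V 1 u) = snd W 1 (A u)))"

abbreviation okc :: "bool => int set => bool" where
 "okc c H \<equiv> (c --> 1 : H)"

lemma eqvD:
 assumes "eqv H V W A"
 shows "linear_iso_Rn (fst V) (fst W) A" "linear_Rn (fst V) (fst W) A" "u : Rn (fst V) ==> A u : Rn (fst W)"
  "fst V = fst W" "1 : H ==> u : Rn (fst V) ==> A (snd V 1 u) = snd W 1 (A u)"
 using assms linear_iso_dim unfolding eqv_def by (auto simp: linear_iso_Rn_def linear_Rn_def)

lemma eqv_cong: "eqv H V W A ==> orep H V ==> subgroup H C2 ==> (!!u. u : Rn (fst V) ==> B u = A u) ==> eqv H V W B"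
 unfolding eqv_def using linear_iso_Rn_cong[of "fst V" "fst W" A B]
 by (auto simp: orth_rep_C2_iff linear_Rn_def Pi_iff)

lemma eqv_comp:
 assumes A: "eqv H U V A" and B: "eqv H V W B"
 shows "eqv H U W (B o A)"
 unfolding eqv_def
proof (intro conjI impI ballI)
 show "linear_iso_Rn (fst U) (fst W) (B o A)" using linear_iso_Rn_comp[OF eqvD(1)[OF A] eqvD(1)[OF B]] .
 fix u assume "1 : H" "u : Rn (fst U)"
 thus "(B o A) (snd U 1 u) = snd W 1 ((B o A) u)"
  using eqvD(5)[OF A] eqvD(3)[OF A] eqvD(5)[OF B] by simp
qed

lemma eqv_id: "eqv H V V (%u. u)"
 by (simp add: eqv_def linear_iso_Rn_id)

lemma eqv_mono: "eqv K V W A ==> H \<subseteq> K ==> eqv H V W A"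
 by (auto simp: eqv_def)

lemma rep_map_in_Rn: "orep H V ==> subgroup H C2 ==> 1 : H ==> u : Rn (fst V) ==> snd V 1 u : Rn (fst V)"
 by (auto simp: orth_rep_C2_iff linear_Rn_def)

lemma rep_map_linear: "orep H V ==> subgroup H C2 ==> 1 : H ==> linear_Rn (fst V) (fst V) (snd V 1)"
 by (auto simp: orth_rep_C2_iff)

lemma rep_map_invol: "orep H V ==> subgroup H C2 ==> 1 : H ==> u : Rn (fst V) ==> snd V 1 (snd V 1 u) = u"
 by (auto simp: orth_rep_C2_iff)

lemma eqv_inv:
 assumes A: "eqv H V W A" and W: "orep H W" "orep H V" and H: "subgroup H C2"
 shows "eqv H W V (inv_into (Rn (fst V)) A)"
 unfolding eqv_def
proof (intro conjI impI ballI)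
 note F = frame_inv[OF eqvD(1)[OF A, unfolded frame_of_iso]]
 show "linear_iso_Rn (fst W) (fst V) (inv_into (Rn (fst V)) A)" using linear_iso_inv[OF eqvD(1)[OF A]] .
 fix u assume 1: "1 : H" and u: "u : Rn (fst W)"
 let ?v = "inv_into (Rn (fst V)) A u"
 have v: "?v : Rn (fst V)" "A ?v = u" using F(1,2)[OF u] .
 have "A (snd V 1 ?v) = snd W 1 u" using eqvD(5)[OF A 1 v(1)] v(2) by simp
 thus "inv_into (Rn (fst V)) A (snd W 1 u) = snd V 1 ?v"
  using F(3)[OF rep_map_in_Rn[OF W(2) H 1 v(1)]] by simp
qed

lemma eqv_inv_comp:
 assumes A: "eqv H V W A"
 shows "u : Rn (fst W) ==> A (inv_into (Rn (fst V)) A u) = u" "u : Rn (fst V) ==> inv_into (Rn (fst V)) A (A u) = u"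
  "u : Rn (fst W) ==> inv_into (Rn (fst V)) A u : Rn (fst V)"
 using frame_inv[OF eqvD(1)[OF A, unfolded frame_of_iso]] by auto

lemma repc_of: "orep H V ==> subgroup H C2 ==> okc c H ==> repc c V"
 by (rule orth_rep_restrict[OF _ _ subgroup_sub_of]) (auto simp: subgroup_C2_iff sub_of_def)

lemma eqv_lin_bij:
 assumes A: "eqv H V W A" and r: "orep H V" "orep H W" "subgroup H C2" "okc c H"
 shows "lin_bij (fst V) (fst W) (subpart c V) (subpart c W) A"
 unfolding lin_bij_def
proof (intro conjI bij_betwI)
 show "linear_Rn (fst V) (fst W) A" using eqvD(2)[OF A] .
 note B = eqv_inv[OF A r(2,1,3)] and AB = eqv_inv_comp[OF A]
 show "A : subpart c V \<rightarrow> subpart c W"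
  using eqvD(3)[OF A] eqvD(5)[OF A] r(4) by (auto simp: subpart_def) metis
 show "inv_into (Rn (fst V)) A : subpart c W \<rightarrow> subpart c V"
  using eqvD(3)[OF B] eqvD(5)[OF B] r(4) by (auto simp: subpart_def) metis
 show "inv_into (Rn (fst V)) A (A u) = u" if "u : subpart c V" for u using AB(2) that by (simp add: subpart_def)
 show "A (inv_into (Rn (fst V)) A y) = y" if "y : subpart c W" for y using AB(1) that by (simp add: subpart_def)
qed

lemma eqv_fdim:
 assumes A: "eqv H V W A" and r: "orep H V" "orep H W" "subgroup H C2" "okc c H"
 shows "fdim c V = fdim c W"
 by (rule linear_iso_dim[OF frame_iso_frame[OF frame_fr[of c V] frame_fr[of c W]]])
  (use eqv_lin_bij[OF A r] repc_of r in \<open>auto simp: lin_bij_def\<close>)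

lemma eqv_dsum:
 assumes A: "eqv H V W A" and k: "eqv H T T' k"
  and r: "orep H V" "orep H T" "subgroup H C2"
 shows "eqv H (V +r T) (W +r T') (dsum (fst V) (fst W) A k)"
 unfolding eqv_def rep_sum_simps
proof (intro conjI impI ballI)
 show "linear_iso_Rn (fst V + fst T) (fst W + fst T') (dsum (fst V) (fst W) A k)"
  using linear_iso_dsum[OF eqvD(1)[OF A] eqvD(1)[OF k]] .
 fix u assume 1: "1 : H" and u: "u : Rn (fst V + fst T)"
 have Du: "dsum (fst V) (fst W) A k u : Rn (fst W + fst T')" using dsum_in_Rn[OF eqvD(2)[OF k] u] .
 have t: "snd V 1 (take_vec (fst V) u) : Rn (fst V)" using rep_map_in_Rn[OF r(1,3) 1 take_in_Rn] .
 have At: "A (take_vec (fst V) u) : Rn (fst W)" using eqvD(3)[OF A take_in_Rn] .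
 show "dsum (fst V) (fst W) A k ((\<lambda>u\<in>Rn (fst V + fst T). dsum (fst V) (fst V) (snd V 1) (snd T 1) u) u) =
   (\<lambda>u\<in>Rn (fst W + fst T'). dsum (fst W) (fst W) (snd W 1) (snd T' 1) u) (dsum (fst V) (fst W) A k u)"
  using u Du eqvD(5)[OF A 1 take_in_Rn] eqvD(5)[OF k 1 drop_in_Rn[OF u]]
  by (simp add: dsum_def take_append[OF t] take_append[OF At] drop_append)
qed

subsection \<open>Splitting into isotypical parts\<close>

text \<open>
  \<open>V\<close> is isomorphic to the sum of \<open>p\<close> trivial and \<open>q\<close> sign representations of \<open>H\<close>.
\<close>

definition splits :: "int set => int rep => nat => nat => (rvec => rvec) => bool" where
 "splits H V p q \<Phi> \<longleftrightarrow> linear_iso_Rn (p + q) (fst V) \<Phi> &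
   (if 1 : H then ALL u:Rn (p + q). snd V 1 (\<Phi> u) = \<Phi> (dsum p p (%u. u) (%u i. - u i) u) else q = 0)"

definition pdim :: "int set => int rep => nat" where
 "pdim H V = fdim (1 : H) V"

lemma splits_frame:
 assumes s: "splits H V p q \<Phi>" and r: "orep H V" "subgroup H C2"
 shows "frame p (fst V) (subpart (1 : H) V) (%u. \<Phi> (append_vec p u (%i. 0)))" "pdim H V = p" "fst V = p + q"
proof -
 have iso: "linear_iso_Rn (p + q) (fst V) \<Phi>" using s by (simp add: splits_def)
 note F = frame_inv[OF iso[unfolded frame_of_iso]]
 show "fst V = p + q" using linear_iso_dim[OF iso] by simp
 show fr: "frame p (fst V) (subpart (1 : H) V) (%u. \<Phi> (append_vec p u (%i. 0)))"
  unfolding frame_def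
 proof (intro conjI bij_betwI)
  have "linear_Rn p (p + q) (%u. append_vec p u (%i. 0))"
   by (auto simp: linear_Rn_def append_vec_def Rn_iff)
  from linear_Rn_comp[OF this linear_iso_RnD(1)[OF iso]]
  show "linear_Rn p (fst V) (%u. \<Phi> (append_vec p u (%i. 0)))" by (simp add: o_def)
  show "(%u. \<Phi> (append_vec p u (%i. 0))) : Rn p \<rightarrow> subpart (1 : H) V"
  proof
   fix u assume u: "u : Rn p"
   have a: "append_vec p u (%i. 0) : Rn (p + q)" by (rule append_in_Rn[OF zero_in_Rn])
   have "snd V 1 (\<Phi> (append_vec p u (%i. 0))) = \<Phi> (append_vec p u (%i. 0))" if "1 : H"
    using s a u that by (simp add: splits_def dsum_append)
   thus "\<Phi> (append_vec p u (%i. 0)) : subpart (1 : H) V"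
    using F(4)[OF a] by (simp add: subpart_def)
  qed
  show "(%y. take_vec p (inv_into (Rn (p + q)) \<Phi> y)) : subpart (1 : H) V \<rightarrow> Rn p" using take_in_Rn by blast
  show "take_vec p (inv_into (Rn (p + q)) \<Phi> (\<Phi> (append_vec p u (%i. 0)))) = u" if u: "u : Rn p" for u
   using F(3)[OF append_in_Rn[OF zero_in_Rn]] u by (simp add: take_append)
  show "\<Phi> (append_vec p (take_vec p (inv_into (Rn (p + q)) \<Phi> y)) (%i. 0)) = y" if y: "y : subpart (1 : H) V" for y
  proof -
   define w where "w = inv_into (Rn (p + q)) \<Phi> y"
   have yR: "y : Rn (fst V)" using y by (simp add: subpart_def)
   have w: "w : Rn (p + q)" "\<Phi> w = y" using F(1,2)[OF yR] by (auto simp: w_def)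
   have "drop_vec p w = (%i. 0)"
   proof (cases "1 : H")
    case True
    let ?n = "%u::rvec. %i. - u i"
    have "snd V 1 (\<Phi> w) = \<Phi> (dsum p p (%u. u) ?n w)" using s True w(1) by (simp add: splits_def)
    hence "\<Phi> (dsum p p (%u. u) ?n w) = \<Phi> w" using w(2) y True by (simp add: subpart_def)
    moreover have "dsum p p (%u. u) ?n w : Rn (p + q)"
     using w(1) by (auto simp: dsum_def Rn_iff append_vec_def drop_vec_def take_vec_def)
    ultimately have "dsum p p (%u. u) ?n w = w" using F(3) w(1) by metis
    hence "append_vec p (take_vec p w) (?n (drop_vec p w)) = append_vec p (take_vec p w) (drop_vec p w)"
     by (simp add: dsum_def append_take_drop)
    hence n: "?n (drop_vec p w) = drop_vec p w" by (simp add: append_inject take_in_Rn)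
    show ?thesis
    proof
     fix i show "drop_vec p w i = 0" using fun_cong[OF n, of i] by simp
    qed
   next
    case False
    thus ?thesis using w(1) s by (auto simp: splits_def drop_vec_def Rn_iff)
   qed
   thus ?thesis using append_take_drop[of p w] w(2) by (simp add: w_def)
  qed
 qed
 show "pdim H V = p" unfolding pdim_def
  by (rule fdim_eqI[OF repc_of[OF r] fr]) simp
qed

text \<open>
  The fixed part and the part on which the involution acts by \<open>-1\<close> span, since \<open>u\<close> is the sum
  of \<open>(u + \<tau> u) / 2\<close> and \<open>(u - \<tau> u) / 2\<close>.
\<close>

lemma splits_exists:
 assumes r: "orep H V" "subgroup H C2"
 shows "EX q \<Phi>. splits H V (pdim H V) q \<Phi>"
proof (cases "1 : H")
 case False
 have "repc False V" using repc_of[OF r] by simp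
 hence "frame (fst V) (fst V) (subpart False V) (fr False V)" using frame_fr fdim_False by metis
 hence "splits H V (fst V) 0 (fr False V)"
  using False by (simp add: splits_def frame_of_iso subpart_def)
 thus ?thesis using \<open>repc False V\<close> fdim_False False by (auto simp: pdim_def)
next
 case True
 let ?n = "fst V"
 note lin = rep_map_linear[OF r True] and inv = rep_map_invol[OF r True] and mem = rep_map_in_Rn[OF r True]
 define p where "p = pdim H V"
 have repT: "repc True V" using repc_of[OF r] True by simp
 have \<phi>: "frame p ?n (subpart True V) (fr True V)"
  using frame_fr[OF repT] True by (simp add: p_def pdim_def)
 define S where "S = {u : Rn ?n. snd V 1 u = (%i. - u i)}"
 have "EX q \<psi>. frame q ?n S \<psi>"
 proof (rule frame_exists)
  show "(%i. 0) : S" using linear_Rn_zero[OF lin] by (simp add: S_def zero_in_Rn)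
  show "(%i. a * u i + b * v i) : S" if "u : S" "v : S" for u v a b
   using that linear_RnD(2)[OF lin, of u v a b] by (auto simp: S_def lincomb_in_Rn fun_eq_iff)
 qed (auto simp: S_def)
 then obtain q \<psi> where \<psi>: "frame q ?n S \<psi>" by blast
 note F = frame_inv[OF \<phi>] and G = frame_inv[OF \<psi>]
 define f where "f = fr True V"
 note F = F[folded f_def]
 have linf: "linear_Rn p ?n f" and lin\<psi>: "linear_Rn q ?n \<psi>" using \<phi> \<psi> by (auto simp: frame_def f_def)
 define \<Phi> where "\<Phi> = (%u. %i. 1 * f (take_vec p u) i + 1 * \<psi> (drop_vec p u) i)"
 have fS: "f (take_vec p u) : Rn ?n" "snd V 1 (f (take_vec p u)) = f (take_vec p u)" for u
  using F(4)[OF take_in_Rn] by (auto simp: subpart_def)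
 have \<psi>S: "\<psi> (drop_vec p u) : Rn ?n" "snd V 1 (\<psi> (drop_vec p u)) = (%i. - \<psi> (drop_vec p u) i)" if "u : Rn (p + q)" for u
  using G(4)[OF drop_in_Rn[OF that]] by (auto simp: S_def)
 have t\<Phi>: "snd V 1 (\<Phi> u) = (%i. f (take_vec p u) i - \<psi> (drop_vec p u) i)" if "u : Rn (p + q)" for u
  unfolding \<Phi>_def linear_RnD(2)[OF lin fS(1) \<psi>S(1)[OF that]] fS(2) \<psi>S(2)[OF that] by simp
 define P where "P = (%y. %i. (1/2) * y i + (1/2) * snd V 1 y i)"
 define N where "N = (%y. %i. (1/2) * y i + (- (1/2)) * snd V 1 y i)"
 have P: "P y : subpart True V" if "y : Rn ?n" for y
 proof -
  have "snd V 1 (P y) = P y"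
   unfolding P_def linear_RnD(2)[OF lin that mem[OF that]] inv[OF that] by auto
  moreover have "P y : Rn ?n" unfolding P_def by (rule lincomb_in_Rn[OF that mem[OF that]])
  ultimately show ?thesis by (simp add: subpart_def)
 qed
 have N: "N y : S" if "y : Rn ?n" for y
 proof -
  have "snd V 1 (N y) = (%i. - N y i)"
   unfolding N_def linear_RnD(2)[OF lin that mem[OF that]] inv[OF that] by auto
  moreover have "N y : Rn ?n" unfolding N_def by (rule lincomb_in_Rn[OF that mem[OF that]])
  ultimately show ?thesis by (simp add: S_def)
 qed
 have "linear_iso_Rn (p + q) ?n \<Phi>"
  unfolding linear_iso_Rn_def
 proof (intro conjI bij_betwI)
  show lin\<Phi>: "linear_Rn (p + q) ?n \<Phi>"
   unfolding linear_Rn_def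
  proof (intro conjI ballI allI funcsetI)
   show "\<Phi> u : Rn ?n" if "u : Rn (p + q)" for u
    unfolding \<Phi>_def by (rule lincomb_in_Rn[OF fS(1) \<psi>S(1)[OF that]])
   fix u v a b assume uv: "u : Rn (p + q)" "v : Rn (p + q)"
   have t: "take_vec p (%i. a * u i + b * v i) = (%i. a * take_vec p u i + b * take_vec p v i)"
    by (auto simp: take_vec_def)
   have d: "drop_vec p (%i. a * u i + b * v i) = (%i. a * drop_vec p u i + b * drop_vec p v i)"
    by (auto simp: drop_vec_def)
   show "\<Phi> (%i. a * u i + b * v i) = (%i. a * \<Phi> u i + b * \<Phi> v i)"
    unfolding \<Phi>_def t d linear_RnD(2)[OF linf take_in_Rn take_in_Rn]
     linear_RnD(2)[OF lin\<psi> drop_in_Rn[OF uv(1)] drop_in_Rn[OF uv(2)]]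
    by (auto simp: algebra_simps)
  qed
  thus "\<Phi> : Rn (p + q) \<rightarrow> Rn ?n" by (simp add: linear_Rn_def)
  let ?g = "%y. append_vec p (inv_into (Rn p) f (P y)) (inv_into (Rn q) \<psi> (N y))"
  show "?g : Rn ?n \<rightarrow> Rn (p + q)" by (intro funcsetI append_in_Rn G(1)[OF N])
  show "?g (\<Phi> u) = u" if u: "u : Rn (p + q)" for u
  proof -
   have "P (\<Phi> u) = f (take_vec p u)" unfolding P_def t\<Phi>[OF u] by (auto simp: \<Phi>_def field_simps)
   moreover have "N (\<Phi> u) = \<psi> (drop_vec p u)" unfolding N_def t\<Phi>[OF u] by (auto simp: \<Phi>_def field_simps)
   ultimately show ?thesis using F(3)[OF take_in_Rn] G(3)[OF drop_in_Rn[OF u]] by (simp add: append_take_drop)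
  qed
  show "\<Phi> (?g y) = y" if y: "y : Rn ?n" for y
   unfolding \<Phi>_def take_append[OF F(1)[OF P[OF y]]] drop_append F(2)[OF P[OF y]] G(2)[OF N[OF y]]
   by (auto simp: P_def N_def)
 qed
 moreover have "snd V 1 (\<Phi> u) = \<Phi> (dsum p p (%u. u) (%u i. - u i) u)" if u: "u : Rn (p + q)" for u
 proof -
  have "\<psi> (%i. - drop_vec p u i) = (%i. - \<psi> (drop_vec p u) i)"
   using linear_Rn_scale[OF lin\<psi> drop_in_Rn[OF u], of "-1"] by simp
  thus ?thesis unfolding t\<Phi>[OF u] by (simp add: \<Phi>_def dsum_def take_append take_in_Rn drop_append)
 qed
 ultimately have "splits H V p q \<Phi>" using True by (simp add: splits_def)
 thus ?thesis by (auto simp: p_def)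
qed

text \<open>
  Automorphisms have a sign that does not depend on the frame, as the determinant is a class function. The sign of a map
  between different representations does depend on the chosen frames.
\<close>

lemma sgf_frame_change:
 assumes \<phi>: "frame p m S \<phi>" and \<psi>: "frame p m S \<psi>" and C: "lin_bij m m S S C"
 shows "sgf p \<phi> \<phi> C = sgf p \<psi> \<psi> C"
proof -
 note I = lin_bij_id[of m S]
 have "sgf p \<phi> \<phi> ((%u. u) o (C o (%u. u))) = sgf p \<psi> \<phi> (%u. u) * (sgf p \<psi> \<psi> C * sgf p \<phi> \<psi> (%u. u))"
  unfolding sgf_comp[OF \<phi> \<psi> \<phi> lin_bij_comp[OF I C] I] sgf_comp[OF \<phi> \<psi> \<psi> I C] ..
 moreover have "sgf p \<psi> \<phi> (%u. u) * sgf p \<phi> \<psi> (%u. u) = 1"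
  using sgf_comp[OF \<phi> \<psi> \<phi> I I] sgf_id[OF \<phi>] by (simp add: o_def)
 ultimately show ?thesis by (simp add: o_def mult.commute mult.left_commute)
qed

definition esgn :: "bool => int rep => int rep => (rvec => rvec) => real" where
 "esgn c V W A = sgf (fdim c V) (fr c V) (fr c W) A"

lemma esgn_values:
 assumes "eqv H V W A" "orep H V" "orep H W" "subgroup H C2" "okc c H"
 shows "esgn c V W A : {1, -1}"
 unfolding esgn_def
 by (rule sgf_values[OF frame_fr[OF repc_of] _ eqv_lin_bij[OF assms]])
  (use assms frame_fr[OF repc_of, of H W c] eqv_fdim[OF assms] in auto)

lemma esgn_comp:
 assumes A: "eqv H U V A" and B: "eqv H V W B"
  and r: "orep H U" "orep H V" "orep H W" and H: "subgroup H C2" "okc c H"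
 shows "esgn c U W (B o A) = esgn c V W B * esgn c U V A"
proof -
 have d: "fdim c V = fdim c U" "fdim c W = fdim c U"
  using eqv_fdim[OF A r(1,2) H] eqv_fdim[OF B r(2,3) H] by auto
 show ?thesis unfolding esgn_def d(1)
  by (rule sgf_comp[OF frame_fr[OF repc_of[OF r(1) H]] frame_fr[OF repc_of[OF r(2) H], unfolded d]
   frame_fr[OF repc_of[OF r(3) H], unfolded d] eqv_lin_bij[OF A r(1,2) H] eqv_lin_bij[OF B r(2,3) H]])
qed

lemma esgn_id: "repc c V ==> esgn c V V (%u. u) = 1"
 unfolding esgn_def by (rule sgf_id[OF frame_fr])

lemma esgn_cong:
 assumes "repc c V" "!!u. u : Rn (fst V) ==> A u = B u"
 shows "esgn c V W A = esgn c V W B"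
 unfolding esgn_def by (rule sgf_cong[OF frame_fr[OF assms(1)]]) (use assms(2) in \<open>auto simp: subpart_def\<close>)

lemma dsum_iso_parts:
 assumes D: "linear_iso_Rn (p + q) (p + q) D"
  and X: "linear_Rn p p X" and Y: "linear_Rn q q Y"
  and eq: "!!u. u : Rn (p + q) ==> D u = dsum p p X Y u"
 shows "linear_iso_Rn p p X" "linear_iso_Rn q q Y"
proof -
 note F = frame_inv[OF D[unfolded frame_of_iso]]
 have Da: "D (append_vec p u v) = append_vec p (X u) (Y v)" if "u : Rn p" "v : Rn q" for u v
  using eq[OF append_in_Rn[OF that(2)]] dsum_append[OF that(1)] by simp
 have inj: "u = u' & v = v'" if "u : Rn p" "v : Rn q" "u' : Rn p" "v' : Rn q" "X u = X u'" "Y v = Y v'" for u v u' v'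
 proof -
  have "D (append_vec p u v) = D (append_vec p u' v')" using Da that by simp
  hence "append_vec p u v = append_vec p u' v'" using F(3) append_in_Rn that(2,4) by metis
  thus ?thesis using append_inject that by simp
 qed
 have surj: "EX u:Rn p. EX v:Rn q. X u = s & Y v = t" if st: "s : Rn p" "t : Rn q" for s t
 proof -
  let ?w = "inv_into (Rn (p + q)) D (append_vec p s t)"
  have w: "?w : Rn (p + q)" "D ?w = append_vec p s t" using F(1,2)[OF append_in_Rn[OF st(2)]] by auto
  hence "append_vec p (X (take_vec p ?w)) (Y (drop_vec p ?w)) = append_vec p s t"
   using eq by (simp add: dsum_def)
  hence "X (take_vec p ?w) = s & Y (drop_vec p ?w) = t"
   using append_inject linear_RnD(1)[OF X take_in_Rn] st by metis
  thus ?thesis using take_in_Rn drop_in_Rn[OF w(1)] by metis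
 qed
 note z = zero_in_Rn
 have "bij_betw X (Rn p) (Rn p)"
 proof (rule bij_betwI')
  show "X x = X y \<longleftrightarrow> x = y" if "x : Rn p" "y : Rn p" for x y using inj[OF that(1) z that(2) z] by auto
  show "X x : Rn p" if "x : Rn p" for x using linear_RnD(1)[OF X that] .
  show "EX x:Rn p. y = X x" if "y : Rn p" for y using surj[OF that z] by auto
 qed
 thus "linear_iso_Rn p p X" using X by (simp add: linear_iso_Rn_def)
 have "bij_betw Y (Rn q) (Rn q)"
 proof (rule bij_betwI')
  show "Y x = Y y \<longleftrightarrow> x = y" if "x : Rn q" "y : Rn q" for x y using inj[OF z that(1) z that(2)] by auto
  show "Y x : Rn q" if "x : Rn q" for x using linear_RnD(1)[OF Y that] .
  show "EX x:Rn q. y = Y x" if "y : Rn q" for y using surj[OF z that] by auto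
 qed
 thus "linear_iso_Rn q q Y" using Y by (simp add: linear_iso_Rn_def)
qed

lemma blocks_sign:
 assumes s: "splits H V p q \<Phi>" and r: "orep H V" "subgroup H C2" and C: "eqv H V V C"
  and X: "linear_iso_Rn p p X" and Y: "linear_iso_Rn q q Y"
  and eq: "!!u. u : Rn (p + q) ==> C (\<Phi> u) = \<Phi> (dsum p p X Y u)"
 shows "esgn False V V C = sgn (detR p X) * sgn (detR q Y)" "esgn (1 : H) V V C = sgn (detR p X)"
proof -
 have iso: "linear_iso_Rn (p + q) (fst V) \<Phi>" using s by (simp add: splits_def)
 note F = frame_inv[OF iso[unfolded frame_of_iso]]
 note sf = splits_frame[OF s r]
 have rF: "repc False V" using repc_of[OF r] by simp
 have rH: "repc (1 : H) V" using repc_of[OF r] by simp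
 have fF: "frame (p + q) (fst V) (subpart False V) (fr False V)" using frame_fr[OF rF] fdim_False[OF rF] sf(3) by simp
 have f\<Phi>: "frame (p + q) (fst V) (subpart False V) \<Phi>" using iso by (simp add: frame_of_iso subpart_def)
 note XY = linear_Rn_dsum[OF linear_iso_RnD(1)[OF X] linear_iso_RnD(1)[OF Y]]
 have "esgn False V V C = sgf (p + q) \<Phi> \<Phi> C"
  unfolding esgn_def fdim_False[OF rF] sf(3)
  using sgf_frame_change[OF fF f\<Phi>] eqv_lin_bij[OF C r(1) r, of False] sf(3) by simp
 also have "\<dots> = sgn (detR (p + q) (dsum p p X Y))"
  unfolding sgf_def
  by (rule arg_cong[of _ _ sgn], rule detR_cong) (use eq F(3)[OF linear_RnD(1)[OF XY]] in simp)
 finally show "esgn False V V C = sgn (detR p X) * sgn (detR q Y)"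
  by (simp add: detR_dsum[OF linear_iso_RnD(1)[OF X] linear_iso_RnD(1)[OF Y]] sgn_mult)
 let ?f = "%u. \<Phi> (append_vec p u (%i. 0))"
 have fH: "frame p (fst V) (subpart (1 : H) V) (fr (1 : H) V)" using frame_fr[OF rH] sf(2) by (simp add: pdim_def)
 have "esgn (1 : H) V V C = sgf p ?f ?f C"
  unfolding esgn_def sf(2)[unfolded pdim_def]
  by (rule sgf_frame_change[OF fH sf(1)]) (use eqv_lin_bij[OF C r(1) r, of "1 : H"] in simp)
 also have "\<dots> = sgn (detR p X)"
  unfolding sgf_def
 proof (rule arg_cong[of _ _ sgn], rule detR_cong)
  fix u assume u: "u : Rn p"
  have "C (?f u) = ?f (X u)"
   using eq[OF append_in_Rn[OF zero_in_Rn]] linear_Rn_zero[OF linear_iso_RnD(1)[OF Y]] by (simp add: dsum_append[OF u])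
  thus "(inv_into (Rn p) ?f o C o ?f) u = X u"
   using frame_inv(3)[OF sf(1) linear_RnD(1)[OF linear_iso_RnD(1)[OF X] u]] by simp
 qed
 finally show "esgn (1 : H) V V C = sgn (detR p X)" .
qed

text \<open>
  Schur's lemma for \<open>C\<^sub>2\<close>: an equivariant automorphism preserves both isotypical parts. Together with
  its converse below, the space of equivariant automorphisms is a product of two general linear groups.
\<close>

lemma eqv_blocks:
 assumes s: "splits H V p q \<Phi>" and r: "orep H V" "subgroup H C2" and C: "eqv H V V C"
 shows "EX X Y. linear_iso_Rn p p X & linear_iso_Rn q q Y & (ALL u:Rn (p + q). C (\<Phi> u) = \<Phi> (dsum p p X Y u))"
proof -
 have iso: "linear_iso_Rn (p + q) (fst V) \<Phi>" using s by (simp add: splits_def)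
 note F = frame_inv[OF iso[unfolded frame_of_iso]]
 define D where "D = inv_into (Rn (p + q)) \<Phi> o C o \<Phi>"
 have D: "linear_iso_Rn (p + q) (p + q) D"
  unfolding D_def using linear_iso_Rn_comp[OF linear_iso_Rn_comp[OF iso eqvD(1)[OF C]] linear_iso_inv[OF iso]]
  by (simp add: o_assoc)
 have \<Phi>D: "\<Phi> (D u) = C (\<Phi> u)" if "u : Rn (p + q)" for u
  unfolding D_def using F(2)[OF eqvD(3)[OF C F(4)[OF that]]] by simp
 note Dl = linear_iso_RnD(1)[OF D] and DR = linear_RnD(1)[OF linear_iso_RnD(1)[OF D]]
 define X where "X = (%u. take_vec p (D (append_vec p u (%i. 0))))"
 define Y where "Y = (%v. drop_vec p (D (append_vec p (%i. 0) v)))"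
 let ?n = "%u::rvec. %i. - u i"
 let ?\<sigma> = "dsum p p (%u. u) ?n"
 have app: "append_vec p u (%i. 0) : Rn (p + q)" for u by (rule append_in_Rn[OF zero_in_Rn])
 have lX: "linear_Rn p p X"
  unfolding linear_Rn_def
 proof (intro conjI ballI allI funcsetI)
  show "X u : Rn p" for u unfolding X_def by (rule take_in_Rn)
  fix u v a b
  have "append_vec p (%i. a * u i + b * v i) (%i. 0) = (%i. a * append_vec p u (%i. 0) i + b * append_vec p v (%i. 0) i)"
   by (auto simp: append_vec_def)
  thus "X (%i. a * u i + b * v i) = (%i. a * X u i + b * X v i)"
   unfolding X_def using linear_RnD(2)[OF Dl app app] by (auto simp: take_vec_def)
 qed
 have lY: "linear_Rn q q Y"
  unfolding linear_Rn_def
 proof (intro conjI ballI allI funcsetI)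
  show "Y v : Rn q" if "v : Rn q" for v unfolding Y_def by (rule drop_in_Rn[OF DR[OF append_in_Rn[OF that]]])
  fix u v a b assume uv: "u : Rn q" "v : Rn q"
  have "append_vec p (%i. 0) (%i. a * u i + b * v i) = (%i. a * append_vec p (%i. 0) u i + b * append_vec p (%i. 0) v i)"
   by (auto simp: append_vec_def)
  thus "Y (%i. a * u i + b * v i) = (%i. a * Y u i + b * Y v i)"
   unfolding Y_def using linear_RnD(2)[OF Dl append_in_Rn[OF uv(1)] append_in_Rn[OF uv(2)]] by (auto simp: drop_vec_def)
 qed
 have \<sigma>R: "?\<sigma> u : Rn (p + q)" if "u : Rn (p + q)" for u
  using that by (auto simp: dsum_def Rn_iff append_vec_def take_vec_def drop_vec_def)
 have com: "D (?\<sigma> u) = ?\<sigma> (D u)" if H1: "1 : H" and u: "u : Rn (p + q)" for u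
 proof -
  have st: "!!u. u : Rn (p + q) ==> snd V 1 (\<Phi> u) = \<Phi> (?\<sigma> u)" using s H1 by (simp add: splits_def)
  have "\<Phi> (D (?\<sigma> u)) = C (\<Phi> (?\<sigma> u))" by (rule \<Phi>D[OF \<sigma>R[OF u]])
  also have "\<dots> = C (snd V 1 (\<Phi> u))" using st[OF u] by simp
  also have "\<dots> = snd V 1 (C (\<Phi> u))" by (rule eqvD(5)[OF C H1 F(4)[OF u]])
  also have "\<dots> = \<Phi> (?\<sigma> (D u))" using st[OF DR[OF u]] \<Phi>D[OF u] by simp
  finally show ?thesis using F(3)[OF DR[OF \<sigma>R[OF u]]] F(3)[OF \<sigma>R[OF DR[OF u]]] by metis
 qed
 have d0: "drop_vec p (D (append_vec p u (%i. 0))) = (%i. 0)" if u: "u : Rn p" for u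
 proof (cases "1 : H")
  case True
  have "?\<sigma> (append_vec p u (%i. 0)) = append_vec p u (%i. 0)" by (simp add: dsum_append[OF u])
  hence "?\<sigma> (D (append_vec p u (%i. 0))) = D (append_vec p u (%i. 0))" using com[OF True app[of u]] by simp
  hence n: "drop_vec p (?\<sigma> (D (append_vec p u (%i. 0)))) = drop_vec p (D (append_vec p u (%i. 0)))" by simp
  show ?thesis
  proof
   fix i show "drop_vec p (D (append_vec p u (%i. 0))) i = 0"
    using fun_cong[OF n, of i] by (simp add: dsum_def drop_append)
  qed
 next
  case False
  thus ?thesis using DR[OF app, of u] s by (auto simp: splits_def drop_vec_def Rn_iff)
 qed
 have t0: "take_vec p (D (append_vec p (%i. 0) v)) = (%i. 0)" if v: "v : Rn q" for v
 proof (cases "1 : H")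
  case True
  let ?w = "append_vec p (%i. 0) v"
  have w: "?w : Rn (p + q)" by (rule append_in_Rn[OF v])
  have "?\<sigma> ?w = append_vec p (%i. 0) (%i. - v i)" by (rule dsum_append[OF zero_in_Rn])
  also have "\<dots> = (%i. - 1 * ?w i)" by (auto simp: append_vec_def)
  finally have "?\<sigma> ?w = (%i. - 1 * ?w i)" .
  hence "?\<sigma> (D ?w) = (%i. - 1 * D ?w i)" using com[OF True w] linear_Rn_scale[OF Dl w, of "-1"] by simp
  hence n: "take_vec p (?\<sigma> (D ?w)) = take_vec p (%i. - 1 * D ?w i)" by simp
  show ?thesis
  proof
   fix i show "take_vec p (D ?w) i = 0"
    using fun_cong[OF n, of i] by (simp add: dsum_def take_append[OF take_in_Rn]) (simp add: take_vec_def split: if_splits)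
  qed
 next
  case False
  hence "v = (%i. 0)" using v s by (auto simp: splits_def Rn_iff)
  hence "append_vec p (%i. 0) v = (%i. 0)" by (auto simp: append_vec_def)
  thus ?thesis using linear_Rn_zero[OF Dl] by (simp add: take_vec_def)
 qed
 have eq: "D u = dsum p p X Y u" if u: "u : Rn (p + q)" for u
 proof -
  let ?a = "append_vec p (take_vec p u) (%i. 0)" and ?b = "append_vec p (%i. 0) (drop_vec p u)"
  have "u = (%i. ?a i + ?b i)" by (auto simp: append_vec_def take_vec_def drop_vec_def)
  hence D: "D u = (%i. D ?a i + D ?b i)"
   using linear_Rn_add[OF Dl app append_in_Rn[OF drop_in_Rn[OF u]]] by metis
  have a: "D ?a = append_vec p (X (take_vec p u)) (%i. 0)"
   using append_take_drop[of p "D ?a"] d0[OF take_in_Rn] by (simp add: X_def)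
  have b: "D ?b = append_vec p (%i. 0) (Y (drop_vec p u))"
   using append_take_drop[of p "D ?b"] t0[OF drop_in_Rn[OF u]] by (simp add: Y_def)
  show ?thesis unfolding D a b dsum_def by (auto simp: append_vec_def)
 qed
 have "C (\<Phi> u) = \<Phi> (dsum p p X Y u)" if "u : Rn (p + q)" for u
  using \<Phi>D[OF that] eq[OF that] by simp
 thus ?thesis using dsum_iso_parts[OF D lX lY eq] by blast
qed

lemma blocks_eqv:
 assumes s: "splits H V p q \<Phi>" and r: "orep H V" "subgroup H C2"
  and X: "linear_iso_Rn p p X" and Y: "linear_iso_Rn q q Y"
 shows "eqv H V V (\<Phi> o dsum p p X Y o inv_into (Rn (p + q)) \<Phi>)"
proof -
 have iso: "linear_iso_Rn (p + q) (fst V) \<Phi>" using s by (simp add: splits_def)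
 note F = frame_inv[OF iso[unfolded frame_of_iso]]
 note XY = linear_iso_dsum[OF X Y]
 let ?n = "%u::rvec. %i. - u i"
 let ?\<sigma> = "dsum p p (%u. u) ?n"
 show ?thesis unfolding eqv_def
 proof (intro conjI impI ballI)
  show "linear_iso_Rn (fst V) (fst V) (\<Phi> o dsum p p X Y o inv_into (Rn (p + q)) \<Phi>)"
   using linear_iso_Rn_comp[OF linear_iso_inv[OF iso] linear_iso_Rn_comp[OF XY iso]] by (simp add: o_assoc)
  fix u assume H1: "1 : H" and u: "u : Rn (fst V)"
  let ?w = "inv_into (Rn (p + q)) \<Phi> u"
  have w: "?w : Rn (p + q)" "\<Phi> ?w = u" using F(1,2)[OF u] .
  have \<sigma>R: "?\<sigma> u : Rn (p + q)" if "u : Rn (p + q)" for u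
   using that by (auto simp: dsum_def Rn_iff append_vec_def take_vec_def drop_vec_def)
  have st: "!!u. u : Rn (p + q) ==> snd V 1 (\<Phi> u) = \<Phi> (?\<sigma> u)" using s H1 by (simp add: splits_def)
  have "inv_into (Rn (p + q)) \<Phi> (snd V 1 u) = ?\<sigma> ?w" using st[OF w(1)] F(3)[OF \<sigma>R[OF w(1)]] w(2) by simp
  moreover have "dsum p p X Y (?\<sigma> ?w) = ?\<sigma> (dsum p p X Y ?w)"
  proof -
   have "Y (%i. - drop_vec p ?w i) = (%i. - Y (drop_vec p ?w) i)"
    using linear_Rn_scale[OF linear_iso_RnD(1)[OF Y] drop_in_Rn[OF w(1)], of "-1"] by simp
   thus ?thesis
    using linear_RnD(1)[OF linear_iso_RnD(1)[OF X] take_in_Rn]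
    by (simp add: dsum_def take_append take_in_Rn drop_append)
  qed
  ultimately show "(\<Phi> o dsum p p X Y o inv_into (Rn (p + q)) \<Phi>) (snd V 1 u) =
    snd V 1 ((\<Phi> o dsum p p X Y o inv_into (Rn (p + q)) \<Phi>) u)"
   using st[OF linear_RnD(1)[OF linear_iso_RnD(1)[OF XY] w(1)]] by simp
 qed
qed

text \<open>
  The orientation signs of an equivariant isomorphism, of the whole representation and of its
  fixed part, determine its homotopy class.
\<close>

lemma eqv_path_if_esgn_eq:
 assumes A: "eqv H V W A" and B: "eqv H V W B" and r: "orep H V" "orep H W" and H: "subgroup H C2"
  and s: "!!c. okc c H ==> esgn c V W A = esgn c V W B"
 shows "lin_path (fst V) (eqv H V W) A B"
proof -
 obtain q \<Phi> where S: "splits H V (pdim H V) q \<Phi>" using splits_exists[OF r(1) H] by blast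
 define p where "p = pdim H V"
 note S = S[folded p_def]
 note Bi = eqv_inv[OF B r(2,1) H] and BB = eqv_inv_comp[OF B]
 define C where "C = inv_into (Rn (fst V)) B o A"
 have C: "eqv H V V C" unfolding C_def by (rule eqv_comp[OF A Bi])
 have sC: "esgn c V V C = 1" if "okc c H" for c
 proof -
  have "esgn c V V C = esgn c W V (inv_into (Rn (fst V)) B) * esgn c V W B"
   unfolding C_def using esgn_comp[OF A Bi r(1,2,1) H that] s[OF that] by simp
  also have "\<dots> = esgn c V V (inv_into (Rn (fst V)) B o B)"
   using esgn_comp[OF B Bi r(1,2,1) H that] by simp
  also have "\<dots> = esgn c V V (%u. u)"
   by (rule esgn_cong[OF repc_of[OF r(1) H that]]) (simp add: BB)
  finally show ?thesis using esgn_id[OF repc_of[OF r(1) H that]] by simp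
 qed
 obtain X Y where XY: "linear_iso_Rn p p X" "linear_iso_Rn q q Y" "ALL u:Rn (p + q). C (\<Phi> u) = \<Phi> (dsum p p X Y u)"
  using eqv_blocks[OF S r(1) H C] by blast
 have "sgn (detR p X) = 1 & sgn (detR q Y) = 1"
  using blocks_sign[OF S r(1) H C XY(1,2)] XY(3) sC[of False] sC[of "1 : H"] by simp
 hence X: "iso_path p X (%u. u)" and Y: "iso_path q Y (%u. u)"
  using iso_path_if_sgn_det_eq XY(1,2) linear_iso_Rn_id detR_id by (metis sgn_1)+
 define P where "P = (%D. EX X Y. linear_iso_Rn p p X & linear_iso_Rn q q Y & D = dsum p p X Y)"
 have 1: "lin_path (p + q) P (dsum p p X Y) (dsum p p (%u. u) (%u. u))"
  by (rule lin_path_dsum[OF X Y]) (auto simp: P_def)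
 have iso: "linear_iso_Rn (p + q) (fst V) \<Phi>" using S by (simp add: splits_def)
 note F = frame_inv[OF iso[unfolded frame_of_iso]]
 let ?i = "inv_into (Rn (p + q)) \<Phi>"
 have PR: "D u : Rn (p + q)" if "P D" "u : Rn (p + q)" for D u
  using that linear_RnD(1)[OF linear_iso_RnD(1)[OF linear_iso_dsum]] unfolding P_def by blast
 have 2: "lin_path (p + q) (%E. EX D. P D & E = \<Phi> o D) (\<Phi> o dsum p p X Y) (\<Phi> o dsum p p (%u. u) (%u. u))"
  by (rule lin_path_post[where P = P and n = "p + q", OF 1 _ linear_iso_RnD(1)[OF iso]]) (use PR in auto)
 have 3: "lin_path (fst V) (eqv H V V) ((\<Phi> o dsum p p X Y) o ?i) ((\<Phi> o dsum p p (%u. u) (%u. u)) o ?i)"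
 proof (rule lin_path_pre[OF 2 F(1)])
  fix E assume "EX D. P D & E = \<Phi> o D"
  thus "eqv H V V (E o ?i)" unfolding P_def using blocks_eqv[OF S r(1) H] by auto
 qed
 have 4: "lin_path (fst V) (eqv H V V) C (%u. u)"
 proof (rule lin_path_cong[OF 3])
  fix u assume u: "u : Rn (fst V)"
  show "((\<Phi> o dsum p p X Y) o ?i) u = C u" using XY(3)[rule_format, OF F(1)[OF u]] F(2)[OF u] by simp
  show "((\<Phi> o dsum p p (%u. u) (%u. u)) o ?i) u = u" using F(2)[OF u] by (simp add: dsum_id)
 qed
 have 5: "lin_path (fst V) (eqv H V W) (B o C) (B o (%u. u))"
 proof (rule lin_path_post[OF 4 _ eqvD(2)[OF B]])
  show "X u : Rn (fst V)" if "eqv H V V X" "u : Rn (fst V)" for X u using eqvD(3)[OF that] .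
  show "eqv H V W (B o X)" if "eqv H V V X" for X using eqv_comp[OF that B] .
 qed
 show ?thesis by (rule lin_path_cong[OF 5]) (use BB(1) eqvD(3)[OF A] eqvD(4)[OF A] in \<open>simp_all add: C_def\<close>)
qed

lemma eqv_exists:
 assumes r: "orep H V" "orep H W" and H: "subgroup H C2"
  and d: "fst V = fst W" "pdim H V = pdim H W"
 shows "EX A. eqv H V W A"
proof -
 obtain q \<Phi> where S: "splits H V (pdim H V) q \<Phi>" using splits_exists[OF r(1) H] by blast
 obtain q' \<Psi> where T: "splits H W (pdim H V) q' \<Psi>" using splits_exists[OF r(2) H] d(2) by metis
 define p where "p = pdim H V"
 note S = S[folded p_def] and T = T[folded p_def]
 have q: "q' = q" using splits_frame(3)[OF S r(1) H] splits_frame(3)[OF T r(2) H] d(1) by simp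
 have i: "linear_iso_Rn (p + q) (fst V) \<Phi>" using S by (simp add: splits_def)
 have j: "linear_iso_Rn (p + q) (fst W) \<Psi>" using T by (simp add: splits_def q)
 note F = frame_inv[OF i[unfolded frame_of_iso]]
 have "eqv H V W (\<Psi> o inv_into (Rn (p + q)) \<Phi>)"
  unfolding eqv_def
 proof (intro conjI impI ballI)
  show "linear_iso_Rn (fst V) (fst W) (\<Psi> o inv_into (Rn (p + q)) \<Phi>)"
   by (rule linear_iso_Rn_comp[OF linear_iso_inv[OF i] j])
  fix u assume H1: "1 : H" and u: "u : Rn (fst V)"
  let ?w = "inv_into (Rn (p + q)) \<Phi> u" and ?\<sigma> = "dsum p p (%u. u) (%u i. - u i)"
  have w: "?w : Rn (p + q)" "\<Phi> ?w = u" using F(1,2)[OF u] .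
  have \<sigma>R: "?\<sigma> ?w : Rn (p + q)"
   using w(1) by (auto simp: dsum_def Rn_iff append_vec_def take_vec_def drop_vec_def)
  have "snd V 1 u = \<Phi> (?\<sigma> ?w)" using S H1 w by (auto simp: splits_def)
  hence "inv_into (Rn (p + q)) \<Phi> (snd V 1 u) = ?\<sigma> ?w" using F(3)[OF \<sigma>R] by simp
  thus "(\<Psi> o inv_into (Rn (p + q)) \<Phi>) (snd V 1 u) = snd W 1 ((\<Psi> o inv_into (Rn (p + q)) \<Phi>) u)"
   using T H1 w(1) by (simp add: splits_def q)
 qed
 thus ?thesis by blast
qed

text \<open>All combinations of signs occur once every isotypical part is nonzero.\<close>

lemma eqv_exists_sign:
 assumes r: "orep H V" "orep H W" and H: "subgroup H C2"
  and d: "fst V = fst W" "pdim H V = pdim H W" and pos: "0 < pdim H V" "1 : H ==> pdim H V < fst V"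
  and e: "e0 : {1, -1}" "e1 : {1, -1}"
 shows "EX A. eqv H V W A & esgn False V W A = e0 & (1 : H --> esgn True V W A = e1)"
proof -
 obtain A where A: "eqv H V W A" using eqv_exists[OF r H d] by blast
 obtain q \<Phi> where S: "splits H V (pdim H V) q \<Phi>" using splits_exists[OF r(1) H] by blast
 define p where "p = pdim H V"
 note S = S[folded p_def]
 have p: "0 < p" "1 : H ==> 0 < q" using pos splits_frame(3)[OF S r(1) H] by (auto simp: p_def)
 define a0 where "a0 = esgn False V W A"
 define a1 where "a1 = esgn True V W A"
 have a0: "a0 : {1, -1}" using esgn_values[OF A r H] by (simp add: a0_def)
 have a1: "1 : H ==> a1 : {1, -1}" using esgn_values[OF A r H] by (simp add: a1_def)
 define s where "s = (if 1 : H then a1 * e1 else a0 * e0)"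
 define t where "t = (if 1 : H then a0 * e0 * s else 1)"
 have st: "s : {1, -1}" "t : {1, -1}" using a0 a1 e by (auto simp: s_def t_def)
 have X: "linear_iso_Rn p p (scale0 s)" by (rule scale0_iso[OF p(1)]) (use st in auto)
 define Y where "Y = (if 1 : H then scale0 t else (%u. u))"
 have Y: "linear_iso_Rn q q Y" using scale0_iso[OF p(2), of t] linear_iso_Rn_id st by (auto simp: Y_def)
 have dY: "detR q Y = t" using detR_scale0[OF p(2), of t] detR_id by (simp add: Y_def t_def)
 have iso: "linear_iso_Rn (p + q) (fst V) \<Phi>" using S by (simp add: splits_def)
 note F = frame_inv[OF iso[unfolded frame_of_iso]]
 define C where "C = \<Phi> o dsum p p (scale0 s) Y o inv_into (Rn (p + q)) \<Phi>"
 have C: "eqv H V V C" unfolding C_def by (rule blocks_eqv[OF S r(1) H X Y])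
 have "C (\<Phi> u) = \<Phi> (dsum p p (scale0 s) Y u)" if "u : Rn (p + q)" for u using F(3)[OF that] by (simp add: C_def)
 note sg = blocks_sign[OF S r(1) H C X Y this]
 have s0: "esgn False V V C = s * t" and s1: "1 : H ==> esgn True V V C = s"
  using sg detR_scale0[OF p(1)] dY st by auto
 have "esgn False V W (A o C) = a0 * (s * t)"
  using esgn_comp[OF C A r(1,1,2) H, of False] s0 by (simp add: a0_def)
 moreover have "esgn True V W (A o C) = a1 * s" if "1 : H"
  using esgn_comp[OF C A r(1,1,2) H, of True] s1 that by (simp add: a1_def)
 moreover have "a0 * (s * t) = e0" "1 : H ==> a1 * s = e1"
  using a0 a1 e st by (auto simp: s_def t_def)
 ultimately show ?thesis using eqv_comp[OF C A] by auto
qed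

lemma detR_neg: "detR q (%u i. - u i) = (- 1) ^ q"
proof -
 have "Matrix.mat q q (%(i, j). - ev j i) = (- 1 :: real) \<cdot>\<^sub>m 1\<^sub>m q"
  by (rule eq_matI) (auto simp: ev_def)
 thus ?thesis by (simp add: detR_def det_smult)
qed

lemma esgn_involution:
 assumes r: "orep H V" and H: "subgroup H C2" "1 : H"
 shows "esgn False V V (snd V 1) = (- 1) ^ (fst V - pdim H V)" "eqv H V V (snd V 1)"
proof -
 obtain q \<Phi> where S: "splits H V (pdim H V) q \<Phi>" using splits_exists[OF r H(1)] by blast
 define p where "p = pdim H V"
 note S = S[folded p_def]
 have bij: "bij_betw (snd V 1) (Rn (fst V)) (Rn (fst V))"
  by (rule bij_betw_byWitness[of _ "snd V 1"]) (use rep_map_invol[OF r H] rep_map_in_Rn[OF r H] in auto)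
 thus e: "eqv H V V (snd V 1)"
  using rep_map_linear[OF r H] by (simp add: eqv_def linear_iso_Rn_def)
 have n: "linear_iso_Rn q q (%u i. - u i)"
  unfolding linear_iso_Rn_def
  by (intro conjI bij_betw_byWitness[of _ "%u i. - u i"]) (auto simp: linear_Rn_def Rn_iff algebra_simps)
 have "esgn False V V (snd V 1) = sgn (detR p (%u. u)) * sgn (detR q (%u i. - u i))"
  by (rule blocks_sign(1)[OF S r H(1) e linear_iso_Rn_id n]) (use S H(2) in \<open>simp add: splits_def\<close>)
 hence "esgn False V V (snd V 1) = (- 1) ^ q" by (simp add: detR_id detR_neg)
 moreover have "q = fst V - p" using splits_frame(3)[OF S r H(1)] by simp
 ultimately show "esgn False V V (snd V 1) = (- 1) ^ (fst V - pdim H V)" by (simp add: p_def)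
qed

lemma frame_inv_linear:
 assumes \<phi>: "frame p n S \<phi>" and P: "linear_Rn m n P" "!!u. u : Rn m ==> P u : S"
 shows "linear_Rn m p (inv_into (Rn p) \<phi> o P)"
 unfolding linear_Rn_def
proof (intro conjI ballI allI)
 note F = frame_inv[OF \<phi>]
 have lin: "linear_Rn p n \<phi>" using \<phi> by (simp add: frame_def)
 show "inv_into (Rn p) \<phi> o P : Rn m \<rightarrow> Rn p" using F(1)[OF P(2)] by auto
 fix u v a b assume uv: "u : Rn m" "v : Rn m"
 let ?i = "inv_into (Rn p) \<phi>"
 have i: "?i (P u) : Rn p" "?i (P v) : Rn p" using F(1)[OF P(2)] uv by auto
 have "\<phi> (%i. a * ?i (P u) i + b * ?i (P v) i) = P (%i. a * u i + b * v i)"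
  unfolding linear_RnD(2)[OF lin i] linear_RnD(2)[OF P(1) uv] using F(2)[OF P(2)] uv by simp
 hence "?i (P (%i. a * u i + b * v i)) = ?i (\<phi> (%i. a * ?i (P u) i + b * ?i (P v) i))" by (simp only:)
 also have "\<dots> = (%i. a * ?i (P u) i + b * ?i (P v) i)" by (rule F(3)[OF lincomb_in_Rn[OF i]])
 finally show "(?i o P) (%i. a * u i + b * v i) = (%i. a * (?i o P) u i + b * (?i o P) v i)" by simp
qed

lemma subpart_projection:
 assumes "repc c V"
 shows "EX P. linear_Rn (fst V) (fst V) P & (ALL u:Rn (fst V). P u : subpart c V) & (ALL u:subpart c V. P u = u)"
proof (cases c)
 case False
 hence "linear_Rn (fst V) (fst V) (%u. u) & (ALL u:Rn (fst V). u : subpart c V) & (ALL u:subpart c V. u = u)"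
  by (simp add: subpart_def linear_Rn_def)
 thus ?thesis by blast
next
 case True
 let ?\<tau> = "snd V 1"
 have r: "repc True V" using assms True by simp
 note lin = repc_linear[OF r] and inv = repc_invol[OF r]
 define P where "P = (%y. %i. (1/2) * y i + (1/2) * ?\<tau> y i)"
 have PR: "P y : Rn (fst V)" if "y : Rn (fst V)" for y
  unfolding P_def by (rule lincomb_in_Rn[OF that linear_RnD(1)[OF lin that]])
 have "linear_Rn (fst V) (fst V) P"
  unfolding linear_Rn_def
 proof (intro conjI ballI allI funcsetI PR)
  fix u v a b assume uv: "u : Rn (fst V)" "v : Rn (fst V)"
  show "P (%i. a * u i + b * v i) = (%i. a * P u i + b * P v i)"
   unfolding P_def linear_RnD(2)[OF lin uv] by (auto simp: algebra_simps)
 qed auto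
 moreover have "P u : subpart c V" if "u : Rn (fst V)" for u
 proof -
  have "?\<tau> (P u) = P u"
   unfolding P_def linear_RnD(2)[OF lin that linear_RnD(1)[OF lin that]] inv[OF that] by auto
  thus ?thesis using PR[OF that] by (simp add: subpart_def)
 qed
 moreover have "P u = u" if "u : subpart c V" for u
  using that True by (auto simp: subpart_def P_def)
 ultimately show ?thesis by blast
qed

text \<open>
  The determinant in the frames is continuous along the path. A linear projection onto the subspace of \<open>W\<close>
 makes the inverse of its frame a globally defined linear map.
\<close>

lemma sgf_path:
 assumes h: "lin_path m P A B" and \<phi>: "frame p m S \<phi>" "S \<subseteq> Rn m" and W: "repc c W"
  and \<psi>: "frame p (fst W) (subpart c W) \<psi>"
  and P: "!!X. P X ==> lin_bij m (fst W) S (subpart c W) X"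
 shows "sgf p \<phi> \<psi> A = sgf p \<phi> \<psi> B"
proof -
 obtain Q where Q: "linear_Rn (fst W) (fst W) Q" "ALL u:Rn (fst W). Q u : subpart c W" "ALL u:subpart c W. Q u = u"
  using subpart_projection[OF W] by blast
 let ?i = "inv_into (Rn p) \<psi>"
 let ?L = "?i o Q"
 have L: "linear_Rn (fst W) p ?L" by (rule frame_inv_linear[OF \<psi> Q(1)]) (use Q(2) in auto)
 have XS: "X (\<phi> u) : subpart c W" if "P X" "u : Rn p" for X u
  using P[OF that(1)] frame_inv(4)[OF \<phi>(1) that(2)] by (auto simp: lin_bij_def bij_betw_def)
 define P1 where "P1 = (%X. EX Y. P Y & X = Y o \<phi>)"
 have 1: "lin_path p P1 (A o \<phi>) (B o \<phi>)"
  by (rule lin_path_pre[OF h]) (use frame_inv(4)[OF \<phi>(1)] \<phi>(2) in \<open>auto simp: P1_def\<close>)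
 have 2: "lin_path p (linear_iso_Rn p p) (?L o (A o \<phi>)) (?L o (B o \<phi>))"
 proof (rule lin_path_post[where P = P1 and n = "fst W", OF 1 _ L])
  show "X u : Rn (fst W)" if "P1 X" "u : Rn p" for X u
   using that XS subpart_sub unfolding P1_def by fastforce
  show "linear_iso_Rn p p (?L o X)" if X: "P1 X" for X
  proof -
   obtain Y where Y: "P Y" "X = Y o \<phi>" using X unfolding P1_def by blast
   show ?thesis
    by (rule linear_iso_Rn_cong[OF sgf_iso[OF \<phi>(1) \<psi> P[OF Y(1)]]]) (use Q(3) XS[OF Y(1)] Y(2) in simp)
  qed
 qed
 obtain k where k: "ALL t:{0..1::real}. P (k t)" "ALL u:Rn m. k 0 u = A u & k 1 u = B u"
  using h by (auto simp: lin_path_def)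
 have AB: "A (\<phi> u) : subpart c W" "B (\<phi> u) : subpart c W" if "u : Rn p" for u
  using XS[of "k 0" u] XS[of "k 1" u] k frame_inv(4)[OF \<phi>(1) that] \<phi>(2) that by auto
 have "detR p (?L o (A o \<phi>)) = detR p (?i o A o \<phi>)" "detR p (?L o (B o \<phi>)) = detR p (?i o B o \<phi>)"
  by (rule detR_cong; use AB Q(3) in simp)+
 thus ?thesis using lin_path_det_sgn[OF 2] by (simp add: sgf_def)
qed

section \<open>Bundle maps over orbits in coordinates\<close>

lemma continuous_map_discrete_prod:
 assumes "!!a. a : A ==> continuous_map X Y (%x. f (a, x))"
 shows "continuous_map (prod_topology (discrete_topology A) X) Y f"
 unfolding continuous_map_def
proof (intro conjI allI impI funcsetI)
 show "f x : topspace Y" if "x : topspace (prod_topology (discrete_topology A) X)" for x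
  using that assms[of "fst x"] by (cases x) (auto simp: continuous_map_def Pi_iff)
 fix U assume U: "openin Y U"
 have "{x : topspace (prod_topology (discrete_topology A) X). f x : U} =
   (\<Union>a\<in>A. {a} \<times> {x : topspace X. f (a, x) : U})" by auto
 moreover have "openin (prod_topology (discrete_topology A) X) ({a} \<times> {x : topspace X. f (a, x) : U})" if "a : A" for a
  using assms[OF that] U that by (auto simp: openin_prod_Times_iff continuous_map_def)
 ultimately show "openin (prod_topology (discrete_topology A) X) {x : topspace (prod_topology (discrete_topology A) X). f x : U}"
  by (auto intro!: openin_Union)
qed

lemma bpoint_C2:
 assumes "subgroup H C2"
 shows "bpt H V (a, u) = {((a + h) mod 2, snd V h u) | h. h : H}"
proof -
 have "inv\<^bsub>C2\<^esub> h = h" if "h : H" for h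
  using that assms by (intro C2_inv) (auto simp: subgroup_C2_iff)
 thus ?thesis unfolding bpoint_def C2_simps prod.case by (intro Collect_cong) metis
qed

lemma bpoint_mem:
 assumes "subgroup H C2" "orep H V" "a : {0, 1}" "u : Rn (fst V)"
 shows "(b, w) : bpt H V (a, u) \<longleftrightarrow> (b = a & w = u) \<or> (1 : H & b = 1 - a & w = snd V 1 u)"
proof -
 have s0: "snd V 0 u = u" using assms(2,4) orth_rep_C2_iff[OF assms(1)] by blast
 have a: "a mod 2 = a" "(a + 1) mod 2 = 1 - a" using assms(3) by auto
 have "(b, w) : bpt H V (a, u) \<longleftrightarrow> (EX h:H. b = (a + h) mod 2 & w = snd V h u)"
  unfolding bpoint_C2[OF assms(1)] by blast
 moreover have "H = {0} \<or> H = {0, 1}" using assms(1) by (simp add: subgroup_C2_iff)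
 ultimately show ?thesis using s0 a by auto
qed

lemma bpoint_eqI:
 assumes "subgroup H C2" "orep H V" "a : {0, 1}" "u : Rn (fst V)" "1 : H"
 shows "bpt H V (a, u) = bpt H V (1 - a, snd V 1 u)"
proof -
 have "1 - a : {0, 1}" using assms(3) by auto
 thus ?thesis
  using bpoint_mem[OF assms(1-4)] bpoint_mem[OF assms(1,2), of "1 - a" "snd V 1 u"] assms
   rep_map_in_Rn[OF assms(2,1,5,4)] rep_map_invol[OF assms(2,1,5,4)] by auto
qed

lemma bpoint_inj:
 assumes "subgroup H C2" "orep H V" "a : {0, 1}" "u : Rn (fst V)" "w : Rn (fst V)"
  "bpt H V (a, u) = bpt H V (a, w)"
 shows "u = w"
 using bpoint_mem[OF assms(1-4), of a w] bpoint_mem[OF assms(1-3,5), of a w] assms(3,6) by auto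

lemma bpoints_eq: "bpoints C2 H V = bpt H V ` ({0, 1} \<times> Rn (fst V))"
 by (simp add: vbundle_def topspace_quotient_topology C2_simps)

lemma bpoint_in: "a : {0, 1} ==> u : Rn (fst V) ==> bpt H V (a, u) : bpoints C2 H V"
 by (auto simp: bpoints_eq)

text \<open>A continuous section of the quotient map \<open>(a, u) \<mapsto> [a, u]\<close>.\<close>

definition bsec :: "(int \<times> rvec) set => int \<times> rvec" where
 "bsec p = (let r = (if 0 : fst ` p then 0 else 1) in (r, THE w. (r, w) : p))"

lemma bsec_bpoint:
 assumes "subgroup H C2" "orep H V" "a : {0, 1}" "u : Rn (fst V)"
 shows "bsec (bpt H V (a, u)) = (if 1 : H then (0, snd V a u) else (a, u))"
proof (cases "1 : H")
 case False
 hence "bpt H V (a, u) = {(a, u)}" using bpoint_mem[OF assms] by auto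
 thus ?thesis using False assms(3) by (auto simp: bsec_def)
next
 case True
 have s0: "snd V 0 u = u" using assms by (auto simp: orth_rep_C2_iff)
 have *: "(0, w) : bpt H V (a, u) \<longleftrightarrow> w = snd V a u" for w
  using bpoint_mem[OF assms, of 0 w] True assms(3) s0 by auto
 hence "0 : fst ` bpt H V (a, u)" by force
 thus ?thesis using True * by (simp add: bsec_def)
qed

lemma bpoint_bsec:
 assumes "subgroup H C2" "orep H V" "p : bpoints C2 H V"
 shows "bpt H V (bsec p) = p" "fst (bsec p) : {0, 1}" "snd (bsec p) : Rn (fst V)"
proof -
 obtain a u where au: "a : {0, 1}" "u : Rn (fst V)" "p = bpt H V (a, u)" using assms(3) by (auto simp: bpoints_eq)
 have s0: "snd V 0 u = u" using assms au by (auto simp: orth_rep_C2_iff)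
 note t = bpoint_eqI[OF assms(1,2) au(1,2)] and R = rep_map_in_Rn[OF assms(2,1) _ au(2)]
 have "bpt H V (bsec p) = p & fst (bsec p) : {0, 1} & snd (bsec p) : Rn (fst V)"
 proof (cases "1 : H")
  case False
  thus ?thesis using bsec_bpoint[OF assms(1,2) au(1,2)] au by simp
 next
  case True
  have "a = 0 \<or> a = 1" using au(1) by simp
  thus ?thesis
  proof
   assume "a = 0"
   thus ?thesis using bsec_bpoint[OF assms(1,2) au(1,2)] au True s0 by simp
  next
   assume "a = 1"
   thus ?thesis using bsec_bpoint[OF assms(1,2) au(1,2)] au(3) True t[OF True] R[OF True] by simp
  qed
 qed
 thus "bpt H V (bsec p) = p" "fst (bsec p) : {0, 1}" "snd (bsec p) : Rn (fst V)" by auto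
qed

abbreviation GR :: "nat => (int \<times> rvec) topology" where
 "GR n \<equiv> prod_topology (discrete_topology {0, 1}) (Euclidean_space n)"

lemma gtop_vbundle: "gtop (vbundle C2 H V) = quotient_topology (GR (fst V)) (bpt H V)"
 by (simp add: vbundle_def C2_simps)

lemma continuous_bpoint: "continuous_map (GR (fst V)) (gtop (vbundle C2 H V)) (bpt H V)"
 unfolding gtop_vbundle by (rule quotient_imp_continuous_map[OF quotient_map_quotient_topology])

lemma continuous_map_coord: "continuous_map (Euclidean_space n) euclideanreal (%u. u i)"
 unfolding Euclidean_space_def by (rule continuous_map_from_subtopology[OF continuous_map_product_projection]) simp

lemma continuous_map_Rn_iff:
 assumes "!!x. x : topspace X ==> f x : Rn n"
 shows "continuous_map X (Euclidean_space n) f \<longleftrightarrow> (ALL i. continuous_map X euclideanreal (%x. f x i))"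
proof
 assume f: "continuous_map X (Euclidean_space n) f"
 show "ALL i. continuous_map X euclideanreal (%x. f x i)"
  using continuous_map_compose[OF f continuous_map_coord] by (simp add: o_def)
next
 assume f: "ALL i. continuous_map X euclideanreal (%x. f x i)"
 hence "continuous_map X (Euclidean_space n) (%x i. if i < n then f x i else 0)"
  by (simp add: continuous_map_componentwise_Euclidean_space)
 thus "continuous_map X (Euclidean_space n) f"
  by (rule continuous_map_eq) (use assms in \<open>auto simp: Rn_iff fun_eq_iff\<close>)
qed

lemma continuous_map_linear:
 assumes "linear_Rn m n A"
 shows "continuous_map (Euclidean_space m) (Euclidean_space n) A"
proof (subst continuous_map_Rn_iff)
 show "A u : Rn n" if "u : Rn m" for u using linear_RnD(1)[OF assms that] .
 show "ALL i. continuous_map (Euclidean_space m) euclideanreal (%u. A u i)"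
 proof
  fix i
  have "continuous_map (Euclidean_space m) euclideanreal (%u. \<Sum>j<m. u j * A (ev j) i)"
   by (intro continuous_intros continuous_map_coord) auto
  thus "continuous_map (Euclidean_space m) euclideanreal (%u. A u i)"
   by (rule continuous_map_eq) (use linear_Rn_expand[OF assms] in simp)
 qed
qed

lemma continuous_bsec:
 assumes "subgroup H C2" "orep H V"
 shows "continuous_map (gtop (vbundle C2 H V)) (GR (fst V)) bsec"
proof -
 have q: "quotient_map (GR (fst V)) (gtop (vbundle C2 H V)) (bpt H V)"
  unfolding gtop_vbundle by (rule quotient_map_quotient_topology)
 have "continuous_map (GR (fst V)) (GR (fst V)) (bsec o bpt H V)"
 proof (rule continuous_map_discrete_prod)
  fix a :: int assume a: "a : {0, 1}"
  have 1: "continuous_map (Euclidean_space (fst V)) (Euclidean_space (fst V)) (snd V a)" if "1 : H"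
  proof (rule continuous_map_linear)
   show "linear_Rn (fst V) (fst V) (snd V a)"
    using a that rep_map_linear[OF assms(2,1)] assms by (auto simp: orth_rep_C2_iff linear_Rn_def lincomb_in_Rn)
  qed
  show "continuous_map (Euclidean_space (fst V)) (GR (fst V)) (%u. (bsec o bpt H V) (a, u))"
  proof (cases "1 : H")
   case True
   have "continuous_map (Euclidean_space (fst V)) (GR (fst V)) (%u. (0, snd V a u))"
    using 1[OF True] by (intro continuous_map_pairedI) auto
   thus ?thesis by (rule continuous_map_eq) (use bsec_bpoint[OF assms a] True in simp)
  next
   case False
   have "continuous_map (Euclidean_space (fst V)) (GR (fst V)) (%u. (a, u))"
    using a by (intro continuous_map_pairedI) auto
   thus ?thesis by (rule continuous_map_eq) (use bsec_bpoint[OF assms a] False in simp)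
  qed
 qed
 thus ?thesis using continuous_compose_quotient_map[OF q] by blast
qed

definition bmk :: "int set => int rep => int set => int rep => int => (rvec => rvec) => int bmap" where
 "bmk H V K W b A = (\<lambda>p\<in>bpoints C2 H V. \<Union>(a, u)\<in>p. bpt K W ((a + b) mod 2, A u))"

text \<open>
  Over a map \<open>G/H \<rightarrow> G/K\<close> sending the coset \<open>H\<close> to \<open>b K\<close>; for \<open>K = C\<^sub>2\<close> the representative \<open>b = 0\<close>
 is used.
\<close>

definition opar :: "int set => int set => int => bool" where
 "opar H K b \<longleftrightarrow> subgroup H C2 & subgroup K C2 & H \<subseteq> K & b : {0, 1} & (1 : K --> b = 0)"

lemma oparD:
 assumes "opar H K b"
 shows "subgroup H C2" "subgroup K C2" "H \<subseteq> K" "b : {0, 1}" "1 : K ==> b = 0" "1 : H ==> 1 : K"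
 using assms by (auto simp: opar_def)

lemma bmk_bpoint:
 assumes o: "opar H K b" and V: "orep H V" and W: "orep K W" and A: "eqv H V W A"
  and a: "a : {0, 1}" and u: "u : Rn (fst V)"
 shows "bmk H V K W b A (bpt H V (a, u)) = bpt K W ((a + b) mod 2, A u)"
proof -
 note oD = oparD[OF o]
 have ab: "(a + b) mod 2 : {0, 1}" by auto
 have "bpt K W ((a' + b) mod 2, A w) = bpt K W ((a + b) mod 2, A u)" if "(a', w) : bpt H V (a, u)" for a' w
 proof -
  have "(a' = a & w = u) \<or> (1 : H & a' = 1 - a & w = snd V 1 u)"
   using that bpoint_mem[OF oD(1) V a u] by simp
  thus ?thesis
  proof
   assume h: "1 : H & a' = 1 - a & w = snd V 1 u"
   hence "1 : K" "b = 0" using oD by auto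
   have "(a' + b) mod 2 = 1 - (a + b) mod 2" using h a \<open>b = 0\<close> by auto
   moreover have "A w = snd W 1 (A u)" using h eqvD(5)[OF A _ u] by simp
   ultimately show ?thesis using bpoint_eqI[OF oD(2) W ab eqvD(3)[OF A u] \<open>1 : K\<close>] by simp
  qed simp
 qed
 moreover have "(a, u) : bpt H V (a, u)" using bpoint_mem[OF oD(1) V a u] by simp
 moreover have "(\<Union>(a', w)\<in>P. f a' w) = c" if "!!a' w. (a', w) : P ==> f a' w = c" "(a, u) : P"
  for P :: "(int \<times> rvec) set" and f :: "int => rvec => (int \<times> rvec) set" and c
 proof -
  have "(\<Union>(a', w)\<in>P. f a' w) = (\<Union>x\<in>P. c)"
   using that(1) by (intro arg_cong[of _ _ Union] image_cong refl) auto
  thus ?thesis using that(2) by auto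
 qed
 ultimately have "(\<Union>(a', w)\<in>bpt H V (a, u). bpt K W ((a' + b) mod 2, A w)) = bpt K W ((a + b) mod 2, A u)"
  by blast
 thus ?thesis unfolding bmk_def using bpoint_in[OF a u] by simp
qed

lemma bmk_eqI:
 assumes o: "opar H K b" and V: "orep H V" and W: "orep K W" and A: "eqv H V W A"
  and f: "f : extensional (bpoints C2 H V)"
  and eq: "!!a u. a : {0, 1} ==> u : Rn (fst V) ==> f (bpt H V (a, u)) = bpt K W ((a + b) mod 2, A u)"
 shows "f = bmk H V K W b A"
proof (rule extensionalityI[OF f])
 show "bmk H V K W b A : extensional (bpoints C2 H V)" by (simp add: bmk_def)
 fix p assume "p : bpoints C2 H V"
 then obtain a u where au: "a : {0, 1}" "u : Rn (fst V)" "p = bpt H V (a, u)" by (auto simp: bpoints_eq)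
 show "f p = bmk H V K W b A p" unfolding au(3) eq[OF au(1,2)] bmk_bpoint[OF o V W A au(1,2)] ..
qed

lemma bmk_cong:
 assumes o: "opar H K b" and V: "orep H V" and W: "orep K W" and A: "eqv H V W A"
  and eq: "!!u. u : Rn (fst V) ==> B u = A u"
 shows "bmk H V K W b B = bmk H V K W b A"
proof (rule bmk_eqI[OF o V W A])
 show "bmk H V K W b B (bpt H V (a, u)) = bpt K W ((a + b) mod 2, A u)"
  if "a : {0, 1}" "u : Rn (fst V)" for a u
  using bmk_bpoint[OF o V W eqv_cong[OF A V oparD(1)[OF o] eq] that] eq[OF that(2)] by simp
qed (simp add: bmk_def)

lemma gact_bpoint:
 assumes "subgroup H C2" "orep H V" "a : {0, 1}" "u : Rn (fst V)" "g : {0, 1}"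
 shows "gact (vbundle C2 H V) g (bpt H V (a, u)) = bpt H V ((g + a) mod 2, u)"
proof -
 have "gact (vbundle C2 H V) g (bpt H V (a, u)) = (%(a, u). ((g + a) mod 2, u)) ` bpt H V (a, u)"
  using assms(3,4) by (auto simp: vbundle_def C2_simps)
 also have "\<dots> = bpt H V ((g + a) mod 2, u)"
  unfolding bpoint_C2[OF assms(1)] by (auto simp: image_iff mod_simps add.assoc) (metis add.assoc mod_add_left_eq mod_add_right_eq)+
 finally show ?thesis .
qed

lemma bmk_gmaps:
 assumes o: "opar H K b" and V: "orep H V" and W: "orep K W" and A: "eqv H V W A"
 shows "bmk H V K W b A : gmaps C2 (vbundle C2 H V) (vbundle C2 K W)"
 unfolding gmaps_def
proof (intro CollectI conjI ballI)
 note oD = oparD[OF o]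
 show "bmk H V K W b A : extensional (bpoints C2 H V)" by (simp add: bmk_def)
 have 1: "continuous_map (GR (fst V)) (GR (fst W)) (%(a, u). ((a + b) mod 2, A u))"
  by (rule continuous_map_discrete_prod) (auto intro!: continuous_map_pairedI continuous_map_linear[OF eqvD(2)[OF A]])
 have "continuous_map (gtop (vbundle C2 H V)) (gtop (vbundle C2 K W)) (bpt K W o ((%(a, u). ((a + b) mod 2, A u)) o bsec))"
  by (intro continuous_map_compose[OF _ continuous_bpoint] continuous_map_compose[OF continuous_bsec[OF oD(1) V] 1])
 thus "continuous_map (gtop (vbundle C2 H V)) (gtop (vbundle C2 K W)) (bmk H V K W b A)"
 proof (rule continuous_map_eq)
  fix p assume p: "p : bpoints C2 H V"
  note s = bpoint_bsec[OF oD(1) V p]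
  show "(bpt K W o ((%(a, u). ((a + b) mod 2, A u)) o bsec)) p = bmk H V K W b A p"
   using bmk_bpoint[OF o V W A s(2,3)] s(1) by (simp add: case_prod_unfold)
 qed
 fix g p assume g: "g : carrier C2" and p: "p : bpoints C2 H V"
 have g: "g : {0, 1}" using g by (simp add: C2_simps)
 obtain a u where au: "a : {0, 1}" "u : Rn (fst V)" "p = bpt H V (a, u)" using p by (auto simp: bpoints_eq)
 have m: "(g + a) mod 2 : {0, 1}" "(a + b) mod 2 : {0, 1}" by auto
 show "bmk H V K W b A (gact (vbundle C2 H V) g p) = gact (vbundle C2 K W) g (bmk H V K W b A p)"
  unfolding au(3) gact_bpoint[OF oD(1) V au(1,2) g] bmk_bpoint[OF o V W A m(1) au(2)] bmk_bpoint[OF o V W A au(1,2)]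
   gact_bpoint[OF oD(2) W m(2) eqvD(3)[OF A au(2)] g]
  by (simp add: mod_simps add.assoc)
qed

subsection \<open>Maps of orbits\<close>

definition off :: "int set => (int set => int set) => int" where
 "off H \<alpha> = (if 0 : \<alpha> H then 0 else 1)"

definition otr :: "int set => int set => int => int set => int set" where
 "otr H K b = (\<lambda>c\<in>cosets H. if 1 : K then {0, 1} else (%a. (a + b) mod 2) ` c)"

lemma l_coset_C2: "a <#\<^bsub>C2\<^esub> c = (%h. (a + h) mod 2) ` c"
 by (auto simp: l_coset_def C2_simps)

lemma lcosets_C2: "subgroup H C2 ==> cosets H = (if 1 : H then {{0, 1}} else {{0}, {1}})"
proof -
 assume "subgroup H C2"
 then consider "H = {0}" | "H = {0, 1}" by (auto simp: subgroup_C2_iff)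
 thus ?thesis
  by cases (auto simp: LCOSETS_def l_coset_C2 C2_simps)
qed

lemma coset_self: "subgroup H C2 ==> H : cosets H"
 by (auto simp: lcosets_C2 subgroup_C2_iff)

lemma subgroup_C2_cases: "subgroup H C2 ==> (if 1 : H then H = {0, 1} else H = {0})"
 by (auto simp: subgroup_C2_iff)

lemma orbit_arr_iff:
 assumes H: "subgroup H C2" and K: "subgroup K C2"
 shows "\<alpha> : arr (orbit_cat C2) H K \<longleftrightarrow> opar H K (off H \<alpha>) & \<alpha> = otr H K (off H \<alpha>)"
proof
 assume "\<alpha> : arr (orbit_cat C2) H K"
 hence a: "\<alpha> : extensional (cosets H)" "!!c. c : cosets H ==> \<alpha> c : cosets K"
  and e: "!!c g. g : {0, 1} ==> c : cosets H ==> \<alpha> (g <#\<^bsub>C2\<^esub> c) = g <#\<^bsub>C2\<^esub> \<alpha> c"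
  by (auto simp: orbit_cat_def gmaps_def orbit_gspace_def C2_simps Pi_iff)
 have HK: "1 : K" if "1 : H"
 proof (rule ccontr)
  assume n: "1 ~: K"
  have Hc: "{0, 1} : cosets H" using lcosets_C2[OF H] that by simp
  have "\<alpha> {0, 1} = {0} \<or> \<alpha> {0, 1} = {1}" using a(2)[OF Hc] lcosets_C2[OF K] n by auto
  moreover have "1 <#\<^bsub>C2\<^esub> {0, 1} = {0, 1}" by (auto simp: l_coset_C2)
  hence "\<alpha> {0, 1} = 1 <#\<^bsub>C2\<^esub> \<alpha> {0, 1}" using e[OF _ Hc, of 1] by simp
  ultimately show False by (auto simp: l_coset_C2)
 qed
 have op: "opar H K (off H \<alpha>)"
 proof -
  have "\<alpha> H = {0, 1}" if "1 : K" using a(2)[OF coset_self[OF H]] lcosets_C2[OF K] that by simp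
  thus ?thesis using H K HK subgroup_C2_cases[OF H] subgroup_C2_cases[OF K] by (auto simp: opar_def off_def split: if_splits)
 qed
 have "\<alpha> c = otr H K (off H \<alpha>) c" for c
 proof (cases "c : cosets H")
  case False
  thus ?thesis using a(1) by (auto simp: otr_def extensional_def)
 next
  case c: True
  show ?thesis
  proof (cases "1 : K")
   case True
   thus ?thesis using a(2)[OF c] lcosets_C2[OF K] c by (simp add: otr_def)
  next
   case False
   hence H0: "H = {0}" using HK subgroup_C2_cases[OF H] by (auto split: if_splits)
   have c01: "{0} : cosets H" "c = {0} \<or> c = {1}" using c lcosets_C2[OF H] H0 by auto
   have "\<alpha> {0} = {0} \<or> \<alpha> {0} = {1}" using a(2)[OF c01(1)] lcosets_C2[OF K] False by auto
   hence 0: "\<alpha> {0} = {off H \<alpha>}" by (auto simp: off_def H0)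
   have "\<alpha> {1} = (%h. (1 + h) mod 2) ` \<alpha> {0}" using e[OF _ c01(1), of 1] by (simp add: l_coset_C2)
   hence 1: "\<alpha> {1} = {(1 + off H \<alpha>) mod 2}" using 0 by simp
   show ?thesis using c01(2) c 0 1 False by (auto simp: otr_def off_def)
  qed
 qed
 thus "opar H K (off H \<alpha>) & \<alpha> = otr H K (off H \<alpha>)" using op by blast
next
 assume R: "opar H K (off H \<alpha>) & \<alpha> = otr H K (off H \<alpha>)"
 define b where "b = off H \<alpha>"
 have o: "opar H K b" and \<alpha>: "\<alpha> = otr H K b" using R by (auto simp: b_def)
 note oD = oparD[OF o]
 have gc: "!!g c. g : {0, 1} ==> c : cosets H ==> g <#\<^bsub>C2\<^esub> c : cosets H"
  unfolding lcosets_C2[OF H] by (auto simp: l_coset_C2 split: if_splits)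
 show "\<alpha> : arr (orbit_cat C2) H K"
  unfolding \<alpha> orbit_cat_def cat.simps gmaps_def orbit_gspace_def gspace.simps topspace_discrete_topology C2_simps
 proof (intro CollectI conjI ballI)
  show "otr H K b : extensional (cosets H)" by (simp add: otr_def)
  show m: "continuous_map (discrete_topology (cosets H)) (discrete_topology (cosets K)) (otr H K b)"
   using oD lcosets_C2[OF H] lcosets_C2[OF K] by (auto simp: otr_def)
  fix g c assume g: "g : {0, 1::int}" and c: "c : cosets H"
  have cK: "otr H K b c : cosets K" using m c by (auto simp: continuous_map_def Pi_iff)
  have "otr H K b (g <#\<^bsub>C2\<^esub> c) = g <#\<^bsub>C2\<^esub> otr H K b c"
   using gc[OF g c] c g by (auto simp: otr_def l_coset_C2 image_image mod_simps add.assoc)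
  thus "otr H K b ((\<lambda>c\<in>cosets H. g <#\<^bsub>C2\<^esub> c) c) = (\<lambda>c\<in>cosets K. g <#\<^bsub>C2\<^esub> c) (otr H K b c)"
   using c cK by simp
 qed
qed

lemma off_otr:
 assumes o: "opar H K b"
 shows "off H (otr H K b) = b"
 using oparD[OF o] subgroup_C2_cases[of H] coset_self[of H] by (auto simp: off_def otr_def split: if_splits)

lemma otr_arr: "opar H K b ==> otr H K b : arr (orbit_cat C2) H K"
 using orbit_arr_iff[of H K] off_otr oparD by auto

lemma idt_orbit: "subgroup H C2 ==> idt (orbit_cat C2) H = otr H H 0" "subgroup H C2 ==> opar H H 0"
 by (auto simp: orbit_cat_def otr_def lcosets_C2 opar_def fun_eq_iff)

definition ooff :: "int set => int => int => int" where
 "ooff L b b' = (if 1 : L then 0 else (b + b') mod 2)"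

lemma opar_comp: "opar H K b ==> opar K L b' ==> opar H L (ooff L b b')"
 by (auto simp: opar_def ooff_def)

lemma cmp_orbit:
 assumes o: "opar H K b" and o': "opar K L b'"
 shows "cmp (orbit_cat C2) H K L (otr K L b') (otr H K b) = otr H L (ooff L b b')"
proof
 fix c
 note oD = oparD[OF o] and oD' = oparD[OF o']
 show "cmp (orbit_cat C2) H K L (otr K L b') (otr H K b) c = otr H L (ooff L b b') c"
 proof (cases "c : cosets H")
  case False
  thus ?thesis by (simp add: orbit_cat_def compose_def otr_def)
 next
  case c: True
  have "otr H K b c : cosets K" using otr_arr[OF o] c by (auto simp: orbit_cat_def gmaps_def orbit_gspace_def Pi_iff)
  thus ?thesis using c oD' by (auto simp: orbit_cat_def compose_def otr_def ooff_def image_image mod_simps add.assoc)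
 qed
qed

subsection \<open>Bundle maps as equivariant isomorphisms\<close>

lemma bundle_map_bmk:
 assumes o: "opar H K b" and V: "orep H V" and W: "orep K W" and A: "eqv H V W A"
 shows "bundle_map C2 H V K W (otr H K b) (bmk H V K W b A)"
 unfolding bundle_map_def
proof (intro conjI ballI)
 note oD = oparD[OF o]
 show "bmk H V K W b A : gmaps C2 (vbundle C2 H V) (vbundle C2 K W)" by (rule bmk_gmaps[OF o V W A])
 fix a b' assume a: "a : carrier C2" and b': "b' : otr H K b (a <#\<^bsub>C2\<^esub> H)"
 have a: "a : {0, 1}" using a by (simp add: C2_simps)
 have aH: "a <#\<^bsub>C2\<^esub> H : cosets H"
 proof -
  consider "H = {0}" | "H = {0, 1}" using oD(1) by (auto simp: subgroup_C2_iff)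
  thus ?thesis
  proof cases
   case 1
   hence "a <#\<^bsub>C2\<^esub> H = {a}" using a by (auto simp: l_coset_C2)
   thus ?thesis using a 1 lcosets_C2[OF oD(1)] by auto
  next
   case 2
   hence "a <#\<^bsub>C2\<^esub> H = {0, 1}" using a by (auto simp: l_coset_C2)
   thus ?thesis using 2 lcosets_C2[OF oD(1)] by simp
  qed
 qed
 have r: "linear_iso_Rn (fst V) (fst W) A" by (rule eqvD(1)[OF A])
 show "EX A'. linear_iso_Rn (fst V) (fst W) A' &
   (ALL u:Rn (fst V). bmk H V K W b A (bpt H V (a, u)) = bpt K W (b', A' u))"
 proof (cases "b' = (a + b) mod 2")
  case True
  thus ?thesis using bmk_bpoint[OF o V W A a] r by blast
 next
  case False
  have K: "1 : K & b' = 1 - (a + b) mod 2"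
  proof (cases "1 : K")
   case True
   thus ?thesis using b' aH False a oD(4) by (auto simp: otr_def)
  next
   case n: False
   hence "H = {0}" using oD subgroup_C2_cases[OF oD(1)] by (auto split: if_splits)
   hence "a <#\<^bsub>C2\<^esub> H = {a}" using a by (auto simp: l_coset_C2)
   hence "b' = (a + b) mod 2" using b' aH n by (simp add: otr_def)
   thus ?thesis using False by blast
  qed
  have m: "(a + b) mod 2 : {0, 1}" by auto
  have t: "linear_iso_Rn (fst W) (fst W) (snd W 1)" using eqvD(1)[OF esgn_involution(2)[OF W oD(2)]] K by simp
  have "linear_iso_Rn (fst V) (fst W) (snd W 1 o A)" by (rule linear_iso_Rn_comp[OF r t])
  moreover have "ALL u:Rn (fst V). bmk H V K W b A (bpt H V (a, u)) = bpt K W (b', (snd W 1 o A) u)"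
   using bmk_bpoint[OF o V W A a] bpoint_eqI[OF oD(2) W m eqvD(3)[OF A]] K by simp
  ultimately show ?thesis by blast
 qed
qed

lemma bundle_map_iff:
 assumes o: "opar H K b" and V: "orep H V" and W: "orep K W"
 shows "bundle_map C2 H V K W (otr H K b) f \<longleftrightarrow> (EX A. eqv H V W A & f = bmk H V K W b A)"
proof
 note oD = oparD[OF o]
 assume f: "bundle_map C2 H V K W (otr H K b) f"
 hence g: "f : gmaps C2 (vbundle C2 H V) (vbundle C2 K W)" by (simp add: bundle_map_def)
 have c0: "0 <#\<^bsub>C2\<^esub> H = H" using subgroup_C2_cases[OF oD(1)] by (auto simp: l_coset_C2 split: if_splits)
 have "b : otr H K b H" using oD coset_self[OF oD(1)] subgroup_C2_cases[OF oD(1)] by (auto simp: otr_def split: if_splits)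
 then obtain A where A: "linear_iso_Rn (fst V) (fst W) A" "!!u. u : Rn (fst V) ==> f (bpt H V (0, u)) = bpt K W (b, A u)"
  using f c0 unfolding bundle_map_def by (auto simp: C2_simps)
 have AR: "A u : Rn (fst W)" if "u : Rn (fst V)" for u using linear_RnD(1)[OF linear_iso_RnD(1)[OF A(1)] that] .
 have eq: "f (bpt H V (a, u)) = bpt K W ((a + b) mod 2, A u)" if a: "a : {0, 1}" and u: "u : Rn (fst V)" for a u
 proof -
  have "f (gact (vbundle C2 H V) a (bpt H V (0, u))) = gact (vbundle C2 K W) a (f (bpt H V (0, u)))"
   using g a bpoint_in[of 0 u V H] u by (auto simp: gmaps_def C2_simps)
  moreover have "(a + 0) mod 2 = a" using a by auto
  ultimately show ?thesis
   using gact_bpoint[OF oD(1) V _ u a, of 0] gact_bpoint[OF oD(2) W oD(4) AR[OF u] a] A(2)[OF u] by simp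
 qed
 have "eqv H V W A" unfolding eqv_def
 proof (intro conjI A(1) impI ballI)
  fix u assume H1: "1 : H" and u: "u : Rn (fst V)"
  have tu: "snd V 1 u : Rn (fst V)" using rep_map_in_Rn[OF V oD(1) H1 u] .
  have K1: "1 : K" "b = 0" using oD H1 by auto
  have "bpt K W (1, A (snd V 1 u)) = f (bpt H V (1, snd V 1 u))"
   using eq[OF _ tu, of 1] K1 by simp
  also have "\<dots> = f (bpt H V (0, u))" using bpoint_eqI[OF oD(1) V _ u H1, of 0] by simp
  also have "\<dots> = bpt K W (0, A u)" using A(2)[OF u] K1 by simp
  also have "\<dots> = bpt K W (1, snd W 1 (A u))" using bpoint_eqI[OF oD(2) W _ AR[OF u] K1(1), of 0] by simp
  finally show "A (snd V 1 u) = snd W 1 (A u)"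
   by (rule bpoint_inj[OF oD(2) W _ AR[OF tu] rep_map_in_Rn[OF W oD(2) K1(1) AR[OF u]], rotated]) simp
 qed
 moreover have "f = bmk H V K W b A"
  by (rule bmk_eqI[OF o V W calculation _ eq]) (use g in \<open>auto simp: gmaps_def\<close>)
 ultimately show "EX A. eqv H V W A & f = bmk H V K W b A" by blast
qed (use bundle_map_bmk[OF o V W] in blast)

lemma bundle_homotopic_if_path:
 assumes o: "opar H K b" and V: "orep H V" and W: "orep K W"
  and p: "lin_path (fst V) (eqv H V W) A B" and A: "eqv H V W A" and B: "eqv H V W B"
 shows "bundle_homotopic C2 H V K W (otr H K b) (bmk H V K W b A) (bmk H V K W b B)"
proof -
 note oD = oparD[OF o]
 let ?I = "top_of_set {0..1::real}" and ?X = "gtop (vbundle C2 H V)" and ?Y = "gtop (vbundle C2 K W)"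
 obtain h where h: "ALL t:{0..1::real}. eqv H V W (h t)" "ALL u:Rn (fst V). h 0 u = A u & h 1 u = B u"
   "ALL u:Rn (fst V). ALL i. continuous_on {0..1} (%t. h t u i)" using p by (auto simp: lin_path_def)
 define k where "k = (%(t, p). bmk H V K W b (h t) p)"
 have 1: "continuous_map (prod_topology ?I (Euclidean_space (fst V))) (Euclidean_space (fst W)) (%(t, u). h t u)"
 proof (subst continuous_map_Rn_iff)
  show "(case x of (t, u) => h t u) : Rn (fst W)" if "x : topspace (prod_topology ?I (Euclidean_space (fst V)))" for x
  proof -
   have "fst x : {0..1}" "snd x : Rn (fst V)" using that by auto
   thus ?thesis using eqvD(3)[OF h(1)[rule_format]] by (simp add: case_prod_unfold)
  qed
  show "ALL i. continuous_map (prod_topology ?I (Euclidean_space (fst V))) euclideanreal (%x. (case x of (t, u) => h t u) i)"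
  proof
   fix i
   have "continuous_map (prod_topology ?I (Euclidean_space (fst V))) euclideanreal (%x. \<Sum>j<fst V. snd x j * h (fst x) (ev j) i)"
   proof (intro continuous_intros)
    fix j assume j: "j : {..<fst V}"
    show "continuous_map (prod_topology ?I (Euclidean_space (fst V))) euclideanreal (%x. snd x j)"
     using continuous_map_compose[OF continuous_map_snd continuous_map_coord] by (simp add: o_def)
    have "continuous_map ?I euclideanreal (%t. h t (ev j) i)" using h(3) ev_in_Rn j by auto
    from continuous_map_compose[OF continuous_map_fst this]
    show "continuous_map (prod_topology ?I (Euclidean_space (fst V))) euclideanreal (%x. h (fst x) (ev j) i)"
     by (simp add: o_def)
   qed auto
   thus "continuous_map (prod_topology ?I (Euclidean_space (fst V))) euclideanreal (%x. (case x of (t, u) => h t u) i)"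
   proof (rule continuous_map_eq)
    fix x assume "x : topspace (prod_topology ?I (Euclidean_space (fst V)))"
    hence "fst x : {0..1}" "snd x : Rn (fst V)" by auto
    thus "(\<Sum>j<fst V. snd x j * h (fst x) (ev j) i) = (case x of (t, u) => h t u) i"
     using linear_Rn_expand[OF eqvD(2)[OF h(1)[rule_format]], of "fst x" "snd x"] by (simp add: case_prod_unfold)
   qed
  qed
 qed
 have 2: "continuous_map (prod_topology ?I ?X) (Euclidean_space (fst V)) (%x. snd (bsec (snd x)))"
  using continuous_map_compose[OF continuous_map_compose[OF continuous_map_snd continuous_bsec[OF oD(1) V]] continuous_map_snd]
  by (simp add: o_def)
 have 3: "continuous_map (prod_topology ?I ?X) (Euclidean_space (fst W)) ((%(t, u). h t u) o (%x. (fst x, snd (bsec (snd x)))))"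
  by (rule continuous_map_compose[OF continuous_map_pairedI[OF continuous_map_fst 2] 1])
 have "continuous_map (prod_topology ?I ?X) (discrete_topology {0, 1}) (%x. fst (bsec (snd x)))"
  using continuous_map_compose[OF continuous_map_compose[OF continuous_map_snd continuous_bsec[OF oD(1) V]] continuous_map_fst]
  by (simp add: o_def)
 hence 4: "continuous_map (prod_topology ?I ?X) (discrete_topology {0, 1}) ((%a. (a + b) mod 2) o (%x. fst (bsec (snd x))))"
  by (rule continuous_map_compose) auto
 have "continuous_map (prod_topology ?I ?X) ?Y (bpt K W o (%x. (((%a. (a + b) mod 2) o (%x. fst (bsec (snd x)))) x,
   ((%(t, u). h t u) o (%x. (fst x, snd (bsec (snd x))))) x)))"
  by (rule continuous_map_compose[OF continuous_map_pairedI[OF 4 3] continuous_bpoint])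
 hence k: "continuous_map (prod_topology ?I ?X) ?Y k"
 proof (rule continuous_map_eq)
  fix x assume "x : topspace (prod_topology ?I ?X)"
  hence x: "fst x : {0..1}" "snd x : bpoints C2 H V" by auto
  note s = bpoint_bsec[OF oD(1) V x(2)]
  show "(bpt K W o (%x. (((%a. (a + b) mod 2) o (%x. fst (bsec (snd x)))) x,
   ((%(t, u). h t u) o (%x. (fst x, snd (bsec (snd x))))) x))) x = k x"
   using bmk_bpoint[OF o V W h(1)[rule_format, OF x(1)] s(2,3)] s(1) by (simp add: k_def case_prod_unfold)
 qed
 have k01: "k (0, p) = bmk H V K W b A p" "k (1, p) = bmk H V K W b B p" for p
  using bmk_cong[OF o V W A, of "h 0"] bmk_cong[OF o V W B, of "h 1"] h(2) by (simp_all add: k_def)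
 have P: "bundle_map C2 H V K W (otr H K b) (%p. k (t, p))" if "t : {0..1}" for t
  using bundle_map_bmk[OF o V W h(1)[rule_format, OF that]] by (simp add: k_def)
 show ?thesis
  unfolding bundle_homotopic_def homotopic_with_def using k k01 P by (intro exI[of _ k]) auto
qed

text \<open>
  Evaluating a homotopy of bundle maps on the fibre over the base coset gives a path of linear maps; each coordinate is
  continuous because the quotient map has a continuous section.
\<close>

lemma path_if_bundle_homotopic:
 assumes o: "opar H K b" and V: "orep H V" and W: "orep K W"
  and h: "bundle_homotopic C2 H V K W (otr H K b) f f'"
 shows "EX A B. eqv H V W A & eqv H V W B & f = bmk H V K W b A & f' = bmk H V K W b B & lin_path (fst V) (eqv H V W) A B"
proof -
 note oD = oparD[OF o]
 let ?I = "top_of_set {0..1::real}" and ?X = "gtop (vbundle C2 H V)" and ?Y = "gtop (vbundle C2 K W)"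
 obtain k where k: "continuous_map (prod_topology ?I ?X) ?Y k" "!!x. k (0, x) = f x" "!!x. k (1, x) = f' x"
   "!!t. t : {0..1} ==> bundle_map C2 H V K W (otr H K b) (%x. k (t, x))"
  using h unfolding bundle_homotopic_def homotopic_with_def by auto
 have "EX A. eqv H V W A & (%x. k (t, x)) = bmk H V K W b A" if "t : {0..1}" for t
  using k(4)[OF that] bundle_map_iff[OF o V W] by blast
 then obtain A where A: "!!t. t : {0..1} ==> eqv H V W (A t)" "!!t. t : {0..1} ==> (%x. k (t, x)) = bmk H V K W b (A t)"
  by metis
 have s: "snd (bsec (k (t, bpt H V (0, u)))) = A t u" if t: "t : {0..1}" and u: "u : Rn (fst V)" for t u
 proof -
  have 0: "(0 + b) mod 2 = b" using oD(4) by auto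
  have AR: "A t u : Rn (fst W)" using eqvD(3)[OF A(1)[OF t] u] .
  have "k (t, bpt H V (0, u)) = bpt K W (b, A t u)"
   using fun_cong[OF A(2)[OF t], of "bpt H V (0, u)"] bmk_bpoint[OF o V W A(1)[OF t] _ u, of 0] 0 by simp
  moreover have "snd W 0 (A t u) = A t u" using W AR orth_rep_C2_iff[OF oD(2)] by blast
  ultimately show ?thesis using bsec_bpoint[OF oD(2) W oD(4) AR] oD(5) by simp
 qed
 have "lin_path (fst V) (eqv H V W) (A 0) (A 1)"
 proof (rule lin_pathI[of _ A])
  show "continuous_on {0..1} (%t. A t u i)" if u: "u : Rn (fst V)" for u i
  proof -
   have "continuous_map ?I (prod_topology ?I ?X) (%t. (t, bpt H V (0, u)))"
    using bpoint_in[of 0 u V H] u by (intro continuous_map_pairedI) auto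
   from continuous_map_compose[OF continuous_map_compose[OF continuous_map_compose[OF continuous_map_compose[OF this k(1)]
    continuous_bsec[OF oD(2) W]] continuous_map_snd] continuous_map_coord[of _ i]]
   have "continuous_map ?I euclideanreal (%t. snd (bsec (k (t, bpt H V (0, u)))) i)" by (simp add: o_def)
   hence "continuous_on {0..1} (%t. snd (bsec (k (t, bpt H V (0, u)))) i)" by simp
   thus ?thesis by (rule continuous_on_eq) (use s[OF _ u] in simp)
  qed
 qed (use A(1) in auto)
 moreover have "f = bmk H V K W b (A 0)" "f' = bmk H V K W b (A 1)"
  using A(2)[of 0] A(2)[of 1] k(2,3) by auto
 ultimately show ?thesis using A(1)[of 0] A(1)[of 1] by auto
qed

subsection \<open>Composites and sums of bundle maps\<close>

text \<open>
  In the coordinates at the representatives \<open>0\<close> and \<open>b\<close>, a composite \<open>G/e \<rightarrow> G/e \<rightarrow> G/G\<close> over the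
  nontrivial translation of \<open>G/e\<close> picks up the action on the target.
\<close>

definition otw :: "int set => int set => int rep => int => rvec => rvec" where
 "otw K L W b = (if 1 ~: K & 1 : L & b = 1 then snd W 1 else (%u. u))"

lemma otw_eqv:
 assumes "opar H K b" "opar K L b'" "orep L W"
 shows "eqv H W W (otw K L W b)"
proof (cases "1 ~: K & 1 : L & b = 1")
 case True
 thus ?thesis
  using eqv_mono[OF esgn_involution(2)[OF assms(3), of] , of H] oparD[OF assms(1)] oparD[OF assms(2)] by (auto simp: otw_def)
next
 case False
 thus ?thesis using eqv_id by (simp add: otw_def if_not_P)
qed

lemma bmk_compose:
 assumes o: "opar H K b" and o': "opar K L b'"
  and U: "orep H U" and V: "orep K V" and W: "orep L W"
  and A: "eqv H U V A" and B: "eqv K V W B"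
 shows "compose (bpoints C2 H U) (bmk K V L W b' B) (bmk H U K V b A) = bmk H U L W (ooff L b b') (otw K L W b o (B o A))"
  "eqv H U W (otw K L W b o (B o A))"
proof -
 note oD = oparD[OF o] and oD' = oparD[OF o']
 have BA: "eqv H U W (B o A)" by (rule eqv_comp[OF A eqv_mono[OF B oD(3)]])
 show e: "eqv H U W (otw K L W b o (B o A))" by (rule eqv_comp[OF BA otw_eqv[OF o o' W]])
 show "compose (bpoints C2 H U) (bmk K V L W b' B) (bmk H U K V b A) = bmk H U L W (ooff L b b') (otw K L W b o (B o A))"
 proof (rule bmk_eqI[OF opar_comp[OF o o'] U W e])
  show "compose (bpoints C2 H U) (bmk K V L W b' B) (bmk H U K V b A) : extensional (bpoints C2 H U)" by simp
  fix a :: int and u assume a: "a : {0, 1}" and u: "u : Rn (fst U)"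
  have m: "(a + b) mod 2 : {0, 1}" by auto
  have Au: "A u : Rn (fst V)" by (rule eqvD(3)[OF A u])
  have Bu: "B (A u) : Rn (fst W)" by (rule eqvD(3)[OF B Au])
  have "compose (bpoints C2 H U) (bmk K V L W b' B) (bmk H U K V b A) (bpt H U (a, u)) =
    bpt L W (((a + b) mod 2 + b') mod 2, B (A u))"
   using bpoint_in[OF a u] bmk_bpoint[OF o U V A a u] bmk_bpoint[OF o' V W B m Au] by (simp add: compose_def)
  also have "\<dots> = bpt L W ((a + ooff L b b') mod 2, (otw K L W b o (B o A)) u)"
  proof (cases "1 ~: K & 1 : L & b = 1")
   case True
   hence b': "b' = 0" "ooff L b b' = 0" using oD' by (auto simp: ooff_def)
   have "bpt L W ((a + 1) mod 2, B (A u)) = bpt L W (1 - (a + 1) mod 2, snd W 1 (B (A u)))"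
    by (rule bpoint_eqI[OF oD'(2) W _ Bu]) (use True in auto)
   moreover have "1 - (a + 1) mod 2 = a mod 2" using a by auto
   ultimately show ?thesis using True b' by (simp add: otw_def mod_simps)
  next
   case False
   hence "(a + ooff L b b') mod 2 = ((a + b) mod 2 + b') mod 2"
    using oD oD' by (auto simp: ooff_def mod_simps add.assoc)
   thus ?thesis using False by (simp add: otw_def if_not_P)
  qed
  finally show "compose (bpoints C2 H U) (bmk K V L W b' B) (bmk H U K V b A) (bpt H U (a, u)) =
    bpt L W ((a + ooff L b b') mod 2, (otw K L W b o (B o A)) u)" .
 qed
qed

lemma bid_bmk:
 assumes "subgroup H C2" "orep H V"
 shows "bid C2 H V = bmk H V H V 0 (%u. u)"
proof (rule bmk_eqI[OF idt_orbit(2)[OF assms(1)] assms(2,2) eqv_id])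
 fix a :: int and u assume a: "a : {0, 1}" and u: "u : Rn (fst V)"
 hence "(a + 0) mod 2 = a" by auto
 thus "bid C2 H V (bpt H V (a, u)) = bpt H V ((a + 0) mod 2, u)"
  using bpoint_in[OF a u] by (simp add: bid_def)
qed (simp add: bid_def)

lemma on_fibres_bpoint:
 assumes H: "subgroup H C2" and u: "u : Rn (fst V)" and s0: "orep H V" "orep H W" "\<theta> u : Rn (fst W)"
  and e: "1 : H ==> \<theta> (snd V 1 u) = snd W 1 (\<theta> u)"
 shows "on_fibres \<theta> (bpt H V (a, u)) = bpt H W (a, \<theta> u)"
proof -
 have 0: "snd V 0 u = u" "snd W 0 (\<theta> u) = \<theta> u" using s0 u orth_rep_C2_iff[OF H] by blast+
 consider "H = {0}" | "H = {0, 1}" using H by (auto simp: subgroup_C2_iff)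
 hence "\<theta> (snd V h u) = snd W h (\<theta> u)" if "h : H" for h
  using that 0 e by cases auto
 thus ?thesis unfolding bpoint_C2[OF H] on_fibres_def by (auto simp: image_iff) metis+
qed

lemma bmk_sum:
 assumes o: "opar H K b" and V: "orep H V" and T: "orep H T" and W: "orep K W" and T': "orep K T'"
  and A: "eqv H V W A" and k: "eqv H T T' k"
 shows "bmap_sum C2 H V T (fst W) (bmk H V K W b A) (bmk H T K T' b k) =
  bmk H (V +r T) K (W +r T') b (dsum (fst V) (fst W) A k)"
proof -
 note oD = oparD[OF o]
 have D: "eqv H (V +r T) (W +r T') (dsum (fst V) (fst W) A k)" by (rule eqv_dsum[OF A k V T oD(1)])
 note VT = orth_rep_sum[OF oD(1) V T] and WT = orth_rep_sum[OF oD(2) W T']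
 show ?thesis
 proof (rule bmk_eqI[OF o VT WT D])
  show "bmap_sum C2 H V T (fst W) (bmk H V K W b A) (bmk H T K T' b k) : extensional (bpoints C2 H (V +r T))"
   by (simp add: bmap_sum_def)
  fix a :: int and u assume a: "a : {0, 1}" and u': "u : Rn (fst (V +r T))"
  have u: "u : Rn (fst V + fst T)" using u' by (simp add: rep_sum_simps)
  have 1: "on_fibres (take_vec (fst V)) (bpt H (V +r T) (a, u)) = bpt H V (a, take_vec (fst V) u)"
   by (rule on_fibres_bpoint[where \<theta> = "take_vec (fst V)", OF oD(1) u' VT V take_in_Rn])
    (use u rep_map_in_Rn[OF V oD(1) _ take_in_Rn] in \<open>simp add: rep_sum_simps dsum_def take_append\<close>)
  have 2: "on_fibres (drop_vec (fst V)) (bpt H (V +r T) (a, u)) = bpt H T (a, drop_vec (fst V) u)"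
   by (rule on_fibres_bpoint[where \<theta> = "drop_vec (fst V)", OF oD(1) u' VT T drop_in_Rn[OF u]]) (use u in \<open>simp add: rep_sum_simps dsum_def drop_append\<close>)
  let ?w = "A (take_vec (fst V) u)" and ?s = "k (drop_vec (fst V) u)" and ?c = "(a + b) mod 2"
  have w: "?w : Rn (fst W)" by (rule eqvD(3)[OF A take_in_Rn])
  have s: "?s : Rn (fst T')" by (rule eqvD(3)[OF k drop_in_Rn[OF u]])
  have c: "?c : {0, 1}" by auto
  have ws: "append_vec (fst W) ?w ?s : Rn (fst (W +r T'))" using append_in_Rn[OF s] by (simp add: rep_sum_simps)
  have t: "snd (W +r T') 1 (append_vec (fst W) ?w ?s) = append_vec (fst W) (snd W 1 ?w) (snd T' 1 ?s)"
   using append_in_Rn[OF s] by (simp add: rep_sum_simps dsum_append[OF w])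
  have "bmap_sum C2 H V T (fst W) (bmk H V K W b A) (bmk H T K T' b k) (bpt H (V +r T) (a, u)) =
    {(x, append_vec (fst W) y z) | x y z. (x, y) : bpt K W (?c, ?w) & (x, z) : bpt K T' (?c, ?s)}"
   using bpoint_in[OF a u'] bmk_bpoint[OF o V W A a take_in_Rn] bmk_bpoint[OF o T T' k a drop_in_Rn[OF u]]
   by (simp add: bmap_sum_def 1 2)
  also have "\<dots> = bpt K (W +r T') (?c, append_vec (fst W) ?w ?s)"
  proof (rule Set.set_eqI)
   fix q :: "int \<times> rvec"
   obtain x v where q: "q = (x, v)" by (cases q)
   have "1 - ?c ~= ?c" by presburger
   thus "q : {(x, append_vec (fst W) y z) | x y z. (x, y) : bpt K W (?c, ?w) & (x, z) : bpt K T' (?c, ?s)} \<longleftrightarrow>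
     q : bpt K (W +r T') (?c, append_vec (fst W) ?w ?s)"
    unfolding q bpoint_mem[OF oD(2) WT c ws] t mem_Collect_eq bpoint_mem[OF oD(2) W c w] bpoint_mem[OF oD(2) T' c s]
    by (auto simp del: One_nat_def)
  qed
  finally show "bmap_sum C2 H V T (fst W) (bmk H V K W b A) (bmk H T K T' b k) (bpt H (V +r T) (a, u)) =
    bpt K (W +r T') (?c, dsum (fst V) (fst W) A k u)"
   by (simp add: dsum_def)
 qed
qed

lemma interchange_append:
 assumes "x : Rn a" "y : Rn b" "z : Rn c"
 shows "interchange a b c (append_vec (a + b) (append_vec a x y) (append_vec c z w)) =
  append_vec (a + c) (append_vec a x z) (append_vec b y w)"
proof
 fix i
 consider "i < a" | "a <= i" "i < a + c" | "a + c <= i" "i < a + c + b" | "a + c + b <= i" by linarith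
 thus "interchange a b c (append_vec (a + b) (append_vec a x y) (append_vec c z w)) i =
  append_vec (a + c) (append_vec a x z) (append_vec b y w) i"
 proof cases
  case 3
  hence "\<not> i < a" "\<not> i < a + c" "\<not> i - c < a" "i - c < a + b" "i - (a + c) < b" "i - c - a = i - (a + c)" by linarith+
  thus ?thesis using 3 by (simp only: interchange_def append_vec_def if_True if_False)
 next
  case 4
  hence "\<not> i < a" "\<not> i < a + c" "\<not> i < a + c + b" "\<not> i < a + b" "\<not> i - (a + b) < c" "\<not> i - (a + c) < b"
   "i - (a + b) - c = i - (a + c) - b" by linarith+
  thus ?thesis by (simp only: interchange_def append_vec_def if_True if_False)
 qed (auto simp: interchange_def append_vec_def)
qed

lemma append4:
 assumes "u : Rn ((a + b) + (c + d))"
 obtains x y z w where "x : Rn a" "y : Rn b" "z : Rn c" "w : Rn d" "u = append_vec (a + b) (append_vec a x y) (append_vec c z w)"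
proof -
 let ?l = "take_vec (a + b) u" and ?r = "drop_vec (a + b) u"
 have r: "?r : Rn (c + d)" by (rule drop_in_Rn[OF assms])
 show ?thesis
  by (rule that[of "take_vec a ?l" "drop_vec a ?l" "take_vec c ?r" "drop_vec c ?r"])
   (simp_all add: take_in_Rn drop_in_Rn[OF take_in_Rn] drop_in_Rn[OF r] append_take_drop)
qed

lemma linear_interchange: "linear_Rn (a + b + (c + d)) (a + c + (b + d)) (interchange a b c)"
 by (auto simp: linear_Rn_def interchange_def Rn_iff)

lemma interchange_iso: "linear_iso_Rn (a + b + (c + d)) (a + c + (b + d)) (interchange a b c)"
proof -
 have "bij_betw (interchange a b c) (Rn (a + b + (c + d))) (Rn (a + c + (b + d)))"
 proof (rule bij_betw_byWitness[of _ "interchange a c b"])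
  show "ALL u:Rn (a + b + (c + d)). interchange a c b (interchange a b c u) = u"
  proof
   fix u assume "u : Rn (a + b + (c + d))"
   thus "interchange a c b (interchange a b c u) = u" by (rule append4) (simp add: interchange_append)
  qed
  show "ALL u:Rn (a + c + (b + d)). interchange a b c (interchange a c b u) = u"
  proof
   fix u assume "u : Rn (a + c + (b + d))"
   thus "interchange a b c (interchange a c b u) = u" by (rule append4) (simp add: interchange_append)
  qed
 qed (use linear_RnD(1)[OF linear_interchange] in blast)+
 thus ?thesis using linear_interchange by (simp add: linear_iso_Rn_def)
qed

lemma eqv_interchange:
 assumes H: "subgroup H C2" and r: "orep H V" "orep H V'" "orep H Z" "orep H S"
 shows "eqv H ((V +r V') +r (Z +r S)) ((V +r Z) +r (V' +r S)) (interchange (fst V) (fst V') (fst Z))"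
 unfolding eqv_def
proof (intro conjI impI ballI)
 let ?I = "interchange (fst V) (fst V') (fst Z)"
 show "linear_iso_Rn (fst ((V +r V') +r (Z +r S))) (fst ((V +r Z) +r (V' +r S))) ?I"
  using interchange_iso by (simp add: rep_sum_simps)
 fix u assume 1: "1 : H" and u: "u : Rn (fst ((V +r V') +r (Z +r S)))"
 hence "u : Rn (fst V + fst V' + (fst Z + fst S))" by (simp add: rep_sum_simps)
 then obtain x y z w where xy: "x : Rn (fst V)" "y : Rn (fst V')" "z : Rn (fst Z)" "w : Rn (fst S)"
  and u: "u = append_vec (fst V + fst V') (append_vec (fst V) x y) (append_vec (fst Z) z w)"
  by (rule append4)
 have t: "snd V 1 x : Rn (fst V)" "snd V' 1 y : Rn (fst V')" "snd Z 1 z : Rn (fst Z)" "snd S 1 w : Rn (fst S)"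
  using rep_map_in_Rn[OF _ H 1] r xy by auto
 show "?I (snd ((V +r V') +r (Z +r S)) 1 u) = snd ((V +r Z) +r (V' +r S)) 1 (?I u)"
  unfolding u interchange_append[OF xy(1-3)]
  using xy t by (simp add: rep_sum_simps append_in_Rn dsum_append interchange_append)
qed

definition ssum :: "int rep => int rep => int rep => int rep => int rep => int rep => (rvec => rvec) => (rvec => rvec) => rvec => rvec" where
 "ssum V V' Z W W' Z' A B = interchange (fst W) (fst Z') (fst W') o
   (dsum (fst (V +r Z)) (fst (W +r Z')) A B o interchange (fst V) (fst V') (fst Z))"

lemma bmk_stable_sum:
 assumes o: "opar H K b" and V: "orep H V" "orep H V'" "orep H Z" "orep H S"
  and W: "orep K W" "orep K W'" "orep K Z'" "orep K S'"
  and A: "eqv H (V +r Z) (W +r Z') A" and B: "eqv H (V' +r S) (W' +r S') B"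
 shows "stable_sum C2 H V V' Z S W W' Z' (bmk H (V +r Z) K (W +r Z') b A) (bmk H (V' +r S) K (W' +r S') b B) =
   bmk H ((V +r V') +r (Z +r S)) K ((W +r W') +r (Z' +r S')) b (ssum V V' Z W W' Z' A B)"
  "eqv H ((V +r V') +r (Z +r S)) ((W +r W') +r (Z' +r S')) (ssum V V' Z W W' Z' A B)"
proof -
 note oD = oparD[OF o]
 note su = orth_rep_sum[OF oD(1)] and su' = orth_rep_sum[OF oD(2)]
 note I = eqv_interchange[OF oD(1) V] and J = eqv_interchange[OF oD(2) W(1,3,2,4)]
 have D: "eqv H ((V +r Z) +r (V' +r S)) ((W +r Z') +r (W' +r S')) (dsum (fst (V +r Z)) (fst (W +r Z')) A B)"
  by (rule eqv_dsum[OF A B su[OF V(1,3)] su[OF V(2,4)] oD(1)])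
 show e: "eqv H ((V +r V') +r (Z +r S)) ((W +r W') +r (Z' +r S')) (ssum V V' Z W W' Z' A B)"
  unfolding ssum_def by (rule eqv_comp[OF eqv_comp[OF I D] eqv_mono[OF J oD(3)]])
 note S1 = su[OF su[OF V(1,2)] su[OF V(3,4)]] and S2 = su'[OF su'[OF W(1,2)] su'[OF W(3,4)]]
 note S3 = su[OF su[OF V(1,3)] su[OF V(2,4)]] and S4 = su'[OF su'[OF W(1,3)] su'[OF W(2,4)]]
 show "stable_sum C2 H V V' Z S W W' Z' (bmk H (V +r Z) K (W +r Z') b A) (bmk H (V' +r S) K (W' +r S') b B) =
   bmk H ((V +r V') +r (Z +r S)) K ((W +r W') +r (Z' +r S')) b (ssum V V' Z W W' Z' A B)"
 proof (rule bmk_eqI[OF o S1 S2 e])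
  fix a :: int and u assume a: "a : {0, 1}" and u: "u : Rn (fst ((V +r V') +r (Z +r S)))"
  let ?Iu = "interchange (fst V) (fst V') (fst Z) u"
  have Iu: "?Iu : Rn (fst ((V +r Z) +r (V' +r S)))" by (rule eqvD(3)[OF I u])
  let ?Du = "dsum (fst (V +r Z)) (fst (W +r Z')) A B ?Iu"
  have Du: "?Du : Rn (fst ((W +r Z') +r (W' +r S')))" by (rule eqvD(3)[OF D Iu])
  have 1: "on_fibres (interchange (fst V) (fst V') (fst Z)) (bpt H ((V +r V') +r (Z +r S)) (a, u)) =
    bpt H ((V +r Z) +r (V' +r S)) (a, ?Iu)"
   by (rule on_fibres_bpoint[where \<theta> = "interchange (fst V) (fst V') (fst Z)", OF oD(1) u S1 S3 Iu]) (rule eqvD(5)[OF I _ u])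
  have 2: "on_fibres (interchange (fst W) (fst Z') (fst W')) (bpt K ((W +r Z') +r (W' +r S')) ((a + b) mod 2, ?Du)) =
    bpt K ((W +r W') +r (Z' +r S')) ((a + b) mod 2, interchange (fst W) (fst Z') (fst W') ?Du)"
   by (rule on_fibres_bpoint[where \<theta> = "interchange (fst W) (fst Z') (fst W')", OF oD(2) Du S4 S2 eqvD(3)[OF J Du]]) (rule eqvD(5)[OF J _ Du])
  show "stable_sum C2 H V V' Z S W W' Z' (bmk H (V +r Z) K (W +r Z') b A) (bmk H (V' +r S) K (W' +r S') b B)
    (bpt H ((V +r V') +r (Z +r S)) (a, u)) =
    bpt K ((W +r W') +r (Z' +r S')) ((a + b) mod 2, ssum V V' Z W W' Z' A B u)"
   using bpoint_in[OF a u] 1 2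
    bmk_sum[OF o su[OF V(1,3)] su[OF V(2,4)] su'[OF W(1,3)] su'[OF W(2,4)] A B] bmk_bpoint[OF o S3 S4 D a Iu]
   by (simp add: stable_sum_def ssum_def)
 qed (simp add: stable_sum_def)
qed

subsection \<open>Signs of block permutations\<close>

lemma detR_swap01: "detR 2 (interchange 0 1 1) = - 1"
proof -
 have "Matrix.mat 2 2 (%(i, j). interchange 0 1 1 (ev j) i) = (swaprows_mat 2 0 1 :: real mat)"
  by (rule eq_matI) (auto simp: interchange_def ev_def less_2_cases_iff)
 thus ?thesis by (simp add: detR_def det_swaprows_mat)
qed

lemma sgn_detR_comp_iso:
 "linear_iso_Rn n n A ==> linear_iso_Rn n n B ==> detR n (B o A) = detR n B * detR n A"
 using detR_comp linear_iso_RnD(1) by blast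

lemma interchange_iso_n: "a + b + c <= n ==> linear_iso_Rn n n (interchange a b c)"
 using interchange_iso[of a b c "n - (a + b + c)"] by (simp add: algebra_simps)

lemma interchange_dsum_left: "dsum a a (%u. u) (interchange 0 b c) = interchange a b c"
 by (auto simp: fun_eq_iff dsum_def append_vec_def take_vec_def drop_vec_def interchange_def)

lemma interchange_dsum_right: "dsum (b + c) (b + c) (interchange 0 b c) (%u. u) = interchange 0 b c"
 by (auto simp: fun_eq_iff dsum_def append_vec_def take_vec_def drop_vec_def interchange_def)

lemma detR_interchange_adjacent:
 assumes "a + 2 <= n"
 shows "detR n (interchange a 1 1) = - 1"
proof -
 define d where "d = n - (a + 2)"
 have n: "n = a + (2 + d)" using assms by (simp add: d_def)
 have l: "linear_Rn k k (%u. u)" for k by (rule linear_iso_RnD(1)[OF linear_iso_Rn_id])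
 have i2: "linear_Rn 2 2 (interchange 0 1 1)" by (rule linear_iso_RnD(1)[OF interchange_iso_n]) simp
 have "dsum 2 2 (interchange 0 1 1) (%u. u) = interchange 0 1 1" using interchange_dsum_right[of 1 1] by (simp only: one_add_one)
 hence "detR (2 + d) (interchange 0 1 1) = - 1"
  using detR_dsum[OF i2 l, of d] by (simp add: detR_swap01[simplified] detR_id)
 moreover have i: "linear_Rn (2 + d) (2 + d) (interchange 0 1 1)" by (rule linear_iso_RnD(1)[OF interchange_iso_n]) simp
 ultimately show ?thesis
  using detR_dsum[OF l i, of a] by (simp add: n interchange_dsum_left detR_id)
qed

lemma detR_interchange_one:
 "a + 1 + c <= n ==> detR n (interchange a 1 c) = (- 1) ^ c"
proof (induction c)
 case 0
 have "interchange a 1 0 = (%u. u)" by (auto simp: fun_eq_iff interchange_def)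
 thus ?case by (simp add: detR_id)
next
 case (Suc c)
 have "interchange a 1 (Suc c) = interchange (a + c) 1 1 o interchange a 1 c"
  by (auto simp: fun_eq_iff interchange_def)
 hence "detR n (interchange a 1 (Suc c)) = detR n (interchange (a + c) 1 1) * detR n (interchange a 1 c)"
  using Suc.prems sgn_detR_comp_iso[OF interchange_iso_n interchange_iso_n, of a 1 c n "a + c" 1 1] by simp
 thus ?case using Suc detR_interchange_adjacent[of "a + c" n] by simp
qed

text \<open>
  Interchanging two adjacent blocks of sizes \<open>b\<close> and \<open>c\<close> takes \<open>b c\<close>
 transpositions.
\<close>

lemma detR_interchange:
 "a + b + c <= n ==> detR n (interchange a b c) = (- 1) ^ (b * c)"
proof (induction b)
 case 0
 have "interchange a 0 c = (%u. u)" by (auto simp: fun_eq_iff interchange_def)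
 thus ?case by (simp add: detR_id)
next
 case (Suc b)
 have "interchange a (Suc b) c = interchange a b c o interchange (a + b) 1 c"
  by (auto simp: fun_eq_iff interchange_def)
 hence "detR n (interchange a (Suc b) c) = detR n (interchange a b c) * detR n (interchange (a + b) 1 c)"
  using Suc.prems sgn_detR_comp_iso[OF interchange_iso_n interchange_iso_n, of "a + b" 1 c n a b c] by simp
 thus ?case using Suc detR_interchange_one[of "a + b" c n] by (simp add: power_add)
qed

section \<open>Morphisms of virtual bundles are classified by signs\<close>

lemma esgn_path:
 assumes p: "lin_path (fst V) (eqv H V W) A B" and r: "orep H V" "orep H W" and H: "subgroup H C2" "okc c H"
  and A: "eqv H V W A"
 shows "esgn c V W A = esgn c V W B"
 unfolding esgn_def
proof (rule sgf_path[OF p frame_fr[OF repc_of[OF r(1) H]] subpart_sub repc_of[OF r(2) H]])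
 show "frame (fdim c V) (fst W) (subpart c W) (fr c W)"
  using frame_fr[OF repc_of[OF r(2) H]] eqv_fdim[OF A r H] by simp
 show "lin_bij (fst V) (fst W) (subpart c V) (subpart c W) X" if "eqv H V W X" for X
  by (rule eqv_lin_bij[OF that r H])
qed

lemma rep_sum_assoc: "(U +r V) +r W = U +r (V +r W)"
proof (rule prod_eqI)
 show "fst ((U +r V) +r W) = fst (U +r (V +r W))" by (simp add: rep_sum_simps)
 show "snd ((U +r V) +r W) = snd (U +r (V +r W))"
 proof (intro ext)
  fix h u i
  let ?a = "fst U" and ?b = "fst V" and ?c = "fst W"
  show "snd ((U +r V) +r W) h u i = snd (U +r (V +r W)) h u i"
  proof (cases "u : Rn (?a + ?b + ?c)")
   case False
   thus ?thesis by (simp add: rep_sum_simps add.assoc)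
  next
   case True
   hence T2: "u : Rn (?a + (?b + ?c))" by (simp add: add.assoc)
   have 1: "take_vec ?a (take_vec (?a + ?b) u) = take_vec ?a u" by (auto simp: take_vec_def)
   have 2: "drop_vec ?a (take_vec (?a + ?b) u) = take_vec ?b (drop_vec ?a u)" by (auto simp: take_vec_def drop_vec_def)
   have 3: "drop_vec ?b (drop_vec ?a u) = drop_vec (?a + ?b) u" by (auto simp: drop_vec_def add.commute add.left_commute)
   show ?thesis
    using True T2 take_in_Rn[of "?a + ?b" u] drop_in_Rn[OF T2]
    by (simp add: rep_sum_simps dsum_def 1 2 3) (auto simp: append_vec_def)
  qed
 qed
qed

text \<open>Frames are chosen arbitrarily, so the frame of a sum and the sum of the frames may be oriented differently.\<close>

definition theta :: "bool => int rep => int rep => real" where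
 "theta c V W = sgf (fdim c V + fdim c W) (fr c (V +r W)) (fsum c V W) (%u. u)"

lemma frame_fr_sum:
 assumes "repc c V" "repc c W"
 shows "frame (fdim c V + fdim c W) (fst V + fst W) (subpart c (V +r W)) (fr c (V +r W))"
 using frame_fr[OF repc_sum[OF assms]] fdim_sum[OF assms] by (simp add: rep_sum_simps)

lemma sgf_swap:
 assumes \<phi>: "frame p m S \<phi>" and \<psi>: "frame p m S \<psi>"
 shows "sgf p \<psi> \<phi> (%u. u) = sgf p \<phi> \<psi> (%u. u)"
proof -
 note I = lin_bij_id[of m S]
 have "sgf p \<psi> \<phi> (%u. u) * sgf p \<phi> \<psi> (%u. u) = 1"
  using sgf_comp[OF \<phi> \<psi> \<phi> I I] sgf_id[OF \<phi>] by (simp add: o_def)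
 thus ?thesis using sgf_values[OF \<phi> \<psi> I] sgf_values[OF \<psi> \<phi> I] by auto
qed

lemma theta_values: "repc c V ==> repc c W ==> theta c V W : {1, -1}"
 unfolding theta_def by (rule sgf_values[OF frame_fr_sum frame_fsum lin_bij_id])

lemma sgf_refr:
 assumes \<phi>: "frame p m S \<phi>" and \<phi>': "frame p m S \<phi>'" and \<psi>: "frame p n T \<psi>" and \<psi>': "frame p n T \<psi>'"
  and A: "lin_bij m n S T A"
 shows "sgf p \<phi> \<psi> A = sgf p \<phi> \<phi>' (%u. u) * sgf p \<psi> \<psi>' (%u. u) * sgf p \<phi>' \<psi>' A"
proof -
 note I = lin_bij_id[of m S] and J = lin_bij_id[of n T]
 have "sgf p \<phi> \<psi> ((%u. u) o (A o (%u. u))) = sgf p \<psi>' \<psi> (%u. u) * (sgf p \<phi>' \<psi>' A * sgf p \<phi> \<phi>' (%u. u))"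
  unfolding sgf_comp[OF \<phi> \<psi>' \<psi> lin_bij_comp[OF I A] J] sgf_comp[OF \<phi> \<phi>' \<psi>' I A] ..
 thus ?thesis using sgf_swap[OF \<psi> \<psi>'] by (simp add: o_def mult.commute mult.left_commute)
qed

lemma esgn_dsum:
 assumes A: "eqv H V W A" and k: "eqv H T T' k"
  and r: "orep H V" "orep H W" "orep H T" "orep H T'" and H: "subgroup H C2" "okc c H"
 shows "esgn c (V +r T) (W +r T') (dsum (fst V) (fst W) A k) =
   theta c V T * theta c W T' * (esgn c V W A * esgn c T T' k)"
proof -
 have rc: "repc c V" "repc c W" "repc c T" "repc c T'" using repc_of[OF _ H] r by auto
 have d: "fdim c W = fdim c V" "fdim c T' = fdim c T"
  using eqv_fdim[OF A r(1,2) H] eqv_fdim[OF k r(3,4) H] by auto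
 have n: "fst W = fst V" "fst T' = fst T" using eqvD(4)[OF A] eqvD(4)[OF k] by auto
 note e = eqv_dsum[OF A k r(1,3) H(1)]
 have D: "lin_bij (fst V + fst T) (fst W + fst T') (subpart c (V +r T)) (subpart c (W +r T')) (dsum (fst V) (fst W) A k)"
  using eqv_lin_bij[OF e orth_rep_sum[OF H(1) r(1,3)] orth_rep_sum[OF H(1) r(2,4)] H] by (simp add: rep_sum_simps)
 have "esgn c (V +r T) (W +r T') (dsum (fst V) (fst W) A k) =
   theta c V T * theta c W T' * sgf (fdim c V + fdim c T) (fsum c V T) (fsum c W T') (dsum (fst V) (fst W) A k)"
  unfolding esgn_def fdim_sum[OF rc(1,3)] theta_def
  using sgf_refr[OF frame_fr_sum[OF rc(1,3)] frame_fsum[OF rc(1,3)] frame_fr_sum[OF rc(2,4), unfolded d] frame_fsum[OF rc(2,4), unfolded d] D]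
  by (simp add: d)
 also have "sgf (fdim c V + fdim c T) (fsum c V T) (fsum c W T') (dsum (fst V) (fst W) A k) = esgn c V W A * esgn c T T' k"
  unfolding esgn_def d
  by (rule sgf_dsum[OF frame_fr[OF rc(1)] frame_fr[OF rc(2), unfolded d] eqv_lin_bij[OF A r(1,2) H]
   frame_fr[OF rc(3)] frame_fr[OF rc(4), unfolded d] eqv_lin_bij[OF k r(3,4) H] subpart_sub subpart_sub])
 finally show ?thesis .
qed

lemma dsum_assoc:
 assumes "!!u. u : Rn a ==> f u : Rn n" "!!u. u : Rn b ==> g u : Rn m"
 shows "dsum (a + b) (n + m) (dsum a n f g) h u = dsum a n f (dsum b m g h) u"
proof -
 have 1: "take_vec a (take_vec (a + b) u) = take_vec a u" by (auto simp: take_vec_def)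
 have 2: "drop_vec a (take_vec (a + b) u) = take_vec b (drop_vec a u)" by (auto simp: take_vec_def drop_vec_def)
 have 3: "drop_vec b (drop_vec a u) = drop_vec (a + b) u" by (auto simp: drop_vec_def add.commute add.left_commute)
 show ?thesis
  by (rule ext) (simp add: dsum_def 1 2 3 append_vec_def, auto)
qed

text \<open>
  Both sides compare the frame of the triple sum with the sum of the three frames, which is strictly associative.
\<close>

lemma theta_cocycle:
 assumes r: "repc c V" "repc c Z" "repc c T"
 shows "theta c V Z * theta c (V +r Z) T = theta c Z T * theta c V (Z +r T)"
proof -
 let ?p = "fdim c V" and ?q = "fdim c Z" and ?s = "fdim c T"
 let ?P = "?p + ?q + ?s" and ?n = "fst V + fst Z + fst T"
 let ?S = "subpart c (V +r Z +r T)"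
 note rVZ = repc_sum[OF r(1,2)] and rZT = repc_sum[OF r(2,3)]
 define f3 where "f3 = dsum (?p + ?q) (fst V + fst Z) (fsum c V Z) (fr c T)"
 define f3' where "f3' = dsum ?p (fst V) (fr c V) (fsum c Z T)"
 have F: "frame ?p (fst V) (subpart c V) (fr c V)" "frame ?q (fst Z) (subpart c Z) (fr c Z)" "frame ?s (fst T) (subpart c T) (fr c T)"
  using frame_fr r by auto
 have f33: "f3 u = f3' u" for u
  unfolding f3_def f3'_def
  by (rule dsum_assoc) (use frame_inv(4)[OF F(1)] frame_inv(4)[OF F(2)] subpart_sub in blast)+
 note I = lin_bij_id
 have sV: "fst (V +r Z) = fst V + fst Z" "fst (Z +r T) = fst Z + fst T" by (simp_all add: rep_sum_simps)
 have G: "frame ?P ?n ?S (fr c (V +r Z +r T))"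
  using frame_fr_sum[OF rVZ r(3)] by (simp add: fdim_sum[OF r(1,2)] sV rep_sum_assoc)
 have G1: "frame ?P ?n ?S (fsum c (V +r Z) T)"
  using frame_fsum[OF rVZ r(3)] by (simp add: fdim_sum[OF r(1,2)] sV rep_sum_assoc)
 have S1: "?S = {u. EX s:subpart c (V +r Z). EX t:subpart c T. u = append_vec (fst V + fst Z) s t}"
  using subpart_sum[OF rVZ r(3)] by (simp add: sV rep_sum_assoc)
 have G3: "frame ?P ?n ?S f3"
  unfolding f3_def S1 by (rule frame_dsum[OF frame_fsum[OF r(1,2)] F(3)]) (use subpart_sub[of c "V +r Z"] sV in simp)
 have G2: "frame ?P ?n ?S (fsum c V (Z +r T))"
  using frame_fsum[OF r(1) rZT] by (simp add: fdim_sum[OF r(2,3)] sV add.assoc)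
 have G3': "frame ?P ?n ?S f3'"
  using G3 by (simp add: frame_def linear_Rn_def bij_betw_def inj_on_def image_def f33 Pi_iff)
 have comp: "sgf ?P (fr c (V +r Z +r T)) \<psi> (%u. u) = sgf ?P \<theta> \<psi> (%u. u) * sgf ?P (fr c (V +r Z +r T)) \<theta> (%u. u)"
  if "frame ?P ?n ?S \<theta>" "frame ?P ?n ?S \<psi>" for \<theta> \<psi>
  using sgf_comp[OF G that I I] by (simp add: o_def)
 have a1: "sgf ?P (fr c (V +r Z +r T)) (fsum c (V +r Z) T) (%u. u) = theta c (V +r Z) T"
  by (simp add: theta_def fdim_sum[OF r(1,2)] rep_sum_assoc)
 have a2: "sgf ?P (fr c (V +r Z +r T)) (fsum c V (Z +r T)) (%u. u) = theta c V (Z +r T)"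
  by (simp add: theta_def fdim_sum[OF r(2,3)] add.assoc)
 have dd: "(%u. u) = dsum n n (%u. u) (%u. u)" for n by (rule ext) (simp add: dsum_id)
 have b1: "sgf ?P (fsum c (V +r Z) T) f3 (%u. u) = theta c V Z"
 proof -
  have "sgf ?P (fsum c (V +r Z) T) f3 (dsum (fst V + fst Z) (fst V + fst Z) (%u. u) (%u. u)) =
    sgf (?p + ?q) (fr c (V +r Z)) (fsum c V Z) (%u. u) * sgf ?s (fr c T) (fr c T) (%u. u)"
   unfolding f3_def fdim_sum[OF r(1,2)] sV
   by (rule sgf_dsum[OF frame_fr_sum[OF r(1,2)] frame_fsum[OF r(1,2)] I F(3) F(3) I])
    (use subpart_sub[of c "V +r Z"] sV in simp_all)
  thus ?thesis using sgf_id[OF F(3)] dd by (simp add: theta_def)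
 qed
 have b2: "sgf ?P (fsum c V (Z +r T)) f3' (%u. u) = theta c Z T"
 proof -
  have "sgf (?p + (?q + ?s)) (fsum c V (Z +r T)) f3' (dsum (fst V) (fst V) (%u. u) (%u. u)) =
    sgf ?p (fr c V) (fr c V) (%u. u) * sgf (?q + ?s) (fr c (Z +r T)) (fsum c Z T) (%u. u)"
   unfolding f3'_def
   by (rule sgf_dsum[OF F(1) F(1) I frame_fr_sum[OF r(2,3)] frame_fsum[OF r(2,3)] I subpart_sub subpart_sub])
  thus ?thesis using sgf_id[OF F(1)] dd[of "fst V"] by (simp add: theta_def add.assoc)
 qed
 have "sgf ?P (fr c (V +r Z +r T)) f3 (%u. u) = sgf ?P (fr c (V +r Z +r T)) f3' (%u. u)"
  using f33 by (metis ext)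
 thus ?thesis using comp[OF G1 G3] comp[OF G2 G3'] a1 a2 b1 b2 by simp
qed

text \<open>
  The determinant of \<open>A\<close> in the frames of the summands. Measuring it there, and not in the frames of the
  sums, is what makes stabilization multiply it by a factor depending on the auxiliary data only.
\<close>

definition sg :: "bool => int rep => int rep => int rep => int rep => (rvec => rvec) => real" where
 "sg c V Z W Z' A = theta c V Z * theta c W Z' * esgn c (V +r Z) (W +r Z') A"

definition co :: "int set => int rep => int bmap => rvec => rvec" where
 "co H V f u = snd (bsec (f (bpt H V (0, u))))"

lemma co_bmk:
 assumes o: "opar H K b" and V: "orep H V" and W: "orep K W" and A: "eqv H V W A" and u: "u : Rn (fst V)"
 shows "co H V (bmk H V K W b A) u = A u"
proof -
 note oD = oparD[OF o]
 have 0: "(0 + b) mod 2 = b" using oD(4) by auto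
 have AR: "A u : Rn (fst W)" using eqvD(3)[OF A u] .
 have "bmk H V K W b A (bpt H V (0, u)) = bpt K W (b, A u)"
  using bmk_bpoint[OF o V W A _ u, of 0] 0 by simp
 moreover have "snd W 0 (A u) = A u" using W AR orth_rep_C2_iff[OF oD(2)] by blast
 ultimately show ?thesis using bsec_bpoint[OF oD(2) W oD(4) AR] oD(5) by (simp add: co_def)
qed

text \<open>The sign of a representative of a morphism of virtual bundles. The two maps of the pair share the auxiliary representations, and only the product of their signs is independent of these.\<close>

definition ps :: "bool => int vobj => int vobj => int vpair => real" where
 "ps c = (%(H, V1, V2) (K, W1, W2) (Z, Z', f1, f2).
   sg c V1 Z W1 Z' (co H (V1 +r Z) f1) * sg c V2 Z W2 Z' (co H (V2 +r Z) f2))"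

definition vob :: "int set => int rep => int rep => bool" where
 "vob H V1 V2 \<longleftrightarrow> subgroup H C2 & orep H V1 & orep H V2"

definition vpr :: "int set => int rep => int rep => int set => int rep => int rep => int => int rep => int rep =>
  (rvec => rvec) => (rvec => rvec) => int vpair" where
 "vpr H V1 V2 K W1 W2 b Z Z' A1 A2 = (Z, Z', bmk H (V1 +r Z) K (W1 +r Z') b A1, bmk H (V2 +r Z) K (W2 +r Z') b A2)"

definition vok :: "int set => int rep => int rep => int set => int rep => int rep => int rep => int rep =>
  (rvec => rvec) => (rvec => rvec) => bool" where
 "vok H V1 V2 K W1 W2 Z Z' A1 A2 \<longleftrightarrow> orep H Z & orep K Z' &
   eqv H (V1 +r Z) (W1 +r Z') A1 & eqv H (V2 +r Z) (W2 +r Z') A2"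

lemma vpairs_iff:
 assumes o: "opar H K b" and X: "vob H V1 V2" and Y: "vob K W1 W2"
 shows "p : vpairs C2 (H, V1, V2) (K, W1, W2) (otr H K b) \<longleftrightarrow>
  (EX Z Z' A1 A2. vok H V1 V2 K W1 W2 Z Z' A1 A2 & p = vpr H V1 V2 K W1 W2 b Z Z' A1 A2)"
proof -
 obtain Z Z' f1 f2 where p: "p = (Z, Z', f1, f2)" by (metis surj_pair)
 show ?thesis
 proof (cases "orep H Z & orep K Z'")
  case False
  thus ?thesis unfolding p vpairs_def vok_def vpr_def by auto
 next
  case True
  note su = orth_rep_sum[OF oparD(1)[OF o]] and su' = orth_rep_sum[OF oparD(2)[OF o]]
  have bm: "bundle_map C2 H (V +r Z) K (W +r Z') (otr H K b) f \<longleftrightarrow>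
    (EX A. eqv H (V +r Z) (W +r Z') A & f = bmk H (V +r Z) K (W +r Z') b A)"
   if "orep H V" "orep K W" for V W f
   by (rule bundle_map_iff[OF o su su']) (use that True in auto)
  have "p : vpairs C2 (H, V1, V2) (K, W1, W2) (otr H K b) \<longleftrightarrow>
    bundle_map C2 H (V1 +r Z) K (W1 +r Z') (otr H K b) f1 & bundle_map C2 H (V2 +r Z) K (W2 +r Z') (otr H K b) f2"
   using True by (simp add: p vpairs_def)
  also have "\<dots> \<longleftrightarrow> (EX A1 A2. eqv H (V1 +r Z) (W1 +r Z') A1 & f1 = bmk H (V1 +r Z) K (W1 +r Z') b A1 &
    eqv H (V2 +r Z) (W2 +r Z') A2 & f2 = bmk H (V2 +r Z) K (W2 +r Z') b A2)"
   using X Y bm[of V1 W1 f1] bm[of V2 W2 f2] by (auto simp: vob_def)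
  also have "\<dots> \<longleftrightarrow> (EX A1 A2. vok H V1 V2 K W1 W2 Z Z' A1 A2 & p = vpr H V1 V2 K W1 W2 b Z Z' A1 A2)"
   using True by (simp add: p vok_def vpr_def) blast
  also have "\<dots> \<longleftrightarrow> (EX Y Y' A1 A2. vok H V1 V2 K W1 W2 Y Y' A1 A2 & p = vpr H V1 V2 K W1 W2 b Y Y' A1 A2)"
   unfolding p vpr_def by blast
  finally show ?thesis .
 qed
qed

lemma rep_restrict: "opar H K b ==> orep K W ==> orep H W"
 using orth_rep_restrict[of K W H] oparD by blast

lemma ps_vpr:
 assumes o: "opar H K b" and X: "vob H V1 V2" and Y: "vob K W1 W2" and v: "vok H V1 V2 K W1 W2 Z Z' A1 A2" and c: "okc c H"
 shows "ps c (H, V1, V2) (K, W1, W2) (vpr H V1 V2 K W1 W2 b Z Z' A1 A2) = sg c V1 Z W1 Z' A1 * sg c V2 Z W2 Z' A2"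
proof -
 have s: "orep H (V1 +r Z)" "orep H (V2 +r Z)" "orep K (W1 +r Z')" "orep K (W2 +r Z')"
  using X Y v by (auto simp: vob_def vok_def intro: orth_rep_sum)
 have e: "eqv H (V1 +r Z) (W1 +r Z') A1" "eqv H (V2 +r Z) (W2 +r Z') A2" using v by (auto simp: vok_def)
 have "esgn c (V1 +r Z) (W1 +r Z') (co H (V1 +r Z) (bmk H (V1 +r Z) K (W1 +r Z') b A1)) = esgn c (V1 +r Z) (W1 +r Z') A1"
  by (rule esgn_cong[OF repc_of[OF s(1) oparD(1)[OF o] c]]) (rule co_bmk[OF o s(1,3) e(1)])
 moreover have "esgn c (V2 +r Z) (W2 +r Z') (co H (V2 +r Z) (bmk H (V2 +r Z) K (W2 +r Z') b A2)) = esgn c (V2 +r Z) (W2 +r Z') A2"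
  by (rule esgn_cong[OF repc_of[OF s(2) oparD(1)[OF o] c]]) (rule co_bmk[OF o s(2,4) e(2)])
 ultimately show ?thesis by (simp add: ps_def vpr_def sg_def)
qed

text \<open>
  The factor depends on the auxiliary data alone, so it occurs twice, and cancels, in the product over the two members
  of a pair.
\<close>

lemma sg_stabilize:
 assumes A: "eqv H (V +r Z) (W +r Z') A" and k: "eqv H T T' k"
  and r: "orep H V" "orep H Z" "orep H W" "orep H Z'" "orep H T" "orep H T'"
  and H: "subgroup H C2" "okc c H"
 shows "sg c V (Z +r T) W (Z' +r T') (dsum (fst (V +r Z)) (fst (W +r Z')) A k) =
  (theta c Z T * theta c Z' T' * esgn c T T' k) * sg c V Z W Z' A"
proof -
 have rc: "repc c V" "repc c Z" "repc c W" "repc c Z'" "repc c T" "repc c T'" using repc_of[OF _ H] r by auto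
 note su = orth_rep_sum[OF H(1)]
 have e: "esgn c (V +r Z +r T) (W +r Z' +r T') (dsum (fst (V +r Z)) (fst (W +r Z')) A k) =
   theta c (V +r Z) T * theta c (W +r Z') T' * (esgn c (V +r Z) (W +r Z') A * esgn c T T' k)"
  using esgn_dsum[OF A k su[OF r(1,2)] su[OF r(3,4)] r(5,6) H] by (simp only: rep_sum_assoc)
 have c1: "theta c V (Z +r T) * theta c (V +r Z) T = theta c Z T * theta c V Z"
  using theta_cocycle[OF rc(1,2,5)] theta_values[OF rc(1) repc_sum[OF rc(2,5)]] theta_values[OF rc(1,2)]
   theta_values[OF rc(2,5)] theta_values[OF repc_sum[OF rc(1,2)] rc(5)] by auto
 have c2: "theta c W (Z' +r T') * theta c (W +r Z') T' = theta c Z' T' * theta c W Z'"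
  using theta_cocycle[OF rc(3,4,6)] theta_values[OF rc(3) repc_sum[OF rc(4,6)]] theta_values[OF rc(3,4)]
   theta_values[OF rc(4,6)] theta_values[OF repc_sum[OF rc(3,4)] rc(6)] by auto
 have "sg c V (Z +r T) W (Z' +r T') (dsum (fst (V +r Z)) (fst (W +r Z')) A k) =
   (theta c V (Z +r T) * theta c (V +r Z) T) * (theta c W (Z' +r T') * theta c (W +r Z') T') *
   (esgn c (V +r Z) (W +r Z') A * esgn c T T' k)"
  unfolding sg_def e by (simp add: mult_ac)
 thus ?thesis unfolding c1 c2 sg_def by (simp add: mult_ac)
qed

lemma sg_change:
 assumes A: "eqv H (V +r Z) (W +r Z') A" and j: "eqv H U Z j" and k: "eqv H Z' U' k"
  and r: "orep H V" "orep H Z" "orep H W" "orep H Z'" "orep H U" "orep H U'"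
  and H: "subgroup H C2" "okc c H"
 shows "sg c V U W U' (dsum (fst W) (fst W) (%u. u) k o (A o dsum (fst V) (fst V) (%u. u) j)) =
  (esgn c U Z j * esgn c Z' U' k) * sg c V Z W Z' A"
  "eqv H (V +r U) (W +r U') (dsum (fst W) (fst W) (%u. u) k o (A o dsum (fst V) (fst V) (%u. u) j))"
proof -
 have rc: "repc c V" "repc c Z" "repc c W" "repc c Z'" "repc c U" "repc c U'" using repc_of[OF _ H] r by auto
 note su = orth_rep_sum[OF H(1)]
 have J: "eqv H (V +r U) (V +r Z) (dsum (fst V) (fst V) (%u. u) j)" by (rule eqv_dsum[OF eqv_id j r(1,5) H(1)])
 have K: "eqv H (W +r Z') (W +r U') (dsum (fst W) (fst W) (%u. u) k)" by (rule eqv_dsum[OF eqv_id k r(3,4) H(1)])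
 have AJ: "eqv H (V +r U) (W +r Z') (A o dsum (fst V) (fst V) (%u. u) j)" by (rule eqv_comp[OF J A])
 show "eqv H (V +r U) (W +r U') (dsum (fst W) (fst W) (%u. u) k o (A o dsum (fst V) (fst V) (%u. u) j))"
  by (rule eqv_comp[OF AJ K])
 have sq: "t * t = 1" if "t : {1, -1 :: real}" for t using that by auto
 have e1: "esgn c (V +r U) (W +r U') (dsum (fst W) (fst W) (%u. u) k o (A o dsum (fst V) (fst V) (%u. u) j)) =
   esgn c (W +r Z') (W +r U') (dsum (fst W) (fst W) (%u. u) k) * (esgn c (V +r Z) (W +r Z') A *
   esgn c (V +r U) (V +r Z) (dsum (fst V) (fst V) (%u. u) j))"
  unfolding esgn_comp[OF AJ K su[OF r(1,5)] su[OF r(3,4)] su[OF r(3,6)] H]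
   esgn_comp[OF J A su[OF r(1,5)] su[OF r(1,2)] su[OF r(3,4)] H] ..
 have e2: "esgn c (V +r U) (V +r Z) (dsum (fst V) (fst V) (%u. u) j) = theta c V U * theta c V Z * esgn c U Z j"
  using esgn_dsum[OF eqv_id j r(1,1,5,2) H] esgn_id[OF rc(1)] by simp
 have e3: "esgn c (W +r Z') (W +r U') (dsum (fst W) (fst W) (%u. u) k) = theta c W Z' * theta c W U' * esgn c Z' U' k"
  using esgn_dsum[OF eqv_id k r(3,3,4,6) H] esgn_id[OF rc(3)] by simp
 have "sg c V U W U' (dsum (fst W) (fst W) (%u. u) k o (A o dsum (fst V) (fst V) (%u. u) j)) =
  (theta c V U * theta c V U) * (theta c W U' * theta c W U') * (esgn c U Z j * esgn c Z' U' k) * sg c V Z W Z' A"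
  unfolding sg_def e1 e2 e3 by (simp only: mult_ac)
 thus "sg c V U W U' (dsum (fst W) (fst W) (%u. u) k o (A o dsum (fst V) (fst V) (%u. u) j)) =
  (esgn c U Z j * esgn c Z' U' k) * sg c V Z W Z' A"
  using sq[OF theta_values[OF rc(1,5)]] sq[OF theta_values[OF rc(3,6)]] by simp
qed

lemma square_cancel: "t * t = 1 ==> (t * a) * (t * b) = a * (b :: real)"
 by (metis mult.assoc mult.left_commute mult_1)

definition chg :: "int rep => int rep => (rvec => rvec) => (rvec => rvec) => (rvec => rvec) => rvec => rvec" where
 "chg V W j k A = dsum (fst W) (fst W) (%u. u) k o (A o dsum (fst V) (fst V) (%u. u) j)"

lemma bmk_change:
 assumes o: "opar H K b" and r: "orep H V" "orep H Z" "orep H U" "orep K W" "orep K Z'" "orep K U'"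
  and A: "eqv H (V +r Z) (W +r Z') A" and j: "eqv H U Z j" and k: "eqv K Z' U' k"
 shows "compose (bpoints C2 H (V +r U)) (bmap_sum C2 K W Z' (fst W) (bid C2 K W) (bmk K Z' K U' 0 k) o bmk H (V +r Z) K (W +r Z') b A)
   (bmap_sum C2 H V U (fst V) (bid C2 H V) (bmk H U H Z 0 j)) = bmk H (V +r U) K (W +r U') b (chg V W j k A)"
proof -
 note oD = oparD[OF o]
 note oH = idt_orbit(2)[OF oD(1)] and oK = idt_orbit(2)[OF oD(2)]
 note su = orth_rep_sum[OF oD(1)] and su' = orth_rep_sum[OF oD(2)]
 have J: "eqv H (V +r U) (V +r Z) (dsum (fst V) (fst V) (%u. u) j)" by (rule eqv_dsum[OF eqv_id j r(1,3) oD(1)])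
 have K: "eqv K (W +r Z') (W +r U') (dsum (fst W) (fst W) (%u. u) k)" by (rule eqv_dsum[OF eqv_id k r(4,5) oD(2)])
 have 1: "bmap_sum C2 H V U (fst V) (bid C2 H V) (bmk H U H Z 0 j) = bmk H (V +r U) H (V +r Z) 0 (dsum (fst V) (fst V) (%u. u) j)"
  unfolding bid_bmk[OF oD(1) r(1)] by (rule bmk_sum[OF oH r(1,3,1,2) eqv_id j])
 have 2: "bmap_sum C2 K W Z' (fst W) (bid C2 K W) (bmk K Z' K U' 0 k) = bmk K (W +r Z') K (W +r U') 0 (dsum (fst W) (fst W) (%u. u) k)"
  unfolding bid_bmk[OF oD(2) r(4)] by (rule bmk_sum[OF oK r(4,5,4,6) eqv_id k])
 have b1: "ooff K 0 b = b" "ooff K b 0 = b" using oD by (auto simp: ooff_def)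
 have t: "otw H K X 0 = (%u. u)" "otw K K X b = (%u. u)" for X by (auto simp: otw_def)
 note c1 = bmk_compose[OF oH o su[OF r(1,3)] su[OF r(1,2)] su'[OF r(4,5)] J A, unfolded b1 t]
 note c2 = bmk_compose[OF o oK su[OF r(1,3)] su'[OF r(4,5)] su'[OF r(4,6)] c1(2) K, unfolded b1 t]
 have cc: "compose S (g o f) h = compose S g (compose S f h)" for S :: "(int \<times> rvec) set set" and g f h :: "int bmap"
  by (simp add: compose_def fun_eq_iff restrict_def)
 show ?thesis unfolding 1 2 cc c1(1) c2(1) by (simp add: chg_def o_def)
qed

lemma stabilize_vpr:
 assumes o: "opar H K b" and X: "vob H V1 V2" and Y: "vob K W1 W2" and v: "vok H V1 V2 K W1 W2 Z Z' A1 A2"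
  and T: "orep H T" "orep K T'" "eqv H T T' k"
 shows "((fst (vpr H V1 V2 K W1 W2 b Z Z' A1 A2)) +r T, Z' +r T',
   bmap_sum C2 H (V1 +r Z) T (fst (W1 +r Z')) (bmk H (V1 +r Z) K (W1 +r Z') b A1) (bmk H T K T' b k),
   bmap_sum C2 H (V2 +r Z) T (fst (W2 +r Z')) (bmk H (V2 +r Z) K (W2 +r Z') b A2) (bmk H T K T' b k)) =
  vpr H V1 V2 K W1 W2 b (Z +r T) (Z' +r T') (dsum (fst (V1 +r Z)) (fst (W1 +r Z')) A1 k) (dsum (fst (V2 +r Z)) (fst (W2 +r Z')) A2 k)" (is ?A)
  "vok H V1 V2 K W1 W2 (Z +r T) (Z' +r T') (dsum (fst (V1 +r Z)) (fst (W1 +r Z')) A1 k) (dsum (fst (V2 +r Z)) (fst (W2 +r Z')) A2 k)" (is ?B)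
proof -
 note su = orth_rep_sum[OF oparD(1)[OF o]] and su' = orth_rep_sum[OF oparD(2)[OF o]]
 have r: "orep H V1" "orep H V2" "orep K W1" "orep K W2" "orep H Z" "orep K Z'"
  and e: "eqv H (V1 +r Z) (W1 +r Z') A1" "eqv H (V2 +r Z) (W2 +r Z') A2"
  using X Y v by (auto simp: vob_def vok_def)
 show ?A
  using bmk_sum[OF o su[OF r(1,5)] T(1) su'[OF r(3,6)] T(2) e(1) T(3)] bmk_sum[OF o su[OF r(2,5)] T(1) su'[OF r(4,6)] T(2) e(2) T(3)]
  by (simp add: vpr_def rep_sum_assoc)
 show ?B
  unfolding vok_def rep_sum_assoc[symmetric]
  using su[OF r(5) T(1)] su'[OF r(6) T(2)] eqv_dsum[OF e(1) T(3) su[OF r(1,5)] T(1) oparD(1)[OF o]]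
   eqv_dsum[OF e(2) T(3) su[OF r(2,5)] T(1) oparD(1)[OF o]] by blast
qed

lemma change_vpr:
 assumes o: "opar H K b" and X: "vob H V1 V2" and Y: "vob K W1 W2" and v: "vok H V1 V2 K W1 W2 Z Z' A1 A2"
  and U: "orep H U" "orep K U'" and j: "eqv H U Z j" and k: "eqv K Z' U' k"
 shows "(U, U',
    compose (bpoints C2 H (V1 +r U)) (bmap_sum C2 K W1 Z' (fst W1) (bid C2 K W1) (bmk K Z' K U' 0 k) o bmk H (V1 +r Z) K (W1 +r Z') b A1)
     (bmap_sum C2 H V1 U (fst V1) (bid C2 H V1) (bmk H U H Z 0 j)),
    compose (bpoints C2 H (V2 +r U)) (bmap_sum C2 K W2 Z' (fst W2) (bid C2 K W2) (bmk K Z' K U' 0 k) o bmk H (V2 +r Z) K (W2 +r Z') b A2)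
     (bmap_sum C2 H V2 U (fst V2) (bid C2 H V2) (bmk H U H Z 0 j))) =
   vpr H V1 V2 K W1 W2 b U U' (chg V1 W1 j k A1) (chg V2 W2 j k A2)" (is ?A)
  "vok H V1 V2 K W1 W2 U U' (chg V1 W1 j k A1) (chg V2 W2 j k A2)" (is ?B)
proof -
 have r: "orep H V1" "orep H V2" "orep K W1" "orep K W2" "orep H Z" "orep K Z'"
  and e: "eqv H (V1 +r Z) (W1 +r Z') A1" "eqv H (V2 +r Z) (W2 +r Z') A2"
  using X Y v by (auto simp: vob_def vok_def)
 show ?A unfolding bmk_change[OF o r(1,5) U(1) r(3,6) U(2) e(1) j k] bmk_change[OF o r(2,5) U(1) r(4,6) U(2) e(2) j k] vpr_def ..
 note rr = rep_restrict[OF o]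
 note kH = eqv_mono[OF k oparD(3)[OF o]]
 show ?B unfolding vok_def chg_def
  using U sg_change(2)[OF e(1) j kH r(1,5) rr[OF r(3)] rr[OF r(6)] U(1) rr[OF U(2)] oparD(1)[OF o], of False]
   sg_change(2)[OF e(2) j kH r(2,5) rr[OF r(4)] rr[OF r(6)] U(1) rr[OF U(2)] oparD(1)[OF o], of False] by simp
qed

lemma ps_stabilize:
 assumes o: "opar H K b" and X: "vob H V1 V2" and Y: "vob K W1 W2" and v: "vok H V1 V2 K W1 W2 Z Z' A1 A2"
  and T: "orep H T" "orep K T'" "eqv H T T' k" and c: "okc c H"
 shows "ps c (H, V1, V2) (K, W1, W2) (vpr H V1 V2 K W1 W2 b (Z +r T) (Z' +r T') (dsum (fst (V1 +r Z)) (fst (W1 +r Z')) A1 k) (dsum (fst (V2 +r Z)) (fst (W2 +r Z')) A2 k)) =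
  ps c (H, V1, V2) (K, W1, W2) (vpr H V1 V2 K W1 W2 b Z Z' A1 A2)"
proof -
 have r: "orep H V1" "orep H V2" "orep K W1" "orep K W2" "orep H Z" "orep K Z'"
  and e: "eqv H (V1 +r Z) (W1 +r Z') A1" "eqv H (V2 +r Z) (W2 +r Z') A2"
  using X Y v by (auto simp: vob_def vok_def)
 note rr = rep_restrict[OF o] and H = oparD(1)[OF o]
 let ?t = "theta c Z T * theta c Z' T' * esgn c T T' k"
 have "?t : {1, -1}"
  using theta_values[OF repc_of[OF r(5) H c] repc_of[OF T(1) H c]] theta_values[OF repc_of[OF rr[OF r(6)] H c] repc_of[OF rr[OF T(2)] H c]]
   esgn_values[OF T(3,1) rr[OF T(2)] H c] by auto
 hence t: "?t * ?t = 1" by auto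
 show ?thesis
  unfolding ps_vpr[OF o X Y stabilize_vpr(2)[OF o X Y v T] c] ps_vpr[OF o X Y v c]
   sg_stabilize[OF e(1) T(3) r(1,5) rr[OF r(3)] rr[OF r(6)] T(1) rr[OF T(2)] H c]
   sg_stabilize[OF e(2) T(3) r(2,5) rr[OF r(4)] rr[OF r(6)] T(1) rr[OF T(2)] H c]
  by (rule square_cancel[OF t])
qed

lemma ps_change:
 assumes o: "opar H K b" and X: "vob H V1 V2" and Y: "vob K W1 W2" and v: "vok H V1 V2 K W1 W2 Z Z' A1 A2"
  and U: "orep H U" "orep K U'" and j: "eqv H U Z j" and k: "eqv K Z' U' k" and c: "okc c H"
 shows "ps c (H, V1, V2) (K, W1, W2) (vpr H V1 V2 K W1 W2 b U U' (chg V1 W1 j k A1) (chg V2 W2 j k A2)) =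
  ps c (H, V1, V2) (K, W1, W2) (vpr H V1 V2 K W1 W2 b Z Z' A1 A2)"
  "sg c V1 U W1 U' (chg V1 W1 j k A1) = (esgn c U Z j * esgn c Z' U' k) * sg c V1 Z W1 Z' A1"
  "sg c V2 U W2 U' (chg V2 W2 j k A2) = (esgn c U Z j * esgn c Z' U' k) * sg c V2 Z W2 Z' A2"
proof -
 have r: "orep H V1" "orep H V2" "orep K W1" "orep K W2" "orep H Z" "orep K Z'"
  and e: "eqv H (V1 +r Z) (W1 +r Z') A1" "eqv H (V2 +r Z) (W2 +r Z') A2"
  using X Y v by (auto simp: vob_def vok_def)
 note rr = rep_restrict[OF o] and H = oparD(1)[OF o]
 note kH = eqv_mono[OF k oparD(3)[OF o]]
 let ?t = "esgn c U Z j * esgn c Z' U' k"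
 have "?t : {1, -1}"
  using esgn_values[OF j U(1) r(5) H c] esgn_values[OF kH rr[OF r(6)] rr[OF U(2)] H c] by auto
 hence t: "?t * ?t = 1" by auto
 show s1: "sg c V1 U W1 U' (chg V1 W1 j k A1) = ?t * sg c V1 Z W1 Z' A1"
  unfolding chg_def by (rule sg_change(1)[OF e(1) j kH r(1,5) rr[OF r(3)] rr[OF r(6)] U(1) rr[OF U(2)] H c])
 show s2: "sg c V2 U W2 U' (chg V2 W2 j k A2) = ?t * sg c V2 Z W2 Z' A2"
  unfolding chg_def by (rule sg_change(1)[OF e(2) j kH r(2,5) rr[OF r(4)] rr[OF r(6)] U(1) rr[OF U(2)] H c])
 show "ps c (H, V1, V2) (K, W1, W2) (vpr H V1 V2 K W1 W2 b U U' (chg V1 W1 j k A1) (chg V2 W2 j k A2)) =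
  ps c (H, V1, V2) (K, W1, W2) (vpr H V1 V2 K W1 W2 b Z Z' A1 A2)"
  unfolding ps_vpr[OF o X Y change_vpr(2)[OF o X Y v U j k] c] ps_vpr[OF o X Y v c] s1 s2
  by (rule square_cancel[OF t])
qed

text \<open>
  Homotopies preserve both factors of a sign, while stabilization and change of the auxiliary representations multiply
  both factors by the same number. So the product of the two factors is an invariant of the class.
\<close>

lemma vpair_rel_sound:
 assumes o: "opar H K b" and X: "vob H V1 V2" and Y: "vob K W1 W2"
  and rel: "(p, q) : vpair_rel C2 (H, V1, V2) (K, W1, W2) (otr H K b)"
 shows "p : vpairs C2 (H, V1, V2) (K, W1, W2) (otr H K b) & q : vpairs C2 (H, V1, V2) (K, W1, W2) (otr H K b) &
  (ALL c. okc c H --> ps c (H, V1, V2) (K, W1, W2) p = ps c (H, V1, V2) (K, W1, W2) q)"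
 using rel
proof (induction rule: vpair_rel.induct)
 case (homotopy H' V1' V2' K' W1' W2' Z Z' f1 f2 f1' f2')
 note su = orth_rep_sum[OF oparD(1)[OF o]] and su' = orth_rep_sum[OF oparD(2)[OF o]]
 have eqs: "H' = H" "V1' = V1" "V2' = V2" "K' = K" "W1' = W1" "W2' = W2" using homotopy(1,2) by auto
 note hom = homotopy(3-5)[unfolded eqs]
 have Z: "orep H Z" "orep K Z'" using hom(1) by (auto simp: vpairs_def)
 have r: "orep H V1" "orep H V2" "orep K W1" "orep K W2" using X Y by (auto simp: vob_def)
 obtain A1 B1 where 1: "eqv H (V1 +r Z) (W1 +r Z') A1" "eqv H (V1 +r Z) (W1 +r Z') B1"
   "f1 = bmk H (V1 +r Z) K (W1 +r Z') b A1" "f1' = bmk H (V1 +r Z) K (W1 +r Z') b B1"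
   "lin_path (fst (V1 +r Z)) (eqv H (V1 +r Z) (W1 +r Z')) A1 B1"
  using path_if_bundle_homotopic[OF o su[OF r(1) Z(1)] su'[OF r(3) Z(2)] hom(2)] by blast
 obtain A2 B2 where 2: "eqv H (V2 +r Z) (W2 +r Z') A2" "eqv H (V2 +r Z) (W2 +r Z') B2"
   "f2 = bmk H (V2 +r Z) K (W2 +r Z') b A2" "f2' = bmk H (V2 +r Z) K (W2 +r Z') b B2"
   "lin_path (fst (V2 +r Z)) (eqv H (V2 +r Z) (W2 +r Z')) A2 B2"
  using path_if_bundle_homotopic[OF o su[OF r(2) Z(1)] su'[OF r(4) Z(2)] hom(3)] by blast
 have p: "(Z, Z', f1, f2) = vpr H V1 V2 K W1 W2 b Z Z' A1 A2" "(Z, Z', f1', f2') = vpr H V1 V2 K W1 W2 b Z Z' B1 B2"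
  using 1 2 by (auto simp: vpr_def)
 have v: "vok H V1 V2 K W1 W2 Z Z' A1 A2" "vok H V1 V2 K W1 W2 Z Z' B1 B2" using 1 2 Z by (auto simp: vok_def)
 have "ps c (H, V1, V2) (K, W1, W2) (Z, Z', f1, f2) = ps c (H, V1, V2) (K, W1, W2) (Z, Z', f1', f2')" if c: "okc c H" for c
 proof -
  note rr = rep_restrict[OF o] and H = oparD(1)[OF o]
  have "sg c V1 Z W1 Z' A1 = sg c V1 Z W1 Z' B1" "sg c V2 Z W2 Z' A2 = sg c V2 Z W2 Z' B2"
   unfolding sg_def
   using esgn_path[OF 1(5) su[OF r(1) Z(1)] rr[OF su'[OF r(3) Z(2)]] H c 1(1)]
    esgn_path[OF 2(5) su[OF r(2) Z(1)] rr[OF su'[OF r(4) Z(2)]] H c 2(1)] by auto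
  thus ?thesis unfolding p ps_vpr[OF o X Y v(1) c] ps_vpr[OF o X Y v(2) c] by simp
 qed
 moreover have "(Z, Z', f1, f2) : vpairs C2 (H, V1, V2) (K, W1, W2) (otr H K b)"
   "(Z, Z', f1', f2') : vpairs C2 (H, V1, V2) (K, W1, W2) (otr H K b)"
  unfolding p vpairs_iff[OF o X Y] using v by blast+
 ultimately show ?case by blast
next
 case (stabilize H' V1' V2' K' W1' W2' Z Z' f1 f2 T T' k)
 have eqs: "H' = H" "V1' = V1" "V2' = V2" "K' = K" "W1' = W1" "W2' = W2" using stabilize(1,2) by auto
 note s = stabilize(3-6)[unfolded eqs]
 obtain A1 A2 where v: "vok H V1 V2 K W1 W2 Z Z' A1 A2" and p: "(Z, Z', f1, f2) = vpr H V1 V2 K W1 W2 b Z Z' A1 A2"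
  using s(1) unfolding vpairs_iff[OF o X Y] by (auto simp: vpr_def)
 obtain \<kappa> where k: "eqv H T T' \<kappa>" "k = bmk H T K T' b \<kappa>" using s(4) bundle_map_iff[OF o s(2,3)] by blast
 have f: "f1 = bmk H (V1 +r Z) K (W1 +r Z') b A1" "f2 = bmk H (V2 +r Z) K (W2 +r Z') b A2"
  using p by (auto simp: vpr_def)
 note st = stabilize_vpr[OF o X Y v s(2,3) k(1)]
 have q: "(Z +r T, Z' +r T', bmap_sum C2 H (V1 +r Z) T (fst (W1 +r Z')) f1 k, bmap_sum C2 H (V2 +r Z) T (fst (W2 +r Z')) f2 k) =
   vpr H V1 V2 K W1 W2 b (Z +r T) (Z' +r T') (dsum (fst (V1 +r Z)) (fst (W1 +r Z')) A1 \<kappa>) (dsum (fst (V2 +r Z)) (fst (W2 +r Z')) A2 \<kappa>)"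
  using st(1) by (simp add: f k(2) vpr_def)
 show ?case
  unfolding eqs q p using ps_stabilize[OF o X Y v s(2,3) k(1)] vpairs_iff[OF o X Y] v st(2) by metis
next
 case (change H' V1' V2' K' W1' W2' Z Z' f1 f2 U j U' k)
 have eqs: "H' = H" "V1' = V1" "V2' = V2" "K' = K" "W1' = W1" "W2' = W2" using change(1,2) by auto
 note s = change(3-7)[unfolded eqs]
 obtain A1 A2 where v: "vok H V1 V2 K W1 W2 Z Z' A1 A2" and p: "(Z, Z', f1, f2) = vpr H V1 V2 K W1 W2 b Z Z' A1 A2"
  using s(1) unfolding vpairs_iff[OF o X Y] by (auto simp: vpr_def)
 have Z: "orep H Z" "orep K Z'" using v by (auto simp: vok_def)
 note oD = oparD[OF o]
 obtain \<iota> where j: "eqv H U Z \<iota>" "j = bmk H U H Z 0 \<iota>"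
  using s(3) bundle_map_iff[OF idt_orbit(2)[OF oD(1)] s(2) Z(1)] unfolding idt_orbit(1)[OF oD(1)] by blast
 obtain \<kappa> where k: "eqv K Z' U' \<kappa>" "k = bmk K Z' K U' 0 \<kappa>"
  using s(5) bundle_map_iff[OF idt_orbit(2)[OF oD(2)] Z(2) s(4)] unfolding idt_orbit(1)[OF oD(2)] by blast
 have f: "f1 = bmk H (V1 +r Z) K (W1 +r Z') b A1" "f2 = bmk H (V2 +r Z) K (W2 +r Z') b A2"
  using p by (auto simp: vpr_def)
 note ch = change_vpr[OF o X Y v s(2,4) j(1) k(1)]
 show ?case
  unfolding eqs j(2) k(2) f ch(1) unfolding vpr_def[symmetric]
  using ps_change(1)[OF o X Y v s(2,4) j(1) k(1)] vpairs_iff[OF o X Y] v ch(2) by metis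
qed auto

lemma pdim_sum: "orep H V ==> orep H W ==> subgroup H C2 ==> pdim H (V +r W) = pdim H V + pdim H W"
 unfolding pdim_def by (rule fdim_sum) (auto intro: repc_of)

lemma pdim_le: "orep H V ==> subgroup H C2 ==> pdim H V <= fst V"
 using splits_exists[of H V] splits_frame(3) by fastforce

lemma pdim_trivial: "orep H V ==> subgroup H C2 ==> 1 ~: H ==> pdim H V = fst V"
 unfolding pdim_def using fdim_False repc_of[of H V False] by simp

lemma pdim_std:
 assumes H: "subgroup H C2"
 shows "pdim H (std_rep p q) = (if 1 : H then p else p + q)"
proof (cases "1 : H")
 case False
 thus ?thesis using pdim_trivial[OF orth_rep_std[OF H] H] by simp
next
 case True
 have "snd (std_rep p q) 1 u = dsum p p (%u. u) (%u i. - u i) u" if "u : Rn (p + q)" for u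
  using that by (auto simp: std_rep_def dsum_def append_vec_def take_vec_def drop_vec_def)
 hence "splits H (std_rep p q) p q (%u. u)"
  using True linear_iso_Rn_id by (simp add: splits_def)
 thus ?thesis using splits_frame(2) orth_rep_std[OF H] H True by simp
qed

lemma eqv_pdim:
 assumes "eqv H V W A" "orep H V" "orep H W" "subgroup H C2"
 shows "pdim H V = pdim H W"
 unfolding pdim_def by (rule eqv_fdim[OF assms]) simp

lemma vok_reps:
 assumes "opar H K b" "vob H V1 V2" "vob K W1 W2" "vok H V1 V2 K W1 W2 Z Z' A1 A2"
 shows "orep H V1" "orep H V2" "orep H Z" "orep K W1" "orep K W2" "orep K Z'"
  "orep H W1" "orep H W2" "orep H Z'"
  "eqv H (V1 +r Z) (W1 +r Z') A1" "eqv H (V2 +r Z) (W2 +r Z') A2"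
  "fst V1 + fst Z = fst W1 + fst Z'" "fst V2 + fst Z = fst W2 + fst Z'"
  "pdim H V1 + pdim H Z = pdim H W1 + pdim H Z'" "pdim H V2 + pdim H Z = pdim H W2 + pdim H Z'"
proof -
 note rr = rep_restrict[OF assms(1)] and H = oparD(1)[OF assms(1)]
 show r: "orep H V1" "orep H V2" "orep H Z" "orep K W1" "orep K W2" "orep K Z'"
  and e: "eqv H (V1 +r Z) (W1 +r Z') A1" "eqv H (V2 +r Z) (W2 +r Z') A2"
  using assms by (auto simp: vob_def vok_def)
 show r': "orep H W1" "orep H W2" "orep H Z'" using rr r by auto
 show "fst V1 + fst Z = fst W1 + fst Z'" "fst V2 + fst Z = fst W2 + fst Z'"
  using eqvD(4)[OF e(1)] eqvD(4)[OF e(2)] by (auto simp: rep_sum_simps)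
 note su = orth_rep_sum[OF H]
 show "pdim H V1 + pdim H Z = pdim H W1 + pdim H Z'"
  using eqv_pdim[OF e(1) su[OF r(1,3)] su[OF r'(1,3)] H] by (simp add: pdim_sum[OF r(1,3) H] pdim_sum[OF r'(1,3) H])
 show "pdim H V2 + pdim H Z = pdim H W2 + pdim H Z'"
  using eqv_pdim[OF e(2) su[OF r(2,3)] su[OF r'(2,3)] H] by (simp add: pdim_sum[OF r(2,3) H] pdim_sum[OF r'(2,3) H])
qed

lemma sg_values:
 assumes e: "eqv H (V +r Z) (W +r Z') A" and r: "orep H V" "orep H Z" "orep H W" "orep H Z'"
  and H: "subgroup H C2" "okc c H"
 shows "sg c V Z W Z' A : {1, -1}"
 unfolding sg_def
 using theta_values[OF repc_of[OF r(1) H] repc_of[OF r(2) H]] theta_values[OF repc_of[OF r(3) H] repc_of[OF r(4) H]]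
  esgn_values[OF e orth_rep_sum[OF H(1) r(1,2)] orth_rep_sum[OF H(1) r(3,4)] H] by auto

lemma rel_stabilize:
 assumes o: "opar H K b" and X: "vob H V1 V2" and Y: "vob K W1 W2" and v: "vok H V1 V2 K W1 W2 Z Z' A1 A2"
  and T: "orep H T" "orep K T'" "eqv H T T' k"
 shows "(vpr H V1 V2 K W1 W2 b Z Z' A1 A2, vpr H V1 V2 K W1 W2 b (Z +r T) (Z' +r T')
   (dsum (fst (V1 +r Z)) (fst (W1 +r Z')) A1 k) (dsum (fst (V2 +r Z)) (fst (W2 +r Z')) A2 k)) : vpair_rel C2 (H, V1, V2) (K, W1, W2) (otr H K b)"
proof -
 have "vpr H V1 V2 K W1 W2 b Z Z' A1 A2 : vpairs C2 (H, V1, V2) (K, W1, W2) (otr H K b)"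
  using vpairs_iff[OF o X Y] v by blast
 from vpair_rel.stabilize[OF HOL.refl HOL.refl this[unfolded vpr_def] T(1,2) bundle_map_bmk[OF o T]]
 show ?thesis using stabilize_vpr(1)[OF o X Y v T] by (simp add: vpr_def)
qed

lemma rel_change:
 assumes o: "opar H K b" and X: "vob H V1 V2" and Y: "vob K W1 W2" and v: "vok H V1 V2 K W1 W2 Z Z' A1 A2"
  and U: "orep H U" "orep K U'" and j: "eqv H U Z j" and k: "eqv K Z' U' k"
 shows "(vpr H V1 V2 K W1 W2 b Z Z' A1 A2, vpr H V1 V2 K W1 W2 b U U' (chg V1 W1 j k A1) (chg V2 W2 j k A2))
   : vpair_rel C2 (H, V1, V2) (K, W1, W2) (otr H K b)"
proof -
 have 1: "vpr H V1 V2 K W1 W2 b Z Z' A1 A2 : vpairs C2 (H, V1, V2) (K, W1, W2) (otr H K b)"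
  using vpairs_iff[OF o X Y] v by blast
 have Z: "orep H Z" "orep K Z'" using v by (auto simp: vok_def)
 note oD = oparD[OF o]
 have j': "bundle_map C2 H U H Z (idt (orbit_cat C2) H) (bmk H U H Z 0 j)"
  unfolding idt_orbit(1)[OF oD(1)] by (rule bundle_map_bmk[OF idt_orbit(2)[OF oD(1)] U(1) Z(1) j])
 have k': "bundle_map C2 K Z' K U' (idt (orbit_cat C2) K) (bmk K Z' K U' 0 k)"
  unfolding idt_orbit(1)[OF oD(2)] by (rule bundle_map_bmk[OF idt_orbit(2)[OF oD(2)] Z(2) U(2) k])
 from vpair_rel.change[OF HOL.refl HOL.refl 1[unfolded vpr_def] U(1) j' U(2) k']
 show ?thesis unfolding change_vpr(1)[OF o X Y v U j k] unfolding vpr_def .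
qed

lemma rel_same_aux:
 assumes o: "opar H K b" and X: "vob H V1 V2" and Y: "vob K W1 W2"
  and v: "vok H V1 V2 K W1 W2 Z Z' A1 A2" and w: "vok H V1 V2 K W1 W2 Z Z' B1 B2"
  and s: "!!c. okc c H ==> sg c V1 Z W1 Z' A1 = sg c V1 Z W1 Z' B1 & sg c V2 Z W2 Z' A2 = sg c V2 Z W2 Z' B2"
 shows "(vpr H V1 V2 K W1 W2 b Z Z' A1 A2, vpr H V1 V2 K W1 W2 b Z Z' B1 B2) : vpair_rel C2 (H, V1, V2) (K, W1, W2) (otr H K b)"
proof -
 note r = vok_reps[OF o X Y v] and r' = vok_reps[OF o X Y w]
 note H = oparD(1)[OF o]
 note su = orth_rep_sum[OF H] and su' = orth_rep_sum[OF oparD(2)[OF o]]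
 have es: "esgn c (V1 +r Z) (W1 +r Z') A1 = esgn c (V1 +r Z) (W1 +r Z') B1 &
   esgn c (V2 +r Z) (W2 +r Z') A2 = esgn c (V2 +r Z) (W2 +r Z') B2" if c: "okc c H" for c
 proof -
  have "theta c V1 Z ~= 0" "theta c W1 Z' ~= 0" "theta c V2 Z ~= 0" "theta c W2 Z' ~= 0"
   using theta_values[OF repc_of[OF r(1) H c] repc_of[OF r(3) H c]] theta_values[OF repc_of[OF r(2) H c] repc_of[OF r(3) H c]]
    theta_values[OF repc_of[OF r(7) H c] repc_of[OF r(9) H c]] theta_values[OF repc_of[OF r(8) H c] repc_of[OF r(9) H c]] by auto
  thus ?thesis using s[OF c] by (simp add: sg_def)
 qed
 have p1: "lin_path (fst (V1 +r Z)) (eqv H (V1 +r Z) (W1 +r Z')) A1 B1"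
  by (rule eqv_path_if_esgn_eq[OF r(10) r'(10) su[OF r(1,3)] su[OF r(7,9)] H]) (use es in blast)
 have p2: "lin_path (fst (V2 +r Z)) (eqv H (V2 +r Z) (W2 +r Z')) A2 B2"
  by (rule eqv_path_if_esgn_eq[OF r(11) r'(11) su[OF r(2,3)] su[OF r(8,9)] H]) (use es in blast)
 have m: "vpr H V1 V2 K W1 W2 b Z Z' A1 A2 : vpairs C2 (H, V1, V2) (K, W1, W2) (otr H K b)"
  using vpairs_iff[OF o X Y] v by blast
 show ?thesis
  using vpair_rel.homotopy[OF HOL.refl HOL.refl m[unfolded vpr_def]
   bundle_homotopic_if_path[OF o su[OF r(1,3)] su'[OF r(4,6)] p1 r(10) r'(10)]
   bundle_homotopic_if_path[OF o su[OF r(2,3)] su'[OF r(5,6)] p2 r(11) r'(11)]]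
  unfolding vpr_def .
qed

text \<open>
  Two representatives with equal signs become equal after enlarging the auxiliary
  representations to common ones, adjusting the signs of the two maps simultaneously by an
  automorphism of the common auxiliary representation, and a homotopy.
\<close>

lemma vpair_rel_complete:
 assumes o: "opar H K b" and X: "vob H V1 V2" and Y: "vob K W1 W2"
  and v: "vok H V1 V2 K W1 W2 Z Z' A1 A2" and w: "vok H V1 V2 K W1 W2 Y1 Y' B1 B2"
  and s: "!!c. okc c H ==> ps c (H, V1, V2) (K, W1, W2) (vpr H V1 V2 K W1 W2 b Z Z' A1 A2) =
    ps c (H, V1, V2) (K, W1, W2) (vpr H V1 V2 K W1 W2 b Y1 Y' B1 B2)"
 shows "(vpr H V1 V2 K W1 W2 b Z Z' A1 A2, vpr H V1 V2 K W1 W2 b Y1 Y' B1 B2) : vpair_rel C2 (H, V1, V2) (K, W1, W2) (otr H K b)"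
proof -
 note r = vok_reps[OF o X Y v] and q = vok_reps[OF o X Y w]
 note oD = oparD[OF o]
 note H = oD(1) and K = oD(2) and rr = rep_restrict[OF o]
 note su = orth_rep_sum[OF H] and su' = orth_rep_sum[OF K]
 note trans = vpair_rel.trans and sym = vpair_rel.sym
 let ?v = "vpr H V1 V2 K W1 W2 b"
 let ?R = "vpair_rel C2 (H, V1, V2) (K, W1, W2) (otr H K b)"
 define S :: "int rep" where "S = std_rep 1 1"
 have SK: "orep K S" and SH: "orep H S" using orth_rep_std H K by (auto simp: S_def)
 have pS: "pdim H S = (if 1 : H then 1 else 2)" "fst S = 2" using pdim_std[OF H] by (auto simp: S_def)
 define T' where "T' = Y' +r S"
 define Q' where "Q' = Z' +r S"
 have T': "orep K T'" "orep H T'" and Q': "orep K Q'" "orep H Q'"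
  unfolding T'_def Q'_def using su su' r q SK SH by blast+
 define U where "U = Z +r T'"
 define U' where "U' = Z' +r T'"
 have U: "orep H U" "orep K U'" unfolding U_def U'_def using su su' r T' by blast+
 define C1 where "C1 = dsum (fst (V1 +r Z)) (fst (W1 +r Z')) A1 (%u. u)"
 define C2' where "C2' = dsum (fst (V2 +r Z)) (fst (W2 +r Z')) A2 (%u. u)"
 have 1: "(?v Z Z' A1 A2, ?v U U' C1 C2') : ?R" "vok H V1 V2 K W1 W2 U U' C1 C2'"
  unfolding U_def U'_def C1_def C2'_def
  by (rule rel_stabilize[OF o X Y v T'(2,1) eqv_id], rule stabilize_vpr(2)[OF o X Y v T'(2,1) eqv_id])
 define D1 where "D1 = dsum (fst (V1 +r Y1)) (fst (W1 +r Y')) B1 (%u. u)"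
 define D2 where "D2 = dsum (fst (V2 +r Y1)) (fst (W2 +r Y')) B2 (%u. u)"
 have 2: "(?v Y1 Y' B1 B2, ?v (Y1 +r Q') (Y' +r Q') D1 D2) : ?R" "vok H V1 V2 K W1 W2 (Y1 +r Q') (Y' +r Q') D1 D2"
  unfolding D1_def D2_def
  by (rule rel_stabilize[OF o X Y w Q'(2,1) eqv_id], rule stabilize_vpr(2)[OF o X Y w Q'(2,1) eqv_id])
 have "EX j. eqv H U (Y1 +r Q') j"
 proof (rule eqv_exists[OF U(1) su[OF q(3) Q'(2)] H])
  show "fst U = fst (Y1 +r Q')" using r(12) q(12) by (simp add: U_def T'_def Q'_def rep_sum_simps)
  show "pdim H U = pdim H (Y1 +r Q')"
   using r(14) q(14) pdim_sum[OF r(3) T'(2) H] pdim_sum[OF q(9) SH H] pdim_sum[OF q(3) Q'(2) H] pdim_sum[OF r(9) SH H]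
   by (simp add: U_def T'_def Q'_def)
 qed
 then obtain j where j: "eqv H U (Y1 +r Q') j" by blast
 have "EX k. eqv K (Y' +r Q') U' k"
 proof (rule eqv_exists[OF su'[OF q(6) Q'(1)] U(2) K])
  show "fst (Y' +r Q') = fst U'" by (simp add: U'_def T'_def Q'_def rep_sum_simps)
  show "pdim K (Y' +r Q') = pdim K U'"
   using pdim_sum[OF q(6) Q'(1) K] pdim_sum[OF r(6) SK K] pdim_sum[OF r(6) T'(1) K] pdim_sum[OF q(6) SK K]
   by (simp add: U'_def T'_def Q'_def)
 qed
 then obtain k where k: "eqv K (Y' +r Q') U' k" by blast
 define E1 where "E1 = chg V1 W1 j k D1"
 define E2 where "E2 = chg V2 W2 j k D2"
 have 3: "(?v (Y1 +r Q') (Y' +r Q') D1 D2, ?v U U' E1 E2) : ?R" "vok H V1 V2 K W1 W2 U U' E1 E2"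
  unfolding E1_def E2_def by (rule rel_change[OF o X Y 2(2) U j k], rule change_vpr(2)[OF o X Y 2(2) U j k])
 have YE: "(?v Y1 Y' B1 B2, ?v U U' E1 E2) : ?R" by (rule trans[OF 2(1) 3(1)])
 note rC = vok_reps[OF o X Y 1(2)] and rE = vok_reps[OF o X Y 3(2)]
 define e where "e = (%c. sg c V1 U W1 U' C1 * sg c V1 U W1 U' E1)"
 have C: "sg c V1 U W1 U' C1 : {1, -1}" "sg c V1 U W1 U' E1 : {1, -1}" "sg c V2 U W2 U' C2' : {1, -1}" "sg c V2 U W2 U' E2 : {1, -1}"
  if c: "okc c H" for c
  using sg_values[OF rC(10) rC(1,3,7,9) H c] sg_values[OF rE(10) rE(1,3,7,9) H c]
   sg_values[OF rC(11) rC(2,3,8,9) H c] sg_values[OF rE(11) rE(2,3,8,9) H c] by auto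
 have e: "e c : {1, -1}" if "okc c H" for c using C[OF that] by (auto simp: e_def)
 define e1 where "e1 = (if 1 : H then e True else 1)"
 have e1: "e1 : {1, -1}" using e[of True] by (auto simp: e1_def)
 have "EX i. eqv H U U i & esgn False U U i = e False & (1 : H --> esgn True U U i = e1)"
 proof (rule eqv_exists_sign[OF U(1,1) H HOL.refl HOL.refl _ _ _ e1])
  have p: "pdim H U = pdim H Z + (pdim H Y' + pdim H S)"
   using pdim_sum[OF r(3) T'(2) H] pdim_sum[OF q(9) SH H] by (simp add: U_def T'_def)
  show "0 < pdim H U" using p pS by (simp split: if_splits)
  show "pdim H U < fst U" if "1 : H"
   using p pS that pdim_le[OF r(3) H] pdim_le[OF q(9) H] by (simp add: U_def T'_def rep_sum_simps)
  show "e False : {1, -1}" using e by simp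
 qed
 then obtain i where i: "eqv H U U i" "esgn False U U i = e False" "1 : H ==> esgn True U U i = e1" by blast
 have ie: "esgn c U U i = e c" if "okc c H" for c using i that by (cases c) (auto simp: e1_def)
 note 4 = rel_change[OF o X Y 3(2) U i(1) eqv_id] change_vpr(2)[OF o X Y 3(2) U i(1) eqv_id]
 have 5: "(?v U U' C1 C2', ?v U U' (chg V1 W1 i (%u. u) E1) (chg V2 W2 i (%u. u) E2)) : ?R"
 proof (rule rel_same_aux[OF o X Y 1(2) 4(2)])
  fix c assume c: "okc c H"
  have one: "esgn c U' U' (%u. u) = 1" by (rule esgn_id[OF repc_of[OF rr[OF U(2)] H c]])
  have "sg c V1 U W1 U' C1 * sg c V2 U W2 U' C2' = ps c (H, V1, V2) (K, W1, W2) (?v Z Z' A1 A2)"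
   using ps_vpr[OF o X Y 1(2) c] vpair_rel_sound[OF o X Y 1(1)] c by simp
  also have "\<dots> = ps c (H, V1, V2) (K, W1, W2) (?v Y1 Y' B1 B2)" by (rule s[OF c])
  also have "\<dots> = sg c V1 U W1 U' E1 * sg c V2 U W2 U' E2"
   using ps_vpr[OF o X Y 3(2) c] vpair_rel_sound[OF o X Y YE] c by simp
  finally have "sg c V1 U W1 U' C1 * sg c V2 U W2 U' C2' = sg c V1 U W1 U' E1 * sg c V2 U W2 U' E2" .
  thus "sg c V1 U W1 U' C1 = sg c V1 U W1 U' (chg V1 W1 i (%u. u) E1) &
    sg c V2 U W2 U' C2' = sg c V2 U W2 U' (chg V2 W2 i (%u. u) E2)"
   unfolding ps_change(2,3)[OF o X Y 3(2) U i(1) eqv_id c] one ie[OF c]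
   using C[OF c] by (auto simp: e_def)
 qed
 show ?thesis
  by (rule trans[OF 1(1) trans[OF 5 sym[OF trans[OF YE 4(1)]]]])
qed

definition vcls :: "int vobj => int vobj => (int set => int set) => real => real => int vpair set" where
 "vcls X Y \<alpha> e0 e1 = {p : vpairs C2 X Y \<alpha>. ps False X Y p = e0 & (1 : fst X --> ps True X Y p = e1)}"

lemma vpair_rel_image:
 assumes o: "opar H K b" and X: "vob H V1 V2" and Y: "vob K W1 W2"
  and p: "p : vcls (H, V1, V2) (K, W1, W2) (otr H K b) e0 e1"
 shows "vpair_rel C2 (H, V1, V2) (K, W1, W2) (otr H K b) `` {p} = vcls (H, V1, V2) (K, W1, W2) (otr H K b) e0 e1"
proof (intro equalityI subsetI)
 fix q assume "q : vpair_rel C2 (H, V1, V2) (K, W1, W2) (otr H K b) `` {p}"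
 thus "q : vcls (H, V1, V2) (K, W1, W2) (otr H K b) e0 e1"
  using vpair_rel_sound[OF o X Y, of p q] p by (auto simp: vcls_def)
next
 fix q assume q: "q : vcls (H, V1, V2) (K, W1, W2) (otr H K b) e0 e1"
 obtain Z Z' A1 A2 where 1: "vok H V1 V2 K W1 W2 Z Z' A1 A2" "p = vpr H V1 V2 K W1 W2 b Z Z' A1 A2"
  using p vpairs_iff[OF o X Y] by (auto simp: vcls_def)
 obtain Y1 Y' B1 B2 where 2: "vok H V1 V2 K W1 W2 Y1 Y' B1 B2" "q = vpr H V1 V2 K W1 W2 b Y1 Y' B1 B2"
  using q vpairs_iff[OF o X Y] by (auto simp: vcls_def)
 have "ps c (H, V1, V2) (K, W1, W2) p = ps c (H, V1, V2) (K, W1, W2) q" if "okc c H" for c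
  using p q that by (cases c) (auto simp: vcls_def)
 hence "(p, q) : vpair_rel C2 (H, V1, V2) (K, W1, W2) (otr H K b)"
  unfolding 1(2) 2(2) by (intro vpair_rel_complete[OF o X Y 1(1) 2(1)]) blast
 thus "q : vpair_rel C2 (H, V1, V2) (K, W1, W2) (otr H K b) `` {p}" by blast
qed

lemma ps_values:
 assumes o: "opar H K b" and X: "vob H V1 V2" and Y: "vob K W1 W2"
  and p: "p : vpairs C2 (H, V1, V2) (K, W1, W2) (otr H K b)" and c: "okc c H"
 shows "ps c (H, V1, V2) (K, W1, W2) p : {1, -1}"
proof -
 obtain Z Z' A1 A2 where 1: "vok H V1 V2 K W1 W2 Z Z' A1 A2" "p = vpr H V1 V2 K W1 W2 b Z Z' A1 A2"
  using p vpairs_iff[OF o X Y] by blast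
 note r = vok_reps[OF o X Y 1(1)]
 show ?thesis unfolding 1(2) ps_vpr[OF o X Y 1(1) c]
  using sg_values[OF r(10) r(1,3,7,9) oparD(1)[OF o] c] sg_values[OF r(11) r(2,3,8,9) oparD(1)[OF o] c] by auto
qed

definition vdim_eq :: "int set => int rep => int rep => int rep => int rep => bool" where
 "vdim_eq H V1 V2 W1 W2 \<longleftrightarrow> int (fst V1) - int (fst V2) = int (fst W1) - int (fst W2) &
   int (pdim H V1) - int (pdim H V2) = int (pdim H W1) - int (pdim H W2)"

lemma vdim_eq_if_vpair:
 assumes o: "opar H K b" and X: "vob H V1 V2" and Y: "vob K W1 W2"
  and p: "p : vpairs C2 (H, V1, V2) (K, W1, W2) (otr H K b)"
 shows "vdim_eq H V1 V2 W1 W2"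
proof -
 obtain Z Z' A1 A2 where 1: "vok H V1 V2 K W1 W2 Z Z' A1 A2"
  using p vpairs_iff[OF o X Y] by blast
 show ?thesis using vok_reps(12-15)[OF o X Y 1] unfolding vdim_eq_def by linarith
qed

text \<open>
  With auxiliary representations that contain enough of every irreducible, the two dimension conditions make source and
  target isomorphic, and every pair of signs is realized.
\<close>

lemma vok_exists_aux:
 assumes o: "opar H K b" and X: "vob H V1 V2" and Y: "vob K W1 W2"
  and Z: "orep H Z" "orep K Z'" and d: "vdim_eq H V1 V2 W1 W2"
  and f: "fst V1 + fst Z = fst W1 + fst Z'" "pdim H V1 + pdim H Z = pdim H W1 + pdim H Z'"
  and pos: "0 < pdim H Z" "1 : H ==> pdim H Z < fst Z"
  and e: "e0 : {1, -1}" "e1 : {1, -1}"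
 shows "EX A1 A2. vok H V1 V2 K W1 W2 Z Z' A1 A2 & vpr H V1 V2 K W1 W2 b Z Z' A1 A2 : vcls (H, V1, V2) (K, W1, W2) (otr H K b) e0 e1"
proof -
 have f2: "fst V2 + fst Z = fst W2 + fst Z'" "pdim H V2 + pdim H Z = pdim H W2 + pdim H Z'"
  using d f unfolding vdim_eq_def by linarith+
 note H = oparD(1)[OF o] and rr = rep_restrict[OF o]
 note su = orth_rep_sum[OF H]
 have ex: "EX A. eqv H (V +r Z) (W +r Z') A & sg False V Z W Z' A = a0 & (1 : H --> sg True V Z W Z' A = a1)"
  if V: "orep H V" and W: "orep K W" and f: "fst V + fst Z = fst W + fst Z'" "pdim H V + pdim H Z = pdim H W + pdim H Z'"
   and a: "a0 : {1, -1}" "a1 : {1, -1}" for V W a0 a1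
 proof -
  define t where "t = (%c. theta c V Z * theta c W Z')"
  have t: "t c : {1, -1}" if c: "okc c H" for c
   unfolding t_def using theta_values[OF repc_of[OF V H c] repc_of[OF Z(1) H c]]
    theta_values[OF repc_of[OF rr[OF W] H c] repc_of[OF rr[OF Z(2)] H c]] by auto
  have "EX A. eqv H (V +r Z) (W +r Z') A & esgn False (V +r Z) (W +r Z') A = t False * a0 &
    (1 : H --> esgn True (V +r Z) (W +r Z') A = (if 1 : H then t True * a1 else 1))"
  proof (rule eqv_exists_sign[OF su[OF V Z(1)] su[OF rr[OF W] rr[OF Z(2)]] H])
   show "fst (V +r Z) = fst (W +r Z')" using f by (simp add: rep_sum_simps)
   show "pdim H (V +r Z) = pdim H (W +r Z')"
    using f by (simp add: pdim_sum[OF V Z(1) H] pdim_sum[OF rr[OF W] rr[OF Z(2)] H])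
   show "0 < pdim H (V +r Z)" using pos by (simp add: pdim_sum[OF V Z(1) H])
   show "pdim H (V +r Z) < fst (V +r Z)" if "1 : H"
    using pos(2)[OF that] pdim_le[OF V H] by (simp add: pdim_sum[OF V Z(1) H] rep_sum_simps)
   show "t False * a0 : {1, -1}" "(if 1 : H then t True * a1 else 1) : {1, -1}" using t[of False] t[of True] a by auto
  qed
  then obtain A where A: "eqv H (V +r Z) (W +r Z') A" "esgn False (V +r Z) (W +r Z') A = t False * a0"
   "1 : H ==> esgn True (V +r Z) (W +r Z') A = t True * a1" by auto
  have tt: "t c * (t c * x) = x" if "okc c H" for c x using t[OF that] by auto
  have "sg False V Z W Z' A = a0" "1 : H ==> sg True V Z W Z' A = a1"
   unfolding sg_def using A(2,3) tt[of False] tt[of True] by (auto simp: t_def)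
  thus ?thesis using A(1) by blast
 qed
 have r: "orep H V1" "orep H V2" "orep K W1" "orep K W2" using X Y by (auto simp: vob_def)
 obtain A1 where A1: "eqv H (V1 +r Z) (W1 +r Z') A1" "sg False V1 Z W1 Z' A1 = e0" "1 : H --> sg True V1 Z W1 Z' A1 = e1"
  using ex[OF r(1,3) f e] by blast
 obtain A2 where A2: "eqv H (V2 +r Z) (W2 +r Z') A2" "sg False V2 Z W2 Z' A2 = 1" "1 : H --> sg True V2 Z W2 Z' A2 = 1"
  using ex[OF r(2,4) f2, of 1 1] by blast
 have v: "vok H V1 V2 K W1 W2 Z Z' A1 A2" using Z A1 A2 by (simp add: vok_def)
 hence "vpr H V1 V2 K W1 W2 b Z Z' A1 A2 : vpairs C2 (H, V1, V2) (K, W1, W2) (otr H K b)" using vpairs_iff[OF o X Y] by blast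
 hence "vpr H V1 V2 K W1 W2 b Z Z' A1 A2 : vcls (H, V1, V2) (K, W1, W2) (otr H K b) e0 e1"
  using ps_vpr[OF o X Y v, of False] ps_vpr[OF o X Y v, of True] A1 A2 by (simp add: vcls_def)
 thus ?thesis using v by blast
qed

lemma vcls_aux_target:
 assumes o: "opar H K b" and X: "vob H V1 V2" and Y: "vob K W1 W2" and d: "vdim_eq H V1 V2 W1 W2"
  and e: "e0 : {1, -1}" "e1 : {1, -1}" and M: "fst V1 < M"
 shows "EX Z A1 A2. vok H V1 V2 K W1 W2 Z (std_rep M M) A1 A2 &
   vpr H V1 V2 K W1 W2 b Z (std_rep M M) A1 A2 : vcls (H, V1, V2) (K, W1, W2) (otr H K b) e0 e1"
proof -
 note H = oparD(1)[OF o] and K = oparD(2)[OF o] and rr = rep_restrict[OF o]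
 have r: "orep H V1" "orep H W1" using X Y rr by (auto simp: vob_def)
 define n where "n = fst W1 + 2 * M - fst V1"
 define p where "p = (if 1 : H then pdim H W1 + M - pdim H V1 else n)"
 have le: "pdim H V1 <= fst V1" "pdim H W1 <= fst W1" using pdim_le r H by auto
 have le2: "fst V1 - pdim H V1 <= M" using M by simp
 have pn: "p <= n" "1 : H ==> p < n" using le M by (auto simp: p_def n_def)
 define Z :: "int rep" where "Z = std_rep p (n - p)"
 have Z: "orep H Z" "fst Z = n" "pdim H Z = p"
  using orth_rep_std[OF H] pdim_std[OF H] pn by (auto simp: Z_def p_def)
 have Z': "orep K (std_rep M M)" by (rule orth_rep_std[OF K])
 have f: "fst V1 + fst Z = fst W1 + fst (std_rep M M)" using M by (simp add: Z n_def)
 have g: "pdim H V1 + pdim H Z = pdim H W1 + pdim H (std_rep M M)"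
  using M le pdim_trivial[OF r(1) H] pdim_trivial[OF r(2) H] by (simp add: Z pdim_std[OF H] p_def n_def)
 have pos: "0 < pdim H Z" "1 : H ==> pdim H Z < fst Z" using Z pn M le by (auto simp: p_def n_def)
 from vok_exists_aux[OF o X Y Z(1) Z' d f g pos e] show ?thesis by blast
qed

lemma vcls_aux_source:
 assumes o: "opar H K b" and X: "vob H V1 V2" and Y: "vob K W1 W2" and d: "vdim_eq H V1 V2 W1 W2"
  and e: "e0 : {1, -1}" "e1 : {1, -1}" and M: "fst W1 < M"
 shows "EX Z' A1 A2. vok H V1 V2 K W1 W2 (std_rep M M) Z' A1 A2 &
   vpr H V1 V2 K W1 W2 b (std_rep M M) Z' A1 A2 : vcls (H, V1, V2) (K, W1, W2) (otr H K b) e0 e1"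
proof -
 note H = oparD(1)[OF o] and K = oparD(2)[OF o] and rr = rep_restrict[OF o]
 have r: "orep H V1" "orep H W1" using X Y rr by (auto simp: vob_def)
 define n where "n = fst V1 + 2 * M - fst W1"
 define p where "p = (if 1 : H then pdim H V1 + M - pdim H W1 else n)"
 have le: "pdim H V1 <= fst V1" "pdim H W1 <= fst W1" using pdim_le r H by auto
 have pn: "p <= n" using le M by (auto simp: p_def n_def)
 define Z' :: "int rep" where "Z' = std_rep p (n - p)"
 have Z': "orep K Z'" "fst Z' = n" "pdim H Z' = p"
  using orth_rep_std[OF K] pdim_std[OF H] pn by (auto simp: Z'_def p_def)
 have Z: "orep H (std_rep M M)" by (rule orth_rep_std[OF H])
 have f: "fst V1 + fst (std_rep M M) = fst W1 + fst Z'" using M by (simp add: Z' n_def)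
 have g: "pdim H V1 + pdim H (std_rep M M) = pdim H W1 + pdim H Z'"
  using M le pdim_trivial[OF r(1) H] pdim_trivial[OF r(2) H] by (simp add: Z' pdim_std[OF H] p_def n_def)
 have pos: "0 < pdim H (std_rep M M)" "1 : H ==> pdim H (std_rep M M) < fst (std_rep M M)" using M by (auto simp: pdim_std[OF H])
 from vok_exists_aux[OF o X Y Z Z'(1) d f g pos e] show ?thesis by blast
qed

subsection \<open>Signs of composites\<close>

text \<open>
  The sign of the involution on a virtual representation, \<open>-1\<close> to the virtual dimension of its sign part.
\<close>

definition kap :: "int rep => int rep => real" where
 "kap U1 U2 = (- 1) ^ ((fst U1 - pdim {0, 1} U1) + (fst U2 - pdim {0, 1} U2))"

definition vtw :: "int set => int set => int => int rep => int rep => real" where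
 "vtw K L b U1 U2 = (if 1 ~: K & 1 : L & b = 1 then kap U1 U2 else 1)"

text \<open>
  Each of the two members of the pair contributes the determinant of the involution on its target; the contributions of
  the auxiliary representation cancel and those of \<open>U\<^sub>1\<close>, \<open>U\<^sub>2\<close> form the twist. On
  fixed parts the involution is the identity.
\<close>

lemma esgn_otw:
 assumes o: "opar H K b" and o': "opar K L b'" and c: "okc c H"
  and r: "orep L U1" "orep L U2" "orep L Z"
 shows "esgn c (U1 +r Z) (U1 +r Z) (otw K L (U1 +r Z) b) * esgn c (U2 +r Z) (U2 +r Z) (otw K L (U2 +r Z) b) =
  (if c then 1 else vtw K L b U1 U2)"
proof (cases "1 ~: K & 1 : L & b = 1")
 case False
 note rr = rep_restrict[OF opar_comp[OF o o']]
 note su = orth_rep_sum[OF oparD(2)[OF o']]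
 have "esgn c (U1 +r Z) (U1 +r Z) (%u. u) = 1" "esgn c (U2 +r Z) (U2 +r Z) (%u. u) = 1"
  using esgn_id[OF repc_of[OF rr[OF su] oparD(1)[OF o] c]] r by auto
 thus ?thesis using False by (simp add: otw_def vtw_def if_not_P)
next
 case True
 hence L: "L = {0, 1}" and c: "c = False" using oparD[OF o] oparD[OF o'] c by (auto simp: subgroup_C2_iff)
 note su = orth_rep_sum[OF oparD(2)[OF o']] and H = oparD(2)[OF o']
 have p: "pdim L U1 <= fst U1" "pdim L U2 <= fst U2" "pdim L Z <= fst Z" using pdim_le r H by auto
 have "esgn c (U1 +r Z) (U1 +r Z) (otw K L (U1 +r Z) b) = (- 1) ^ ((fst U1 - pdim L U1) + (fst Z - pdim L Z))"
  using esgn_involution(1)[OF su[OF r(1,3)] H] True c p by (simp add: otw_def pdim_sum[OF r(1,3) H] rep_sum_simps)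
 moreover have "esgn c (U2 +r Z) (U2 +r Z) (otw K L (U2 +r Z) b) = (- 1) ^ ((fst U2 - pdim L U2) + (fst Z - pdim L Z))"
  using esgn_involution(1)[OF su[OF r(2,3)] H] True c p by (simp add: otw_def pdim_sum[OF r(2,3) H] rep_sum_simps)
 moreover have "(-1::real) ^ (x + z) * (-1) ^ (y + z) = (-1) ^ (x + y)" for x y z :: nat
  by (simp add: power_add mult_ac power_mult_distrib[symmetric])
 ultimately show ?thesis using True c by (simp add: vtw_def kap_def L)
qed

lemma sg_compose:
 assumes A: "eqv H (V +r Z) (W +r Z') A" and B: "eqv H (W +r Z') (U +r Z'') B" and C: "eqv H (U +r Z'') (U +r Z'') C"
  and r: "orep H V" "orep H Z" "orep H W" "orep H Z'" "orep H U" "orep H Z''"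
  and H: "subgroup H C2" "okc c H"
 shows "sg c V Z U Z'' (C o (B o A)) = esgn c (U +r Z'') (U +r Z'') C * (sg c V Z W Z' A * sg c W Z' U Z'' B)"
proof -
 note su = orth_rep_sum[OF H(1)]
 have "theta c W Z' * theta c W Z' = 1" using theta_values[OF repc_of[OF r(3) H] repc_of[OF r(4) H]] by auto
 hence "esgn c (U +r Z'') (U +r Z'') C * (sg c V Z W Z' A * sg c W Z' U Z'' B) =
   theta c V Z * theta c U Z'' * (esgn c (U +r Z'') (U +r Z'') C * (esgn c (W +r Z') (U +r Z'') B * esgn c (V +r Z) (W +r Z') A))"
  unfolding sg_def by (simp add: mult_ac)
 thus ?thesis
  unfolding sg_def[of c V Z U] esgn_comp[OF eqv_comp[OF A B] C su[OF r(1,2)] su[OF r(5,6)] su[OF r(5,6)] H]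
   esgn_comp[OF A B su[OF r(1,2)] su[OF r(3,4)] su[OF r(5,6)] H] by (rule HOL.sym)
qed

lemma vpr_compose:
 assumes o: "opar H K b" and o': "opar K L b'" and X: "vob H V1 V2" and Y: "vob K W1 W2" and L: "vob L U1 U2"
  and v: "vok H V1 V2 K W1 W2 Z Z' A1 A2" and w: "vok K W1 W2 L U1 U2 Z' Z'' B1 B2"
 shows "(Z, Z'', compose (bpoints C2 H (V1 +r Z)) (bmk K (W1 +r Z') L (U1 +r Z'') b' B1) (bmk H (V1 +r Z) K (W1 +r Z') b A1),
   compose (bpoints C2 H (V2 +r Z)) (bmk K (W2 +r Z') L (U2 +r Z'') b' B2) (bmk H (V2 +r Z) K (W2 +r Z') b A2)) =
   vpr H V1 V2 L U1 U2 (ooff L b b') Z Z'' (otw K L (U1 +r Z'') b o (B1 o A1)) (otw K L (U2 +r Z'') b o (B2 o A2))" (is ?A)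
  "vok H V1 V2 L U1 U2 Z Z'' (otw K L (U1 +r Z'') b o (B1 o A1)) (otw K L (U2 +r Z'') b o (B2 o A2))" (is ?B)
  "okc c H ==> ps c (H, V1, V2) (L, U1, U2) (vpr H V1 V2 L U1 U2 (ooff L b b') Z Z'' (otw K L (U1 +r Z'') b o (B1 o A1)) (otw K L (U2 +r Z'') b o (B2 o A2))) =
   ps c (H, V1, V2) (K, W1, W2) (vpr H V1 V2 K W1 W2 b Z Z' A1 A2) * ps c (K, W1, W2) (L, U1, U2) (vpr K W1 W2 L U1 U2 b' Z' Z'' B1 B2) *
   (if c then 1 else vtw K L b U1 U2)"
proof -
 note r = vok_reps[OF o X Y v] and q = vok_reps[OF o' Y L w]
 note oo = opar_comp[OF o o']
 note su = orth_rep_sum[OF oparD(1)[OF o]] and su' = orth_rep_sum[OF oparD(1)[OF o']] and su'' = orth_rep_sum[OF oparD(2)[OF o']]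
 note c1 = bmk_compose[OF o o' su[OF r(1,3)] su'[OF r(4,6)] su''[OF q(4,6)] r(10) q(10)]
 note c2 = bmk_compose[OF o o' su[OF r(2,3)] su'[OF r(5,6)] su''[OF q(5,6)] r(11) q(11)]
 show ?A unfolding c1(1) c2(1) vpr_def ..
 show B: ?B using c1(2) c2(2) r(3) q(6) by (simp add: vok_def)
 assume c: "okc c H"
 have cK: "okc c K" using c oparD(3)[OF o] by blast
 note rr = rep_restrict[OF oo] and HK = oparD(3)[OF o] and H = oparD(1)[OF o]
 have t: "eqv H (U1 +r Z'') (U1 +r Z'') (otw K L (U1 +r Z'') b)" "eqv H (U2 +r Z'') (U2 +r Z'') (otw K L (U2 +r Z'') b)"
  using otw_eqv[OF o o' su''[OF q(4,6)]] otw_eqv[OF o o' su''[OF q(5,6)]] by auto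
 show "ps c (H, V1, V2) (L, U1, U2) (vpr H V1 V2 L U1 U2 (ooff L b b') Z Z'' (otw K L (U1 +r Z'') b o (B1 o A1)) (otw K L (U2 +r Z'') b o (B2 o A2))) =
   ps c (H, V1, V2) (K, W1, W2) (vpr H V1 V2 K W1 W2 b Z Z' A1 A2) * ps c (K, W1, W2) (L, U1, U2) (vpr K W1 W2 L U1 U2 b' Z' Z'' B1 B2) *
   (if c then 1 else vtw K L b U1 U2)"
  unfolding ps_vpr[OF oo X L B c] ps_vpr[OF o X Y v c] ps_vpr[OF o' Y L w cK]
   sg_compose[OF r(10) eqv_mono[OF q(10) HK] t(1) r(1,3,7,9) rr[OF q(4)] rr[OF q(6)] H c]
   sg_compose[OF r(11) eqv_mono[OF q(11) HK] t(2) r(2,3,8,9) rr[OF q(5)] rr[OF q(6)] H c]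
   esgn_otw[OF o o' c q(4,5,6), symmetric]
  by (simp only: mult_ac)
qed

lemma vcls_compose:
 assumes o: "opar H K b" and o': "opar K L b'" and X: "vob H V1 V2" and Y: "vob K W1 W2" and L: "vob L U1 U2"
  and d: "vdim_eq H V1 V2 W1 W2" "vdim_eq K W1 W2 U1 U2"
  and e: "e0 : {1, -1}" "e1 : {1, -1}" "g0 : {1, -1}" "g1 : {1, -1}"
 shows "vpair_rel C2 (H, V1, V2) (L, U1, U2) (otr H L (ooff L b b')) ``
   {(Z, Z'', compose (bpoints C2 H (V1 +r Z)) h1 f1, compose (bpoints C2 H (V2 +r Z)) h2 f2) | Z Z' Z'' f1 f2 h1 h2.
    (Z, Z', f1, f2) : vcls (H, V1, V2) (K, W1, W2) (otr H K b) e0 e1 & (Z', Z'', h1, h2) : vcls (K, W1, W2) (L, U1, U2) (otr K L b') g0 g1} =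
  vcls (H, V1, V2) (L, U1, U2) (otr H L (ooff L b b')) (e0 * g0 * vtw K L b U1 U2) (e1 * g1)" (is "?R `` ?S = ?C")
proof -
 note oo = opar_comp[OF o o']
 have sub: "?S \<subseteq> ?C"
 proof
  fix s assume "s : ?S"
  then obtain Z Z' Z'' f1 f2 h1 h2 where s: "s = (Z, Z'', compose (bpoints C2 H (V1 +r Z)) h1 f1, compose (bpoints C2 H (V2 +r Z)) h2 f2)"
   and P: "(Z, Z', f1, f2) : vcls (H, V1, V2) (K, W1, W2) (otr H K b) e0 e1"
   and Q: "(Z', Z'', h1, h2) : vcls (K, W1, W2) (L, U1, U2) (otr K L b') g0 g1" by auto
  obtain A1 A2 where v: "vok H V1 V2 K W1 W2 Z Z' A1 A2" and p: "(Z, Z', f1, f2) = vpr H V1 V2 K W1 W2 b Z Z' A1 A2"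
   using P vpairs_iff[OF o X Y] by (auto simp: vcls_def vpr_def)
  obtain B1 B2 where w: "vok K W1 W2 L U1 U2 Z' Z'' B1 B2" and q: "(Z', Z'', h1, h2) = vpr K W1 W2 L U1 U2 b' Z' Z'' B1 B2"
   using Q vpairs_iff[OF o' Y L] by (auto simp: vcls_def vpr_def)
  note vc = vpr_compose[OF o o' X Y L v w]
  have s': "s = vpr H V1 V2 L U1 U2 (ooff L b b') Z Z'' (otw K L (U1 +r Z'') b o (B1 o A1)) (otw K L (U2 +r Z'') b o (B2 o A2))"
   using vc(1) p q unfolding s by (simp add: vpr_def)
  have "1 : H ==> 1 : K" using oparD(3)[OF o] by blast
  moreover have "s : vpairs C2 (H, V1, V2) (L, U1, U2) (otr H L (ooff L b b'))"
   using vpairs_iff[OF oo X L] vc(2) unfolding s' by blast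
  ultimately show "s : ?C"
   using vc(3)[of False] vc(3)[of True] P Q unfolding s' p q vcls_def by auto
 qed
 obtain M where M: "fst V1 < M" "fst U1 < M" by (metis less_add_Suc1 less_add_Suc2)
 obtain Z A1 A2 where 1: "vok H V1 V2 K W1 W2 Z (std_rep M M) A1 A2"
   "vpr H V1 V2 K W1 W2 b Z (std_rep M M) A1 A2 : vcls (H, V1, V2) (K, W1, W2) (otr H K b) e0 e1"
  using vcls_aux_target[OF o X Y d(1) e(1,2) M(1)] by blast
 obtain Z'' B1 B2 where 2: "vok K W1 W2 L U1 U2 (std_rep M M) Z'' B1 B2"
   "vpr K W1 W2 L U1 U2 b' (std_rep M M) Z'' B1 B2 : vcls (K, W1, W2) (L, U1, U2) (otr K L b') g0 g1"
  using vcls_aux_source[OF o' Y L d(2) e(3,4) M(2)] by blast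
 have ne: "?S ~= {}" using 1(2) 2(2) unfolding vpr_def by blast
 have im: "?R `` {s} = ?C" if "s : ?S" for s using vpair_rel_image[OF oo X L] sub that by blast
 show ?thesis
 proof (intro equalityI subsetI)
  fix x assume "x : ?R `` ?S"
  then obtain s where "s : ?S" "(s, x) : ?R" by blast
  thus "x : ?C" using im by blast
 next
  fix x assume x: "x : ?C"
  obtain s where "s : ?S" using ne by blast
  thus "x : ?R `` ?S" using im x by blast
 qed
qed

subsection \<open>Signs of sums\<close>

lemma frame_quad:
 assumes r: "repc c V" "repc c V'" "repc c Z" "repc c S"
 shows "frame (fdim c V + fdim c V' + (fdim c Z + fdim c S)) (fst V + fst V' + (fst Z + fst S)) (subpart c ((V +r V') +r (Z +r S)))
   (dsum (fdim c V + fdim c V') (fst V + fst V') (fsum c V V') (fsum c Z S))" (is ?frame)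
  "sgf (fdim c V + fdim c V' + (fdim c Z + fdim c S)) (fr c ((V +r V') +r (Z +r S)))
   (dsum (fdim c V + fdim c V') (fst V + fst V') (fsum c V V') (fsum c Z S)) (%u. u) = theta c (V +r V') (Z +r S) * (theta c V V' * theta c Z S)" (is ?sign)
proof -
 let ?P = "fdim c V + fdim c V' + (fdim c Z + fdim c S)" and ?n = "fst V + fst V' + (fst Z + fst S)"
 let ?T = "subpart c ((V +r V') +r (Z +r S))" and ?F = "dsum (fdim c V + fdim c V') (fst V + fst V') (fsum c V V') (fsum c Z S)"
 note r1 = repc_sum[OF r(1,2)] and r2 = repc_sum[OF r(3,4)]
 have sV: "fst (V +r V') = fst V + fst V'" "fst (Z +r S) = fst Z + fst S" by (simp_all add: rep_sum_simps)
 have sub: "subpart c (V +r V') \<subseteq> Rn (fst V + fst V')" using subpart_sub[of c "V +r V'"] sV by simp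
 show F: ?frame
  unfolding subpart_sum[OF r1 r2] sV by (rule frame_dsum[OF frame_fsum[OF r(1,2)] frame_fsum[OF r(3,4)] sub])
 note I = lin_bij_id
 have G: "frame ?P ?n ?T (fr c ((V +r V') +r (Z +r S)))"
  using frame_fr_sum[OF r1 r2] by (simp add: fdim_sum[OF r(1,2)] fdim_sum[OF r(3,4)] sV)
 have G': "frame ?P ?n ?T (fsum c (V +r V') (Z +r S))"
  using frame_fsum[OF r1 r2] by (simp add: fdim_sum[OF r(1,2)] fdim_sum[OF r(3,4)] sV)
 have 1: "sgf ?P (fr c ((V +r V') +r (Z +r S))) (fsum c (V +r V') (Z +r S)) (%u. u) = theta c (V +r V') (Z +r S)"
  by (simp add: theta_def fdim_sum[OF r(1,2)] fdim_sum[OF r(3,4)])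
 have dd: "(%u. u) = dsum n n (%u. u) (%u. u)" for n by (rule ext) (simp add: dsum_id)
 have "sgf ?P (fsum c (V +r V') (Z +r S)) ?F (dsum (fst V + fst V') (fst V + fst V') (%u. u) (%u. u)) = theta c V V' * theta c Z S"
  unfolding theta_def fdim_sum[OF r(1,2)] sV
  by (rule sgf_dsum[OF frame_fr_sum[OF r(1,2)] frame_fsum[OF r(1,2)] I frame_fr_sum[OF r(3,4)] frame_fsum[OF r(3,4)] I sub sub])
 hence 2: "sgf ?P (fsum c (V +r V') (Z +r S)) ?F (%u. u) = theta c V V' * theta c Z S"
  using dd[of "fst V + fst V'"] by simp
 show ?sign
  using sgf_comp[OF G G' F I I] 1 2 by (simp add: o_def)
qed

lemma esgn_interchange:
 assumes H: "subgroup H C2" "okc c H" and r: "orep H V" "orep H V'" "orep H Z" "orep H S"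
 shows "esgn c ((V +r V') +r (Z +r S)) ((V +r Z) +r (V' +r S)) (interchange (fst V) (fst V') (fst Z)) =
  theta c (V +r V') (Z +r S) * (theta c V V' * theta c Z S) * (theta c (V +r Z) (V' +r S) * (theta c V Z * theta c V' S)) *
  (- 1) ^ (fdim c V' * fdim c Z)"
proof -
 have rc: "repc c V" "repc c V'" "repc c Z" "repc c S" using repc_of[OF _ H] r by auto
 note su = orth_rep_sum[OF H(1)]
 let ?v = "fdim c V" and ?w = "fdim c V'" and ?z = "fdim c Z" and ?s = "fdim c S"
 let ?I = "interchange (fst V) (fst V') (fst Z)"
 let ?P = "?v + ?w + (?z + ?s)"
 have P: "?v + ?z + (?w + ?s) = ?P" by simp
 define F1 where "F1 = dsum (?v + ?w) (fst V + fst V') (fsum c V V') (fsum c Z S)"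
 define F2 where "F2 = dsum (?v + ?z) (fst V + fst Z) (fsum c V Z) (fsum c V' S)"
 note q1 = frame_quad[OF rc, folded F1_def] and q2 = frame_quad[OF rc(1,3,2,4), folded F2_def, unfolded P]
 let ?A = "(V +r V') +r (Z +r S)" and ?B = "(V +r Z) +r (V' +r S)"
 have rA: "orep H ?A" "orep H ?B" using su r by blast+
 have dA: "fdim c ?A = ?P" "fdim c ?B = ?P"
  using fdim_sum[OF repc_sum[OF rc(1,2)] repc_sum[OF rc(3,4)]] fdim_sum[OF repc_sum[OF rc(1,3)] repc_sum[OF rc(2,4)]]
  by (simp_all add: fdim_sum rc)
 have fA: "fst ?A = fst V + fst V' + (fst Z + fst S)" "fst ?B = fst V + fst Z + (fst V' + fst S)" by (simp_all add: rep_sum_simps)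
 have e: "lin_bij (fst ?A) (fst ?B) (subpart c ?A) (subpart c ?B) ?I" by (rule eqv_lin_bij[OF eqv_interchange[OF H(1) r] rA H])
 have gA: "frame ?P (fst ?A) (subpart c ?A) (fr c ?A)" "frame ?P (fst ?B) (subpart c ?B) (fr c ?B)"
  using frame_fr[OF repc_of[OF rA(1) H]] frame_fr[OF repc_of[OF rA(2) H]] dA by auto
 have "sgf ?P F1 F2 ?I = sgn (detR ?P (interchange ?v ?w ?z))"
  unfolding sgf_def
 proof (rule arg_cong[of _ _ sgn], rule detR_cong)
  fix u assume u: "u : Rn ?P"
  then obtain x y z w where xy: "x : Rn ?v" "y : Rn ?w" "z : Rn ?z" "w : Rn ?s"
   and u': "u = append_vec (?v + ?w) (append_vec ?v x y) (append_vec ?z z w)" by (rule append4)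
  have m: "fr c V x : Rn (fst V)" "fr c V' y : Rn (fst V')" "fr c Z z : Rn (fst Z)"
   using frame_inv(4)[OF frame_fr[OF rc(1)] xy(1)] frame_inv(4)[OF frame_fr[OF rc(2)] xy(2)] frame_inv(4)[OF frame_fr[OF rc(3)] xy(3)] subpart_sub by blast+
  have F1u: "F1 u = append_vec (fst V + fst V') (append_vec (fst V) (fr c V x) (fr c V' y)) (append_vec (fst Z) (fr c Z z) (fr c S w))"
   unfolding F1_def u' by (simp add: dsum_append append_in_Rn xy)
  have "F2 (interchange ?v ?w ?z u) = append_vec (fst V + fst Z) (append_vec (fst V) (fr c V x) (fr c Z z)) (append_vec (fst V') (fr c V' y) (fr c S w))"
   unfolding F2_def u' interchange_append[OF xy(1-3)] by (simp add: dsum_append append_in_Rn xy)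
  hence "?I (F1 u) = F2 (interchange ?v ?w ?z u)" unfolding F1u interchange_append[OF m] by simp
  moreover have "interchange ?v ?w ?z u : Rn ?P" using linear_RnD(1)[OF linear_interchange u] P by simp
  ultimately show "(inv_into (Rn ?P) F2 o ?I o F1) u = interchange ?v ?w ?z u"
   using frame_inv(3)[OF q2(1)] by simp
 qed
 also have "\<dots> = (- 1) ^ (?w * ?z)" by (subst detR_interchange) (auto simp: sgn_if minus_one_power_iff)
 finally have s: "sgf ?P F1 F2 ?I = (- 1) ^ (?w * ?z)" .
 have "esgn c ?A ?B ?I = sgf ?P (fr c ?A) F1 (%u. u) * sgf ?P (fr c ?B) F2 (%u. u) * sgf ?P F1 F2 ?I"
  unfolding esgn_def dA by (rule sgf_refr[OF gA(1) q1(1)[folded fA] gA(2) q2(1)[folded fA] e])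
 thus ?thesis unfolding s q1(2) q2(2) .
qed

lemma sg_ssum:
 assumes H: "subgroup H C2" "okc c H" and r: "orep H V" "orep H V'" "orep H Z" "orep H S"
  and q: "orep H W" "orep H W'" "orep H Z'" "orep H S'"
  and A: "eqv H (V +r Z) (W +r Z') A" and B: "eqv H (V' +r S) (W' +r S') B"
 shows "sg c (V +r V') (Z +r S) (W +r W') (Z' +r S') (ssum V V' Z W W' Z' A B) =
   (theta c V V' * theta c Z S * (- 1) ^ (fdim c V' * fdim c Z)) * (theta c W W' * theta c Z' S' * (- 1) ^ (fdim c W' * fdim c Z')) *
   (sg c V Z W Z' A * sg c V' S W' S' B)"
proof -
 note su = orth_rep_sum[OF H(1)]
 have th: "theta c X Y * theta c X Y = 1" if "orep H X" "orep H Y" for X Y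
  using theta_values[OF repc_of[OF that(1) H] repc_of[OF that(2) H]] by auto
 note I = eqv_interchange[OF H(1) r] and J = eqv_interchange[OF H(1) q(1,3,2,4)]
 have D: "eqv H ((V +r Z) +r (V' +r S)) ((W +r Z') +r (W' +r S')) (dsum (fst (V +r Z)) (fst (W +r Z')) A B)"
  by (rule eqv_dsum[OF A B su[OF r(1,3)] su[OF r(2,4)] H(1)])
 note s1 = su[OF su[OF r(1,2)] su[OF r(3,4)]] and s2 = su[OF su[OF r(1,3)] su[OF r(2,4)]]
  and s3 = su[OF su[OF q(1,3)] su[OF q(2,4)]] and s4 = su[OF su[OF q(1,2)] su[OF q(3,4)]]
 define a where "a = theta c (V +r V') (Z +r S)"
 define b where "b = theta c (W +r W') (Z' +r S')"
 define x where "x = theta c (V +r Z) (V' +r S)"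
 define y where "y = theta c (W +r Z') (W' +r S')"
 have sq: "a * (a * t) = t" "b * (b * t) = t" "x * (x * t) = t" "y * (y * t) = t" for t
  using th[OF su[OF r(1,2)] su[OF r(3,4)]] th[OF su[OF q(1,2)] su[OF q(3,4)]] th[OF su[OF r(1,3)] su[OF r(2,4)]] th[OF su[OF q(1,3)] su[OF q(2,4)]]
  unfolding a_def b_def x_def y_def by (simp_all add: mult.assoc[symmetric])
 show ?thesis
  unfolding ssum_def sg_def esgn_comp[OF eqv_comp[OF I D] J s1 s3 s4 H] esgn_comp[OF I D s1 s2 s3 H]
   esgn_interchange[OF H r] esgn_interchange[OF H q(1,3,2,4)] esgn_dsum[OF A B su[OF r(1,3)] su[OF q(1,3)] su[OF r(2,4)] su[OF q(2,4)] H]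
   a_def[symmetric] b_def[symmetric] x_def[symmetric] y_def[symmetric]
  by (simp add: mult_ac sq)
qed

lemma vpair_sum:
 assumes o: "opar H K b" and X: "vob H V1 V2" and Y: "vob K W1 W2" and X': "vob H V1' V2'" and Y': "vob K W1' W2'"
  and v: "vok H V1 V2 K W1 W2 Z Z' A1 A2" and w: "vok H V1' V2' K W1' W2' S S' B1 B2"
 shows "(Z +r S, Z' +r S', stable_sum C2 H V1 V1' Z S W1 W1' Z' (bmk H (V1 +r Z) K (W1 +r Z') b A1) (bmk H (V1' +r S) K (W1' +r S') b B1),
   stable_sum C2 H V2 V2' Z S W2 W2' Z' (bmk H (V2 +r Z) K (W2 +r Z') b A2) (bmk H (V2' +r S) K (W2' +r S') b B2)) =
   vpr H (V1 +r V1') (V2 +r V2') K (W1 +r W1') (W2 +r W2') b (Z +r S) (Z' +r S') (ssum V1 V1' Z W1 W1' Z' A1 B1) (ssum V2 V2' Z W2 W2' Z' A2 B2)" (is ?A)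
  "vok H (V1 +r V1') (V2 +r V2') K (W1 +r W1') (W2 +r W2') (Z +r S) (Z' +r S') (ssum V1 V1' Z W1 W1' Z' A1 B1) (ssum V2 V2' Z W2 W2' Z' A2 B2)" (is ?B)
proof -
 note r = vok_reps[OF o X Y v] and q = vok_reps[OF o X' Y' w]
 note s1 = bmk_stable_sum[OF o r(1) q(1) r(3) q(3) r(4) q(4) r(6) q(6) r(10) q(10)]
 note s2 = bmk_stable_sum[OF o r(2) q(2) r(3) q(3) r(5) q(5) r(6) q(6) r(11) q(11)]
 show ?A unfolding s1(1) s2(1) vpr_def ..
 show ?B unfolding vok_def using s1(2) s2(2) orth_rep_sum[OF oparD(1)[OF o] r(3) q(3)] orth_rep_sum[OF oparD(2)[OF o] r(6) q(6)] by blast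
qed

text \<open>
  Reordering the summands costs a sign that depends on the auxiliary representations. It is
  a product of a sign of the source and a sign of the target, because virtual dimensions are
  preserved by morphisms.
\<close>

definition nu :: "bool => int vobj => int vobj => real" where
 "nu c = (%(H, V1, V2) (H', V1', V2'). theta c V1 V1' * theta c V2 V2' * (- 1) ^ ((fdim c V1' + fdim c V2') * fdim c V1))"

text \<open>
  The signs of the block permutations split into a factor of the source and a factor of the target, although they
  involve the auxiliary dimensions \<open>z\<close> and \<open>z'\<close>.
\<close>

lemma parity_identity:
 assumes "v + z = w + z'" "v1' + w2' = w1' + (v2' :: nat)"
 shows "(-1::real) ^ (v1' * z) * (-1) ^ (w1' * z') * ((-1) ^ (v2' * z) * (-1) ^ (w2' * z')) = (-1) ^ ((v1' + v2') * v) * (-1) ^ ((w1' + w2') * w)"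
proof -
 have "v1' * z + w1' * z' + (v2' * z + w2' * z') + ((v1' + v2') * v + (w1' + w2') * w) = (v1' + v2') * (v + z) + (w1' + w2') * (w + z')"
  by (simp add: algebra_simps)
 also have "\<dots> = (v1' + v2' + (w1' + w2')) * (w + z')" using assms(1) by (simp add: algebra_simps)
 also have "v1' + v2' + (w1' + w2') = 2 * (w1' + v2')" using assms(2) by simp
 finally have "even (v1' * z + w1' * z' + (v2' * z + w2' * z') + ((v1' + v2') * v + (w1' + w2') * w))" by simp
 hence "even (v1' * z + w1' * z' + (v2' * z + w2' * z')) = even ((v1' + v2') * v + (w1' + w2') * w)" by (metis even_add)
 hence "(-1::real) ^ (v1' * z + w1' * z' + (v2' * z + w2' * z')) = (-1) ^ ((v1' + v2') * v + (w1' + w2') * w)"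
  by (simp add: minus_one_power_iff)
 thus ?thesis by (simp add: power_add)
qed

lemma ps_sum:
 assumes o: "opar H K b" and X: "vob H V1 V2" and Y: "vob K W1 W2" and X': "vob H V1' V2'" and Y': "vob K W1' W2'"
  and v: "vok H V1 V2 K W1 W2 Z Z' A1 A2" and w: "vok H V1' V2' K W1' W2' S S' B1 B2" and c: "okc c H"
 shows "ps c (H, V1 +r V1', V2 +r V2') (K, W1 +r W1', W2 +r W2')
   (vpr H (V1 +r V1') (V2 +r V2') K (W1 +r W1') (W2 +r W2') b (Z +r S) (Z' +r S') (ssum V1 V1' Z W1 W1' Z' A1 B1) (ssum V2 V2' Z W2 W2' Z' A2 B2)) =
  ps c (H, V1, V2) (K, W1, W2) (vpr H V1 V2 K W1 W2 b Z Z' A1 A2) * ps c (H, V1', V2') (K, W1', W2') (vpr H V1' V2' K W1' W2' b S S' B1 B2) *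
  (nu c (H, V1, V2) (H, V1', V2') * nu c (K, W1, W2) (K, W1', W2'))"
proof -
 note r = vok_reps[OF o X Y v] and q = vok_reps[OF o X' Y' w] and H = oparD(1)[OF o]
 have XX: "vob H (V1 +r V1') (V2 +r V2')" "vob K (W1 +r W1') (W2 +r W2')"
  using X X' Y Y' orth_rep_sum by (auto simp: vob_def)
 have rc: "repc c V1" "repc c V2" "repc c Z" "repc c W1" "repc c W2" "repc c Z'" "repc c V1'" "repc c V2'" "repc c S" "repc c W1'" "repc c W2'" "repc c S'"
  using repc_of[OF _ H c] r q by auto
 note su = orth_rep_sum[OF H]
 have d: "fdim c V1 + fdim c Z = fdim c W1 + fdim c Z'"
  using eqv_fdim[OF r(10) su[OF r(1,3)] su[OF r(7,9)] H c] by (simp add: fdim_sum rc)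
 have d': "fdim c V1' + fdim c S = fdim c W1' + fdim c S'" "fdim c V2' + fdim c S = fdim c W2' + fdim c S'"
  using eqv_fdim[OF q(10) su[OF q(1,3)] su[OF q(7,9)] H c] eqv_fdim[OF q(11) su[OF q(2,3)] su[OF q(8,9)] H c] by (simp_all add: fdim_sum rc)
 have d2: "fdim c V1' + fdim c W2' = fdim c W1' + fdim c V2'" using d' by linarith
 have th: "theta c Z S * (theta c Z S * t) = t" "theta c Z' S' * (theta c Z' S' * t) = t" for t
  using theta_values[OF rc(3,9)] theta_values[OF rc(6,12)] by auto
 note par = parity_identity[OF d d2]
 let ?m = "%a b. (-1::real) ^ (a * b)"
 have "ps c (H, V1 +r V1', V2 +r V2') (K, W1 +r W1', W2 +r W2')
   (vpr H (V1 +r V1') (V2 +r V2') K (W1 +r W1') (W2 +r W2') b (Z +r S) (Z' +r S') (ssum V1 V1' Z W1 W1' Z' A1 B1) (ssum V2 V2' Z W2 W2' Z' A2 B2)) =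
  (sg c V1 Z W1 Z' A1 * sg c V2 Z W2 Z' A2) * (sg c V1' S W1' S' B1 * sg c V2' S W2' S' B2) *
  ((theta c V1 V1' * theta c V2 V2') * (theta c W1 W1' * theta c W2 W2') *
  (?m (fdim c V1') (fdim c Z) * ?m (fdim c W1') (fdim c Z') * (?m (fdim c V2') (fdim c Z) * ?m (fdim c W2') (fdim c Z'))))"
  unfolding ps_vpr[OF o XX vpair_sum(2)[OF o X Y X' Y' v w] c]
   sg_ssum[OF H c r(1) q(1) r(3) q(3) r(7) q(7) r(9) q(9) r(10) q(10)]
   sg_ssum[OF H c r(2) q(2) r(3) q(3) r(8) q(8) r(9) q(9) r(11) q(11)]
  by (simp add: mult_ac th)
 thus ?thesis unfolding par ps_vpr[OF o X Y v c] ps_vpr[OF o X' Y' w c] by (simp add: nu_def mult_ac)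
qed

section \<open>The category of virtual bundles in terms of signs\<close>

definition good_sys :: "(int set => int rep set) => bool" where
 "good_sys R \<longleftrightarrow> (ALL H. subgroup H C2 --> (ALL V:R H. orep H V))"

definition is_vob :: "int vobj => bool" where
 "is_vob X \<longleftrightarrow> vob (fst X) (fst (snd X)) (snd (snd X))"

lemma ob_is_vob: "good_sys R ==> X : ob (vbund R n) ==> is_vob X"
 by (auto simp: virtual_bundles_def good_sys_def is_vob_def vob_def)

definition vdim :: "int vobj => int" where
 "vdim X = int (fst (fst (snd X))) - int (fst (snd (snd X)))"

definition fixdim :: "int vobj => int" where
 "fixdim X = int (pdim {0, 1} (fst (snd X))) - int (pdim {0, 1} (snd (snd X)))"

definition dims_eq :: "int vobj => int vobj => bool" where
 "dims_eq X Y \<longleftrightarrow> vdim X = vdim Y & (1 : fst X --> fixdim X = fixdim Y)"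

lemma dims_eq_iff:
 assumes "opar H K b" "vob H V1 V2" "vob K W1 W2"
 shows "dims_eq (H, V1, V2) (K, W1, W2) \<longleftrightarrow> vdim_eq H V1 V2 W1 W2"
proof -
 have H: "subgroup H C2" using oparD(1)[OF assms(1)] .
 have r: "orep H V1" "orep H V2" "orep H W1" "orep H W2"
  using assms rep_restrict[OF assms(1)] by (auto simp: vob_def)
 show ?thesis
 proof (cases "1 : H")
  case True
  hence "H = {0, 1}" using subgroup_C2_cases[OF H] by simp
  thus ?thesis by (simp add: dims_eq_def vdim_eq_def vdim_def fixdim_def)
 next
  case False
  thus ?thesis using pdim_trivial[OF _ H False] r by (simp add: dims_eq_def vdim_eq_def vdim_def)
 qed
qed

text \<open>
  All representatives have the same sign, so any of them may be chosen; \<open>c\<close> selects the sign on fixed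
  parts, which is meaningful over fixed orbits only.
\<close>

definition asg :: "bool => int vobj => int vobj => (int set => int set) \<times> int vpair set => real" where
 "asg c X Y f = ps c X Y (SOME p. p : snd f)"

lemma asg_vcls:
 assumes "vcls X Y \<alpha> e0 e1 ~= {}"
 shows "asg False X Y (\<beta>, vcls X Y \<alpha> e0 e1) = e0" "1 : fst X ==> asg True X Y (\<beta>, vcls X Y \<alpha> e0 e1) = e1"
proof -
 have "(SOME p. p : vcls X Y \<alpha> e0 e1) : vcls X Y \<alpha> e0 e1" using assms by (simp add: some_in_eq)
 thus "asg False X Y (\<beta>, vcls X Y \<alpha> e0 e1) = e0" "1 : fst X ==> asg True X Y (\<beta>, vcls X Y \<alpha> e0 e1) = e1"
  by (auto simp: asg_def vcls_def)
qed

lemma vcls_nonempty: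
 assumes o: "opar (fst X) (fst Y) b" and X: "is_vob X" and Y: "is_vob Y" and d: "dims_eq X Y"
  and e: "e0 : {1, -1}" "e1 : {1, -1}"
 shows "vcls X Y (otr (fst X) (fst Y) b) e0 e1 ~= {}"
proof -
 obtain H V1 V2 K W1 W2 where XY: "X = (H, V1, V2)" "Y = (K, W1, W2)" by (metis surj_pair)
 have v: "vob H V1 V2" "vob K W1 W2" using X Y by (auto simp: is_vob_def XY)
 have o': "opar H K b" using o XY by simp
 have "vdim_eq H V1 V2 W1 W2" using d dims_eq_iff[OF o' v] XY by simp
 from vcls_aux_target[OF o' v this e, of "Suc (fst V1)"] show ?thesis unfolding XY by auto
qed

lemma arr_vb: "arr (vbund R n) X Y = {(\<alpha>, P). \<alpha> : arr (orbit_cat C2) (fst X) (fst Y) & P : vpairs C2 X Y \<alpha> // vpair_rel C2 X Y \<alpha>}"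
 by (simp add: virtual_bundles_def)

lemma arr_vcls:
 assumes o: "opar (fst X) (fst Y) b" and X: "is_vob X" and Y: "is_vob Y" and d: "dims_eq X Y"
  and e: "e0 : {1, -1}" "e1 : {1, -1}"
 shows "(otr (fst X) (fst Y) b, vcls X Y (otr (fst X) (fst Y) b) e0 e1) : arr (vbund R n) X Y"
proof -
 obtain H V1 V2 K W1 W2 where XY: "X = (H, V1, V2)" "Y = (K, W1, W2)" by (metis surj_pair)
 have v: "vob H V1 V2" "vob K W1 W2" using X Y by (auto simp: is_vob_def XY)
 have o': "opar H K b" using o XY by simp
 obtain p where p: "p : vcls X Y (otr (fst X) (fst Y) b) e0 e1" using vcls_nonempty[OF assms] by blast
 hence "vpair_rel C2 X Y (otr (fst X) (fst Y) b) `` {p} = vcls X Y (otr (fst X) (fst Y) b) e0 e1"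
  using vpair_rel_image[OF o' v] unfolding XY by simp
 moreover have "p : vpairs C2 X Y (otr (fst X) (fst Y) b)" using p by (simp add: vcls_def)
 ultimately have "vcls X Y (otr (fst X) (fst Y) b) e0 e1 : vpairs C2 X Y (otr (fst X) (fst Y) b) // vpair_rel C2 X Y (otr (fst X) (fst Y) b)"
  by (metis quotientI)
 thus ?thesis using otr_arr[OF o] by (simp add: arr_vb)
qed

lemma arrD:
 assumes f: "f : arr (vbund R n) X Y" and X: "is_vob X" and Y: "is_vob Y"
 shows "opar (fst X) (fst Y) (off (fst X) (fst f))" "fst f = otr (fst X) (fst Y) (off (fst X) (fst f))" "dims_eq X Y"
  "asg False X Y f : {1, -1}" "1 : fst X ==> asg True X Y f : {1, -1}"
  "f = (fst f, vcls X Y (fst f) (asg False X Y f) (if 1 : fst X then asg True X Y f else 1))"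
proof -
 obtain H V1 V2 K W1 W2 where XY: "X = (H, V1, V2)" "Y = (K, W1, W2)" by (metis surj_pair)
 have v: "vob H V1 V2" "vob K W1 W2" using X Y by (auto simp: is_vob_def XY)
 obtain \<alpha> P where fP: "f = (\<alpha>, P)" by (cases f)
 have "\<alpha> : arr (orbit_cat C2) (fst X) (fst Y)" "P : vpairs C2 X Y \<alpha> // vpair_rel C2 X Y \<alpha>" using f by (auto simp: arr_vb fP)
 then obtain p where p: "p : vpairs C2 X Y \<alpha>" "P = vpair_rel C2 X Y \<alpha> `` {p}" by (auto elim: quotientE)
 have "subgroup (fst X) C2" "subgroup (fst Y) C2" using X Y by (auto simp: is_vob_def vob_def)
 from orbit_arr_iff[OF this] \<open>\<alpha> : _\<close>
 show o: "opar (fst X) (fst Y) (off (fst X) (fst f))" and \<alpha>: "fst f = otr (fst X) (fst Y) (off (fst X) (fst f))" by (auto simp: fP)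
 define b where "b = off (fst X) (fst f)"
 have o': "opar H K b" and \<alpha>': "\<alpha> = otr H K b" using o \<alpha> by (auto simp: b_def XY fP)
 note p' = p(1)[unfolded XY \<alpha>']
 show "dims_eq X Y" unfolding XY dims_eq_iff[OF o' v] by (rule vdim_eq_if_vpair[OF o' v p'])
 have val: "ps False X Y p : {1, -1}" "1 : H ==> ps True X Y p : {1, -1}" using ps_values[OF o' v p'] by (auto simp: XY)
 have pc: "p : vcls X Y \<alpha> (ps False X Y p) (if 1 : H then ps True X Y p else 1)" using p by (simp add: vcls_def XY)
 have P: "P = vcls X Y \<alpha> (ps False X Y p) (if 1 : H then ps True X Y p else 1)"
  using vpair_rel_image[OF o' v] pc p(2) unfolding XY \<alpha>' by blast
 have a: "asg False X Y f = ps False X Y p" "1 : H ==> asg True X Y f = ps True X Y p"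
 proof -
  have ne: "vcls X Y \<alpha> (ps False X Y p) (if 1 : H then ps True X Y p else 1) ~= {}" using pc by blast
  show "asg False X Y f = ps False X Y p" unfolding fP by (subst P) (rule asg_vcls(1)[OF ne])
  show "asg True X Y f = ps True X Y p" if "1 : H"
   unfolding fP by (subst P) (use asg_vcls(2)[OF ne] that in \<open>simp add: XY\<close>)
 qed
 show "asg False X Y f : {1, -1}" "1 : fst X ==> asg True X Y f : {1, -1}" using a val by (auto simp: XY)
 show "f = (fst f, vcls X Y (fst f) (asg False X Y f) (if 1 : fst X then asg True X Y f else 1))"
  using P a by (auto simp: fP XY)
qed

lemma arr_eqI:
 assumes "f : arr (vbund R n) X Y" "g : arr (vbund R' n') X Y" "is_vob X" "is_vob Y"
  and "fst f = fst g" "asg False X Y f = asg False X Y g" "1 : fst X ==> asg True X Y f = asg True X Y g"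
 shows "f = g"
proof -
 have "f = (fst f, vcls X Y (fst f) (asg False X Y f) (if 1 : fst X then asg True X Y f else 1))" by (rule arrD(6)[OF assms(1,3,4)])
 also have "\<dots> = (fst g, vcls X Y (fst g) (asg False X Y g) (if 1 : fst X then asg True X Y g else 1))"
  using assms(5-7) by (cases "1 : fst X") auto
 also have "\<dots> = g" by (rule arrD(6)[OF assms(2-4), symmetric])
 finally show ?thesis .
qed

lemma arr_exists:
 assumes "opar (fst X) (fst Y) b" "is_vob X" "is_vob Y" "dims_eq X Y" "e0 : {1, -1}" "e1 : {1, -1}"
 obtains f where "f : arr (vbund R n) X Y" "fst f = otr (fst X) (fst Y) b" "asg False X Y f = e0" "1 : fst X ==> asg True X Y f = e1"
 using that[OF arr_vcls[OF assms]] asg_vcls[OF vcls_nonempty[OF assms]] by simp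

definition kapo :: "int vobj => real" where
 "kapo X = (if even (vdim X - fixdim X) then 1 else - 1)"

lemma kap_kapo:
 assumes "is_vob (L, U1, U2)" "1 : L"
 shows "kap U1 U2 = kapo (L, U1, U2)"
proof -
 have L: "subgroup L C2" "L = {0, 1}" using assms subgroup_C2_cases[of L] by (auto simp: is_vob_def vob_def)
 have "pdim {0, 1} U1 <= fst U1" "pdim {0, 1} U2 <= fst U2" using pdim_le[of L] assms(1) L by (auto simp: is_vob_def vob_def)
 hence "vdim (L, U1, U2) - fixdim (L, U1, U2) = int ((fst U1 - pdim {0, 1} U1)) - int (fst U2 - pdim {0, 1} U2)"
  by (simp add: vdim_def fixdim_def of_nat_diff)
 thus ?thesis unfolding kapo_def kap_def minus_one_power_iff by simp
qed

definition vtwo :: "int vobj => int vobj => int => real" where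
 "vtwo Y L b = (if 1 ~: fst Y & 1 : fst L & b = 1 then kapo L else 1)"

text \<open>
  Signs multiply under composition, with one exception: the composite \<open>G/e \<rightarrow> G/e \<rightarrow>
  G/G\<close> over the nontrivial automorphism of \<open>G/e\<close> acquires the sign of the involution on the target.
  This twist ties the values of a virtual representation on free orbits to its fixed dimensions.
\<close>

lemma cmp_vb:
 assumes f: "f : arr (vbund R n) X Y" and g: "g : arr (vbund R' n') Y L"
  and X: "is_vob X" and Y: "is_vob Y" and L: "is_vob L"
 shows "cmp (vbund R'' n'') X Y L g f : arr (vbund R'' n'') X L" (is ?A)
  "fst (cmp (vbund R'' n'') X Y L g f) = cmp (orbit_cat C2) (fst X) (fst Y) (fst L) (fst g) (fst f)" (is ?B)
  "asg False X L (cmp (vbund R'' n'') X Y L g f) = asg False X Y f * asg False Y L g * vtwo Y L (off (fst X) (fst f))" (is ?C)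
  "1 : fst X ==> asg True X L (cmp (vbund R'' n'') X Y L g f) = asg True X Y f * asg True Y L g"
proof -
 obtain H V1 V2 K W1 W2 M U1 U2 where XY: "X = (H, V1, V2)" "Y = (K, W1, W2)" "L = (M, U1, U2)" by (metis surj_pair)
 have v: "vob H V1 V2" "vob K W1 W2" "vob M U1 U2" using X Y L by (auto simp: is_vob_def XY)
 note F = arrD[OF f X Y] and G = arrD[OF g Y L]
 define b where "b = off H (fst f)"
 define b' where "b' = off K (fst g)"
 have o: "opar H K b" "opar K M b'" and ff: "fst f = otr H K b" "fst g = otr K M b'"
  using F(1,2) G(1,2) by (auto simp: b_def b'_def XY)
 note oo = opar_comp[OF o]
 have HK: "1 : H ==> 1 : K" using oparD(3)[OF o(1)] by blast
 define e1 where "e1 = (if 1 : H then asg True X Y f else 1)"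
 define g1 where "g1 = (if 1 : K then asg True Y L g else 1)"
 define e0 where "e0 = asg False X Y f"
 define g0 where "g0 = asg False Y L g"
 have e: "e0 : {1, -1}" "e1 : {1, -1}" "g0 : {1, -1}" "g1 : {1, -1}"
  using F(4,5) G(4,5) by (auto simp: e0_def e1_def g0_def g1_def XY)
 have f': "f = (otr H K b, vcls (H, V1, V2) (K, W1, W2) (otr H K b) e0 e1)" and g': "g = (otr K M b', vcls (K, W1, W2) (M, U1, U2) (otr K M b') g0 g1)"
  using F(6) G(6) by (simp_all add: XY ff e0_def e1_def g0_def g1_def)
 have d: "vdim_eq H V1 V2 W1 W2" "vdim_eq K W1 W2 U1 U2"
  using F(3) G(3) dims_eq_iff[OF o(1) v(1,2)] dims_eq_iff[OF o(2) v(2,3)] by (auto simp: XY)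
 have tw: "vtw K M b U1 U2 = vtwo Y L (off (fst X) (fst f))"
  using kap_kapo[of M U1 U2] L by (auto simp: vtw_def vtwo_def XY b_def)
 have c: "cmp (vbund R'' n'') X Y L g f = (otr H M (ooff M b b'),
   vcls (H, V1, V2) (M, U1, U2) (otr H M (ooff M b b')) (e0 * g0 * vtw K M b U1 U2) (e1 * g1))"
 proof -
  have "cmp (vbund R'' n'') X Y L g f = (otr H M (ooff M b b'),
    vpair_rel C2 (H, V1, V2) (M, U1, U2) (otr H M (ooff M b b')) ``
   {(Z, Z'', compose (bpoints C2 H (V1 +r Z)) h1 f1, compose (bpoints C2 H (V2 +r Z)) h2 f2) | Z Z' Z'' f1 f2 h1 h2.
    (Z, Z', f1, f2) : vcls (H, V1, V2) (K, W1, W2) (otr H K b) e0 e1 & (Z', Z'', h1, h2) : vcls (K, W1, W2) (M, U1, U2) (otr K M b') g0 g1})"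
   unfolding f' g' XY by (simp add: virtual_bundles_def cmp_orbit[OF o])
  thus ?thesis unfolding vcls_compose[OF o v d e] .
 qed
 have kv: "vtw K M b U1 U2 : {1, -1}" by (auto simp: vtw_def kap_def minus_one_power_iff)
 have de: "dims_eq X L" using F(3) G(3) HK by (auto simp: dims_eq_def XY)
 have ee: "e0 * g0 * vtw K M b U1 U2 : {1, -1}" "e1 * g1 : {1, -1}" using e kv by auto
 have o'': "opar (fst X) (fst L) (ooff M b b')" using oo by (simp add: XY)
 note ac = arr_vcls[OF o'' X L de ee, of R'' n''] and av = asg_vcls[OF vcls_nonempty[OF o'' X L de ee]]
 show ?A by (subst c) (use ac in \<open>simp add: XY\<close>)
 show ?B unfolding c by (simp add: XY ff cmp_orbit[OF o])
 show ?C unfolding c using av(1) tw by (simp add: XY e0_def g0_def)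
 assume 1: "1 : fst X"
 hence "asg True X L (cmp (vbund R'' n'') X Y L g f) = e1 * g1" unfolding c using av(2) by (simp add: XY)
 thus "asg True X L (cmp (vbund R'' n'') X Y L g f) = asg True X Y f * asg True Y L g"
  using 1 HK by (simp add: e1_def g1_def XY)
qed

lemma idt_vb:
 assumes X: "is_vob X"
 shows "idt (vbund R n) X : arr (vbund R n) X X" (is ?A)
  "fst (idt (vbund R n) X) = idt (orbit_cat C2) (fst X)" (is ?B)
  "asg False X X (idt (vbund R n) X) = 1" (is ?C) "1 : fst X ==> asg True X X (idt (vbund R n) X) = 1"
proof -
 obtain H V1 V2 where XX: "X = (H, V1, V2)" by (metis surj_pair)
 have v: "vob H V1 V2" using X by (simp add: is_vob_def XX)
 have H: "subgroup H C2" and r: "orep H V1" "orep H V2" using v by (auto simp: vob_def)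
 note o = idt_orbit(2)[OF H]
 note z = orth_rep_zero[OF H]
 note su = orth_rep_sum[OF H]
 let ?p = "vpr H V1 V2 H V1 V2 0 zero_rep zero_rep (%u. u) (%u. u)"
 have k: "vok H V1 V2 H V1 V2 zero_rep zero_rep (%u. u) (%u. u)" using z eqv_id by (simp add: vok_def)
 have p: "?p = (zero_rep, zero_rep, bid C2 H (V1 +r zero_rep), bid C2 H (V2 +r zero_rep))"
  using bid_bmk[OF H su[OF r(1) z]] bid_bmk[OF H su[OF r(2) z]] by (simp add: vpr_def)
 have ps1: "ps c X X ?p = 1" if c: "okc c H" for c
 proof -
  have "sg c V zero_rep V zero_rep (%u. u) = 1" if V: "orep H V" for V
   unfolding sg_def using esgn_id[OF repc_of[OF su[OF V z] H c]] theta_values[OF repc_of[OF V H c] repc_of[OF z H c]] by auto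
  thus ?thesis unfolding XX ps_vpr[OF o v v k c] using r by simp
 qed
 have "?p : vpairs C2 X X (otr H H 0)" using vpairs_iff[OF o v v] k unfolding XX by blast
 hence pc: "?p : vcls X X (otr H H 0) 1 1" using ps1[of False] ps1[of True] by (simp add: vcls_def XX)
 have i: "idt (vbund R n) X = (otr H H 0, vcls X X (otr H H 0) 1 1)"
  using vpair_rel_image[OF o v v pc[unfolded XX]] p idt_orbit(1)[OF H] by (simp add: virtual_bundles_def XX)
 have d: "dims_eq X X" by (simp add: dims_eq_def)
 have o': "opar (fst X) (fst X) 0" using o by (simp add: XX)
 show ?A using arr_vcls[OF o' X X d, of 1 1 R n] unfolding i by (simp add: XX)
 show ?B unfolding i using idt_orbit(1)[OF H] by (simp add: XX)
 show ?C unfolding i using asg_vcls(1) pc by blast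
 show "1 : fst X ==> asg True X X (idt (vbund R n) X) = 1" unfolding i using asg_vcls(2) pc by blast
qed

lemma is_iso_vb:
 assumes f: "f : arr (vbund R n) X Y" and X: "is_vob X" and Y: "is_vob Y"
  and e: "fst X = fst Y" "fst f = idt (orbit_cat C2) (fst X)"
 shows "is_iso_arr (vbund R n) X Y f"
proof -
 note F = arrD[OF f X Y]
 have H: "subgroup (fst X) C2" using X by (simp add: is_vob_def vob_def)
 have i: "idt (orbit_cat C2) (fst X) = otr (fst X) (fst X) 0" and o: "opar (fst X) (fst X) 0" using idt_orbit[OF H] by auto
 have d: "dims_eq Y X" using F(3) e by (auto simp: dims_eq_def)
 define e1 where "e1 = (if 1 : fst X then asg True X Y f else 1)"
 have e1: "e1 : {1, -1}" using F(5) by (simp add: e1_def)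
 obtain g where g: "g : arr (vbund R n) Y X" "fst g = otr (fst X) (fst X) 0" "asg False Y X g = asg False X Y f"
   "1 : fst Y ==> asg True Y X g = e1"
  using arr_exists[OF _ Y X d F(4) e1, of 0 R n] o e by auto
 have cc: "cmp (orbit_cat C2) (fst X) (fst X) (fst X) (otr (fst X) (fst X) 0) (otr (fst X) (fst X) 0) = otr (fst X) (fst X) 0"
  using cmp_orbit[OF o o] by (simp add: ooff_def)
 have t: "vtwo Y X b = 1" "vtwo X Y b = 1" for b using e by (auto simp: vtwo_def)
 have "cmp (vbund R n) X Y X g f = idt (vbund R n) X"
  by (rule arr_eqI[OF cmp_vb(1)[OF f g(1) X Y X] idt_vb(1)[OF X] X X])
   (use cmp_vb(2-4)[OF f g(1) X Y X, of R n] idt_vb(2-4)[OF X, of R n] g e t cc i F(4,5) in \<open>auto simp: e1_def\<close>)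
 moreover have "cmp (vbund R n) Y X Y f g = idt (vbund R n) Y"
  by (rule arr_eqI[OF cmp_vb(1)[OF g(1) f Y X Y] idt_vb(1)[OF Y] Y Y])
   (use cmp_vb(2-4)[OF g(1) f Y X Y, of R n] idt_vb(2-4)[OF Y, of R n] g e t cc i F(4,5) in \<open>auto simp: e1_def\<close>)
 ultimately show ?thesis using f g(1) by (auto simp: is_iso_arr_def)
qed

lemma varr_sum_vb:
 assumes f: "f : arr (vbund R n) X Y" and f': "f' : arr (vbund R' n') X' Y'"
  and X: "is_vob X" and Y: "is_vob Y" and X': "is_vob X'" and Y': "is_vob Y'"
  and e: "fst X' = fst X" "fst Y' = fst Y" "fst f' = fst f"
 shows "varr_sum C2 X X' Y Y' f f' : arr (vbund R'' n'') (vobj_sum X X') (vobj_sum Y Y')" (is ?A)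
  "fst (varr_sum C2 X X' Y Y' f f') = fst f" (is ?B)
  "asg False (vobj_sum X X') (vobj_sum Y Y') (varr_sum C2 X X' Y Y' f f') = asg False X Y f * asg False X' Y' f' * (nu False X X' * nu False Y Y')" (is ?C)
  "1 : fst X ==> asg True (vobj_sum X X') (vobj_sum Y Y') (varr_sum C2 X X' Y Y' f f') = asg True X Y f * asg True X' Y' f' * (nu True X X' * nu True Y Y')"
proof -
 obtain H V1 V2 K W1 W2 where XY: "X = (H, V1, V2)" "Y = (K, W1, W2)" by (metis surj_pair)
 obtain V1' V2' W1' W2' where XY': "X' = (H, V1', V2')" "Y' = (K, W1', W2')" using e XY by (metis fst_conv surj_pair)
 have v: "vob H V1 V2" "vob K W1 W2" "vob H V1' V2'" "vob K W1' W2'" using X Y X' Y' by (auto simp: is_vob_def XY XY')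
 note F = arrD[OF f X Y] and G = arrD[OF f' X' Y']
 define b where "b = off H (fst f)"
 have o: "opar H K b" and ff: "fst f = otr H K b" "fst f' = otr H K b"
  using F(1,2) e by (auto simp: b_def XY)
 define e1 where "e1 = (if 1 : H then asg True X Y f else 1)"
 define g1 where "g1 = (if 1 : H then asg True X' Y' f' else 1)"
 define e0 where "e0 = asg False X Y f"
 define g0 where "g0 = asg False X' Y' f'"
 have ee: "e0 : {1, -1}" "e1 : {1, -1}" "g0 : {1, -1}" "g1 : {1, -1}"
  using F(4,5) G(4,5) by (auto simp: e0_def e1_def g0_def g1_def XY XY')
 have f1: "f = (otr H K b, vcls (H, V1, V2) (K, W1, W2) (otr H K b) e0 e1)" and g1: "f' = (otr H K b, vcls (H, V1', V2') (K, W1', W2') (otr H K b) g0 g1)"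
  using F(6) G(6) by (simp_all add: XY XY' ff e0_def e1_def g0_def g1_def)
 have XX: "vob H (V1 +r V1') (V2 +r V2')" "vob K (W1 +r W1') (W2 +r W2')"
  using v orth_rep_sum by (auto simp: vob_def)
 define n0 where "n0 = nu False X X' * nu False Y Y'"
 define n1 where "n1 = nu True X X' * nu True Y Y'"
 let ?P = "vobj_sum X X'" and ?Q = "vobj_sum Y Y'"
 have PQ: "?P = (H, V1 +r V1', V2 +r V2')" "?Q = (K, W1 +r W1', W2 +r W2')" by (simp_all add: vobj_sum_def XY XY')
 define S where "S = {(Z +r S, Z' +r S', stable_sum C2 H V1 V1' Z S W1 W1' Z' f1 g1, stable_sum C2 H V2 V2' Z S W2 W2' Z' f2 g2) | Z Z' S S' f1 f2 g1 g2.
      (Z, Z', f1, f2) : snd f & (S, S', g1, g2) : snd f'}"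
 have vs: "varr_sum C2 X X' Y Y' f f' = (otr H K b, vpair_rel C2 ?P ?Q (otr H K b) `` S)"
 proof -
  have "varr_sum C2 X X' Y Y' (otr H K b, snd f) (otr H K b, snd f') = (otr H K b, vpair_rel C2 ?P ?Q (otr H K b) `` S)"
   unfolding S_def XY XY' varr_sum_def by simp
  moreover have "f = (otr H K b, snd f)" "f' = (otr H K b, snd f')" using ff by (metis prod.collapse)+
  ultimately show ?thesis by simp
 qed
 have sub: "s : vcls ?P ?Q (otr H K b) (e0 * g0 * n0) (e1 * g1 * n1)" if sS: "s : S" for s
 proof -
  obtain Z Z' T T' h1 h2 k1 k2 where s: "s = (Z +r T, Z' +r T', stable_sum C2 H V1 V1' Z T W1 W1' Z' h1 k1, stable_sum C2 H V2 V2' Z T W2 W2' Z' h2 k2)"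
   and P: "(Z, Z', h1, h2) : snd f" and Q: "(T, T', k1, k2) : snd f'" using sS unfolding S_def by blast
  have P: "(Z, Z', h1, h2) : vcls (H, V1, V2) (K, W1, W2) (otr H K b) e0 e1" using P f1 by (metis snd_conv)
  have Q: "(T, T', k1, k2) : vcls (H, V1', V2') (K, W1', W2') (otr H K b) g0 g1" using Q g1 by (metis snd_conv)
  obtain A1 A2 where k: "vok H V1 V2 K W1 W2 Z Z' A1 A2" and p: "(Z, Z', h1, h2) = vpr H V1 V2 K W1 W2 b Z Z' A1 A2"
   using P vpairs_iff[OF o v(1,2)] by (auto simp: vcls_def vpr_def)
  obtain B1 B2 where w: "vok H V1' V2' K W1' W2' T T' B1 B2" and q: "(T, T', k1, k2) = vpr H V1' V2' K W1' W2' b T T' B1 B2"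
   using Q vpairs_iff[OF o v(3,4)] by (auto simp: vcls_def vpr_def)
  note vsum = vpair_sum[OF o v k w] and pss = ps_sum[OF o v k w]
  have s': "s = vpr H (V1 +r V1') (V2 +r V2') K (W1 +r W1') (W2 +r W2') b (Z +r T) (Z' +r T') (ssum V1 V1' Z W1 W1' Z' A1 B1) (ssum V2 V2' Z W2 W2' Z' A2 B2)"
   using vsum(1) p q unfolding s by (simp add: vpr_def)
  have "s : vpairs C2 ?P ?Q (otr H K b)" unfolding s' PQ using vpairs_iff[OF o XX] vsum(2) by blast
  moreover have "ps False ?P ?Q s = e0 * g0 * n0"
   using pss[of False] P Q unfolding p q s' PQ by (simp add: vcls_def n0_def XY XY')
  moreover have "ps True ?P ?Q s = e1 * g1 * n1" if "1 : H"
   using pss[of True] P Q that unfolding p q s' PQ by (simp add: vcls_def n1_def XY XY')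
  ultimately show ?thesis by (simp add: vcls_def PQ)
 qed
 have dX: "dims_eq X Y" "dims_eq X' Y'" using F(3) G(3) .
 have "vcls X Y (otr (fst X) (fst Y) b) e0 e1 ~= {}" "vcls X' Y' (otr (fst X') (fst Y') b) g0 g1 ~= {}"
  using vcls_nonempty[OF _ X Y dX(1) ee(1,2)] vcls_nonempty[OF _ X' Y' dX(2) ee(3,4)] o by (auto simp: XY XY')
 hence "snd f ~= {}" "snd f' ~= {}" by (subst f1, simp add: XY, subst g1, simp add: XY')
 then obtain s where s: "s : S" unfolding S_def by fastforce
 have "vpair_rel C2 ?P ?Q (otr H K b) `` S = vcls ?P ?Q (otr H K b) (e0 * g0 * n0) (e1 * g1 * n1)"
 proof -
  have im: "vpair_rel C2 ?P ?Q (otr H K b) `` {s} = vcls ?P ?Q (otr H K b) (e0 * g0 * n0) (e1 * g1 * n1)" if "s : S" for s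
   using vpair_rel_image[OF o XX] sub[OF that] unfolding PQ by blast
  show ?thesis using im s by blast
 qed
 hence vs': "varr_sum C2 X X' Y Y' f f' = (otr H K b, vcls ?P ?Q (otr H K b) (e0 * g0 * n0) (e1 * g1 * n1))" using vs by simp
 have ne: "vcls ?P ?Q (otr H K b) (e0 * g0 * n0) (e1 * g1 * n1) ~= {}" using sub[OF s] by blast
 have "vpair_rel C2 ?P ?Q (otr H K b) `` {s} = vcls ?P ?Q (otr H K b) (e0 * g0 * n0) (e1 * g1 * n1)"
  using vpair_rel_image[OF o XX] sub[OF s] unfolding PQ by blast
 moreover have "s : vpairs C2 ?P ?Q (otr H K b)" using sub[OF s] by (simp add: vcls_def)
 ultimately show ?A unfolding vs' arr_vb using otr_arr[OF o] quotientI[of s] by (metis (mono_tags, lifting) PQ case_prodI fst_conv mem_Collect_eq)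
 show ?B unfolding vs' ff by simp
 show ?C unfolding vs' asg_vcls(1)[OF ne] by (simp add: e0_def g0_def n0_def)
 assume 1: "1 : fst X"
 hence H1: "1 : H" by (simp add: XY)
 hence P1: "1 : fst ?P" by (simp add: PQ)
 show "asg True (vobj_sum X X') (vobj_sum Y Y') (varr_sum C2 X X' Y Y' f f') = asg True X Y f * asg True X' Y' f' * (nu True X X' * nu True Y Y')"
  unfolding vs' asg_vcls(2)[OF ne P1] using H1 by (simp add: e1_def g1_def n1_def)
qed

section \<open>Paths in the projective space and their lifts to the sphere\<close>

type_synonym vec31 = "(real^2) \<times> real"

abbreviation line :: "vec31 => vec31 set" where "line v \<equiv> span {v}"

abbreviation act31 :: "int => vec31 => vec31" where "act31 \<equiv> R31_action"

text \<open>
  The unit vectors that span an \<open>H\<close>-fixed line: for \<open>H = C\<^sub>2\<close>, a circle and two poles.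
\<close>

definition SH :: "int set => vec31 set" where
 "SH H = {v : sphere 0 1. 1 : H --> snd v = 0 \<or> fst v = 0}"

lemma act31_eq: "act31 b v = (fst v, (if b = 0 then 1 else - 1) * snd v)"
 by (simp add: R31_action_def case_prod_unfold)

lemma act31_simps [simp]: "act31 0 v = v" "act31 b (act31 b v) = v" "norm (act31 b v) = norm v"
 "fst (act31 b v) = fst v" "act31 b (- v) = - act31 b v" "act31 b v = 0 \<longleftrightarrow> v = 0"
 by (auto simp: act31_eq prod_eq_iff norm_prod_def)

lemma SH_simps [simp]: "- v : SH H \<longleftrightarrow> v : SH H" "act31 b v : SH H \<longleftrightarrow> v : SH H"
 by (auto simp: SH_def act31_eq norm_prod_def)

lemma SH_sphere: "v : SH H ==> norm v = 1" "v : SH H ==> v ~= 0" "SH H \<subseteq> sphere 0 1"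
 "1 ~: H ==> SH H = sphere 0 1" "H \<subseteq> K ==> SH K \<subseteq> SH H"
 by (auto simp: SH_def)

lemma linear_act31: "linear (act31 b)"
 by (rule linearI) (auto simp: act31_eq algebra_simps)

lemma act31_line: "act31 b ` line v = line (act31 b v)"
 using linear_span_image[OF linear_act31, of b "{v}"] by simp

lemma line_eq_iff:
 assumes "norm v = 1" "norm w = 1"
 shows "line v = line w \<longleftrightarrow> v = w \<or> v = - w"
proof
 assume "line v = line w"
 hence "v : line w" using span_base by blast
 then obtain k where k: "v = k *\<^sub>R w" by (auto simp: span_singleton)
 hence "\<bar>k\<bar> = 1" using assms by simp
 thus "v = w \<or> v = - w" using k by (auto simp: abs_if split: if_splits)
next
 have "line (- w) = line w" using span_image_scale[of "{w}" "%_. - 1"] by auto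
 thus "v = w \<or> v = - w ==> line v = line w" by auto
qed

lemma topspace_PR31: "topspace (gtop PR31) = {L. subspace L & dim L = 1}"
 by (simp add: PR31_def topspace_projective_gspace)

lemma line_in_PR31: "v ~= 0 ==> line v : topspace (gtop PR31)"
 by (simp add: topspace_PR31 dim_insert span_empty)

lemma gact_PR31: "v ~= 0 ==> gact PR31 b (line v) = line (act31 b v)"
 using line_in_PR31[of v] unfolding topspace_PR31 by (simp add: PR31_def projective_gspace_def act31_line)

lemma quotient_map_line: "quotient_map (top_of_set (UNIV - {0})) (gtop PR31) line"
 by (simp add: PR31_def projective_gspace_def quotient_map_quotient_topology)

lemma PR31_unit_vector:
 assumes "L : topspace (gtop PR31)"
 obtains v where "norm v = 1" "L = line v"
proof -
 have "L : line ` (UNIV - {0})" using assms quotient_imp_surjective_map[OF quotient_map_line] by simp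
 then obtain v where v: "v ~= 0" "L = line v" by blast
 have "L = line ((1 / norm v) *\<^sub>R v)" using v span_image_scale[of "{v}" "%_. 1 / norm v"] by auto
 thus thesis using that[of "(1 / norm v) *\<^sub>R v"] v by simp
qed

text \<open>The orthogonal projection to the line of \<open>v\<close>. It embeds the projective space in a normed
  space.\<close>

definition proj_op :: "vec31 => vec31 \<Rightarrow>\<^sub>L vec31" where
 "proj_op v = blinfun_scaleR_left v o\<^sub>L blinfun_inner_left v"

lemma proj_op_apply: "blinfun_apply (proj_op v) w = (v \<bullet> w) *\<^sub>R v"
 by (simp add: proj_op_def inner_commute[of w v])

lemma continuous_proj_op: "continuous_on S proj_op"
 unfolding proj_op_def
 by (intro bounded_bilinear.continuous_on[OF bounded_bilinear_blinfun_compose]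
   bounded_linear.continuous_on[OF bounded_linear_blinfun_scaleR_left]
   bounded_linear.continuous_on[OF bounded_linear_blinfun_inner_left] continuous_on_id)

lemma proj_op_minus: "proj_op (- v) = proj_op v"
 by (rule blinfun_eqI) (simp add: proj_op_apply)

lemma proj_op_eq_iff:
 assumes "norm v = 1" "norm w = 1"
 shows "proj_op v = proj_op w \<longleftrightarrow> v = w \<or> v = - w"
proof
 assume "proj_op v = proj_op w"
 hence "blinfun_apply (proj_op v) v = blinfun_apply (proj_op w) v" by simp
 hence "(v \<bullet> v) *\<^sub>R v = (w \<bullet> v) *\<^sub>R w" by (simp only: proj_op_apply)
 hence v: "v = (w \<bullet> v) *\<^sub>R w" using assms by (simp only: dot_square_norm power_one scaleR_one)
 hence "\<bar>w \<bullet> v\<bar> = 1" using assms by (metis norm_scaleR mult.right_neutral)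
 thus "v = w \<or> v = - w" using v by (metis abs_eq_iff' scaleR_one scaleR_minus1_left)
qed (auto simp: proj_op_minus)

text \<open>Over the operators \<open>b\<close> that do not kill \<open>v\<^sub>0\<close>, the two sheets are the half spheres
  on the two sides of the hyperplane orthogonal to \<open>v\<^sub>0\<close>: a unit vector on a given side is
  recovered from its projection \<open>b\<close> by normalizing \<open>b v\<^sub>0\<close>.\<close>

lemma covering_proj_op:
 assumes c: "c \<subseteq> sphere 0 1" and sy: "!!v. v : c ==> - v : c"
 shows "covering_space c proj_op (proj_op ` c)"
 unfolding covering_space_def
proof (intro conjI HOL.refl continuous_proj_op ballI)
 fix b0 assume "b0 : proj_op ` c"
 then obtain v0 where v0: "v0 : c" "b0 = proj_op v0" by blast
 have n: "norm v = 1" if "v : c" for v using c that by auto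
 define T where "T = {b : proj_op ` c. v0 \<bullet> blinfun_apply b v0 > 0}"
 define U where "U = (%e::real. {v : c. e * (v \<bullet> v0) > 0})"
 have val: "v0 \<bullet> blinfun_apply (proj_op v) v0 = (v \<bullet> v0)\<^sup>2" for v
  by (simp add: proj_op_apply inner_commute power2_eq_square)
 have opT: "openin (top_of_set (proj_op ` c)) T"
 proof -
  have "continuous_on (proj_op ` c) (%b. v0 \<bullet> blinfun_apply b v0)" by (intro continuous_intros)
  hence "openin (top_of_set (proj_op ` c)) (proj_op ` c \<inter> (%b. v0 \<bullet> blinfun_apply b v0) -` {0<..})"
   by (rule continuous_openin_preimage_gen) simp
  moreover have "T = proj_op ` c \<inter> (%b. v0 \<bullet> blinfun_apply b v0) -` {0<..}" by (auto simp: T_def)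
  ultimately show ?thesis by simp
 qed
 have opU: "openin (top_of_set c) (U e)" for e
 proof -
  have "continuous_on c (%v. e * (v \<bullet> v0))" by (intro continuous_intros)
  hence "openin (top_of_set c) (c \<inter> (%v. e * (v \<bullet> v0)) -` {0<..})"
   by (rule continuous_openin_preimage_gen) simp
  moreover have "U e = c \<inter> (%v. e * (v \<bullet> v0)) -` {0<..}" by (auto simp: U_def)
  ultimately show ?thesis by simp
 qed
 have hom: "homeomorphism (U e) T proj_op (%b. (e / sqrt (v0 \<bullet> blinfun_apply b v0)) *\<^sub>R blinfun_apply b v0)" (is "homeomorphism _ _ _ ?q")
  if e: "e = 1 \<or> e = - 1" for e :: real
 proof (rule homeomorphismI)
  have q: "?q (proj_op v) = v" if "v : U e" for v
  proof -
   have "\<bar>v \<bullet> v0\<bar> = e * (v \<bullet> v0)" "v \<bullet> v0 ~= 0" using that e by (auto simp: U_def)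
   moreover have "sqrt (v0 \<bullet> blinfun_apply (proj_op v) v0) = \<bar>v \<bullet> v0\<bar>" by (simp only: val real_sqrt_abs)
   moreover have "blinfun_apply (proj_op v) v0 = (v \<bullet> v0) *\<^sub>R v" by (simp add: proj_op_apply)
   ultimately show ?thesis using e by auto
  qed
  have s: "EX v:U e. b = proj_op v" if "b : T" for b
  proof -
   obtain v where v: "v : c" "b = proj_op v" "v \<bullet> v0 ~= 0" using \<open>b : T\<close> val by (auto simp: T_def)
   hence "v : U e \<or> - v : U e" using e sy[OF v(1)] by (auto simp: U_def)
   thus ?thesis using v(2) proj_op_minus by metis
  qed
  show "continuous_on (U e) proj_op" by (rule continuous_proj_op)
  show "continuous_on T ?q" by (intro continuous_intros) (auto simp: T_def)
  show "proj_op ` U e \<subseteq> T" by (auto simp: T_def U_def val zero_less_mult_iff)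
  show "?q ` T \<subseteq> U e" "!!b. b : T ==> proj_op (?q b) = b" using s q by fastforce+
  show "!!v. v : U e ==> ?q (proj_op v) = v" by (rule q)
 qed
 show "EX T. b0 : T & openin (top_of_set (proj_op ` c)) T &
   (EX v. \<Union> v = c \<inter> proj_op -` T & (ALL u:v. openin (top_of_set c) u) & pairwise disjnt v &
    (ALL u:v. EX q. homeomorphism u T proj_op q))"
 proof (intro exI[of _ T] conjI exI[of _ "{U 1, U (- 1)}"])
  show "b0 : T" using v0 n[OF v0(1)] by (auto simp: T_def val dot_square_norm)
  show "openin (top_of_set (proj_op ` c)) T" by (rule opT)
  show "\<Union> {U 1, U (- 1)} = c \<inter> proj_op -` T"
  proof -
   have "v : U 1 \<union> U (- 1) \<longleftrightarrow> v : c \<inter> proj_op -` T" for v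
    unfolding T_def U_def using val[of v] by (auto simp: linorder_neq_iff)
   thus ?thesis by blast
  qed
  show "ALL u:{U 1, U (- 1)}. openin (top_of_set c) u" using opU by simp
  show "pairwise disjnt {U 1, U (- 1)}" by (auto simp: pairwise_def disjnt_def U_def)
  show "ALL u:{U 1, U (- 1)}. EX q. homeomorphism u T proj_op q" using hom by blast
 qed
qed

definition line_op :: "vec31 set => vec31 \<Rightarrow>\<^sub>L vec31" where
 "line_op L = proj_op (SOME v. norm v = 1 & L = line v)"

lemma line_op_line: "norm v = 1 ==> line_op (line v) = proj_op v"
proof -
 assume v: "norm v = 1"
 define w where "w = (SOME w. norm w = 1 & line v = line w)"
 have w: "norm w = 1 & line v = line w"
  unfolding w_def by (rule someI[of _ v]) (simp add: v)
 hence "v = w \<or> v = - w" using line_eq_iff[OF v, of w] by blast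
 hence "proj_op w = proj_op v" using proj_op_minus[of w] by auto
 thus ?thesis by (simp add: line_op_def w_def)
qed

lemma continuous_line_op: "continuous_map (gtop PR31) euclidean line_op"
proof -
 have e: "line_op (line v) = proj_op ((1 / norm v) *\<^sub>R v)" if "v ~= 0" for v
 proof -
  have "line v = line ((1 / norm v) *\<^sub>R v)" using that span_image_scale[of "{v}" "%_. 1 / norm v"] by auto
  thus ?thesis using line_op_line[of "(1 / norm v) *\<^sub>R v"] that by simp
 qed
 have "continuous_on (UNIV - {0}) (%v::vec31. proj_op ((1 / norm v) *\<^sub>R v))"
  by (rule continuous_on_compose2[OF continuous_proj_op[of UNIV]]) (auto intro!: continuous_intros)
 hence "continuous_on (UNIV - {0}) (line_op o line)"
  by (rule continuous_on_eq) (simp add: e)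
 hence "continuous_map (top_of_set (UNIV - {0})) euclidean (line_op o line)" by simp
 thus ?thesis using continuous_compose_quotient_map[OF quotient_map_line] by blast
qed

subsection \<open>Equivariant maps of orbits and cylinders\<close>

text \<open>
  The representative at which coordinates on a coset are taken; it is \<open>0\<close> for the coset of the neutral
  element.
\<close>

definition rc :: "int set => int" where "rc c = (if 0 : c then 0 else 1)"

definition opt :: "int set => vec31 => int set => vec31 set" where
 "opt H v = (\<lambda>c\<in>cosets H. line (act31 (rc c) v))"

definition fobj :: "int set => vec31 => int set \<times> (int set => vec31 set)" where
 "fobj H v = (H, opt H v)"

definition ohom :: "int set => (real => vec31) => int set \<times> real => vec31 set" where
 "ohom H g = (\<lambda>(c, t)\<in>(cosets H) \<times> {0..1}. line (act31 (rc c) (g t)))"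

lemma rc_self: "subgroup H C2 ==> rc H = 0"
 by (auto simp: rc_def subgroup_C2_iff)

lemma lcoset_act: "subgroup H C2 ==> c : cosets H ==> a : {0, 1} ==> a <#\<^bsub>C2\<^esub> c : cosets H"
 by (auto simp: lcosets_C2 l_coset_C2 split: if_splits)

lemma rc_act:
 assumes H: "subgroup H C2" and c: "c : cosets H" and a: "a : {0, 1}" and v: "v : SH H"
 shows "line (act31 (rc (a <#\<^bsub>C2\<^esub> c)) v) = line (act31 a (act31 (rc c) v))"
proof (cases "1 : H")
 case True
 hence "act31 1 v = v \<or> act31 1 v = - v" using v by (auto simp: SH_def act31_eq prod_eq_iff)
 hence l: "line (act31 1 v) = line v" using line_eq_iff[of "act31 1 v" v] SH_sphere(1)[OF v] by simp
 have "c = {0, 1}" using c True by (simp add: lcosets_C2[OF H])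
 hence r: "rc c = 0" "rc (a <#\<^bsub>C2\<^esub> c) = 0" using a by (auto simp: l_coset_C2 rc_def)
 consider "a = 0" | "a = 1" using a by blast
 thus ?thesis unfolding r by cases (simp_all only: l act31_simps)
next
 case False
 thus ?thesis using c a by (auto simp: lcosets_C2[OF H] l_coset_C2 rc_def)
qed

lemma lcoset_rep:
 assumes H: "subgroup H C2" and c: "c : cosets H"
 shows "c = rc c <#\<^bsub>C2\<^esub> H" "rc c : carrier C2"
 using c subgroup_C2_cases[OF H] by (auto simp: lcosets_C2[OF H] l_coset_C2 rc_def C2_simps split: if_splits)

lemma gact_orbit: "c : cosets H ==> gact (orbit_gspace C2 H) a c = a <#\<^bsub>C2\<^esub> c"
 by (simp add: orbit_gspace_def)

lemma topspace_orbit: "topspace (gtop (orbit_gspace C2 H)) = cosets H"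
 by (simp add: orbit_gspace_def)

lemma continuous_act_line:
 assumes c: "continuous_map X (discrete_topology C) k" and g: "continuous_map X (top_of_set (sphere 0 1)) g"
 shows "continuous_map X (gtop PR31) (%x. line (act31 (rc (k x)) (g x)))"
proof -
 define s where "s = (%c. if rc c = 0 then 1 else - 1 :: real)"
 have s: "continuous_map X euclideanreal (%x. s (k x))"
  using continuous_map_compose[OF c, of euclideanreal s] by (simp add: o_def)
 have g': "continuous_map X euclidean g" using g by (simp add: continuous_map_in_subtopology)
 have "continuous_map euclidean euclidean (fst :: vec31 => _)" "continuous_map euclidean euclideanreal (snd :: vec31 => _)"
  by (simp_all add: continuous_on_fst continuous_on_snd)
 note f = continuous_map_compose[OF g' this(1), unfolded o_def] continuous_map_compose[OF g' this(2), unfolded o_def]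
 have "continuous_map X (prod_topology euclidean euclidean) (%x. (fst (g x), s (k x) * snd (g x)))"
  by (intro continuous_map_pairedI f continuous_map_real_mult s)
 hence "continuous_map X euclidean (%x. act31 (rc (k x)) (g x))"
  by (simp add: euclidean_product_topology act31_eq s_def if_distrib[of "%r. r * _"] cong: if_cong)
 moreover have "norm (g x) = 1" if "x : topspace X" for x
  using continuous_map_image_subset_topspace[OF g] that by auto
 ultimately have "continuous_map X (top_of_set (UNIV - {0})) (%x. act31 (rc (k x)) (g x))"
  unfolding continuous_map_in_subtopology by fastforce
 from continuous_map_compose[OF this quotient_imp_continuous_map[OF quotient_map_line]] show ?thesis by (simp add: o_def)
qed

lemma fixed_line:
 assumes v: "norm v = 1" and f: "1 : H ==> gact PR31 1 (line v) = line v"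
 shows "v : SH H"
proof -
 have "1 : H ==> act31 1 v = v \<or> act31 1 v = - v"
  using f gact_PR31[of v 1] line_eq_iff[of "act31 1 v" v] v by fastforce
 moreover have "fst v = 0" if "fst v = - fst v" using that scaleR_2[of "fst v"] by (metis add_eq_0_iff scaleR_eq_0_iff zero_neq_numeral)
 ultimately show ?thesis using v by (auto simp: SH_def act31_eq prod_eq_iff)
qed

lemma ob_Pi: "ob (fundamental_groupoid C2 PR31) = {fobj H v | H v. subgroup H C2 & v : SH H}"
proof (intro Set.set_eqI iffI)
 fix x assume "x : ob (fundamental_groupoid C2 PR31)"
 then obtain H y where x: "x = (H, y)" and H: "subgroup H C2" and y: "y : gmaps C2 (orbit_gspace C2 H) PR31"
  by (auto simp: fundamental_groupoid_def)
 have yt: "!!c. c : cosets H ==> y c : topspace (gtop PR31)"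
  using y by (auto simp: gmaps_def continuous_map_def topspace_orbit Pi_iff)
 obtain v where v: "norm v = 1" "y H = line v" using PR31_unit_vector[OF yt[OF coset_self[OF H]]] .
 have e: "y (a <#\<^bsub>C2\<^esub> c) = gact PR31 a (y c)" if "a : carrier C2" "c : cosets H" for a c
  using y that gact_orbit[OF that(2), of a] unfolding gmaps_def topspace_orbit by fastforce
 have "v : SH H"
 proof (rule fixed_line[OF v(1)])
  assume "1 : H"
  hence "1 <#\<^bsub>C2\<^esub> H = H" using subgroup_C2_cases[OF H] by (auto simp: l_coset_C2)
  thus "gact PR31 1 (line v) = line v" using e[of 1 H] coset_self[OF H] v(2) by (simp add: C2_simps)
 qed
 moreover have "y = opt H v"
 proof
  fix c show "y c = opt H v c"
  proof (cases "c : cosets H")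
   case True
   have "y c = gact PR31 (rc c) (y H)" using e[OF lcoset_rep(2)[OF H True] coset_self[OF H]] lcoset_rep(1)[OF H True] by simp
   moreover have "v ~= 0" using v by auto
   ultimately show ?thesis using True v(2) gact_PR31[of v] by (simp add: opt_def)
  next
   case False
   thus ?thesis using y by (auto simp: gmaps_def opt_def topspace_orbit extensional_def)
  qed
 qed
 ultimately show "x : {fobj H v | H v. subgroup H C2 & v : SH H}" using x H unfolding fobj_def by blast
next
 fix x assume "x : {fobj H v | H v. subgroup H C2 & v : SH H}"
 then obtain H v where x: "x = fobj H v" and H: "subgroup H C2" and v: "v : SH H" by auto
 have nz: "act31 b v ~= 0" for b using SH_sphere(2)[OF v] by simp
 have "opt H v : gmaps C2 (orbit_gspace C2 H) PR31"
  unfolding gmaps_def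
 proof (intro CollectI conjI ballI)
  show "opt H v : extensional (topspace (gtop (orbit_gspace C2 H)))" by (simp add: opt_def topspace_orbit)
  show "continuous_map (gtop (orbit_gspace C2 H)) (gtop PR31) (opt H v)"
   using line_in_PR31[OF nz] by (auto simp: orbit_gspace_def opt_def)
  fix a c assume a: "a : carrier C2" and "c : topspace (gtop (orbit_gspace C2 H))"
  hence c: "c : cosets H" by (simp add: topspace_orbit)
  have a': "a : {0, 1}" using a by (simp add: C2_simps)
  show "opt H v (gact (orbit_gspace C2 H) a c) = gact PR31 a (opt H v c)"
   using lcoset_act[OF H c a'] c gact_PR31[OF nz] rc_act[OF H c a' v] by (simp add: gact_orbit[OF c] opt_def)
 qed
 thus "x : ob (fundamental_groupoid C2 PR31)" using x H by (simp add: fundamental_groupoid_def fobj_def)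
qed

lemma gtop_cylinder: "gtop (cylinder (orbit_gspace C2 H)) = prod_topology (discrete_topology (cosets H)) (top_of_set {0..1})"
 by (simp add: cylinder_def orbit_gspace_def)

lemma gact_cylinder: "c : cosets H ==> t : {0..1} ==> gact (cylinder (orbit_gspace C2 H)) a (c, t) = (a <#\<^bsub>C2\<^esub> c, t)"
 by (simp add: cylinder_def topspace_orbit gact_orbit)

definition hpath :: "int set => (real => vec31) => bool" where
 "hpath H g \<longleftrightarrow> path g & path_image g \<subseteq> SH H"

lemma hpath_in: "hpath H g ==> t : {0..1} ==> g t : SH H"
 by (auto simp: hpath_def path_image_def)

lemma ohom_gmaps:
 assumes H: "subgroup H C2" and g: "hpath H g"
 shows "ohom H g : gmaps C2 (cylinder (orbit_gspace C2 H)) PR31"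
 unfolding gmaps_def gtop_cylinder
proof (intro CollectI conjI ballI)
 let ?D = "discrete_topology (cosets H)" and ?I = "top_of_set {0..1::real}"
 show "ohom H g : extensional (topspace (prod_topology ?D ?I))" by (simp add: ohom_def)
 have "continuous_map ?I (top_of_set (sphere 0 1)) g"
  using g SH_sphere(3)[of H] by (auto simp: hpath_def path_def path_image_def continuous_map_in_subtopology)
 hence "continuous_map (prod_topology ?D ?I) (top_of_set (sphere 0 1)) (%x. g (snd x))"
  using continuous_map_compose[OF continuous_map_snd, of ?I "top_of_set (sphere 0 1)" g ?D] by (simp add: o_def)
 hence "continuous_map (prod_topology ?D ?I) (gtop PR31) (%x. line (act31 (rc (fst x)) (g (snd x))))"
  by (intro continuous_act_line[OF continuous_map_fst])
 thus "continuous_map (prod_topology ?D ?I) (gtop PR31) (ohom H g)"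
  by (rule continuous_map_eq) (auto simp: ohom_def)
 fix a x assume a: "a : carrier C2" and "x : topspace (prod_topology ?D ?I)"
 then obtain c t where x: "x = (c, t)" "c : cosets H" "t : {0..1}" by auto
 have a': "a : {0, 1}" using a by (simp add: C2_simps)
 note gt = hpath_in[OF g x(3)]
 show "ohom H g (gact (cylinder (orbit_gspace C2 H)) a x) = gact PR31 a (ohom H g x)"
  unfolding x(1) gact_cylinder[OF x(2,3)]
  using x lcoset_act[OF H x(2) a'] rc_act[OF H x(2) a' gt] gact_PR31[of "act31 (rc c) (g t)" a] SH_sphere(2)[OF gt]
  by (simp add: ohom_def)
qed

lemma gmaps_cylinder_fixed:
 assumes H: "subgroup H C2" and w: "w : gmaps C2 (cylinder (orbit_gspace C2 H)) PR31" and t: "t : {0..1}"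
 obtains v where "v : SH H" "w (H, t) = line v" "!!c. c : cosets H ==> w (c, t) = line (act31 (rc c) v)"
proof -
 have e: "w (a <#\<^bsub>C2\<^esub> c, t) = gact PR31 a (w (c, t))" if "a : carrier C2" "c : cosets H" for a c
  
 proof -
  have "(c, t) : topspace (gtop (cylinder (orbit_gspace C2 H)))" using that t by (simp add: gtop_cylinder)
  hence "w (gact (cylinder (orbit_gspace C2 H)) a (c, t)) = gact PR31 a (w (c, t))" using w that(1) unfolding gmaps_def by blast
  thus ?thesis using gact_cylinder[OF that(2) t] by simp
 qed
 have "w (H, t) : topspace (gtop PR31)"
  using w coset_self[OF H] t by (auto simp: gmaps_def continuous_map_def gtop_cylinder Pi_iff)
 then obtain v where v: "norm v = 1" "w (H, t) = line v" using PR31_unit_vector by metis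
 have vS: "v : SH H"
 proof (rule fixed_line[OF v(1)])
  assume "1 : H"
  hence "1 <#\<^bsub>C2\<^esub> H = H" using subgroup_C2_cases[OF H] by (auto simp: l_coset_C2)
  thus "gact PR31 1 (line v) = line v" using e[of 1 H] coset_self[OF H] v(2) by (simp add: C2_simps)
 qed
 have "w (c, t) = line (act31 (rc c) v)" if "c : cosets H" for c
  using e[OF lcoset_rep(2)[OF H that] coset_self[OF H]] lcoset_rep(1)[OF H that] v(2) gact_PR31[OF SH_sphere(2)[OF vS]] by simp
 thus thesis using that[OF vS v(2)] by blast
qed

lemma gmaps_cylinder_op:
 assumes H: "subgroup H C2" and w: "w : gmaps C2 (cylinder (orbit_gspace C2 H)) PR31"
 shows "path (%t. line_op (w (H, t)))" "path_image (%t. line_op (w (H, t))) \<subseteq> proj_op ` SH H"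
proof -
 have "continuous_map (top_of_set {0..1}) (prod_topology (discrete_topology (cosets H)) (top_of_set {0..1})) (%t. (H, t))"
  by (intro continuous_map_pairedI) (auto simp: coset_self[OF H])
 moreover have "continuous_map (prod_topology (discrete_topology (cosets H)) (top_of_set {0..1})) (gtop PR31) w"
  using w by (simp add: gmaps_def gtop_cylinder)
 ultimately have "continuous_map (top_of_set {0..1}) euclidean (line_op o (w o (%t. (H, t))))"
  by (intro continuous_map_compose[OF _ continuous_line_op] continuous_map_compose)
 thus "path (%t. line_op (w (H, t)))" by (simp add: path_def o_def)
 show "path_image (%t. line_op (w (H, t))) \<subseteq> proj_op ` SH H"
 proof -
  have "line_op (w (H, t)) : proj_op ` SH H" if t: "t : {0..1}" for t
  proof -
   obtain v where "v : SH H" "w (H, t) = line v" using gmaps_cylinder_fixed[OF H w t] .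
   thus ?thesis using line_op_line[of v] SH_sphere(1) by simp
  qed
  thus ?thesis unfolding path_image_def by (rule image_subsetI)
 qed
qed

lemma covering_SH: "covering_space (SH H) proj_op (proj_op ` SH H)"
 by (rule covering_proj_op[OF SH_sphere(3)]) simp

text \<open>
  An equivariant homotopy is determined by its restriction to the base coset. This is a path of \<open>H\<close>-fixed
  lines, and it lifts to the double cover by unit vectors.
\<close>

lemma gmaps_cylinder_lift:
 assumes H: "subgroup H C2" and w: "w : gmaps C2 (cylinder (orbit_gspace C2 H)) PR31" and v: "v : SH H" "w (H, 0) = line v"
 obtains g where "hpath H g" "g 0 = v" "w = ohom H g"
proof -
 have st: "pathstart (%t. line_op (w (H, t))) = proj_op v" using v line_op_line SH_sphere(1) by (simp add: pathstart_def)
 obtain g where g: "path g" "path_image g \<subseteq> SH H" "pathstart g = v" "!!t. t : {0..1} ==> proj_op (g t) = line_op (w (H, t))"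
  using covering_space_lift_path_strong[OF covering_SH v(1) gmaps_cylinder_op[OF H w] st] by blast
 have hp: "hpath H g" using g by (simp add: hpath_def)
 have "w x = ohom H g x" for x
 proof (cases "x : (cosets H) \<times> {0..1}")
  case True
  then obtain c t where x: "x = (c, t)" "c : cosets H" "t : {0..1}" by auto
  obtain u where u: "u : SH H" "w (H, t) = line u" "w (c, t) = line (act31 (rc c) u)"
   using gmaps_cylinder_fixed[OF H w x(3)] x(2) by metis
  have gt: "g t : SH H" by (rule hpath_in[OF hp x(3)])
  have "proj_op (g t) = proj_op u" using g(4)[OF x(3)] u line_op_line SH_sphere(1) by metis
  hence "g t = u \<or> g t = - u" using proj_op_eq_iff SH_sphere(1) gt u(1) by blast
  hence "line (act31 (rc c) u) = line (act31 (rc c) (g t))"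
   using line_eq_iff[of "act31 (rc c) u" "act31 (rc c) (g t)"] SH_sphere(1)[OF gt] SH_sphere(1)[OF u(1)] by auto
  thus ?thesis using u(3) x by (simp add: ohom_def)
 next
  case False
  hence "x ~: topspace (gtop (cylinder (orbit_gspace C2 H)))" by (simp add: gtop_cylinder)
  hence "w x = undefined" using w unfolding gmaps_def extensional_def by blast
  moreover have "ohom H g x = undefined" using False unfolding ohom_def restrict_def by (rule if_not_P)
  ultimately show ?thesis by simp
 qed
 thus thesis using that[OF hp] g(3) by (simp add: pathstart_def fun_eq_iff)
qed

subsection \<open>Homotopies of lifted paths\<close>

lemma ohom_ghomotopies:
 assumes H: "subgroup H C2" and g: "hpath H g"
 shows "ohom H g : ghomotopies C2 PR31 H (opt H (g 0)) (opt H (g 1))"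
 using ohom_gmaps[OF assms] by (auto simp: ghomotopies_def ohom_def opt_def)

abbreviation orel :: "int set => vec31 => vec31 => ((int set \<times> real => vec31 set) \<times> (int set \<times> real => vec31 set)) set" where
 "orel H v w \<equiv> rel_homotopy C2 PR31 H (opt H v) (opt H w)"

lemma orel_sym: "(\<omega>, \<omega>') : orel H v w ==> (\<omega>', \<omega>) : orel H v w"
 by (simp add: rel_homotopy_def homotopic_with_sym)

lemma orel_trans: "(\<omega>, \<omega>') : orel H v w ==> (\<omega>', \<omega>'') : orel H v w ==> (\<omega>, \<omega>'') : orel H v w"
 unfolding rel_homotopy_def using homotopic_with_trans by blast

lemma orel_ghomotopies: "(\<omega>, \<omega>') : orel H v w ==> \<omega>' : ghomotopies C2 PR31 H (opt H v) (opt H w)"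
 unfolding rel_homotopy_def by (auto dest: homotopic_with_imp_property)

lemma ohom_homotopic:
 assumes H: "subgroup H C2" and gg: "homotopic_paths (SH H) g g'"
 shows "(ohom H g, ohom H g') : orel H (g 0) (g 1)"
proof -
 let ?I = "top_of_set {0..1::real}" and ?D = "discrete_topology (cosets H)"
 obtain h where h: "continuous_map (prod_topology ?I ?I) (top_of_set (SH H)) h" "!!x. h (0, x) = g x" "!!x. h (1, x) = g' x"
   "!!s. s : {0..1} ==> h (s, 0) = g 0 & h (s, 1) = g 1"
  using gg unfolding homotopic_paths_def homotopic_with_def pathstart_def pathfinish_def by blast
 define k where "k = (%(s, x). ohom H (%t. h (s, t)) x)"
 have "continuous_map (prod_topology ?I (prod_topology ?D ?I)) (prod_topology ?I ?I) (%x. (fst x, snd (snd x)))"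
  using continuous_map_compose[OF continuous_map_snd continuous_map_snd, of ?I ?D ?I]
  by (intro continuous_map_pairedI continuous_map_fst) (simp add: o_def)
 from continuous_map_compose[OF this h(1)]
 have "continuous_map (prod_topology ?I (prod_topology ?D ?I)) (top_of_set (sphere 0 1)) (%x. h (fst x, snd (snd x)))"
  using SH_sphere(3)[of H] by (auto simp: continuous_map_in_subtopology o_def)
 moreover have "continuous_map (prod_topology ?I (prod_topology ?D ?I)) ?D (%x. fst (snd x))"
  using continuous_map_compose[OF continuous_map_snd continuous_map_fst, of ?I ?D ?I] by (simp add: o_def)
 ultimately have "continuous_map (prod_topology ?I (prod_topology ?D ?I)) (gtop PR31) (%x. line (act31 (rc (fst (snd x))) (h (fst x, snd (snd x)))))"
  by (intro continuous_act_line)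
 hence kc: "continuous_map (prod_topology ?I (prod_topology ?D ?I)) (gtop PR31) k"
  by (rule continuous_map_eq) (auto simp: k_def ohom_def)
 have "(%x. k (s, x)) : ghomotopies C2 PR31 H (opt H (g 0)) (opt H (g 1))" if s: "s : {0..1}" for s
 proof -
  have "continuous_map ?I (prod_topology ?I ?I) (%t. (s, t))" using s by (intro continuous_map_pairedI) auto
  from continuous_map_compose[OF this h(1)] have "hpath H (%t. h (s, t))"
   by (auto simp: hpath_def path_def path_image_def continuous_map_in_subtopology o_def)
  from ohom_ghomotopies[OF H this] show ?thesis using h(4)[OF s] by (simp add: k_def)
 qed
 thus ?thesis unfolding rel_homotopy_def homotopic_with_def gtop_cylinder
  using kc h by (intro CollectI case_prodI exI[of _ k] conjI) (auto simp: k_def)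
qed

text \<open>
  A homotopy of homotopies restricts on the base coset to a homotopy of paths of lines, and the homotopy lifting
  property of the double cover applies.
\<close>

lemma homotopic_if_ohom:
 assumes H: "subgroup H C2" and g: "hpath H g" "hpath H g'" "g 0 = g' 0" and r: "(ohom H g, ohom H g') : orel H v w"
 shows "homotopic_paths (SH H) g g'"
proof -
 let ?I = "top_of_set {0..1::real}" and ?D = "discrete_topology (cosets H)"
 obtain h where h: "continuous_map (prod_topology ?I (prod_topology ?D ?I)) (gtop PR31) h" "!!x. h (0, x) = ohom H g x" "!!x. h (1, x) = ohom H g' x"
   "!!s. s : {0..1} ==> (%x. h (s, x)) : ghomotopies C2 PR31 H (opt H v) (opt H w)"
  using r unfolding rel_homotopy_def homotopic_with_def gtop_cylinder by blast
 define k where "k = (%x. line_op (h (fst x, (H, snd x))))"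
 have "continuous_map (prod_topology ?I ?I) (prod_topology ?I (prod_topology ?D ?I)) (%x. (fst x, (H, snd x)))"
  by (intro continuous_map_pairedI continuous_map_fst continuous_map_snd) (simp add: coset_self[OF H])
 hence "continuous_map (prod_topology ?I ?I) euclidean (line_op o (h o (%x. (fst x, (H, snd x)))))"
  by (intro continuous_map_compose[OF _ continuous_line_op] continuous_map_compose[OF _ h(1)])
 hence kc: "continuous_map (prod_topology ?I ?I) euclidean k" by (simp add: k_def o_def)
 have gm: "(%x. h (s, x)) : gmaps C2 (cylinder (orbit_gspace C2 H)) PR31" if "s : {0..1}" for s
  using h(4)[OF that] by (simp add: ghomotopies_def)
 have ki: "k x : proj_op ` SH H" if "x : {0..1} \<times> {0..1}" for x
  using gmaps_cylinder_op(2)[OF H gm, of "fst x"] that by (auto simp: k_def path_image_def image_subset_iff)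
 have ends: "k (s, 0) = line_op (opt H v H)" "k (s, 1) = line_op (opt H w H)" if "s : {0..1}" for s
  using h(4)[OF that] coset_self[OF H] by (simp_all add: k_def ghomotopies_def)
 have kg: "k (0, t) = line_op (ohom H g (H, t))" "k (1, t) = line_op (ohom H g' (H, t))" for t using h(2,3) by (simp_all add: k_def)
 have lp: "line_op (ohom H f (H, t)) = proj_op (f t)" if "hpath H f" "t : {0..1}" for f t
  using that coset_self[OF H] line_op_line SH_sphere(1)[OF hpath_in[OF that]] by (simp add: ohom_def rc_self[OF H])
 have hp: "homotopic_paths (proj_op ` SH H) (%t. line_op (ohom H g (H, t))) (%t. line_op (ohom H g' (H, t)))"
  unfolding homotopic_paths_def homotopic_with_def
 proof (intro exI[of _ k] conjI allI ballI kg)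
  show "continuous_map (prod_topology ?I ?I) (top_of_set (proj_op ` SH H)) k"
   using kc ki by (auto simp: continuous_map_in_subtopology)
  have z: "(0::real) : {0..1}" by simp
  show "pathstart (%t. k (s, t)) = pathstart (%t. line_op (ohom H g (H, t)))"
     "pathfinish (%t. k (s, t)) = pathfinish (%t. line_op (ohom H g (H, t)))" if "s : {0..1}" for s
   using ends[OF that] ends[OF z] kg(1)[symmetric] by (simp_all add: pathstart_def pathfinish_def)
 qed
 note G = ohom_gmaps[OF H g(1)] ohom_gmaps[OF H g(2)]
 show ?thesis
  by (rule covering_space_lift_homotopic_paths[OF covering_SH gmaps_cylinder_op[OF H G(1)] gmaps_cylinder_op[OF H G(2)] hp])
   (use g lp in \<open>auto simp: hpath_def pathstart_def\<close>)
qed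

subsection \<open>Arrows of the fundamental groupoid\<close>

text \<open>
  The arrow over the orbit map with offset \<open>b\<close> that is given by the lifted path \<open>g\<close>.
\<close>

definition parr :: "int set => int set => int => (real => vec31) => (int set => int set) \<times> (int set \<times> real => vec31 set) set" where
 "parr H K b g = (otr H K b, orel H (g 0) (g 1) `` {ohom H g})"

definition pdat :: "int set => int set => int => (real => vec31) => bool" where
 "pdat H K b g \<longleftrightarrow> opar H K b & hpath H g & g 1 : SH K"

abbreviation PiB :: "(int set \<times> (int set => vec31 set), (int set => int set) \<times> (int set \<times> real => vec31 set) set) cat" where
 "PiB \<equiv> fundamental_groupoid C2 PR31"

lemma line_act31_fixed: "1 : K ==> v : SH K ==> line (act31 r v) = line v"
proof -
 assume "1 : K" "v : SH K"
 hence "act31 r v = v \<or> act31 r v = - v" by (auto simp: SH_def act31_eq prod_eq_iff)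
 thus ?thesis using line_eq_iff[of "act31 r v" v] SH_sphere(1)[OF \<open>v : SH K\<close>] by simp
qed

lemma opt_minus: "norm v = 1 ==> opt H (- v) = opt H v"
 using line_eq_iff[of "- act31 r v" "act31 r v" for r] by (auto simp: opt_def intro!: restrict_ext)

lemma opt_eq_iff:
 assumes H: "subgroup H C2" and n: "norm v = 1" "norm w = 1"
 shows "opt H v = opt H w \<longleftrightarrow> v = w \<or> v = - w"
proof
 assume "opt H v = opt H w"
 hence "opt H v H = opt H w H" by simp
 thus "v = w \<or> v = - w" using coset_self[OF H] line_eq_iff[OF n] by (simp add: opt_def rc_self[OF H])
qed (use opt_minus[OF n(2)] in auto)

lemma compose_opt:
 assumes o: "opar H K b" and v: "v : SH K"
 shows "compose (cosets H) (opt K v) (otr H K b) = opt H (act31 b v)"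
proof
 fix c
 note oD = oparD[OF o]
 show "compose (cosets H) (opt K v) (otr H K b) c = opt H (act31 b v) c"
 proof (cases "c : cosets H")
  case True
  hence cK: "otr H K b c : cosets K" using otr_arr[OF o] by (auto simp: orbit_cat_def gmaps_def orbit_gspace_def Pi_iff)
  show ?thesis
  proof (cases "1 : K")
   case 1: True
   thus ?thesis using True cK oD(5) line_act31_fixed[OF 1 v] by (simp add: compose_def opt_def)
  next
   case False
   hence c: "c = {0} \<or> c = {1}" using True oD lcosets_C2[OF oD(1)] by (auto split: if_splits)
   have "otr H K b c = (%a. (a + b) mod 2) ` c" using True False by (simp add: otr_def)
   hence "act31 (rc (otr H K b c)) v = act31 (rc c) (act31 b v)" using c oD(4) by (elim insertE emptyE disjE) (simp_all add: rc_def act31_eq)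
   thus ?thesis using True cK by (simp add: compose_def opt_def)
  qed
 qed (simp add: compose_def opt_def)
qed

lemma fobj_fst [simp]: "fst (fobj H v) = H" by (simp add: fobj_def)

lemma fobj_eq_iff: "subgroup H C2 ==> v : SH H ==> w : SH H ==> fobj H v = fobj H w \<longleftrightarrow> v = w \<or> v = - w"
 using opt_eq_iff[of H v w] SH_sphere(1) by (simp add: fobj_def)

lemma fobj_ob: "subgroup H C2 ==> v : SH H ==> fobj H v : ob PiB"
 unfolding ob_Pi by blast

lemma arr_Pi:
 assumes K: "subgroup H C2" "subgroup K C2" "w : SH K"
 shows "f : arr PiB (fobj H v) (fobj K w) \<longleftrightarrow> (EX b P. opar H K b & f = (otr H K b, P) &
  P : ghomotopies C2 PR31 H (opt H v) (opt H (act31 b w)) // orel H v (act31 b w))"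
proof -
 obtain \<alpha> P where f: "f = (\<alpha>, P)" by (cases f)
 show ?thesis unfolding f using orbit_arr_iff[OF K(1,2), of \<alpha>] compose_opt[OF _ K(3), of H] off_otr[of H K]
  by (fastforce simp: fundamental_groupoid_def fobj_def)
qed

lemma parr_arr:
 assumes p: "pdat H K b g"
 shows "parr H K b g : arr PiB (fobj H (g 0)) (fobj K (act31 b (g 1)))"
proof -
 have o: "opar H K b" "hpath H g" "g 1 : SH K" using p by (auto simp: pdat_def)
 note H = oparD(1,2)[OF o(1)]
 show ?thesis using arr_Pi[OF H, of "act31 b (g 1)" "parr H K b g" "g 0"] o ohom_ghomotopies[OF H(1) o(2)] quotientI
  by (fastforce simp: parr_def)
qed

lemma arr_parr:
 assumes H: "subgroup H C2" "v : SH H" and K: "subgroup K C2" "w : SH K" and f: "f : arr PiB (fobj H v) (fobj K w)"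
 obtains b g where "pdat H K b g" "g 0 = v" "g 1 = act31 b w \<or> g 1 = - act31 b w" "f = parr H K b g"
proof -
 obtain b P where o: "opar H K b" and fP: "f = (otr H K b, P)"
  and P: "P : ghomotopies C2 PR31 H (opt H v) (opt H (act31 b w)) // orel H v (act31 b w)"
  using f arr_Pi[OF H(1) K] by blast
 obtain \<omega> where \<omega>: "\<omega> : ghomotopies C2 PR31 H (opt H v) (opt H (act31 b w))" "P = orel H v (act31 b w) `` {\<omega>}"
  using P by (auto elim: quotientE)
 have e: "\<omega> (H, 0) = line v" "\<omega> (H, 1) = line (act31 b w)" and G: "\<omega> : gmaps C2 (cylinder (orbit_gspace C2 H)) PR31"
  using \<omega>(1) coset_self[OF H(1)] by (auto simp: ghomotopies_def opt_def rc_self[OF H(1)])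
 obtain g where g: "hpath H g" "g 0 = v" "\<omega> = ohom H g" using gmaps_cylinder_lift[OF H(1) G H(2) e(1)] .
 have n: "norm (g 1) = 1" "norm (act31 b w) = 1" using SH_sphere(1)[OF hpath_in[OF g(1)], of 1] SH_sphere(1)[OF K(2)] by auto
 have "line (g 1) = line (act31 b w)" using e(2) coset_self[OF H(1)] unfolding g(3) by (simp add: ohom_def rc_self[OF H(1)])
 hence g1: "g 1 = act31 b w \<or> g 1 = - act31 b w" using line_eq_iff[OF n] by blast
 hence "g 1 : SH K" "opt H (g 1) = opt H (act31 b w)" using K(2) opt_minus[OF n(2)] by auto
 thus thesis using that[OF _ g(2) g1, of] o g \<omega>(2) fP by (simp add: pdat_def parr_def)
qed

lemma parr_homotopic:
 assumes "subgroup H C2" "homotopic_paths (SH H) g g'"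
 shows "parr H K b g = parr H K b g'"
proof -
 have "g 0 = g' 0" "g 1 = g' 1"
  using homotopic_paths_imp_pathstart[OF assms(2)] homotopic_paths_imp_pathfinish[OF assms(2)] by (auto simp: pathstart_def pathfinish_def)
 moreover note r = ohom_homotopic[OF assms]
 have "orel H (g 0) (g 1) `` {ohom H g} = orel H (g 0) (g 1) `` {ohom H g'}"
  by (intro equalityI subsetI) (use orel_trans[OF orel_sym[OF r]] orel_trans[OF r] in \<open>simp_all add: Image_singleton_iff\<close>)
 ultimately show ?thesis by (simp only: parr_def)
qed

lemma parr_minus:
 assumes "subgroup H C2" "hpath H g"
 shows "parr H K b (%t. - g t) = parr H K b g"
proof -
 have n: "t : {0..1} ==> norm (g t) = 1" for t using SH_sphere(1)[OF hpath_in[OF assms(2)]] .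
 hence "ohom H (%t. - g t) = ohom H g"
  using line_eq_iff[of "- act31 r (g t)" "act31 r (g t)" for r t] by (auto simp: ohom_def intro!: restrict_ext)
 thus ?thesis using opt_minus[OF n, of 0] opt_minus[OF n, of 1] by (simp add: parr_def)
qed

lemma rel_lift:
 assumes H: "subgroup H C2" and g: "hpath H g" and r: "(ohom H g, \<omega>) : orel H (g 0) w"
 obtains g' where "hpath H g'" "\<omega> = ohom H g'" "homotopic_paths (SH H) g g'"
proof -
 have \<omega>: "\<omega> : ghomotopies C2 PR31 H (opt H (g 0)) (opt H w)" by (rule orel_ghomotopies[OF r])
 hence "\<omega> : gmaps C2 (cylinder (orbit_gspace C2 H)) PR31" "\<omega> (H, 0) = line (g 0)"
  using coset_self[OF H] by (auto simp: ghomotopies_def opt_def rc_self[OF H])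
 then obtain g' where g': "hpath H g'" "g' 0 = g 0" "\<omega> = ohom H g'" using gmaps_cylinder_lift[OF H _ hpath_in[OF g, of 0]] by auto
 show thesis using that[OF g'(1,3) homotopic_if_ohom[OF H g g'(1) g'(2)[symmetric] r[unfolded g'(3)]]] .
qed

lemma parr_inj:
 assumes p: "pdat H K b g" "pdat H K b' g'" "g 0 = g' 0" "parr H K b g = parr H K b' g'"
 shows "b = b'" "homotopic_paths (SH H) g g'"
proof -
 have o: "opar H K b" "opar H K b'" and g: "hpath H g" "hpath H g'" using p by (auto simp: pdat_def)
 note H = oparD(1)[OF o(1)]
 have "otr H K b = otr H K b'" using arg_cong[OF p(4), of fst] by (simp only: parr_def fst_conv)
 thus "b = b'" using off_otr[OF o(1)] off_otr[OF o(2)] by metis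
 have "(ohom H g', ohom H g') : orel H (g' 0) (g' 1)"
  using ohom_homotopic[OF H] g(2) by (simp add: hpath_def)
 hence "(ohom H g, ohom H g') : orel H (g 0) (g 1)"
  using arg_cong[OF p(4), of snd] by (simp only: parr_def snd_conv Image_singleton_iff[symmetric])
 from homotopic_if_ohom[OF H g p(3) this] show "homotopic_paths (SH H) g g'" .
qed

lemma act31_ooff:
 assumes "opar H K b" "opar K L b'"
 shows "act31 (ooff L b b') u = (if 1 : L then u else act31 b (act31 b' u))"
 using oparD(4)[OF assms(1)] oparD(4)[OF assms(2)] by (auto simp: ooff_def act31_eq)

lemma pdat_join:
 assumes p: "pdat H K b g" "pdat K L b' g'" "g' 0 = act31 b (g 1)"
 shows "pdat H L (ooff L b b') (g +++ (act31 b o g'))" "hpath H (act31 b o g')"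
  "fobj L (act31 (ooff L b b') (act31 b (g' 1))) = fobj L (act31 b' (g' 1))"
  "opt H (act31 (ooff L b b') (act31 b' (g' 1))) = opt H (act31 b (g' 1))"
proof -
 have o: "opar H K b" "opar K L b'" and g: "hpath H g" "hpath K g'" and e: "g' 1 : SH L" using p by (auto simp: pdat_def)
 have cont: "continuous_on UNIV (act31 b)" unfolding act31_eq by (intro continuous_intros)
 have "path (act31 b o g')" using g(2) path_continuous_image[OF _ continuous_on_subset[OF cont]] by (auto simp: hpath_def)
 moreover have "path_image (act31 b o g') \<subseteq> SH H" using g(2) SH_sphere(5)[OF oparD(3)[OF o(1)]] by (auto simp: hpath_def path_image_compose)
 ultimately show h: "hpath H (act31 b o g')" by (simp add: hpath_def)
 have "path (g +++ (act31 b o g'))" using h g p(3) by (simp add: hpath_def pathstart_def pathfinish_def)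
 hence "hpath H (g +++ (act31 b o g'))" using h g(1) path_image_join_subset[of g "act31 b o g'"] unfolding hpath_def by blast
 thus "pdat H L (ooff L b b') (g +++ (act31 b o g'))" using opar_comp[OF o] e by (simp add: pdat_def joinpaths_def)
 have n: "opt M (act31 b (g' 1)) = opt M (g' 1)" if "1 : L" for M
 proof -
  have "act31 b (g' 1) = g' 1 \<or> act31 b (g' 1) = - g' 1" using e that by (auto simp: SH_def act31_eq prod_eq_iff)
  thus ?thesis using opt_minus[OF SH_sphere(1)[OF e]] by auto
 qed
 have c: "act31 b (act31 b' (act31 b u)) = act31 b' u" for u by (simp add: act31_eq)
 show "fobj L (act31 (ooff L b b') (act31 b (g' 1))) = fobj L (act31 b' (g' 1))"
  using n oparD(5)[OF o(2)] by (auto simp: act31_ooff[OF o] fobj_def c)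
 show "opt H (act31 (ooff L b b') (act31 b' (g' 1))) = opt H (act31 b (g' 1))"
  using n oparD(5)[OF o(2)] by (auto simp: act31_ooff[OF o])
qed

lemma concat_ohom:
 assumes o: "opar H K b" and g: "hpath K g'"
 shows "concat_htpy C2 H (%(c, t). ohom K g' (otr H K b c, t)) (ohom H g) = ohom H (g +++ (act31 b o g'))"
 unfolding concat_htpy_def ohom_def[of H "g +++ _"]
proof (rule restrict_ext)
 fix x :: "int set \<times> real" assume "x : (cosets H) \<times> {0..1}"
 then obtain c t where x: "x = (c, t)" and c: "c : cosets H" and t: "t : {0..1}" by blast
 have cK: "otr H K b c : cosets K" using c otr_arr[OF o] by (auto simp: orbit_cat_def gmaps_def orbit_gspace_def Pi_iff)
 show "(case x of (c, t) => if t <= 1 / 2 then ohom H g (c, 2 * t) else (case (c, 2 * t - 1) of (c, t) => ohom K g' (otr H K b c, t))) =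
   (case x of (c, t) => line (act31 (rc c) ((g +++ (act31 b o g')) t)))"
 proof (cases "t <= 1 / 2")
  case True
  thus ?thesis unfolding x using c t by (simp add: ohom_def joinpaths_def)
 next
  case False
  hence v: "g' (2 * t - 1) : SH K" using hpath_in[OF g] t by simp
  have "opt K (g' (2 * t - 1)) (otr H K b c) = opt H (act31 b (g' (2 * t - 1))) c"
   using compose_opt[OF o v] c by (metis compose_eq)
  thus ?thesis unfolding x using False c cK t by (simp add: ohom_def opt_def joinpaths_def)
 qed
qed

text \<open>
  The second path starts where the first one ends only after applying the translation \<open>b\<close> of orbits, hence
  the action in the concatenation.
\<close>

lemma parr_comp:
 assumes p: "pdat H K b g" "pdat K L b' g'" "g' 0 = act31 b (g 1)"
 shows "cmp PiB (fobj H (g 0)) (fobj K (g' 0)) (fobj L (act31 b' (g' 1))) (parr K L b' g') (parr H K b g) =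
  parr H L (ooff L b b') (g +++ (act31 b o g'))"
proof -
 have o: "opar H K b" "opar K L b'" and g: "hpath H g" "hpath K g'" and e: "act31 b' (g' 1) : SH L" using p by (auto simp: pdat_def)
 note H = oparD(1)[OF o(1)] and K = oparD(1)[OF o(2)]
 define j where "j = g +++ (act31 b o g')"
 have j01: "j 0 = g 0" "j 1 = act31 b (g' 1)" by (simp_all add: j_def joinpaths_def)
 define S where "S = {concat_htpy C2 H (%(c, t). \<omega> (otr H K b c, t)) \<omega>' | \<omega> \<omega>'. \<omega> : snd (parr K L b' g') & \<omega>' : snd (parr H K b g)}"
 have "cmp PiB (fobj H (g 0)) (fobj K (g' 0)) (fobj L (act31 b' (g' 1))) (parr K L b' g') (parr H K b g) =
   (otr H L (ooff L b b'), orel H (j 0) (j 1) `` S)"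
  unfolding S_def j01 pdat_join(4)[OF p, symmetric]
  by (simp add: fundamental_groupoid_def fobj_def parr_def cmp_orbit[OF o] compose_opt[OF opar_comp[OF o] e])
 moreover have rS: "(ohom H j, s) : orel H (j 0) (j 1)" if "s : S" for s
 proof -
  obtain \<omega> \<omega>' where s: "s = concat_htpy C2 H (%(c, t). \<omega> (otr H K b c, t)) \<omega>'"
   and r: "(ohom K g', \<omega>) : orel K (g' 0) (g' 1)" "(ohom H g, \<omega>') : orel H (g 0) (g 1)"
   using \<open>s : S\<close> by (auto simp: S_def parr_def)
  obtain k' where k': "hpath K k'" "\<omega> = ohom K k'" "homotopic_paths (SH K) g' k'" using rel_lift[OF K g(2) r(1)] .
  obtain k where k: "hpath H k" "\<omega>' = ohom H k" "homotopic_paths (SH H) g k" using rel_lift[OF H g(1) r(2)] .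
  have cont: "continuous_on (SH K) (act31 b)" unfolding act31_eq by (intro continuous_intros)
  have "homotopic_paths (SH H) (act31 b o g') (act31 b o k')"
   by (rule homotopic_paths_continuous_image[OF k'(3) cont]) (use SH_sphere(5)[OF oparD(3)[OF o(1)]] in auto)
  hence "homotopic_paths (SH H) j (k +++ (act31 b o k'))"
   unfolding j_def by (rule homotopic_paths_join[OF k(3)]) (simp add: pathstart_def pathfinish_def p(3))
  from ohom_homotopic[OF H this] show ?thesis unfolding s k(2) k'(2) concat_ohom[OF o(1) k'(1)] .
 qed
 moreover have "ohom H j : S"
 proof -
  have "(ohom H g, ohom H g) : orel H (g 0) (g 1)" "(ohom K g', ohom K g') : orel K (g' 0) (g' 1)"
   using ohom_homotopic[OF H] ohom_homotopic[OF K] g by (simp_all add: hpath_def)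
  hence "ohom H g : snd (parr H K b g)" "ohom K g' : snd (parr K L b' g')" by (simp_all add: parr_def)
  thus ?thesis unfolding S_def j_def concat_ohom[OF o(1) g(2), of g, symmetric] by blast
 qed
 hence "orel H (j 0) (j 1) `` S = orel H (j 0) (j 1) `` {ohom H j}" using rS orel_sym orel_trans by blast
 ultimately show ?thesis by (simp add: parr_def j_def)
qed

lemma parr_idt:
 assumes "subgroup H C2" "v : SH H"
 shows "idt PiB (fobj H v) = parr H H 0 (%_. v)" "pdat H H 0 (%_. v)"
proof -
 have "(\<lambda>(c, t)\<in>(cosets H) \<times> {0..1::real}. opt H v c) = ohom H (%_. v)"
  unfolding ohom_def by (rule restrict_ext) (auto simp: opt_def)
 thus "idt PiB (fobj H v) = parr H H 0 (%_. v)" by (simp add: fundamental_groupoid_def fobj_def parr_def idt_orbit(1)[OF assms(1)])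
 show "pdat H H 0 (%_. v)" using idt_orbit(2)[OF assms(1)] assms(2) by (auto simp: pdat_def hpath_def path_def path_image_def)
qed

section \<open>Coboundaries on the fundamental groupoid\<close>

abbreviation EE :: "int set" where "EE \<equiv> {0}"
abbreviation FF :: "int set" where "FF \<equiv> {0, 1}"

lemma opar_EF: "opar EE EE 0" "opar EE EE 1" "opar EE FF 0" "opar FF FF 0"
 by (auto simp: opar_def subgroup_C2_iff)

lemma opar_cases:
 assumes "opar H K b"
 obtains "H = EE" "K = EE" "b = 0" | "H = EE" "K = EE" "b = 1" | "H = EE" "K = FF" "b = 0" | "H = FF" "K = FF" "b = 0"
proof -
 have "H = EE \<or> H = FF" "K = EE \<or> K = FF" "b = 0 \<or> b = 1" "H \<subseteq> K" "1 : K --> b = 0"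
  using assms by (simp_all add: opar_def subgroup_C2_iff)
 moreover have "\<not> FF \<subseteq> EE" "1 : FF" by simp_all
 ultimately show thesis using that by metis
qed

lemma hpath_const: "v : SH H ==> hpath H (%_. v)"
 by (auto simp: hpath_def path_def path_image_def)

lemma hpath_mono: "hpath FF g ==> hpath EE g"
 using SH_sphere(5)[of EE FF] by (auto simp: hpath_def)

lemma hpath_minus: "hpath H g ==> hpath H (%t. - g t)"
 by (auto simp: hpath_def path_def path_image_def intro: continuous_on_minus)

lemma hpath_act: "hpath EE g ==> hpath EE (act31 b o g)"
proof -
 assume g: "hpath EE g"
 have "continuous_on UNIV (act31 b)" unfolding act31_eq by (intro continuous_intros)
 hence "path (act31 b o g)" using g path_continuous_image continuous_on_subset by (metis hpath_def subset_UNIV)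
 thus ?thesis using g by (auto simp: hpath_def path_image_compose)
qed

definition north :: vec31 where "north = (0, 1)"

lemma north_SH: "north : SH H" by (simp add: SH_def north_def norm_prod_def)

lemma dim_vec31: "3 <= DIM(vec31)" by simp

lemma sphere_path:
 assumes "v : SH EE" "w : SH EE"
 obtains p where "hpath EE p" "p 0 = v" "p 1 = w"
proof -
 have "path_connected (sphere (0::vec31) 1)" using path_connected_sphere[of "0::vec31" 1] by simp
 hence "path_connected (SH EE)" using SH_sphere(4)[of EE] by simp
 then obtain p where "path p" "path_image p \<subseteq> SH EE" "pathstart p = v" "pathfinish p = w"
  using assms unfolding path_connected_def by blast
 thus thesis using that[of p] by (simp add: hpath_def pathstart_def pathfinish_def)
qed

lemma sphere_homotopic:
 assumes "hpath EE p" "hpath EE q" "p 0 = q 0" "p 1 = q 1"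
 shows "homotopic_paths (SH EE) p q"
proof -
 have "simply_connected (sphere (0::vec31) 1)" by (rule simply_connected_sphere[OF dim_vec31])
 hence "simply_connected (SH EE)" using SH_sphere(4)[of EE] by simp
 thus ?thesis using assms by (simp add: simply_connected_eq_homotopic_paths hpath_def pathstart_def pathfinish_def)
qed

lemma hpath_join:
 assumes "hpath EE p" "hpath EE q" "q 0 = p 1"
 shows "hpath EE (p +++ q)"
 using assms path_image_join_subset[of p q] by (auto simp: hpath_def pathstart_def pathfinish_def)

lemma join01 [simp]: "(p +++ q) 0 = p 0" "(p +++ q) 1 = q 1" by (simp_all add: joinpaths_def)

text \<open>
  A multiplicative sign on all arrows of the fundamental groupoid, written in terms of lifted paths; \<open>neg\<close>
 says that the two lifts of a path of lines give the same sign.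
\<close>

locale path_cocycle =
 fixes d :: "int set => int set => int => (real => vec31) => real"
 assumes sgn: "pdat H K b g ==> d H K b g : {1, - 1}"
  and comp: "pdat H K b g ==> pdat K L b' g' ==> g' 0 = act31 b (g 1) ==>
   d H L (ooff L b b') (g +++ (act31 b o g')) = d K L b' g' * d H K b g"
  and hom: "pdat H K b g ==> pdat H K b g' ==> homotopic_paths (SH H) g g' ==> d H K b g = d H K b g'"
  and neg: "pdat H K b g ==> d H K b (%t. - g t) = d H K b g"
begin

definition D :: "vec31 => real" where
 "D v = d EE EE 0 (SOME p. hpath EE p & p 0 = north & p 1 = v)"

lemma pdE: "hpath EE g ==> b : {0, 1} ==> pdat EE EE b g"
 using opar_EF hpath_in[of EE g 1] by (auto simp: pdat_def)

lemma eqE: "hpath EE p ==> hpath EE q ==> p 0 = q 0 ==> p 1 = q 1 ==> b : {0, 1} ==> d EE EE b p = d EE EE b q"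
 by (rule hom[OF pdE pdE sphere_homotopic])

lemma eqEF: "hpath EE p ==> hpath EE q ==> p 0 = q 0 ==> p 1 = q 1 ==> q 1 : SH FF ==> d EE FF 0 p = d EE FF 0 q"
 by (rule hom[OF _ _ sphere_homotopic]) (auto simp: pdat_def opar_EF)

lemma D_path: "hpath EE p ==> p 0 = north ==> D (p 1) = d EE EE 0 p"
proof -
 assume p: "hpath EE p" "p 0 = north"
 define q where "q = (SOME q. hpath EE q & q 0 = north & q 1 = p 1)"
 have "hpath EE q & q 0 = north & q 1 = p 1" unfolding q_def by (rule someI[of _ p]) (use p in simp)
 thus ?thesis using eqE[of q p 0] p by (simp add: D_def q_def)
qed

lemma D_sgn: "v : SH EE ==> D v : {1, - 1}"
proof -
 assume v: "v : SH EE"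
 obtain p where p: "hpath EE p" "p 0 = north" "p 1 = v" using sphere_path[OF north_SH v] .
 thus ?thesis using D_path[OF p(1,2)] sgn[OF pdE[OF p(1), of 0]] by simp
qed

lemma D_sq: "v : SH EE ==> D v * D v = 1"
 using D_sgn[of v] by auto

lemma d_EE0: "hpath EE p ==> d EE EE 0 p = D (p 0) * D (p 1)"
proof -
 assume p: "hpath EE p"
 obtain q where q: "hpath EE q" "q 0 = north" "q 1 = p 0" using sphere_path[OF north_SH hpath_in[OF p, of 0]] by auto
 have j: "hpath EE (q +++ p)" by (rule hpath_join[OF q(1) p]) (simp add: q)
 have "act31 0 o p = p" by (simp add: fun_eq_iff)
 hence "d EE EE 0 (q +++ p) = d EE EE 0 p * d EE EE 0 q"
  using comp[OF pdE[OF q(1)] pdE[OF p], of 0 0] q by (simp add: ooff_def)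
 hence "D (p 1) = d EE EE 0 p * D (p 0)" using D_path[OF j] D_path[OF q(1,2)] q by simp
 thus ?thesis using D_sq[OF hpath_in[OF p, of 0]] by simp
qed

definition tw :: "vec31 => real" where "tw v = d EE EE 1 (%_. v)"

lemma d_EE1:
 assumes p: "hpath EE p"
 shows "d EE EE 1 p = tw (p 1) * (D (p 0) * D (p 1))" "d EE EE 1 p = D (act31 1 (p 0)) * D (act31 1 (p 1)) * tw (p 0)"
proof -
 have i: "p 0 : SH EE" "p 1 : SH EE" using hpath_in[OF p] by auto
 have a: "act31 0 o (%_. w) = (%_. w)" for w by (simp add: fun_eq_iff)
 have j: "hpath EE (p +++ (%_. p 1))" by (rule hpath_join[OF p hpath_const[OF i(2)]]) simp
 have "d EE EE 1 (p +++ (%_. p 1)) = tw (p 1) * d EE EE 0 p"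
  using comp[OF pdE[OF p] pdE[OF hpath_const[OF i(2)]], of 0 1] by (simp add: ooff_def tw_def a)
 thus "d EE EE 1 p = tw (p 1) * (D (p 0) * D (p 1))" using eqE[OF p j, of 1] d_EE0[OF p] by simp
 have c: "act31 1 o (act31 1 o p) = p" by (simp add: fun_eq_iff)
 have j2: "hpath EE ((%_. p 0) +++ p)" by (rule hpath_join[OF hpath_const[OF i(1)] p]) simp
 have "d EE EE 1 ((%_. p 0) +++ p) = d EE EE 0 (act31 1 o p) * tw (p 0)"
  using comp[OF pdE[OF hpath_const[OF i(1)]] pdE[OF hpath_act[OF p, of 1]], of 1 0] c by (simp add: ooff_def tw_def)
 thus "d EE EE 1 p = D (act31 1 (p 0)) * D (act31 1 (p 1)) * tw (p 0)"
  using eqE[OF p j2, of 1] d_EE0[OF hpath_act[OF p, of 1]] by simp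
qed

definition q :: "vec31 => real" where "q z = d EE FF 0 (%_. z)"

lemma pdF: "z : SH FF ==> pdat EE FF 0 (%_. z)"
 using SH_sphere(5)[of EE FF] hpath_const[of z EE] by (auto simp: pdat_def opar_EF)

lemma q_neg: "z : SH FF ==> q (- z) = q z"
 using neg[OF pdF] by (simp add: q_def)

lemma q_sgn: "z : SH FF ==> q z : {1, - 1}"
 using sgn[OF pdF] by (simp add: q_def)

text \<open>The involution of the orbit over a fixed line becomes trivial on the fixed orbit.\<close>

lemma tw_fixed:
 assumes z: "z : SH FF"
 shows "tw z = 1"
proof -
 have zE: "z : SH EE" using z SH_sphere(5)[of EE FF] by auto
 have a: "act31 1 o (%_. act31 1 z) = (%_. z)" "(%_. z) +++ (%_. z) = (%_. z)" by (simp_all add: fun_eq_iff joinpaths_def)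
 have "q z = d EE FF 0 (%_. act31 1 z) * tw z"
  using comp[OF pdE[OF hpath_const[OF zE]] pdF, of 1 "act31 1 z"] z a by (simp add: ooff_def tw_def q_def)
 moreover have "act31 1 z = z \<or> act31 1 z = - z" using z by (auto simp: SH_def act31_eq prod_eq_iff)
 hence "d EE FF 0 (%_. act31 1 z) = q z" using q_neg[OF z] by (auto simp: q_def)
 ultimately show ?thesis using q_sgn[OF z] by auto
qed

lemma tw_D: "v : SH EE ==> tw v = D v * D (act31 1 v)" and D_neg: "v : SH EE ==> D (- v) = D v"
proof -
 have k: "tw v * (D v * D (act31 1 v)) = tw w * (D w * D (act31 1 w))" if v: "v : SH EE" and w: "w : SH EE" for v w
 proof -
  obtain p where p: "hpath EE p" "p 0 = v" "p 1 = w" using sphere_path[OF v w] .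
  have "tw w * (D v * D w) = D (act31 1 v) * D (act31 1 w) * tw v" using d_EE1[OF p(1)] p by simp
  moreover have "D v : {1, - 1}" "D w : {1, - 1}" "D (act31 1 v) : {1, - 1}" "D (act31 1 w) : {1, - 1}"
   using D_sgn v w by auto
  ultimately show ?thesis by auto
 qed
 define e where "e = (axis 1 1 :: real^2, 0::real)"
 have e: "e : SH FF" "act31 1 e = e" by (auto simp: e_def SH_def norm_prod_def act31_eq)
 hence eE: "e : SH EE" using SH_sphere(5)[of EE FF] by auto
 have c: "tw v * (D v * D (act31 1 v)) = 1" if v: "v : SH EE" for v
  using k[OF v eE] tw_fixed[OF e(1)] e(2) D_sq[OF eE] by simp
 show twD: "tw v = D v * D (act31 1 v)" if v: "v : SH EE"
  using c[OF v] D_sgn[OF v] D_sgn[of "act31 1 v"] v by auto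
 have N: "act31 1 north = - north" "tw north = 1" using tw_fixed[OF north_SH] by (auto simp: north_def act31_eq)
 have DN: "D north * D (- north) = 1" using c[OF north_SH] N by simp
 show "D (- v) = D v" if v: "v : SH EE"
 proof -
  obtain p where p: "hpath EE p" "p 0 = north" "p 1 = v" using sphere_path[OF north_SH v] .
  have "D (- north) * D (- v) = D north * D v"
   using neg[OF pdE[OF p(1)], of 0] d_EE0[OF p(1)] d_EE0[OF hpath_minus[OF p(1)]] p by simp
  moreover have "D north : {1, - 1}" "D (- north) : {1, - 1}" using D_sgn[OF north_SH] D_sgn[of "- north"] north_SH by auto
  ultimately show ?thesis using DN by auto
 qed
qed

text \<open>
  Since the sphere is simply connected, a cocycle on paths between free orbits is the coboundary of a function
  \<open>D\<close> on the sphere. The involution contributes a constant, which is \<open>1\<close> because the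
  involution is trivial over a fixed line. The antipode contributes a constant too, which is computed at the pole
  \<open>north\<close>, where antipode and involution coincide. Paths of fixed lines are reduced to free ones by the
  projection \<open>G/e \<rightarrow> G/G\<close>.
\<close>

theorem coboundary:
 obtains u where "!!H v. subgroup H C2 ==> v : SH H ==> u H v : {1, - 1 :: real}" "!!H v. v : SH H ==> u H (- v) = u H v"
  "!!H K b g. pdat H K b g ==> d H K b g = u H (g 0) * u K (act31 b (g 1))"
proof -
 have FE: "z : SH FF ==> z : SH EE" "z : SH H ==> z : SH EE" for z H using SH_sphere(5)[of EE FF] by (auto simp: SH_def)
 define u where "u = (%(H :: int set) v. if 1 : H then q v * D v else D v)"
 have EF: "d EE FF 0 p = D (p 0) * (q (p 1) * D (p 1))" if p: "hpath EE p" "p 1 : SH FF" for p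
 proof -
  have j: "hpath EE (p +++ (%_. p 1))" by (rule hpath_join[OF p(1) hpath_const[OF FE(1)[OF p(2)]]]) simp
  have "act31 0 o (%_. p 1) = (%_. p 1)" by (simp add: fun_eq_iff)
  hence "d EE FF 0 (p +++ (%_. p 1)) = q (p 1) * d EE EE 0 p"
   using comp[OF pdE[OF p(1)] pdF[OF p(2)], of 0] by (simp add: ooff_def q_def)
  thus ?thesis using eqEF[OF p(1) j] p(2) d_EE0[OF p(1)] by simp
 qed
 have main: "d H K b g = u H (g 0) * u K (act31 b (g 1))" if p: "pdat H K b g" for H K b g
 proof -
  have g: "hpath H g" "g 1 : SH K" "opar H K b" using p by (auto simp: pdat_def)
  have gi: "g 0 : SH H" using hpath_in[OF g(1), of 0] by simp
  from g(3) show ?thesis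
  proof (cases rule: opar_cases)
   case 1
   thus ?thesis using d_EE0[of g] g by (simp add: u_def)
  next
   case 2
   thus ?thesis using d_EE1(1)[of g] g tw_D[of "g 1"] D_sq[of "g 1"] by (simp add: u_def)
  next
   case 3
   thus ?thesis using EF[of g] g by (simp add: u_def)
  next
   case 4
   have z: "g 0 : SH FF" using gi 4 by simp
   have gE: "hpath EE g" using hpath_mono g(1) 4 by simp
   have j: "hpath EE ((%_. g 0) +++ g)" by (rule hpath_join[OF hpath_const[OF FE(1)[OF z]] gE]) simp
   have "act31 0 o g = g" by (simp add: fun_eq_iff)
   hence "d EE FF 0 ((%_. g 0) +++ g) = d FF FF 0 g * q (g 0)"
    using comp[OF pdF[OF z], of FF 0 g] p 4 by (simp add: ooff_def q_def)
   hence "D (g 0) * (q (g 1) * D (g 1)) = d FF FF 0 g * q (g 0)" using eqEF[OF gE j] EF[OF gE] g 4 by simp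
   thus ?thesis using q_sgn[OF z] 4 by (auto simp: u_def)
  qed
 qed
 have "u H v : {1, - 1}" if "v : SH H" for H v
 proof -
  have "1 : H ==> v : SH FF" using that by (simp add: SH_def)
  thus ?thesis using q_sgn[of v] D_sgn[OF FE(2)[OF that]] by (auto simp: u_def)
 qed
 moreover have "u H (- v) = u H v" if "v : SH H" for H v
 proof -
  have "1 : H ==> v : SH FF" using that by (simp add: SH_def)
  thus ?thesis using q_neg D_neg[OF FE(2)[OF that]] by (simp add: u_def)
 qed
 ultimately show thesis using that[of u] main by blast
qed

end

subsection \<open>Paths of fixed lines\<close>

definition circ :: "real => vec31" where "circ s = (vector [cos s, sin s], 0)"

lemma circ_SH: "circ s : SH H"
 by (simp add: circ_def SH_def norm_prod_def norm_vec_def L2_set_def UNIV_2)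

lemma circ_comp: "fst (circ s) $ 1 = cos s" "fst (circ s) $ 2 = sin s"
 by (simp_all add: circ_def)

lemma circ_simps: "snd (circ s) = 0" "circ (s + pi) = - circ s" "circ s ~= 0" "fst (circ s) ~= 0"
 using SH_sphere(2)[OF circ_SH[of s]] by (auto simp: circ_def Finite_Cartesian_Product.vec_eq_iff forall_2 prod_eq_iff)

lemma circ_continuous: "continuous_on S circ"
proof -
 have "continuous_on S (%s. \<chi> i. (if i = 1 then cos s else sin s) :: real^2)"
 proof (rule continuous_on_vec_lambda)
  show "continuous_on S (%s. if i = 1 then cos s else sin s)" for i :: 2
   by (cases "i = 1") (simp_all add: continuous_on_cos continuous_on_sin)
 qed
 moreover have "(\<chi> i. (if i = 1 then cos s else sin s)) = (vector [cos s, sin s] :: real^2)" for s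
  by (simp add: Finite_Cartesian_Product.vec_eq_iff forall_2)
 ultimately have "continuous_on S (%s. vector [cos s, sin s] :: real^2)" by simp
 thus ?thesis unfolding circ_def by (intro continuous_intros)
qed

lemma circ_hpath: "path \<theta> ==> hpath H (circ o \<theta>)"
 using path_continuous_image[OF _ circ_continuous] circ_SH by (auto simp: hpath_def path_image_def)

text \<open>The fixed lines form a circle and a point, and a path in the circle has an angle.\<close>

lemma fixed_path_cases:
 assumes g: "hpath FF g"
 obtains (circle) \<theta> where "path \<theta>" "!!t. t : {0..1} ==> g t = circ (\<theta> t)"
  | (point) "!!t. t : {0..1} ==> g t = g 0" "fst (g 0) = 0" "g 0 = north \<or> g 0 = - north"
proof -
 have gF: "norm (g t) = 1" "snd (g t) = 0 \<or> fst (g t) = 0" if "t : {0..1}" for t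
  using hpath_in[OF g that] by (auto simp: SH_def)
 have nm: "snd (g t) : {0, 1, - 1}" if "t : {0..1}" for t
  using gF[OF that] by (auto simp: norm_prod_def power2_eq_1_iff)
 have cg: "continuous_on {0..1} g" using g by (simp add: hpath_def path_def)
 have "(%t. snd (g t)) constant_on {0..1}"
 proof (rule continuous_finite_range_constant)
  have "(%t. snd (g t)) ` {0..1} \<subseteq> {0, 1, - 1}" using nm by blast
  thus "finite ((%t. snd (g t)) ` {0..1})" by (rule finite_subset) simp
 qed (use cg in \<open>auto intro: continuous_intros\<close>)
 hence k: "snd (g t) = snd (g 0)" if "t : {0..1}" for t using that by (force simp: constant_on_def)
 show thesis
 proof (cases "snd (g 0) = 0")
  case False
  hence f0: "fst (g t) = 0" if "t : {0..1}" for t using gF(2)[OF that] k[OF that] by simp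
  have z: "fst (g 0) = 0" using f0[of 0] by simp
  have "snd (g 0) = 1 \<or> snd (g 0) = - 1" using nm[of 0] False by simp
  hence "g 0 = north \<or> g 0 = - north" using z unfolding north_def prod_eq_iff by auto
  moreover have "g t = g 0" if "t : {0..1}" for t using f0[OF that] k[OF that] z by (simp add: prod_eq_iff)
  ultimately show thesis using point z by blast
 next
  case True
  define h where "h = (%t. Complex (fst (g t) $ 1) (fst (g t) $ 2))"
  have ch: "continuous_on {0..1} h" unfolding h_def by (intro continuous_intros cg)
  have nh: "norm (h t) = 1" if "t : {0..1}" for t
   using gF(1)[OF that] k[OF that] True by (simp add: h_def norm_prod_def norm_vec_def L2_set_def UNIV_2 cmod_def)
  have "contractible {0..1::real}" by (simp add: convex_imp_contractible)
  then obtain l where l: "continuous_on {0..1} l" "!!t. t : {0..1} ==> h t = exp (l t)"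
   using continuous_logarithm_on_contractible[OF ch] nh by (metis norm_zero zero_neq_one)
  have "g t = circ (Im (l t))" if t: "t : {0..1}" for t
  proof -
   have "exp (Re (l t)) = 1" using nh[OF t] l(2)[OF t] by simp
   hence "h t = cis (Im (l t))" using l(2)[OF t] by (simp add: exp_eq_polar)
   hence "fst (g t) $ 1 = cos (Im (l t))" "fst (g t) $ 2 = sin (Im (l t))" by (auto simp: h_def complex_eq_iff)
   thus ?thesis using k[OF t] True by (simp add: circ_def prod_eq_iff Finite_Cartesian_Product.vec_eq_iff forall_2)
  qed
  moreover have "path (%t. Im (l t))" unfolding path_def by (intro continuous_intros l)
  ultimately show thesis using circle by blast
 qed
qed

lemma circ_surj: "z : SH FF ==> fst z ~= 0 ==> EX s. z = circ s"
 using fixed_path_cases[OF hpath_const] by (metis atLeastAtMost_iff order_refl zero_le_one)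

lemma circ_eq: "circ a = circ b ==> EX k::int. a = b + 2 * pi * k"
proof -
 assume "circ a = circ b"
 hence "cos a = cos b" "sin a = sin b" using circ_comp[of a] circ_comp[of b] by simp_all
 thus ?thesis using sin_cos_eq_iff[of a b] by (metis add.commute mult.commute mult.left_commute)
qed

lemma circ_homotopic:
 assumes "path \<theta>" "path \<theta>'" "\<theta> 0 = \<theta>' 0" "\<theta> 1 = \<theta>' 1"
 shows "homotopic_paths (SH FF) (circ o \<theta>) (circ o \<theta>')"
proof -
 have "simply_connected (UNIV :: real set)" by (simp add: convex_imp_simply_connected)
 hence "homotopic_paths UNIV \<theta> \<theta>'" using assms by (simp add: simply_connected_eq_homotopic_paths pathstart_def pathfinish_def)
 thus ?thesis by (rule homotopic_paths_continuous_image[OF _ circ_continuous]) (use circ_SH in auto)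
qed

text \<open>On paths of fixed lines, the half turn of the circle is the only obstruction.\<close>

theorem fixed_coboundary:
 fixes e :: "(real => vec31) => real"
 assumes sgn: "!!g. hpath FF g ==> e g : {1, - 1}"
  and comp: "!!g g'. hpath FF g ==> hpath FF g' ==> g' 0 = g 1 ==> e (g +++ g') = e g' * e g"
  and hom: "!!g g'. homotopic_paths (SH FF) g g' ==> e g = e g'"
  and neg: "!!g. hpath FF g ==> e (%t. - g t) = e g"
  and half: "e (%t. circ (pi * t)) = 1"
 obtains u where "!!z. z : SH FF ==> u z : {1, - 1 :: real}" "!!z. z : SH FF ==> u (- z) = u z" "!!g. hpath FF g ==> e g = u (g 0) * u (g 1)"
proof -
 define U where "U = (%s::real. e (circ o (%t. s * t)))"
 have pl: "path (%t::real. a + s * t)" for a s :: real unfolding path_def by (intro continuous_intros)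
 have Us: "U s : {1, - 1}" for s using sgn[OF circ_hpath[OF pl[of 0]]] by (simp add: U_def)
 have eU: "e (circ o \<theta>) = U (\<theta> 0) * U (\<theta> 1)" if \<theta>: "path \<theta>" for \<theta>
 proof -
  let ?l = "%t. \<theta> 0 * t"
  have pl0: "path ?l" using pl[of 0] by simp
  have "path (?l +++ \<theta>)" using pl0 \<theta> by (simp add: pathstart_def pathfinish_def)
  hence "e (circ o (?l +++ \<theta>)) = U (\<theta> 1)"
   unfolding U_def by (intro hom circ_homotopic) (use pl[of 0] in auto)
  moreover have "e (circ o (?l +++ \<theta>)) = e (circ o \<theta>) * U (\<theta> 0)"
   using comp[OF circ_hpath[OF pl0] circ_hpath[OF \<theta>]] by (simp add: path_compose_join U_def)
  ultimately show ?thesis using Us[of "\<theta> 0"] by auto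
 qed
 \<comment> \<open>A half turn of an arc replaces it by its antipode, which lifts the same path of lines.\<close>
 have "U (s + pi) = U s" for s
 proof -
  have "e (circ o (%t. pi + s * t)) = U pi * U (pi + s)" using eU[OF pl[of pi s]] by simp
  moreover have "circ o (%t. pi + s * t) = (%t. - (circ o (%t. s * t)) t)" using circ_simps(2)[of "s * t" for t] by (simp add: add.commute[of pi] fun_eq_iff)
  hence "e (circ o (%t. pi + s * t)) = U s" using neg[OF circ_hpath[OF pl[of 0 s]]] by (simp add: U_def)
  moreover have "U pi = 1" using half by (simp add: U_def o_def)
  ultimately show ?thesis by (simp add: add.commute)
 qed
 note Up = this
 have Uk: "U (s + pi * real n) = U s" for s n
 proof (induction n)
  case (Suc n)
  have e: "s + pi * real (Suc n) = (s + pi * real n) + pi" by (simp add: algebra_simps)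
  show ?case unfolding e Up by (rule Suc)
 qed simp
 have Uc: "U a = U b" if ab: "circ a = circ b" for a b
 proof -
  obtain k :: int where k: "a = b + 2 * pi * k" using circ_eq[OF ab] by blast
  show ?thesis
  proof (cases "k >= 0")
   case True
   hence "a = b + pi * real (nat (2 * k))" using k by simp
   thus ?thesis using Uk by metis
  next
   case False
   hence "b = a + pi * real (nat (- 2 * k))" using k by simp
   thus ?thesis using Uk by metis
  qed
 qed
 define u where "u = (%z. if fst z = 0 then 1 else U (SOME s. z = circ s))"
 have uc: "u (circ s) = U s" for s
 proof -
  have "circ s = circ (SOME s'. circ s = circ s')" by (rule someI[of _ s]) simp
  from Uc[OF this] show ?thesis unfolding u_def using circ_simps(4)[of s] by (simp only: if_False)
 qed
 have eg: "e g = u (g 0) * u (g 1)" if g: "hpath FF g" for g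
  using g
 proof (cases rule: fixed_path_cases)
  case (circle \<theta>)
  have "homotopic_paths (SH FF) g (circ o \<theta>)"
   by (rule homotopic_paths_eq) (use g circle in \<open>auto simp: hpath_def\<close>)
  thus ?thesis using eU[OF circle(1)] circle(2)[of 0] circle(2)[of 1] hom uc by simp
 next
  case point
  let ?c = "%_::real. g 0"
  have c: "hpath FF ?c" using hpath_const hpath_in[OF g, of 0] by simp
  have "homotopic_paths (SH FF) g ?c" by (rule homotopic_paths_eq) (use g point(1) in \<open>simp_all only: hpath_def\<close>)
  hence "e g = e ?c" by (rule hom)
  moreover have "?c +++ ?c = ?c" by (simp add: joinpaths_def fun_eq_iff)
  hence "e ?c = e ?c * e ?c" using comp[OF c c] by simp
  ultimately show ?thesis using sgn[OF c] point(1)[of 1] point(2) by (auto simp: u_def)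
 qed
 have zs: "(EX s. z = circ s) \<or> fst z = 0" if "z : SH FF" for z using circ_surj[OF that] by blast
 show thesis
 proof (rule that[of u, OF _ _ eg])
  fix z assume "z : SH FF"
  from zs[OF this] have "u z : {1, - 1} & u (- z) = u z"
  proof
   assume "EX s. z = circ s"
   then obtain s where z: "z = circ s" by blast
   have "u (- z) = U s" using uc[of "s + pi"] circ_simps(2)[of s] Up[of s] z by simp
   thus ?thesis using uc[of s] Us[of s] z by simp
  qed (simp add: u_def)
  thus "u z : {1, - 1}" "u (- z) = u z" by auto
 qed
qed

section \<open>The sign of an arrow of the fundamental groupoid\<close>

definition vv :: "int set \<times> (int set => vec31 set) => vec31" where
 "vv x = (SOME v. v : SH (fst x) & x = fobj (fst x) v)"

lemma vvD:
 assumes "x : ob PiB"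
 shows "subgroup (fst x) C2" "vv x : SH (fst x)" "x = fobj (fst x) (vv x)" "vv x ~= 0" "x = fobj (fst x) (- vv x)"
proof -
 obtain H v where x: "x = fobj H v" "subgroup H C2" "v : SH H" using assms unfolding ob_Pi by blast
 thus "subgroup (fst x) C2" by simp
 have "vv x : SH (fst x) & x = fobj (fst x) (vv x)" unfolding vv_def by (rule someI[of _ v]) (use x in simp)
 thus v: "vv x : SH (fst x)" and e: "x = fobj (fst x) (vv x)" by auto
 show "vv x ~= 0" by (rule SH_sphere(2)[OF v])
 show "x = fobj (fst x) (- vv x)" using e opt_minus[OF SH_sphere(1)[OF v]] by (simp add: fobj_def)
qed

lemma act31_scaleR: "act31 b (k *\<^sub>R v) = k *\<^sub>R act31 b v"
 by (simp add: act31_eq)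

definition lamrel :: "int set \<times> (int set => vec31 set) => int set \<times> (int set => vec31 set) =>
  (int set => int set) \<times> (int set \<times> real => vec31 set) set => int => (real => vec31) => real => bool" where
 "lamrel x y f b g l \<longleftrightarrow> pdat (fst x) (fst y) b g & g 0 = vv x & l : {1, - 1} & act31 b (g 1) = l *\<^sub>R vv y & f = parr (fst x) (fst y) b g"

text \<open>An arrow lifts to a path from the chosen unit vector of its source; the sign says whether
  the path ends, up to the action, at the chosen unit vector of its target or at its negative.\<close>

definition lam :: "int set \<times> (int set => vec31 set) => int set \<times> (int set => vec31 set) =>
  (int set => int set) \<times> (int set \<times> real => vec31 set) set => real" where
 "lam x y f = (SOME l. EX b g. lamrel x y f b g l)"

lemma lamrel_ex:
 assumes "x : ob PiB" "y : ob PiB" "f : arr PiB x y"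
 obtains b g l where "lamrel x y f b g l"
proof -
 note X = vvD[OF assms(1)] and Y = vvD[OF assms(2)]
 obtain b g where g: "pdat (fst x) (fst y) b g" "g 0 = vv x" "g 1 = act31 b (vv y) \<or> g 1 = - act31 b (vv y)" "f = parr (fst x) (fst y) b g"
  using arr_parr[OF X(1,2) Y(1,2)] assms(3) X(3) Y(3) by metis
 have "act31 b (g 1) = 1 *\<^sub>R vv y \<or> act31 b (g 1) = (- 1) *\<^sub>R vv y" using g(3) by auto
 thus thesis using that g unfolding lamrel_def by blast
qed

lemma lamrelD:
 assumes "x : ob PiB" "y : ob PiB" "lamrel x y f b g l"
 shows "opar (fst x) (fst y) b" "off (fst x) (fst f) = b" "x = fobj (fst x) (g 0)" "y = fobj (fst y) (act31 b (g 1))"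
proof -
 show o: "opar (fst x) (fst y) b" using assms(3) by (simp add: lamrel_def pdat_def)
 show "off (fst x) (fst f) = b" using assms(3) off_otr[OF o] by (simp add: lamrel_def parr_def)
 show "x = fobj (fst x) (g 0)" using assms(3) vvD(3)[OF assms(1)] by (simp add: lamrel_def)
 show "y = fobj (fst y) (act31 b (g 1))" using assms(3) vvD(3,5)[OF assms(2)] by (auto simp: lamrel_def)
qed

lemma lam_eq:
 assumes y: "y : ob PiB" and r: "lamrel x y f b g l"
 shows "lam x y f = l"
proof -
 have "EX b g. lamrel x y f b g (lam x y f)" unfolding lam_def by (rule someI[of _ l]) (use r in blast)
 then obtain b' g' where r': "lamrel x y f b' g' (lam x y f)" by blast
 have p: "pdat (fst x) (fst y) b g" "pdat (fst x) (fst y) b' g'" "g 0 = g' 0" "parr (fst x) (fst y) b g = parr (fst x) (fst y) b' g'"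
  using r r' unfolding lamrel_def by auto
 have "b = b'" "g 1 = g' 1" using parr_inj[OF p] homotopic_paths_imp_pathfinish by (auto simp: pathfinish_def)
 hence "l *\<^sub>R vv y = lam x y f *\<^sub>R vv y" using r r' unfolding lamrel_def by metis
 thus ?thesis using vvD(4)[OF y] by simp
qed

lemma lam_sgn: "x : ob PiB ==> y : ob PiB ==> f : arr PiB x y ==> lam x y f : {1, - 1}"
proof -
 assume a: "x : ob PiB" "y : ob PiB" "f : arr PiB x y"
 obtain b g l where "lamrel x y f b g l" using lamrel_ex[OF a] .
 thus ?thesis using lam_eq[OF a(2)] unfolding lamrel_def by metis
qed

definition kz :: "int set \<times> (int set => vec31 set) => real" where
 "kz z = (if fst (vv z) = 0 then - 1 else 1)"

lemma lamrel_arr: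
 assumes "x : ob PiB" "y : ob PiB" "lamrel x y f b g l"
 shows "f : arr PiB x y"
 using parr_arr[of "fst x" "fst y" b g] lamrelD(3,4)[OF assms] assms(3) by (simp add: lamrel_def)

text \<open>The correction occurs because the involution acts by a sign on the vector of a fixed line: by \<open>1\<close> on the circle and by \<open>-1\<close> at the pole.\<close>

lemma lam_comp:
 assumes ob: "x : ob PiB" "y : ob PiB" "z : ob PiB" and f: "f : arr PiB x y" and h: "h : arr PiB y z"
 shows "lam x z (cmp PiB x y z h f) = lam x y f * lam y z h * (if 1 ~: fst y & 1 : fst z & off (fst x) (fst f) = 1 then kz z else 1)" (is ?A)
  "fst (cmp PiB x y z h f) = cmp (orbit_cat C2) (fst x) (fst y) (fst z) (fst h) (fst f)" (is ?B)
  "off (fst x) (fst (cmp PiB x y z h f)) = ooff (fst z) (off (fst x) (fst f)) (off (fst y) (fst h))" (is ?C)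
  "cmp PiB x y z h f : arr PiB x z"
proof -
 obtain b g l where r: "lamrel x y f b g l" using lamrel_ex[OF ob(1,2) f] .
 obtain b' g' l' where r': "lamrel y z h b' g' l'" using lamrel_ex[OF ob(2,3) h] .
 note R = lamrelD[OF ob(1,2) r] and R' = lamrelD[OF ob(2,3) r'] and Y = vvD[OF ob(2)] and Z = vvD[OF ob(3)]
 have l: "l = 1 \<or> l = - 1" "l' = 1 \<or> l' = - 1" using r r' by (auto simp: lamrel_def)
 have g: "pdat (fst x) (fst y) b g" "act31 b (g 1) = l *\<^sub>R vv y" "f = parr (fst x) (fst y) b g" "g 0 = vv x"
  and g': "pdat (fst y) (fst z) b' g'" "g' 0 = vv y" "act31 b' (g' 1) = l' *\<^sub>R vv z" "h = parr (fst y) (fst z) b' g'"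
  using r r' by (auto simp: lamrel_def)
 define k where "k = (%t. l *\<^sub>R g' t)"
 have k: "pdat (fst y) (fst z) b' k & h = parr (fst y) (fst z) b' k"
 proof (cases "l = 1")
  case True
  hence "k = g'" by (simp add: k_def)
  thus ?thesis using g' by simp
 next
  case False
  hence "k = (%t. - g' t)" using l by (auto simp: k_def)
  thus ?thesis using g'(1,4) parr_minus[OF Y(1), of g'] hpath_minus[of "fst y" g'] by (auto simp: pdat_def)
 qed
 have k0: "k 0 = act31 b (g 1)" using g g' by (simp add: k_def)
 note kk = k[THEN conjunct1]
 have "fobj (fst z) (act31 b' (k 1)) = z" using Z(3,5) l g'(3) by (auto simp: k_def act31_scaleR)
 moreover have "fobj (fst y) (k 0) = y" using R(4) k0 by simp
 ultimately have c: "cmp PiB x y z h f = parr (fst x) (fst z) (ooff (fst z) b b') (g +++ (act31 b o k))"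
  using parr_comp[OF g(1) kk k0] R(3) k g(3) by metis
 note o = R(1) R'(1)
 show ?B unfolding c using g(3) g'(4) cmp_orbit[OF o] by (simp add: parr_def)
 show ?C unfolding c R(2) R'(2) using off_otr[OF opar_comp[OF o]] by (simp add: parr_def)
 define m where "m = (if 1 ~: fst y & 1 : fst z & b = 1 then kz z else 1)"
 have e: "act31 (ooff (fst z) b b') (act31 b (k 1)) = (l * l' * m) *\<^sub>R vv z"
 proof (cases "1 : fst z")
  case False
  have "act31 b (act31 b' (act31 b (k 1))) = act31 b' (k 1)" by (simp add: act31_eq)
  thus ?thesis using False g'(3) by (simp add: act31_ooff[OF o] m_def k_def act31_scaleR)
 next
  case True
  hence "g' 1 = l' *\<^sub>R vv z" using g'(3) oparD(5)[OF o(2)] by simp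
  hence "act31 b (k 1) = (l * l') *\<^sub>R act31 b (vv z)" by (simp add: k_def act31_scaleR)
  moreover have "act31 b (vv z) = m *\<^sub>R vv z"
   using Z(2) True oparD(4,5)[OF o(1)] by (auto simp: m_def kz_def SH_def act31_eq prod_eq_iff)
  ultimately show ?thesis using True by (simp add: act31_ooff[OF o])
 qed
 have "lamrel x z (cmp PiB x y z h f) (ooff (fst z) b b') (g +++ (act31 b o k)) (l * l' * m)"
  unfolding lamrel_def using pdat_join(1)[OF g(1) kk k0] g(4) l e c by (auto simp: m_def kz_def)
 from lamrel_arr[OF ob(1,3) this] show "cmp PiB x y z h f : arr PiB x z" .
 from lam_eq[OF ob(3) \<open>lamrel x z _ _ _ _\<close>] show ?A unfolding m_def R(2) using lam_eq[OF ob(2) r] lam_eq[OF ob(3) r'] by simp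
qed

lemma lam_idt:
 assumes x: "x : ob PiB"
 shows "lam x x (idt PiB x) = 1" "fst (idt PiB x) = otr (fst x) (fst x) 0"
proof -
 note X = vvD[OF x]
 have i: "idt PiB x = parr (fst x) (fst x) 0 (%_. vv x)" using parr_idt(1)[OF X(1,2)] X(3) by simp
 have "lamrel x x (idt PiB x) 0 (%_. vv x) 1" unfolding lamrel_def using i parr_idt(2)[OF X(1,2)] by simp
 thus "lam x x (idt PiB x) = 1" by (rule lam_eq[OF x])
 show "fst (idt PiB x) = otr (fst x) (fst x) 0" using i by (simp add: parr_def)
qed

subsection \<open>Multiplicative signs of arrows\<close>

lemma parr_arr_ob:
 assumes p: "pdat H K b g"
 shows "fobj H (g 0) : ob PiB" "fobj K (act31 b (g 1)) : ob PiB"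
 using p hpath_in[of H g 0] oparD(1,2)[of H K b] by (auto simp: pdat_def intro!: fobj_ob)

lemma fobj_minus: "v : SH H ==> fobj H (- v) = fobj H v"
 using opt_minus[OF SH_sphere(1)] by (simp add: fobj_def)

definition arrow_sign :: "int set set => (int set \<times> (int set => vec31 set) => int set \<times> (int set => vec31 set) =>
  (int set => int set) \<times> (int set \<times> real => vec31 set) set => real) => bool" where
 "arrow_sign \<S> \<delta> \<longleftrightarrow> (ALL x:ob PiB. ALL y:ob PiB. ALL f:arr PiB x y. fst x : \<S> --> \<delta> x y f : {1, - 1} &
   (ALL z:ob PiB. ALL g:arr PiB y z. \<delta> x z (cmp PiB x y z g f) = \<delta> y z g * \<delta> x y f))"

definition pd where "pd \<delta> H K b g = \<delta> (fobj H (g 0)) (fobj K (act31 b (g 1))) (parr H K b g)"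

lemma pd_props:
 assumes p: "pdat H K b g" and \<delta>: "arrow_sign \<S> \<delta>" and H: "H : \<S>"
 shows "pd \<delta> H K b g : {1, - 1}"
  "pdat K L b' g' ==> g' 0 = act31 b (g 1) ==> pd \<delta> H L (ooff L b b') (g +++ (act31 b o g')) = pd \<delta> K L b' g' * pd \<delta> H K b g"
  "homotopic_paths (SH H) g g'' ==> pd \<delta> H K b g = pd \<delta> H K b g''"
  "pd \<delta> H K b (%t. - g t) = pd \<delta> H K b g"
proof -
 note ob = parr_arr_ob[OF p]
 have h: "hpath H g" "g 1 : SH K" "subgroup H C2" using p oparD(1) by (auto simp: pdat_def)
 show "pd \<delta> H K b g : {1, - 1}" using \<delta> ob parr_arr[OF p] H unfolding pd_def arrow_sign_def by simp
 show "pd \<delta> H K b (%t. - g t) = pd \<delta> H K b g"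
  using parr_minus[OF h(3,1)] fobj_minus[of "g 0" H] fobj_minus[of "act31 b (g 1)" K] hpath_in[OF h(1), of 0] h(2) by (simp add: pd_def)
 show "pd \<delta> H K b g = pd \<delta> H K b g''" if q: "homotopic_paths (SH H) g g''"
 proof -
  have "g 0 = g'' 0" "g 1 = g'' 1"
   using homotopic_paths_imp_pathstart[OF q] homotopic_paths_imp_pathfinish[OF q] by (auto simp: pathstart_def pathfinish_def)
  thus ?thesis using parr_homotopic[OF h(3) q] by (simp add: pd_def)
 qed
 assume p': "pdat K L b' g'" and e: "g' 0 = act31 b (g 1)"
 note ob' = parr_arr_ob[OF p']
 have "\<delta> (fobj H (g 0)) (fobj L (act31 b' (g' 1))) (parr H L (ooff L b b') (g +++ (act31 b o g'))) = pd \<delta> K L b' g' * pd \<delta> H K b g"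
  unfolding parr_comp[OF p p' e, symmetric] pd_def using \<delta> ob ob'(2) parr_arr[OF p] parr_arr[OF p'] H
  unfolding arrow_sign_def e by simp
 thus "pd \<delta> H L (ooff L b b') (g +++ (act31 b o g')) = pd \<delta> K L b' g' * pd \<delta> H K b g"
  using pdat_join(3)[OF p p' e] by (simp add: pd_def)
qed

lemma arrow_coboundary:
 assumes \<delta>: "arrow_sign UNIV \<delta>"
 obtains u where "!!x. x : ob PiB ==> u x : {1, - 1 :: real}" "!!x y f. x : ob PiB ==> y : ob PiB ==> f : arr PiB x y ==> \<delta> x y f = u x * u y"
proof -
 interpret path_cocycle "pd \<delta>"
 proof (unfold_locales, goal_cases)
  case 1 thus ?case by (rule pd_props(1)[OF _ \<delta> UNIV_I])
 next
  case 2 thus ?case by (rule pd_props(2)[OF _ \<delta> UNIV_I])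
 next
  case (3 H K b g g') show ?case by (rule pd_props(3)[OF 3(1) \<delta> UNIV_I 3(3)])
 next
  case 4 thus ?case by (rule pd_props(4)[OF _ \<delta> UNIV_I])
 qed
 obtain u where u: "!!H v. subgroup H C2 ==> v : SH H ==> u H v : {1, - 1}" "!!H v. v : SH H ==> u H (- v) = u H v"
  "!!H K b g. pdat H K b g ==> pd \<delta> H K b g = u H (g 0) * u K (act31 b (g 1))" by (rule coboundary) blast
 show thesis
 proof (rule that[of "%x. u (fst x) (vv x)"])
  show "x : ob PiB ==> u (fst x) (vv x) : {1, - 1}" for x using u(1) vvD by blast
  fix x y f assume x: "x : ob PiB" and y: "y : ob PiB" and f: "f : arr PiB x y"
  obtain b g l where r: "lamrel x y f b g l" using lamrel_ex[OF x y f] .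
  note R = lamrelD[OF x y r]
  have "\<delta> x y f = u (fst x) (g 0) * u (fst y) (act31 b (g 1))"
   using u(3)[of "fst x" "fst y" b g] r R(3,4) unfolding lamrel_def pd_def by metis
  thus "\<delta> x y f = u (fst x) (vv x) * u (fst y) (vv y)"
   using r u(2)[OF vvD(2)[OF y]] by (auto simp: lamrel_def)
 qed
qed

abbreviation c0 :: "int set \<times> (int set => vec31 set)" where "c0 \<equiv> fobj FF (circ 0)"
abbreviation pt0 :: "int set \<times> (int set => vec31 set)" where "pt0 \<equiv> fobj FF north"
definition half :: "(int set => int set) \<times> (int set \<times> real => vec31 set) set" where
 "half = parr FF FF 0 (%t. circ (pi * t))"

lemma c0_ob: "c0 : ob PiB" "pt0 : ob PiB"
 using oparD(1)[OF opar_EF(4)] circ_SH north_SH by (auto intro!: fobj_ob)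

lemma circ_pdat: "pdat FF FF 0 (%t. circ (s * t))"
proof -
 have "path (%t::real. s * t)" unfolding path_def by (intro continuous_intros)
 from circ_hpath[OF this, of FF] show ?thesis using circ_SH opar_EF(4) by (simp add: pdat_def o_def)
qed

lemma circ_pi: "circ pi = - circ 0"
 using circ_simps(2)[of 0] by simp

lemma half_arr: "half : arr PiB c0 c0"
 using parr_arr[OF circ_pdat[of pi]] fobj_minus[OF circ_SH, of FF 0] by (simp add: half_def circ_pi)

lemma vv_c0: "vv c0 = circ 0 \<or> vv c0 = - circ 0"
 using vvD(2,3)[OF c0_ob(1)] fobj_eq_iff[OF _ circ_SH] oparD(1)[OF opar_EF(4)] by (metis fobj_fst minus_minus)

lemma lam_half: "lam c0 c0 half = - 1"
proof -
 obtain l where l: "l = 1 \<or> l = - 1" "vv c0 = l *\<^sub>R circ 0" using vv_c0 by force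
 have "lamrel c0 c0 half 0 (%t. l *\<^sub>R circ (pi * t)) (- 1)"
 proof -
  have h: "hpath FF (%t. circ (pi * t))" using circ_pdat by (simp add: pdat_def)
  have "parr FF FF 0 (%t. l *\<^sub>R circ (pi * t)) = half"
   using l parr_minus[OF oparD(1)[OF opar_EF(4)] h] by (auto simp: half_def)
  moreover have "pdat FF FF 0 (%t. l *\<^sub>R circ (pi * t))" using circ_pdat[of pi] l hpath_minus[OF h] by (auto simp: pdat_def)
  ultimately show ?thesis using l by (simp add: lamrel_def circ_pi)
 qed
 thus ?thesis by (rule lam_eq[OF c0_ob(1)])
qed

lemma fst_FF: "x : ob PiB ==> 1 : fst x ==> fst x = FF"
 using vvD(1)[of x] subgroup_C2_cases[of "fst x"] by simp

lemma arr_FF: "x : ob PiB ==> y : ob PiB ==> f : arr PiB x y ==> 1 : fst x ==> 1 : fst y"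
proof -
 assume a: "x : ob PiB" "y : ob PiB" "f : arr PiB x y" "1 : fst x"
 obtain b g l where "lamrel x y f b g l" using lamrel_ex[OF a(1-3)] .
 from oparD(6)[OF lamrelD(1)[OF a(1,2) this] a(4)] show ?thesis .
qed

lemma fixed_arrow_coboundary:
 assumes \<delta>: "arrow_sign {FF} \<delta>"
  and half: "\<delta> c0 c0 half = 1"
 obtains u where "!!x. x : ob PiB ==> fst x = FF ==> u x : {1, - 1 :: real}"
  "!!x y f. x : ob PiB ==> y : ob PiB ==> f : arr PiB x y ==> fst x = FF ==> \<delta> x y f = u x * u y"
proof -
 have pF: "pdat FF FF 0 g" if "hpath FF g" for g using that opar_EF(4) hpath_in[OF that, of 1] by (simp add: pdat_def)
 note P = pd_props[OF pF \<delta> singletonI]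
 have a0: "act31 0 o g = g" for g by (simp add: fun_eq_iff)
 have o0: "ooff FF 0 0 = 0" by (simp add: ooff_def)
 have hm: "pd \<delta> FF FF 0 g = pd \<delta> FF FF 0 g'" if "homotopic_paths (SH FF) g g'" for g g'
  using P(3)[OF _ that] homotopic_paths_imp_path[OF that] homotopic_paths_imp_subset[OF that] by (simp add: hpath_def)
 have cp: "pd \<delta> FF FF 0 (g +++ g') = pd \<delta> FF FF 0 g' * pd \<delta> FF FF 0 g" if g: "hpath FF g" "hpath FF g'" "g' 0 = g 1" for g g'
  using P(2)[OF g(1) pF[OF g(2)]] g(3) by (simp only: o0 a0 act31_simps)
 have hf: "pd \<delta> FF FF 0 (%t. circ (pi * t)) = 1"
  using half fobj_minus[OF circ_SH, of FF 0] by (simp add: pd_def half_def circ_pi)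
 obtain u where u: "!!z. z : SH FF ==> u z : {1, - 1 :: real}" "!!z. z : SH FF ==> u (- z) = u z" "!!g. hpath FF g ==> pd \<delta> FF FF 0 g = u (g 0) * u (g 1)"
 proof (rule fixed_coboundary[OF P(1) cp hm P(4) hf], goal_cases)
  case (7 u)
  show ?case by (rule 7(1)[OF 7(2) 7(3) 7(4)])
 qed
 show thesis
 proof (rule that[of "%x. u (vv x)"])
  show "u (vv x) : {1, - 1}" if "x : ob PiB" "fst x = FF" for x using u(1) vvD(2)[OF that(1)] that(2) by simp
  fix x y f assume x: "x : ob PiB" and y: "y : ob PiB" and f: "f : arr PiB x y" and xF: "fst x = FF"
  have yF: "fst y = FF" using fst_FF[OF y arr_FF[OF x y f]] xF by simp
  obtain b g l where r: "lamrel x y f b g l" using lamrel_ex[OF x y f] .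
  note R = lamrelD[OF x y r]
  have b: "b = 0" using oparD(5)[OF R(1)] yF by simp
  have "\<delta> x y f = pd \<delta> FF FF 0 g" using r R(3,4) b xF yF unfolding lamrel_def pd_def by metis
  also have "\<dots> = u (g 0) * u (g 1)" by (rule u(3)) (use r xF in \<open>simp add: lamrel_def pdat_def\<close>)
  finally show "\<delta> x y f = u (vv x) * u (vv y)"
   using r u(2)[OF vvD(2)[OF y, unfolded yF]] b by (auto simp: lamrel_def)
 qed
qed

lemma arr_kind:
 assumes x: "x : ob PiB" and y: "y : ob PiB" and f: "f : arr PiB x y" and F: "1 : fst x"
 shows "fst (vv x) = 0 \<longleftrightarrow> fst (vv y) = 0"
proof -
 obtain b g l where r: "lamrel x y f b g l" using lamrel_ex[OF x y f] .
 have "hpath FF g" using r fst_FF[OF x F] by (simp add: lamrel_def pdat_def)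
 hence "fst (g 0) = 0 \<longleftrightarrow> fst (g 1) = 0"
  by (cases rule: fixed_path_cases) (use circ_simps(4) in \<open>force, metis atLeastAtMost_iff order_refl zero_le_one\<close>)
 thus ?thesis using r by (auto simp: lamrel_def act31_eq prod_eq_iff)
qed

lemma point_ob:
 assumes x: "x : ob PiB" and F: "1 : fst x" and z: "fst (vv x) = 0"
 shows "x = pt0"
proof -
 have "norm (vv x) = 1" using SH_sphere(1)[OF vvD(2)[OF x]] .
 hence "snd (vv x) = 1 \<or> snd (vv x) = - 1" using z by (auto simp: norm_prod_def power2_eq_1_iff)
 hence "vv x = north \<or> vv x = - north" using z by (auto simp: north_def prod_eq_iff)
 thus ?thesis using vvD(3)[OF x] fst_FF[OF x F] fobj_minus[OF north_SH] by metis
qed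

lemma circle_ob:
 assumes x: "x : ob PiB" and F: "1 : fst x" and z: "fst (vv x) ~= 0"
 obtains f where "f : arr PiB c0 x"
proof -
 obtain s where s: "vv x = circ s" using circ_surj[of "vv x"] vvD(2)[OF x] fst_FF[OF x F] z by auto
 have "fobj FF (circ s) = x" using s vvD(3)[OF x] fst_FF[OF x F] by simp
 thus thesis using that parr_arr[OF circ_pdat[of s]] by simp
qed

lemma vv_kind: "fst (vv c0) ~= 0" "fst (vv pt0) = 0"
proof -
 show "fst (vv c0) ~= 0" using vv_c0 circ_simps(4)[of 0] by auto
 have "vv pt0 = north \<or> vv pt0 = - north"
  using vvD(2,3)[OF c0_ob(2)] fobj_eq_iff[OF _ north_SH] oparD(1)[OF opar_EF(4)] by (metis fobj_fst minus_minus)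
 thus "fst (vv pt0) = 0" by (auto simp: north_def)
qed

section \<open>Classification of virtual representations\<close>

abbreviation VB :: "int => (int vobj, (int set => int set) \<times> int vpair set) cat" where
 "VB n \<equiv> vbund (all_reps C2) n"

abbreviation VR :: "int => (int, vec31 set) virtual_rep set" where
 "VR n \<equiv> virtual_reps C2 (all_reps C2) PR31 n"

lemma virtual_bundles_indep:
 "arr (vbund R n) = arr (vbund R' n')" "cmp (vbund R n) = cmp (vbund R' n')"
 "idt (vbund R n) = idt (vbund R' n')"
 by (simp_all add: virtual_bundles_def)

lemma nat_iso_indep: "nat_iso_over C2 PiB (vbund R n) E D = nat_iso_over C2 PiB (vbund R' n') E D"
 unfolding nat_iso_over_def is_iso_arr_def virtual_bundles_indep[of R n R' n'] by (rule HOL.refl)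

lemma virtual_reps_iff:
 "E : vreps R n \<longleftrightarrow> E : VR n & (ALL x:ob PiB. fst E x : ob (vbund R n))" if "good_sys R"
proof -
 have "ob (vbund R n) \<subseteq> ob (VB n)" using that by (auto simp: good_sys_def virtual_bundles_def)
 thus ?thesis unfolding virtual_reps_def is_functor_def virtual_bundles_indep[of R n "all_reps C2" n]
  by (cases E) auto
qed

lemma VR_D:
 assumes g: "E : VR n"
 shows "x : ob PiB ==> is_vob (fst E x)" "x : ob PiB ==> fst (fst E x) = fst x" "x : ob PiB ==> vdim (fst E x) = n"
  "[|x : ob PiB; y : ob PiB; f : arr PiB x y|] ==> snd E x y f : arr (VB n) (fst E x) (fst E y)"
  "[|x : ob PiB; y : ob PiB; f : arr PiB x y|] ==> fst (snd E x y f) = fst f"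
  "[|x : ob PiB; y : ob PiB; z : ob PiB; f : arr PiB x y; h : arr PiB y z|] ==>
   snd E x z (cmp PiB x y z h f) = cmp (VB n) (fst E x) (fst E y) (fst E z) (snd E y z h) (snd E x y f)"
  "x : ob PiB ==> snd E x x (idt PiB x) = idt (VB n) (fst E x)"
proof -
 obtain G0 G1 where G: "E = (G0, G1)" by (cases E)
 have o: "x : ob PiB ==> G0 x : ob (VB n)" for x using g by (auto simp: G virtual_reps_def is_functor_def)
 have gs: "good_sys (all_reps C2)" by (simp add: good_sys_def)
 show "x : ob PiB ==> is_vob (fst E x)" using ob_is_vob[OF gs o] by (simp add: G)
 show "x : ob PiB ==> vdim (fst E x) = n" using o[of x] by (auto simp: G virtual_bundles_def vdim_def)
qed (use g in \<open>auto simp: virtual_reps_def is_functor_def over_orbits_def\<close>)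

abbreviation vsg where "vsg c E x y f \<equiv> asg c (fst E x) (fst E y) (snd E x y f)"

lemma VR_arr:
 assumes g: "E : VR n" and o: "x : ob PiB" "y : ob PiB" "f : arr PiB x y"
 shows "dims_eq (fst E x) (fst E y)" "vsg False E x y f : {1, - 1}"
  "1 : fst x ==> vsg True E x y f : {1, - 1}"
 using arrD[OF VR_D(4)[OF g o] VR_D(1)[OF g o(1)] VR_D(1)[OF g o(2)]] VR_D(2)[OF g o(1)] by simp_all

definition fixp :: "(int, vec31 set) virtual_rep => int" where "fixp E = fixdim (fst E pt0)"
definition fixc :: "(int, vec31 set) virtual_rep => int" where "fixc E = fixdim (fst E c0)"
definition loop_sign :: "(int, vec31 set) virtual_rep => real" where
 "loop_sign E = vsg True E c0 c0 half"

lemma fixdim_VR: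
 assumes g: "E : VR n" and x: "x : ob PiB" "1 : fst x"
 shows "fixdim (fst E x) = (if fst (vv x) = 0 then fixp E else fixc E)"
proof (cases "fst (vv x) = 0")
 case True
 thus ?thesis using point_ob[OF x True] by (simp add: fixp_def)
next
 case False
 obtain f where f: "f : arr PiB c0 x" using circle_ob[OF x False] .
 have "dims_eq (fst E c0) (fst E x)" by (rule VR_arr(1)[OF g c0_ob(1) x(1) f])
 thus ?thesis using VR_D(2)[OF g c0_ob(1)] False by (simp add: dims_eq_def fixc_def)
qed

lemma loop_sign_values: "E : VR n ==> loop_sign E : {1, - 1}"
 unfolding loop_sign_def by (rule VR_arr(3)[OF _ c0_ob(1) c0_ob(1) half_arr]) simp_all

lemma VR_asg_comp:
 assumes g: "E : VR n" and o: "x : ob PiB" "y : ob PiB" "z : ob PiB" "f : arr PiB x y" "h : arr PiB y z"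
 shows "vsg False E x z (cmp PiB x y z h f) =
   vsg False E x y f * vsg False E y z h * vtwo (fst E y) (fst E z) (off (fst x) (fst f))"
  "1 : fst x ==> vsg True E x z (cmp PiB x y z h f) =
   vsg True E x y f * vsg True E y z h"
 unfolding VR_D(6)[OF g o]
 using cmp_vb(3,4)[OF VR_D(4)[OF g o(1,2,4)] VR_D(4)[OF g o(2,3,5)] VR_D(1)[OF g o(1)] VR_D(1)[OF g o(2)] VR_D(1)[OF g o(3)]]
  VR_D(2)[OF g o(1)] VR_D(5)[OF g o(1,2,4)] by simp_all

lemma sign_regroup1: "t * t = (1::real) ==> t' = t ==> a * b * t' * (c * d * t) = b * d * (a * c)"
 using mult.assoc[of "a * b * c * d" t t] by (simp add: mult_ac)

lemma sign_regroup2: "k * k = (1::real) ==> a * b * t * (c * d * s) * (m * p) = a * c * (m * k) * (b * d * (k * p)) * (t * s)"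
proof -
 assume "k * k = 1"
 moreover have "a * c * (m * k) * (b * d * (k * p)) * (t * s) = (a * b * t * (c * d * s) * (m * p)) * (k * k)" by (simp add: mult_ac)
 ultimately show ?thesis by simp
qed

text \<open>
  Two virtual representations with the same fixed dimensions have fibres that are isomorphic over every orbit, and the
  discrepancy of their signs is multiplicative, because the twists agree. A natural isomorphism is a pair of functions
  whose coboundaries are the discrepancies: on total signs it always exists, and on fixed parts it exists exactly if the
  signs of the half turn agree.
\<close>

theorem nat_iso_iff:
 assumes g: "E : VR n" and d: "D : VR n"
 shows "nat_iso_over C2 PiB (VB n) E D \<longleftrightarrow> fixp E = fixp D & fixc E = fixc D & loop_sign E = loop_sign D"
proof
 note G = VR_D[OF g] and D = VR_D[OF d]
 assume "nat_iso_over C2 PiB (VB n) E D"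
 then obtain \<eta> where \<eta>: "!!x. x : ob PiB ==> \<eta> x : arr (VB n) (fst E x) (fst D x)"
  and nat: "!!x y f. x : ob PiB ==> y : ob PiB ==> f : arr PiB x y ==>
   cmp (VB n) (fst E x) (fst E y) (fst D y) (\<eta> y) (snd E x y f) = cmp (VB n) (fst E x) (fst D x) (fst D y) (snd D x y f) (\<eta> x)"
  unfolding nat_iso_over_def is_iso_arr_def case_prod_unfold by blast
 have "dims_eq (fst E x) (fst D x)" if "x : ob PiB" for x using arrD(3)[OF \<eta> G(1) D(1)] that by blast
 hence "fixp E = fixp D" "fixc E = fixc D" using c0_ob G(2) by (simp_all add: dims_eq_def fixp_def fixc_def)
 moreover have "loop_sign E = loop_sign D"
 proof -
  note c = c0_ob(1)
  have F: "1 : fst (fst E c0)" using G(2)[OF c] by simp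
  define s where "s = asg True (fst E c0) (fst D c0) (\<eta> c0)"
  have "s : {1, - 1}" unfolding s_def by (rule arrD(5)[OF \<eta>[OF c] G(1)[OF c] D(1)[OF c] F])
  moreover have "loop_sign E * s = s * loop_sign D"
   using arg_cong[OF nat[OF c c half_arr], of "asg True (fst E c0) (fst D c0)"]
    cmp_vb(4)[OF G(4)[OF c c half_arr] \<eta>[OF c] G(1)[OF c] G(1)[OF c] D(1)[OF c] F]
    cmp_vb(4)[OF \<eta>[OF c] D(4)[OF c c half_arr] G(1)[OF c] D(1)[OF c] D(1)[OF c] F] by (simp add: loop_sign_def s_def)
  ultimately show ?thesis by auto
 qed
 ultimately show "fixp E = fixp D & fixc E = fixc D & loop_sign E = loop_sign D" by blast
next
 note G = VR_D[OF g] and D = VR_D[OF d]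
 assume inv: "fixp E = fixp D & fixc E = fixc D & loop_sign E = loop_sign D"
 have dm: "dims_eq (fst E x) (fst D x)" if x: "x : ob PiB" for x
  using fixdim_VR[OF g x] fixdim_VR[OF d x] inv G(2,3)[OF x] D(3)[OF x] by (simp add: dims_eq_def)
 define s where "s = (%c x y f. vsg c E x y f * vsg c D x y f)"
 have s0: "arrow_sign UNIV (s False)"
  unfolding arrow_sign_def
 proof (intro ballI impI conjI)
  fix x y f assume o: "x : ob PiB" "y : ob PiB" "f : arr PiB x y"
  show "s False x y f : {1, - 1}" using VR_arr(2)[OF g o] VR_arr(2)[OF d o] by (auto simp: s_def)
  fix z h assume o2: "z : ob PiB" "h : arr PiB y z"
  let ?t = "%E. vtwo (fst E y) (fst E z) (off (fst x) (fst f))"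
  have "kapo (fst E z) = kapo (fst D z)" if "1 : fst z"
   using dm[OF o2(1)] that G(2)[OF o2(1)] by (simp add: kapo_def dims_eq_def)
  hence "?t E = ?t D" using G(2)[OF o(2)] D(2)[OF o(2)] G(2)[OF o2(1)] D(2)[OF o2(1)] by (simp add: vtwo_def)
  moreover have "?t D * ?t D = 1" by (auto simp: vtwo_def kapo_def)
  ultimately show "s False x z (cmp PiB x y z h f) = s False y z h * s False x y f"
   unfolding s_def VR_asg_comp(1)[OF g o(1,2) o2(1) o(3) o2(2)] VR_asg_comp(1)[OF d o(1,2) o2(1) o(3) o2(2)] by (rule sign_regroup1[rotated])
 qed
 have s1: "arrow_sign {FF} (s True)"
  unfolding arrow_sign_def
 proof (intro ballI impI conjI)
  fix x y f assume o: "x : ob PiB" "y : ob PiB" "f : arr PiB x y" and "fst x : {FF}"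
  hence F: "1 : fst x" by simp
  show "s True x y f : {1, - 1}" using VR_arr(3)[OF g o F] VR_arr(3)[OF d o F] by (auto simp: s_def)
  fix z h assume o2: "z : ob PiB" "h : arr PiB y z"
  show "s True x z (cmp PiB x y z h f) = s True y z h * s True x y f"
   unfolding s_def VR_asg_comp(2)[OF g o(1,2) o2(1) o(3) o2(2) F] VR_asg_comp(2)[OF d o(1,2) o2(1) o(3) o2(2) F] by simp
 qed
 have "s True c0 c0 half = loop_sign E * loop_sign D" by (simp add: s_def loop_sign_def)
 hence sh: "s True c0 c0 half = 1" using inv loop_sign_values[OF d] by auto
 obtain u where u: "!!x. x : ob PiB ==> u x : {1, - 1}" "!!x y f. x : ob PiB ==> y : ob PiB ==> f : arr PiB x y ==> s False x y f = u x * u y"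
  by (rule arrow_coboundary[OF s0]) blast
 obtain w where w: "!!x. x : ob PiB ==> fst x = FF ==> w x : {1, - 1}"
  "!!x y f. x : ob PiB ==> y : ob PiB ==> f : arr PiB x y ==> fst x = FF ==> s True x y f = w x * w y"
  by (rule fixed_arrow_coboundary[OF s1 sh]) blast
 have "EX e. e : arr (VB n) (fst E x) (fst D x) & fst e = otr (fst x) (fst x) 0 & asg False (fst E x) (fst D x) e = u x
   & (1 : fst x --> asg True (fst E x) (fst D x) e = w x)" if x: "x : ob PiB" for x
 proof -
  have o: "opar (fst (fst E x)) (fst (fst D x)) 0" using idt_orbit(2)[OF vvD(1)[OF x]] G(2)[OF x] D(2)[OF x] by simp
  have e: "(if 1 : fst x then w x else 1) : {1, - 1}" using w(1)[OF x] fst_FF[OF x] by simp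
  show ?thesis using arr_exists[OF o G(1)[OF x] D(1)[OF x] dm[OF x] u(1)[OF x] e, of "all_reps C2" n] G(2)[OF x] D(2)[OF x] by metis
 qed
 then obtain \<eta> where \<eta>: "!!x. x : ob PiB ==> \<eta> x : arr (VB n) (fst E x) (fst D x)" "!!x. x : ob PiB ==> fst (\<eta> x) = otr (fst x) (fst x) 0"
   "!!x. x : ob PiB ==> asg False (fst E x) (fst D x) (\<eta> x) = u x" "!!x. x : ob PiB ==> 1 : fst x ==> asg True (fst E x) (fst D x) (\<eta> x) = w x"
  by metis
 show "nat_iso_over C2 PiB (VB n) E D"
  unfolding nat_iso_over_def case_prod_unfold
 proof (intro exI[of _ \<eta>] conjI ballI)
  fix x assume x: "x : ob PiB"
  have i: "idt (orbit_cat C2) (fst x) = otr (fst x) (fst x) 0" by (rule idt_orbit(1)[OF vvD(1)[OF x]])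
  show "fst (\<eta> x) = idt (orbit_cat C2) (fst x)" using \<eta>(2)[OF x] i by simp
  thus "is_iso_arr (VB n) (fst E x) (fst D x) (\<eta> x)"
   by (intro is_iso_vb[OF \<eta>(1)[OF x] G(1)[OF x] D(1)[OF x]]) (simp_all add: G(2)[OF x] D(2)[OF x])
  fix y f assume y: "y : ob PiB" and f: "f : arr PiB x y"
  note c1 = cmp_vb[OF G(4)[OF x y f] \<eta>(1)[OF y] G(1)[OF x] G(1)[OF y] D(1)[OF y], of "all_reps C2" n]
  note c2 = cmp_vb[OF \<eta>(1)[OF x] D(4)[OF x y f] G(1)[OF x] D(1)[OF x] D(1)[OF y], of "all_reps C2" n]
  note fs = G(2)[OF x] G(2)[OF y] D(2)[OF x] D(2)[OF y] G(5)[OF x y f] D(5)[OF x y f]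
  have o: "opar (fst x) (fst y) (off (fst x) (fst f))" "fst f = otr (fst x) (fst y) (off (fst x) (fst f))"
   using arrD(1,2)[OF G(4)[OF x y f] G(1)[OF x] G(1)[OF y]] unfolding fs by simp_all
  note ii = idt_orbit(2)[OF vvD(1)[OF x]] idt_orbit(2)[OF vvD(1)[OF y]]
  have ff: "cmp (orbit_cat C2) (fst x) (fst y) (fst y) (otr (fst y) (fst y) 0) (fst f) = cmp (orbit_cat C2) (fst x) (fst x) (fst y) (fst f) (otr (fst x) (fst x) 0)"
   using cmp_orbit[OF o(1) ii(2)] cmp_orbit[OF ii(1) o(1)] o(2) by (simp add: ooff_def add.commute)
  have off0: "off (fst x) (otr (fst x) (fst x) 0) = 0" by (rule off_otr[OF ii(1)])
  have t: "vtwo (fst E y) (fst D y) b = 1" "vtwo (fst D x) (fst D y) 0 = 1" for b by (auto simp: vtwo_def fs)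
  have uw: "vsg False E x y f * u y = u x * vsg False D x y f"
   using u(2)[OF x y f] u(1)[OF x] u(1)[OF y] VR_arr(2)[OF g x y f] VR_arr(2)[OF d x y f] by (auto simp: s_def)
  have ww: "vsg True E x y f * w y = w x * vsg True D x y f" if F: "1 : fst x"
   using w(2)[OF x y f fst_FF[OF x F]] w(1)[OF x fst_FF[OF x F]] w(1)[OF y fst_FF[OF y arr_FF[OF x y f F]]]
    VR_arr(3)[OF g x y f F] VR_arr(3)[OF d x y f F] by (auto simp: s_def)
  show "cmp (VB n) (fst E x) (fst E y) (fst D y) (\<eta> y) (snd E x y f) = cmp (VB n) (fst E x) (fst D x) (fst D y) (snd D x y f) (\<eta> x)"
   by (rule arr_eqI[OF c1(1) c2(1) G(1)[OF x] D(1)[OF y]])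
    (use c1(2-4) c2(2-4) \<eta>(2-4) x y arr_FF[OF x y f] uw ww ff off0 t in \<open>simp_all add: fs\<close>)
 qed
qed

lemma Pi_arr_opar:
 assumes "x : ob PiB" "y : ob PiB" "f : arr PiB x y"
 shows "opar (fst x) (fst y) (off (fst x) (fst f))" "fst f = otr (fst x) (fst y) (off (fst x) (fst f))"
proof -
 obtain b g l where r: "lamrel x y f b g l" using lamrel_ex[OF assms] .
 show "opar (fst x) (fst y) (off (fst x) (fst f))" "fst f = otr (fst x) (fst y) (off (fst x) (fst f))"
  using lamrelD(1,2)[OF assms(1,2) r] r by (simp_all add: lamrel_def parr_def)
qed

text \<open>A virtual representation is given by its fibres and by the two signs of the arrows.\<close>

lemma VR_intro:
 assumes ob: "!!x. x : ob PiB ==> is_vob (fst E x)" "!!x. x : ob PiB ==> fst (fst E x) = fst x" "!!x. x : ob PiB ==> vdim (fst E x) = n"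
  and de: "!!x y f. x : ob PiB ==> y : ob PiB ==> f : arr PiB x y ==> dims_eq (fst E x) (fst E y)"
  and eq: "!!x y f. x : ob PiB ==> y : ob PiB ==> f : arr PiB x y ==> snd E x y f = (fst f, vcls (fst E x) (fst E y) (fst f) (e False x y f) (e True x y f))"
  and sg: "!!c x y f. x : ob PiB ==> y : ob PiB ==> f : arr PiB x y ==> e c x y f : {1, - 1}"
  and id: "!!c x. x : ob PiB ==> e c x x (idt PiB x) = 1"
  and comp: "!!x y z f h. x : ob PiB ==> y : ob PiB ==> z : ob PiB ==> f : arr PiB x y ==> h : arr PiB y z ==>
   e False x z (cmp PiB x y z h f) = e False x y f * e False y z h * vtwo (fst E y) (fst E z) (off (fst x) (fst f))"
  and comp1: "!!x y z f h. x : ob PiB ==> y : ob PiB ==> z : ob PiB ==> f : arr PiB x y ==> h : arr PiB y z ==> 1 : fst x ==>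
   e True x z (cmp PiB x y z h f) = e True x y f * e True y z h"
 shows "E : VR n" "loop_sign E = e True c0 c0 half"
proof -
 have A: "snd E x y f : arr (VB n) (fst E x) (fst E y)" "fst (snd E x y f) = fst f" "vsg False E x y f = e False x y f"
  "1 : fst x ==> vsg True E x y f = e True x y f"
  if o: "x : ob PiB" "y : ob PiB" "f : arr PiB x y" for x y f
 proof -
  note p = Pi_arr_opar[OF o]
  have p': "opar (fst (fst E x)) (fst (fst E y)) (off (fst x) (fst f))" using p(1) ob(2) o by simp
  note a = arr_vcls[OF p' ob(1)[OF o(1)] ob(1)[OF o(2)] de[OF o] sg[OF o, of False] sg[OF o, of True], of "all_reps C2" n]
  note ne = vcls_nonempty[OF p' ob(1)[OF o(1)] ob(1)[OF o(2)] de[OF o] sg[OF o, of False] sg[OF o, of True]]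
  have ff: "otr (fst (fst E x)) (fst (fst E y)) (off (fst x) (fst f)) = fst f" using p(2) ob(2) o by simp
  show "snd E x y f : arr (VB n) (fst E x) (fst E y)" using a unfolding eq[OF o] ff .
  show "fst (snd E x y f) = fst f" using eq[OF o] by simp
  show "vsg False E x y f = e False x y f" unfolding eq[OF o] by (rule asg_vcls(1)[OF ne[unfolded ff]])
  show "1 : fst x ==> vsg True E x y f = e True x y f"
   unfolding eq[OF o] by (rule asg_vcls(2)[OF ne[unfolded ff]]) (simp add: ob(2)[OF o(1)])
 qed
 show "loop_sign E = e True c0 c0 half" using A(4)[OF c0_ob(1) c0_ob(1) half_arr] by (simp add: loop_sign_def)
 show "E : VR n"
  unfolding virtual_reps_def is_functor_def over_orbits_def case_prod_unfold
 proof (intro CollectI conjI ballI)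
  fix x assume x: "x : ob PiB"
  note X = ob[OF x]
  show "fst (fst E x) = fst x" by (rule X(2))
  show "fst E x : ob (VB n)" using X by (auto simp: virtual_bundles_def is_vob_def vob_def vdim_def case_prod_unfold)
  have I: "idt PiB x : arr PiB x x"
   using parr_arr[OF parr_idt(2)[OF vvD(1,2)[OF x]]] parr_idt(1)[OF vvD(1,2)[OF x]] vvD(3)[OF x] by simp
  have fi: "fst (idt PiB x) = idt (orbit_cat C2) (fst x)" using lam_idt(2)[OF x] idt_orbit(1)[OF vvD(1)[OF x]] by simp
  show "snd E x x (idt PiB x) = idt (VB n) (fst E x)"
   by (rule arr_eqI[OF A(1)[OF x x I] idt_vb(1)[OF X(1)] X(1) X(1)])
    (use A(2-4)[OF x x I] idt_vb(2-4)[OF X(1), of "all_reps C2" n] X(2) fi id[OF x] in simp_all)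
  fix y assume y: "y : ob PiB"
  show "fst (snd E x y f) = fst f" "snd E x y f : arr (VB n) (fst E x) (fst E y)" if "f : arr PiB x y" for f
   using A(1,2)[OF x y that] by auto
  fix z f h assume z: "z : ob PiB" and f: "f : arr PiB x y" and h: "h : arr PiB y z"
  note C = lam_comp(4)[OF x y z f h] and c = cmp_vb[OF A(1)[OF x y f] A(1)[OF y z h] ob(1)[OF x] ob(1)[OF y] ob(1)[OF z], of "all_reps C2" n]
  show "snd E x z (cmp PiB x y z h f) = cmp (VB n) (fst E x) (fst E y) (fst E z) (snd E y z h) (snd E x y f)"
   by (rule arr_eqI[OF A(1)[OF x z C] c(1) ob(1)[OF x] ob(1)[OF z]])
    (use A(2-4)[OF x z C] A(2-4)[OF x y f] A(2-4)[OF y z h] c(2-4) ob(2)[OF x] ob(2)[OF y] ob(2)[OF z] lam_comp(2)[OF x y z f h]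
     comp[OF x y z f h] comp1[OF x y z f h] arr_FF[OF x y f] in simp_all)
 qed
qed

subsection \<open>Sums\<close>

lemma vobj_sum_simps:
 assumes "is_vob X" "is_vob Y" "fst X = fst Y"
 shows "is_vob (vobj_sum X Y)" "fst (vobj_sum X Y) = fst X" "vdim (vobj_sum X Y) = vdim X + vdim Y"
  "1 : fst X ==> fixdim (vobj_sum X Y) = fixdim X + fixdim Y"
proof -
 obtain H V1 V2 W1 W2 where XY: "X = (H, V1, V2)" "Y = (H, W1, W2)" using assms(3) by (metis fst_conv surj_pair)
 have v: "subgroup H C2" "orep H V1" "orep H V2" "orep H W1" "orep H W2"
  using assms(1,2) by (auto simp: is_vob_def vob_def XY)
 show "is_vob (vobj_sum X Y)" using v orth_rep_sum by (auto simp: is_vob_def vob_def vobj_sum_def XY)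
 show "fst (vobj_sum X Y) = fst X" by (simp add: vobj_sum_def XY)
 show "vdim (vobj_sum X Y) = vdim X + vdim Y" by (simp add: vobj_sum_def XY vdim_def rep_sum_def case_prod_unfold)
 show "1 : fst X ==> fixdim (vobj_sum X Y) = fixdim X + fixdim Y"
  using pdim_sum[of H] v subgroup_C2_cases[OF v(1)] by (simp add: vobj_sum_def XY fixdim_def)
qed

lemma nu_sq:
 assumes "is_vob X" "is_vob Y" "fst X = fst Y" "okc c (fst X)"
 shows "nu c X Y * nu c X Y = 1"
proof -
 obtain H V1 V2 W1 W2 where XY: "X = (H, V1, V2)" "Y = (H, W1, W2)" using assms(3) by (metis fst_conv surj_pair)
 have v: "subgroup H C2" "orep H V1" "orep H V2" "orep H W1" "orep H W2" and c: "okc c H"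
  using assms by (auto simp: is_vob_def vob_def XY)
 have "theta c V1 W1 : {1, - 1}" "theta c V2 W2 : {1, - 1}"
  using theta_values[OF repc_of[OF v(2,1) c] repc_of[OF v(4,1) c]] theta_values[OF repc_of[OF v(3,1) c] repc_of[OF v(5,1) c]] by auto
 thus ?thesis by (auto simp: nu_def XY minus_one_power_iff)
qed

lemma virtual_rep_sum_VR:
 assumes g: "E : VR m" and d: "D : VR n"
 shows "virtual_rep_sum C2 E D : VR (m + n)" "fixp (virtual_rep_sum C2 E D) = fixp E + fixp D"
  "fixc (virtual_rep_sum C2 E D) = fixc E + fixc D" "loop_sign (virtual_rep_sum C2 E D) = loop_sign E * loop_sign D"
proof -
 note G = VR_D[OF g] and D = VR_D[OF d]
 let ?F = "virtual_rep_sum C2 E D"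
 have F0: "fst ?F x = vobj_sum (fst E x) (fst D x)" and F1: "snd ?F x y f = varr_sum C2 (fst E x) (fst D x) (fst E y) (fst D y) (snd E x y f) (snd D x y f)" for x y f
  by (simp_all add: virtual_rep_sum_def case_prod_unfold)
 have S: "is_vob (fst ?F x)" "fst (fst ?F x) = fst x" "vdim (fst ?F x) = m + n" "1 : fst x ==> fixdim (fst ?F x) = fixdim (fst E x) + fixdim (fst D x)"
  if x: "x : ob PiB" for x
  using vobj_sum_simps[OF G(1)[OF x] D(1)[OF x]] G(2,3)[OF x] D(2,3)[OF x] unfolding F0 by simp_all
 define nn where "nn = (%c x. nu c (fst E x) (fst D x))"
 have A: "snd ?F x y f : arr (VB (m + n)) (fst ?F x) (fst ?F y)" "fst (snd ?F x y f) = fst f"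
  "vsg False ?F x y f = vsg False E x y f * vsg False D x y f * (nn False x * nn False y)"
  "1 : fst x ==> vsg True ?F x y f = vsg True E x y f * vsg True D x y f * (nn True x * nn True y)"
  if o: "x : ob PiB" "y : ob PiB" "f : arr PiB x y" for x y f
  using varr_sum_vb[OF G(4)[OF o] D(4)[OF o] G(1)[OF o(1)] G(1)[OF o(2)] D(1)[OF o(1)] D(1)[OF o(2)]]
   G(2)[OF o(1)] G(2)[OF o(2)] D(2)[OF o(1)] D(2)[OF o(2)] G(5)[OF o] D(5)[OF o] unfolding F0 F1 nn_def by simp_all
 have nq: "nn False x * nn False x = 1" "1 : fst x ==> nn True x * nn True x = 1" if x: "x : ob PiB" for x
  using nu_sq[OF G(1)[OF x] D(1)[OF x]] G(2)[OF x] D(2)[OF x] by (simp_all add: nn_def)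
 have pm: "s * t * (u * v) : {1, - 1}" if "s : {1, - 1}" "t : {1, - 1}" "u * u = 1" "v * v = 1" for s t u v :: real
  using that square_eq_1_iff[of u] square_eq_1_iff[of v] by auto
 \<comment> \<open>The factors \<open>nn\<close> are coboundaries, so they do not disturb multiplicativity.\<close>
 define e where "e = (%c x y f. if c then if 1 : fst x then vsg True E x y f * vsg True D x y f * (nn True x * nn True y) else 1
  else vsg False E x y f * vsg False D x y f * (nn False x * nn False y))"
 show "?F : VR (m + n)"
 proof (rule VR_intro(1)[of ?F _ e])
  fix x assume x: "x : ob PiB"
  show "is_vob (fst ?F x)" "fst (fst ?F x) = fst x" "vdim (fst ?F x) = m + n" using S[OF x] by auto
  show "e c x x (idt PiB x) = 1" for c
   using idt_vb(3,4)[OF G(1)[OF x], of "all_reps C2" m] idt_vb(3,4)[OF D(1)[OF x], of "all_reps C2" n] G(2,7)[OF x] D(2,7)[OF x] nq[OF x]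
   by (simp add: e_def)
  fix y f assume y: "y : ob PiB" and f: "f : arr PiB x y"
  note a = A[OF x y f] arrD(3,6)[OF A(1)[OF x y f] S(1)[OF x] S(1)[OF y]]
  show "dims_eq (fst ?F x) (fst ?F y)" by (rule a(5))
  show "snd ?F x y f = (fst f, vcls (fst ?F x) (fst ?F y) (fst f) (e False x y f) (e True x y f))"
   by (subst a(6)) (use a(2-4) S(2)[OF x] in \<open>auto simp: e_def\<close>)
  show "e c x y f : {1, - 1}" for c
   using pm[OF VR_arr(2)[OF g x y f] VR_arr(2)[OF d x y f] nq(1)[OF x] nq(1)[OF y]]
    pm[OF VR_arr(3)[OF g x y f] VR_arr(3)[OF d x y f] nq(2)[OF x] nq(2)[OF y]] arr_FF[OF x y f] by (simp add: e_def)
  fix z h assume z: "z : ob PiB" and h: "h : arr PiB y z"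
  let ?b = "off (fst x) (fst f)"
  have vt: "vtwo (fst ?F y) (fst ?F z) ?b = vtwo (fst E y) (fst E z) ?b * vtwo (fst D y) (fst D z) ?b"
   using S[OF y] S[OF z] G(2,3)[OF y] G(2,3)[OF z] D(2,3)[OF y] D(2,3)[OF z] by (auto simp: vtwo_def kapo_def)
  show "e False x z (cmp PiB x y z h f) = e False x y f * e False y z h * vtwo (fst ?F y) (fst ?F z) ?b"
   unfolding e_def if_False vt VR_asg_comp(1)[OF g x y z f h] VR_asg_comp(1)[OF d x y z f h] by (rule sign_regroup2[OF nq(1)[OF y]])
  assume F: "1 : fst x"
  show "e True x z (cmp PiB x y z h f) = e True x y f * e True y z h"
   using sign_regroup2[OF nq(2)[OF y arr_FF[OF x y f F]], of _ _ 1 _ _ 1] F arr_FF[OF x y f F]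
   unfolding e_def if_True VR_asg_comp(2)[OF g x y z f h F] VR_asg_comp(2)[OF d x y z f h F] by simp
 qed
 show "fixp ?F = fixp E + fixp D" "fixc ?F = fixc E + fixc D" using S(4)[OF c0_ob(1)] S(4)[OF c0_ob(2)] by (simp_all add: fixp_def fixc_def)
 show "loop_sign ?F = loop_sign E * loop_sign D"
  using A(4)[OF c0_ob(1) c0_ob(1) half_arr] nq(2)[OF c0_ob(1)] by (simp add: loop_sign_def)
qed

subsection \<open>The zero virtual representation\<close>

lemma Rn0: "u : Rn 0 \<longleftrightarrow> u = (%i. 0)"
 by (auto simp: Rn_iff fun_eq_iff)

text \<open>
  The bundle with zero fibres is the orbit itself.
\<close>

lemma zero_bpoint:
 assumes H: "subgroup H C2" and a: "a : {0, 1}"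
 shows "bpt H (zero_rep +r zero_rep) (a, %i. 0) = (%c. (c, %i. 0)) ` (a <#\<^bsub>C2\<^esub> H)"
proof -
 have s: "snd (zero_rep +r zero_rep) h (%i. 0) = (%i. 0)" for h :: int
  by (simp add: rep_sum_def zero_rep_def append_vec_def drop_vec_def take_vec_def Rn0 fun_eq_iff)
 have h: "h : {0, 1}" if "h : H" for h using that subgroup_C2_cases[OF H] by (auto split: if_splits)
 have m: "a \<otimes>\<^bsub>C2\<^esub> inv\<^bsub>C2\<^esub> h = (a + h) mod 2" if "h : H" for h
  unfolding C2_inv[OF h[OF that]] by (simp add: C2_simps)
 have "bpt H (zero_rep +r zero_rep) (a, %i. 0) = (%h. (a \<otimes>\<^bsub>C2\<^esub> inv\<^bsub>C2\<^esub> h, %i. 0)) ` H"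
  unfolding bpoint_def by (simp only: case_prod_conv s Setcompr_eq_image)
 also have "\<dots> = (%h. ((a + h) mod 2, %i. 0)) ` H" by (rule image_cong[OF HOL.refl]) (simp only: m)
 finally show ?thesis unfolding l_coset_C2 image_image .
qed

lemma otr_act:
 assumes o: "opar H K b" and a: "a : {0, 1}"
 shows "otr H K b (a <#\<^bsub>C2\<^esub> H) = (a + b) mod 2 <#\<^bsub>C2\<^esub> K"
proof -
 note oD = oparD[OF o]
 have "a <#\<^bsub>C2\<^esub> H : cosets H" by (rule lcoset_act[OF oD(1) coset_self[OF oD(1)] a])
 hence e: "otr H K b (a <#\<^bsub>C2\<^esub> H) = (if 1 : K then {0, 1} else (%a. (a + b) mod 2) ` (a <#\<^bsub>C2\<^esub> H))" by (simp add: otr_def)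
 show ?thesis
 proof (cases "1 : K")
  case True
  have K: "K = FF" "b = 0" using True subgroup_C2_cases[OF oD(2)] oD(5) by auto
  have "(a + 0) mod 2 <#\<^bsub>C2\<^esub> FF = {0, 1}" using a by (auto simp: l_coset_C2)
  thus ?thesis using e True unfolding K by simp
 next
  case False
  hence "H = EE" "K = EE" using subgroup_C2_cases[OF oD(2)] subgroup_C2_cases[OF oD(1)] oD(6) by (auto split: if_splits)
  thus ?thesis using e by (simp add: l_coset_C2 mod_simps)
 qed
qed

lemma zero_VR: "virtual_rep_zero C2 : VR 0" "fixp (virtual_rep_zero C2) = 0" "fixc (virtual_rep_zero C2) = 0" "loop_sign (virtual_rep_zero C2) = 1"
proof -
 let ?Z = "virtual_rep_zero C2 :: (int, vec31 set) virtual_rep"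
 have f0: "fst ?Z x = (fst x, zero_rep, zero_rep)" for x by (simp add: virtual_rep_zero_def case_prod_unfold)
 have v: "vob (fst x) zero_rep zero_rep" if "x : ob PiB" for x :: "int set \<times> (int set => vec31 set)"
  using orth_rep_zero[OF vvD(1)[OF that]] vvD(1)[OF that] by (simp add: vob_def)
 have eq: "snd ?Z x y f = (fst f, vcls (fst ?Z x) (fst ?Z y) (fst f) 1 1)" if o: "x : ob PiB" "y : ob PiB" "f : arr PiB x y" for x y f
 proof -
  define H where "H = fst x"
  define K where "K = fst y"
  define b where "b = off (fst x) (fst f)"
  have p: "opar H K b" and ff: "fst f = otr H K b" using Pi_arr_opar[OF o] by (simp_all add: H_def K_def b_def)
  note oD = oparD[OF p]
  have vv: "vob H zero_rep zero_rep" "vob K zero_rep zero_rep" using v o by (simp_all add: H_def K_def)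
  define z where "z = (\<lambda>p\<in>bpoints C2 H (zero_rep +r zero_rep). {(b, %i::nat. 0 :: real) | b. b : fst f (fst ` p)})"
  have zz: "orep H (zero_rep +r zero_rep)" "orep K (zero_rep +r zero_rep)"
   using orth_rep_sum[OF oD(1)] orth_rep_sum[OF oD(2)] vv by (simp_all add: vob_def)
  have n0: "fst (zero_rep +r zero_rep :: int rep) = 0" by (simp add: rep_sum_def zero_rep_def)
  have zb: "z = bmk H (zero_rep +r zero_rep) K (zero_rep +r zero_rep) b (%u. u)"
  proof (rule bmk_eqI[OF p zz eqv_id])
   show "z : extensional (bpoints C2 H (zero_rep +r zero_rep))" by (simp add: z_def)
   fix a :: int and u assume a: "a : {0, 1}" and u: "u : Rn (fst (zero_rep +r zero_rep :: int rep))"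
   have u0: "u = (%i. 0)" using u by (simp add: n0 Rn0)
   have m: "(a + b) mod 2 : {0, 1}" by auto
   have "z (bpt H (zero_rep +r zero_rep) (a, u)) = (%c. (c, %i. 0)) ` fst f (a <#\<^bsub>C2\<^esub> H)"

   proof -
    have "z (bpt H (zero_rep +r zero_rep) (a, u)) = {(b, %i. 0) | b. b : fst f (fst ` bpt H (zero_rep +r zero_rep) (a, u))}"
     unfolding z_def by (rule restrict_apply'[OF bpoint_in[OF a u]])
    thus ?thesis unfolding u0 zero_bpoint[OF oD(1) a] image_image fst_conv image_ident by (simp only: Setcompr_eq_image)
   qed
   thus "z (bpt H (zero_rep +r zero_rep) (a, u)) = bpt K (zero_rep +r zero_rep) ((a + b) mod 2, u)"
    unfolding u0 zero_bpoint[OF oD(2) m] ff otr_act[OF p a] .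
  qed
  let ?p = "vpr H zero_rep zero_rep K zero_rep zero_rep b zero_rep zero_rep (%u. u) (%u. u)"
  have k: "vok H zero_rep zero_rep K zero_rep zero_rep zero_rep zero_rep (%u. u) (%u. u)" using vv eqv_id by (simp add: vok_def vob_def)
  have ps1: "ps c (H, zero_rep, zero_rep) (K, zero_rep, zero_rep) ?p = 1" if c: "okc c H" for c
  proof -
   have r: "repc c (zero_rep +r zero_rep)" "repc c (zero_rep :: int rep)" using repc_of[OF zz(1) oD(1) c] repc_of[OF _ oD(1) c] vv(1) by (auto simp: vob_def)
   have "sg c zero_rep zero_rep zero_rep zero_rep (%u. u) = 1"
    unfolding sg_def using esgn_id[OF r(1)] theta_values[OF r(2) r(2)] by auto
   thus ?thesis unfolding ps_vpr[OF p vv k c] by simp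
  qed
  have "?p : vpairs C2 (H, zero_rep, zero_rep) (K, zero_rep, zero_rep) (otr H K b)" using vpairs_iff[OF p vv] k by blast
  hence "?p : vcls (H, zero_rep, zero_rep) (K, zero_rep, zero_rep) (otr H K b) 1 1" using ps1[of False] ps1[of True] by (simp add: vcls_def)
  from vpair_rel_image[OF p vv this]
  have "vpair_rel C2 (H, zero_rep, zero_rep) (K, zero_rep, zero_rep) (fst f) `` {(zero_rep, zero_rep, z, z)} = vcls (H, zero_rep, zero_rep) (K, zero_rep, zero_rep) (fst f) 1 1"
   unfolding ff vpr_def zb by simp
  moreover have "snd ?Z x y f = (fst f, vpair_rel C2 (H, zero_rep, zero_rep) (K, zero_rep, zero_rep) (fst f) `` {(zero_rep, zero_rep, z, z)})"
   by (simp add: virtual_rep_zero_def case_prod_unfold Let_def z_def H_def K_def)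
  ultimately show ?thesis by (simp add: f0 H_def K_def)
 qed
 have z1: "is_vob (fst ?Z x)" if "x : ob PiB" for x using v[OF that] by (simp add: f0 is_vob_def)
 have dm: "vdim (fst ?Z x) = 0" "fixdim (fst ?Z x) = 0" for x by (simp_all add: f0 vdim_def fixdim_def)
 have t: "vtwo (fst ?Z y) (fst ?Z z) b = 1" for y z b by (simp add: vtwo_def kapo_def dm)
 have de: "dims_eq (fst ?Z x) (fst ?Z y)" for x y by (simp add: dims_eq_def dm)
 show "?Z : VR 0" "loop_sign ?Z = 1"
  using VR_intro[of ?Z 0 "%_ _ _ _. 1", OF z1 _ dm(1) de eq] by (simp_all add: f0 t[unfolded f0])
 show "fixp ?Z = 0" "fixc ?Z = 0" by (simp_all add: fixp_def fixc_def dm)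
qed

subsection \<open>Existence\<close>

definition rrep :: "(int set => int rep set) => int set => nat => nat => int rep" where
 "rrep R H p q = (SOME W. W : R H & rep_iso H (std_rep p q) W)"

lemma rrepD:
 assumes R: "rep_system C2 R" and H: "subgroup H C2"
 shows "rrep R H p q : R H" "orep H (rrep R H p q)" "fst (rrep R H p q) = p + q" "1 : H ==> pdim {0, 1} (rrep R H p q) = p"
proof -
 let ?W = "rrep R H p q"
 note s = orth_rep_std[OF H, of p q]
 have "EX W. W : R H & rep_iso H (std_rep p q) W" using R H s unfolding rep_system_def by blast
 hence W: "?W : R H & rep_iso H (std_rep p q) ?W" unfolding rrep_def by (rule someI_ex)
 thus "?W : R H" by blast
 thus o: "orep H ?W" using R H unfolding rep_system_def by blast
 obtain A where A: "eqv H (std_rep p q) ?W A"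
  using W by (auto simp: rep_iso_def eqv_def case_prod_unfold)
 have E: "opar EE H 0" "subgroup EE C2" using H subgroup_C2_cases[OF H] by (auto simp: opar_def subgroup_C2_iff split: if_splits)
 have "pdim EE (std_rep p q) = pdim EE ?W"
  using eqv_pdim[OF eqv_mono[OF A oparD(3)[OF E(1)]] rep_restrict[OF E(1) s] rep_restrict[OF E(1) o] E(2)] .
 thus "fst ?W = p + q" using pdim_trivial[OF rep_restrict[OF E(1) s] E(2)] pdim_trivial[OF rep_restrict[OF E(1) o] E(2)] by simp
 show "1 : H ==> pdim {0, 1} ?W = p"
  using eqv_pdim[OF A s o H] pdim_std[OF H, of p q] subgroup_C2_cases[OF H] by simp
qed

text \<open>As \<open>nat\<close> truncates, at most one of \<open>nat a\<close> and \<open>nat (- a)\<close> is nonzero, and they differ by \<open>a\<close>.\<close>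

definition robj :: "(int set => int rep set) => int => int => int set => int vobj" where
 "robj R n a H = (H, rrep R H (nat a) (nat (n - a)), rrep R H (nat (- a)) (nat (a - n)))"

lemma robjD:
 assumes R: "rep_system C2 R" and H: "subgroup H C2"
 shows "robj R n a H : ob (vbund R n)" "is_vob (robj R n a H)" "fst (robj R n a H) = H" "vdim (robj R n a H) = n" "1 : H ==> fixdim (robj R n a H) = a"
 using rrepD[OF R H] H by (auto simp: robj_def virtual_bundles_def is_vob_def vob_def vdim_def fixdim_def)

definition pw :: "real => int => real" where "pw s k = (if even k then 1 else s)"

lemma pw_props: "pw (s * t) k = pw s k * pw t k" "pw 1 k = 1" "s : {1, - 1} ==> pw s k : {1, - 1}"
 by (auto simp: pw_def)

text \<open>The signs of the arrows are powers of the sign \<open>lam\<close>, corrected on the involution of the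
  free orbits; the parity of the exponent of the signs on the fibres is forced by the twist in the composition of virtual
  bundles.\<close>

lemma VR_exists:
 assumes R: "rep_system C2 R"
 obtains E where "E : vreps R n" "fixp E = a" "fixc E = b" "loop_sign E = pw (- 1) k"
proof -
 define fd where "fd = (%x :: int set \<times> (int set => vec31 set). if 1 : fst x then if fst (vv x) = 0 then a else b else n)"
 define G0 where "G0 = (%x. robj R n (fd x) (fst x))"
 define \<sigma> where "\<sigma> = (%(x :: int set \<times> (int set => vec31 set)) (y :: int set \<times> (int set => vec31 set)) (f :: (int set => int set) \<times> (int set \<times> real => vec31 set) set). if 1 ~: fst x & 1 ~: fst y & off (fst x) (fst f) = 1 then pw (- 1) (n - b) else 1)"
 define e where "e = (%c x y f. if c then pw (lam x y f) k else pw (lam x y f) (b - a) * \<sigma> x y f)"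
 define E where "E = (G0, %x y (f :: (int set => int set) \<times> (int set \<times> real => vec31 set) set). (fst f, vcls (G0 x) (G0 y) (fst f) (e False x y f) (e True x y f)))"
 have O: "G0 x : ob (vbund R n)" "is_vob (G0 x)" "fst (G0 x) = fst x" "vdim (G0 x) = n" "1 : fst x ==> fixdim (G0 x) = (if fst (vv x) = 0 then a else b)"
  if x: "x : ob PiB" for x
  using robjD[OF R vvD(1)[OF x]] by (simp_all add: G0_def fd_def)
 have ob: "is_vob (fst E x)" "fst (fst E x) = fst x" "vdim (fst E x) = n" if "x : ob PiB" for x using O[OF that] by (simp_all add: E_def)
 have de: "dims_eq (fst E x) (fst E y)" if o: "x : ob PiB" "y : ob PiB" "f : arr PiB x y" for x y f
  using O(3-5)[OF o(1)] O(3-5)[OF o(2)] arr_FF[OF o] arr_kind[OF o] by (auto simp: E_def dims_eq_def)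
 have eq: "snd E x y f = (fst f, vcls (fst E x) (fst E y) (fst f) (e False x y f) (e True x y f))" for x y f by (simp add: E_def)
 have sv: "\<sigma> x y f : {1, - 1}" for x y f by (auto simp: \<sigma>_def pw_def)
 have sg: "e c x y f : {1, - 1}" if o: "x : ob PiB" "y : ob PiB" "f : arr PiB x y" for c x y f
  using pw_props(3)[OF lam_sgn[OF o], of k] pw_props(3)[OF lam_sgn[OF o], of "b - a"] sv[of x y f] by (cases c) (auto simp: e_def)
 have id: "e c x x (idt PiB x) = 1" if x: "x : ob PiB" for c x
  using lam_idt[OF x] off_otr[OF idt_orbit(2)[OF vvD(1)[OF x]]] by (simp add: e_def pw_props \<sigma>_def)
 have comp: "e False x z (cmp PiB x y z h f) = e False x y f * e False y z h * vtwo (fst E y) (fst E z) (off (fst x) (fst f))"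
  if o: "x : ob PiB" "y : ob PiB" "z : ob PiB" "f : arr PiB x y" "h : arr PiB y z" for x y z f h
 proof -
  define bf where "bf = off (fst x) (fst f)"
  define bh where "bh = off (fst y) (fst h)"
  define c where "c \<longleftrightarrow> 1 ~: fst y & 1 : fst z & bf = 1"
  note lc = lam_comp(1,3)[OF o]
  have p: "opar (fst x) (fst y) bf" "opar (fst y) (fst z) bh" using Pi_arr_opar(1)[OF o(1,2,4)] Pi_arr_opar(1)[OF o(2,3,5)] by (simp_all add: bf_def bh_def)
  have "pw (if c then kz z else 1) (b - a) * \<sigma> x z (cmp PiB x y z h f) = \<sigma> x y f * \<sigma> y z h * vtwo (fst E y) (fst E z) bf"
  proof (cases "1 : fst z")
   case True
   have k: "kapo (G0 z) = pw (- 1) (n - (if fst (vv z) = 0 then a else b))" using O(4,5)[OF o(3)] True by (simp add: kapo_def pw_def)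
   have "pw (kz z) (b - a) = pw (- 1) (n - b) * pw (- 1) (n - (if fst (vv z) = 0 then a else b))" by (auto simp: pw_def kz_def)
   moreover have "1 : fst x ==> 1 : fst y" using arr_FF[OF o(1,2,4)] .
   moreover have "1 : fst y ==> bf = 0" using oparD(5)[OF p(1)] .
   ultimately show ?thesis using True k O(3)[OF o(2)] O(3)[OF o(3)]
    by (auto simp: \<sigma>_def vtwo_def E_def c_def bf_def[symmetric] pw_props)
  next
   case False
   hence nF: "1 ~: fst y" "1 ~: fst x" using arr_FF[OF o(2,3,5)] arr_FF[OF o(1,2,4)] by auto
   have "bf = 0 \<or> bf = 1" "bh = 0 \<or> bh = 1" using oparD(4)[OF p(1)] oparD(4)[OF p(2)] by auto
   thus ?thesis using False nF O(3)[OF o(3)] lc(2)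
    by (elim disjE) (simp_all add: \<sigma>_def vtwo_def E_def c_def ooff_def bf_def[symmetric] bh_def[symmetric] pw_def)
  qed
  thus ?thesis unfolding e_def lc(1) bf_def[symmetric] c_def[symmetric] pw_props(1) if_False by (simp add: mult_ac)
 qed
 have comp1: "e True x z (cmp PiB x y z h f) = e True x y f * e True y z h"
  if o: "x : ob PiB" "y : ob PiB" "z : ob PiB" "f : arr PiB x y" "h : arr PiB y z" and F: "1 : fst x" for x y z f h
  using lam_comp(1)[OF o] arr_FF[OF o(1,2,4) F] by (simp add: e_def pw_props)
 note V = VR_intro[of E n e, OF ob de eq sg id comp comp1]
 have "good_sys R" using R by (simp add: good_sys_def rep_system_def)
 hence "E : vreps R n" using V(1) O(1) virtual_reps_iff by (simp add: E_def)
 moreover have "fixp E = a" "fixc E = b"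
  using O(5)[OF c0_ob(1)] O(5)[OF c0_ob(2)] vv_kind by (simp_all add: fixp_def fixc_def E_def)
 moreover have "loop_sign E = pw (- 1) k" using V(2) lam_half by (simp add: e_def)
 ultimately show thesis using that by blast
qed

section \<open>The group structure\<close>

abbreviation inv_group :: "(int \<times> int \<times> int \<times> int) monoid" where
 "inv_group \<equiv> integer_group \<times>\<times> integer_group \<times>\<times> integer_group \<times>\<times> integer_mod_group 2"

text \<open>
  The virtual representations of dimension \<open>n\<close> with fixed dimension \<open>a\<close> at the isolated fixed
  point, \<open>b\<close> on the fixed circle, and sign \<open>(-1)\<^sup>k\<close> on the half turn of the circle.
\<close>

definition iso_class :: "(int set => int rep set) => int \<times> int \<times> int \<times> int => (int, vec31 set) virtual_rep set" where
 "iso_class R = (%(n, a, b, k). {E : vreps R n. fixp E = a & fixc E = b & loop_sign E = pw (- 1) k})"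

lemma inv_group_simps: "carrier inv_group = UNIV \<times> UNIV \<times> UNIV \<times> {0, 1}"
 "mult inv_group (n, a, b, k) (n', a', b', k') = (n + n', a + a', b + b', (k + k') mod 2)" "one inv_group = (0, 0, 0, 0)"
 by (auto simp: DirProd_def integer_group_def C2_simps)

lemma comm_group_inv_group: "comm_group inv_group"
proof -
 have "group inv_group" by (intro DirProd_group group_integer_group group_integer_mod_group)
 thus ?thesis
  by (rule group.group_comm_groupI) (auto simp: DirProd_def integer_group_def C2_simps add.commute)
qed

context
 fixes R :: "int set => int rep set"
 assumes R: "rep_system C2 R"
begin

lemma R_VR: "E : vreps R n ==> E : VR n"
 using virtual_reps_iff[of R] R by (simp add: good_sys_def rep_system_def)

lemma dim_unique: "E : vreps R n ==> E : vreps R m ==> n = m"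
 using VR_D(3)[OF R_VR c0_ob(1)] by metis

lemma iso_class_nonempty: "EX E. E : iso_class R p"
proof -
 obtain n a b k where p: "p = (n, a, b, k)" by (metis surj_pair)
 show ?thesis using VR_exists[OF R, of n a b k] unfolding p iso_class_def by blast
qed

lemma virtual_rep_iso_image:
 assumes g: "E : vreps R n" and k: "loop_sign E = pw (- 1) k"
 shows "virtual_rep_iso C2 R PR31 n `` {E} = iso_class R (n, fixp E, fixc E, k)"
proof -
 have "(E, D) : virtual_rep_iso C2 R PR31 n \<longleftrightarrow> D : iso_class R (n, fixp E, fixc E, k)" for D
  using nat_iso_iff[OF R_VR[OF g] R_VR[of D n]] g k
  by (auto simp: virtual_rep_iso_def iso_class_def nat_iso_indep[of R n _ _ "all_reps C2" n])
 thus ?thesis by blast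
qed

lemma carrier_RO_Pi: "carrier (RO_Pi C2 R PR31) = iso_class R ` carrier inv_group"
proof (intro equalityI subsetI)
 fix X assume "X : carrier (RO_Pi C2 R PR31)"
 then obtain n E where g: "E : vreps R n" "X = virtual_rep_iso C2 R PR31 n `` {E}"
  by (auto simp: RO_Pi_def elim!: quotientE)
 have "EX k:{0, 1}. loop_sign E = pw (- 1) k" using loop_sign_values[OF R_VR[OF g(1)]] by (auto simp: pw_def)
 then obtain k where "k : {0, 1}" "loop_sign E = pw (- 1) k" by blast
 thus "X : iso_class R ` carrier inv_group" using virtual_rep_iso_image[OF g(1)] g(2) unfolding inv_group_simps by blast
next
 fix X assume "X : iso_class R ` carrier inv_group"
 then obtain n a b k where p: "X = iso_class R (n, a, b, k)" unfolding inv_group_simps by blast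
 obtain E where "E : iso_class R (n, a, b, k)" using iso_class_nonempty by blast
 hence g: "E : vreps R n" "fixp E = a" "fixc E = b" "loop_sign E = pw (- 1) k" by (auto simp: iso_class_def)
 hence "X = virtual_rep_iso C2 R PR31 n `` {E}" using virtual_rep_iso_image[OF g(1,4)] p by simp
 thus "X : carrier (RO_Pi C2 R PR31)" using g(1) quotientI[of E] by (auto simp: RO_Pi_def)
qed

lemma inj_iso_class: "inj_on (iso_class R) (carrier inv_group)"
proof (rule inj_onI)
 fix p q assume pq: "p : carrier inv_group" "q : carrier inv_group" "iso_class R p = iso_class R q"
 obtain n a b k n' a' b' k' where p: "p = (n, a, b, k)" "q = (n', a', b', k')" by (metis surj_pair)
 obtain E where g: "E : iso_class R p" using iso_class_nonempty by blast
 hence "E : iso_class R q" using pq(3) by simp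
 thus "p = q" using g dim_unique[of E n n'] pq(1,2) unfolding p inv_group_simps by (auto simp: iso_class_def pw_def split: if_splits)
qed

lemma iso_class_mult:
 assumes "p : carrier inv_group" "q : carrier inv_group"
 shows "mult (RO_Pi C2 R PR31) (iso_class R p) (iso_class R q) = iso_class R (mult inv_group p q)"
proof -
 obtain n a b k n' a' b' k' where p: "p = (n, a, b, k)" "q = (n', a', b', k')" by (metis surj_pair)
 have kk: "pw (- 1) k * pw (- 1) k' = pw (- 1) ((k + k') mod 2)" by (auto simp: pw_def)
 have sum: "nat_iso_over C2 PiB (VB (n + n')) \<epsilon> (virtual_rep_sum C2 E D) \<longleftrightarrow> \<epsilon> : iso_class R (mult inv_group p q)"
  if "\<epsilon> : vreps R (n + n')" "E : iso_class R p" "D : iso_class R q" for \<epsilon> E D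
 proof -
  have "E : VR n" "D : VR n'" using that R_VR by (auto simp: iso_class_def p)
  note S = virtual_rep_sum_VR[OF this]
  show ?thesis using nat_iso_iff[OF R_VR[OF that(1)] S(1)] S(2-4) that kk by (auto simp: iso_class_def p inv_group_simps)
 qed
 have dm: "E : iso_class R p ==> E : vreps R m ==> m = n" "E : iso_class R q ==> E : vreps R m ==> m = n'" for E m
  using dim_unique[of E] by (auto simp: iso_class_def p)
 obtain E D where gd: "E : iso_class R p" "D : iso_class R q" using iso_class_nonempty by metis
 have gv: "E : vreps R n" "D : vreps R n'" using gd by (auto simp: iso_class_def p)
 have "\<epsilon> : mult (RO_Pi C2 R PR31) (iso_class R p) (iso_class R q) \<longleftrightarrow> \<epsilon> : iso_class R (mult inv_group p q)" for \<epsilon>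
 proof
  assume "\<epsilon> : mult (RO_Pi C2 R PR31) (iso_class R p) (iso_class R q)"
  then obtain m m' E' D' where e: "E' : iso_class R p" "E' : vreps R m" "D' : iso_class R q" "D' : vreps R m'"
   "\<epsilon> : vreps R (m + m')" "nat_iso_over C2 PiB (VB (m + m')) \<epsilon> (virtual_rep_sum C2 E' D')"
   by (auto simp: RO_Pi_def)
  have "m = n" "m' = n'" using dm e by blast+
  thus "\<epsilon> : iso_class R (mult inv_group p q)" using sum[OF _ e(1,3)] e(5,6) by simp
 next
  assume e: "\<epsilon> : iso_class R (mult inv_group p q)"
  hence "\<epsilon> : vreps R (n + n')" by (auto simp: iso_class_def p inv_group_simps)
  moreover from this have "nat_iso_over C2 PiB (VB (n + n')) \<epsilon> (virtual_rep_sum C2 E D)" using sum[OF _ gd] e by blast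
  ultimately show "\<epsilon> : mult (RO_Pi C2 R PR31) (iso_class R p) (iso_class R q)" using gd gv unfolding RO_Pi_def monoid.simps by blast
 qed
 thus ?thesis by blast
qed

lemma one_RO_Pi: "one (RO_Pi C2 R PR31) = iso_class R (one inv_group)"
proof -
 have "nat_iso_over C2 PiB (VB 0) \<epsilon> (virtual_rep_zero C2) \<longleftrightarrow> \<epsilon> : iso_class R (0, 0, 0, 0)" if "\<epsilon> : vreps R 0" for \<epsilon>
  using nat_iso_iff[OF R_VR[OF that] zero_VR(1)] zero_VR(2-4) that by (auto simp: iso_class_def pw_def)
 thus ?thesis unfolding inv_group_simps RO_Pi_def by (auto simp: iso_class_def)
qed

lemma iso_class_iso: "iso_class R : iso inv_group (RO_Pi C2 R PR31)"
 using iso_class_mult inj_iso_class by (auto simp: iso_def hom_def bij_betw_def carrier_RO_Pi)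

end

theorem lemma1p1:
  fixes R :: "int set \<Rightarrow> int rep set"
  assumes "rep_system C2 R"
  shows "comm_group (RO_Pi C2 R PR31) \<and>
    RO_Pi C2 R PR31 \<cong> integer_group \<times>\<times> integer_group \<times>\<times> integer_group \<times>\<times> integer_mod_group 2"
proof
  interpret comm_group inv_group by (rule comm_group_inv_group)
  have "RO_Pi C2 R PR31 = (RO_Pi C2 R PR31)\<lparr>one := iso_class R \<one>\<^bsub>inv_group\<^esub>\<rparr>"
    using one_RO_Pi[OF assms] by simp
  then show "comm_group (RO_Pi C2 R PR31)" using iso_imp_img_comm_group[OF iso_class_iso[OF assms]] by simp
  have "inv_group \<cong> RO_Pi C2 R PR31" using iso_class_iso[OF assms] by (auto simp: is_iso_def)
  then show "RO_Pi C2 R PR31 \<cong> inv_group" by (rule group.iso_sym[OF is_group])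
qed

end
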